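(* Let $p$ be a prime and let $(S,\mathcal F,\mathcal L)$ be a $p$-local finite group. The natural map $$\mathrm{Out}_{\mathcal F}(S)\longrightarrow\pi_1(|\mathcal L|)/O^{p'}(\pi_1(|\mathcal L|))$$ is surjective, with kernel equal to $$\mathrm{Out}^0_{\mathcal F}(S)=\bigl\langle\alpha\in\mathrm{Out}_{\mathcal F}(S)\ \big|\ \alpha|_P\in\mathrm{Mor}_{O^{p'}_*(\mathcal F)}(P,S)\text{ for some }\mathcal F\text{-centric }P\le S\bigr\rangle .$$
   Context: Fusion systems. Let $S$ be a finite $p$-group. Write $c_x(g)=xgx^{-1}$; for $P,Q\le S$ let $\mathrm{Hom}_S(P,Q)=\{c_x|_P: x\in S,\ xPx^{-1}\le Q\}$, $\mathrm{Aut}_S(P)=\mathrm{Hom}_S(P,P)$, and let $\mathrm{Inj}(P,Q)$ be the set of injective homomorphisms. A fusion system $\mathcal F$ over $S$ is a category whose objects are all subgroups of $S$, with $\mathrm{Hom}_S(P,Q)\subseteq\mathrm{Hom}_{\mathcal F}(P,Q)\subseteq\mathrm{Inj}(P,Q)$, and such that each morphism is the composite of an isomorphism in $\mathcal F$ followed by an inclusion. Write $\mathrm{Aut}_{\mathcal F}(P)=\mathrm{Hom}_{\mathcal F}(P,P)$ and $\mathrm{Out}_{\mathcal F}(P)=\mathrm{Aut}_{\mathcal F}(P)/\mathrm{Inn}(P)$. Subgroups isomorphic in $\mathcal F$ are called $\mathcal F$-conjugate. $P\le S$ is fully centralized (resp. fully normalized) in $\mathcal F$ if $|C_S(P)|\ge|C_S(P')|$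 (resp. $|N_S(P)|\ge|N_S(P')|$) for all $P'$ $\mathcal F$-conjugate to $P$. $\mathcal F$ is saturated if: (I) every fully normalized $P$ is fully centralized and $\mathrm{Aut}_S(P)\in\mathrm{Syl}_p(\mathrm{Aut}_{\mathcal F}(P))$; (II) if $\varphi\in\mathrm{Hom}_{\mathcal F}(P,S)$ is such that $\varphi(P)$ is fully centralized, then $\varphi$ extends to some $\overline\varphi\in\mathrm{Hom}_{\mathcal F}(N_\varphi,S)$, where $N_\varphi=\{g\in N_S(P): \varphi c_g\varphi^{-1}\in\mathrm{Aut}_S(\varphi(P))\}$. Linking systems. $P\le S$ is $\mathcal F$-centric if $C_S(P')=Z(P')$ for all $P'$ $\mathcal F$-conjugate to $P$; $\mathcal F^c\subseteq\mathcal F$ is the full subcategory on the $\mathcal F$-centric subgroups. A centric linking system associated to $\mathcal F$ is a category $\mathcal L$ whose objects are the $\mathcal F$-centric subgroups, with a functor $\pi:\mathcal L\to\mathcal F^c$ and monomorphisms $\delta_P:P\to\mathrm{Aut}_{\mathcal L}(P)$ such that: (A) $\pi$ is the identity on objects, $Z(P)$ acts freely on $\mathrm{Mor}_{\mathcal L}(P,Q)$ by composition via $\delta_P$, and $\pi$ induces a bijection $\mathrm{Mor}_{\mathcal L}(P,Q)/Z(P)\cong\mathrm{Hom}_{\mathcal F}(P,Q)$; (B) $\pi(\delta_P(x))=c_x$ for $x\in P$; (C) $f\circ\delta_P(x)=\delta_Q(\pi(f)(x))\circ f$ for $f\in\mathrm{Mor}_{\mathcal L}(P,Q)$, $x\in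 P$. A $p$-local finite group is a triple $(S,\mathcal F,\mathcal L)$ with $S$ a finite $p$-group, $\mathcal F$ a saturated fusion system over $S$, and $\mathcal L$ a centric linking system associated to $\mathcal F$. $|\mathcal C|$ is the geometric realization of the nerve of a category $\mathcal C$. For a (possibly infinite) group $G$, $O^{p'}(G)$ is the intersection of all normal subgroups of $G$ of finite index prime to $p$ (for finite $G$, the subgroup generated by elements of $p$-power order). $O^{p'}_*(\mathcal F)\subseteq\mathcal F$ is the smallest fusion subsystem of $\mathcal F$ over $S$ which contains all the groups $O^{p'}(\mathrm{Aut}_{\mathcal F}(P))$ for $P\le S$; equivalently, the smallest subcategory of $\mathcal F$ with the same objects which contains all restrictions of all automorphisms in $\mathcal F$ of $p$-power order. The condition on $\alpha$ in the definition of $\mathrm{Out}_{\mathcal F}^0(S)$ is understood for representatives $\alpha\in\mathrm{Aut}_{\mathcal F}(S)$ (it does not depend on the choice, since $\mathrm{Inn}(S)\subseteq O^{p'}_*(\mathcal F)$). The natural map sends the class of $\alpha\in\mathrm{Aut}_{\mathcal F}(S)$ to the class of the loop at the vertex $S$ of $|\mathcal L|$ defined by any $\widehat\alpha\in\mathrm{Aut}_{\mathcal L}(S)$ with $\pi(\widehat\alpha)=\alpha$. *)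

theory Defs
  imports
    "HOL-Computational_Algebra.Primes"
    "HOL-Algebra.Bij"
    "HOL-Algebra.Generated_Groups"
    "HOL-Algebra.Group_Action"
    "HOL-Analysis.Homotopy"
    "HOL-Analysis.Sum_Topology"
    "HOL-Homology.Simplices"
begin

section \<open>Groups\<close>

definition finite_p_group :: "nat \<Rightarrow> ('a, 'b) monoid_scheme \<Rightarrow> bool" where
  "finite_p_group p G \<longleftrightarrow> group G \<and> finite (carrier G) \<and> (\<exists>n. order G = p ^ n)"

definition sylow_subgroup :: "nat \<Rightarrow> 'a set \<Rightarrow> ('a, 'b) monoid_scheme \<Rightarrow> bool" where
  "sylow_subgroup p H G \<longleftrightarrow>
     finite (carrier G) \<and> subgroup H G \<and> card H = p ^ multiplicity p (order G)"

definition centralizer :: "('a, 'b) monoid_scheme \<Rightarrow> 'a set \<Rightarrow> 'a set" where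
  "centralizer G P = {g \<in> carrier G. \<forall>x\<in>P. g \<otimes>\<^bsub>G\<^esub> x = x \<otimes>\<^bsub>G\<^esub> g}"

definition center_of :: "('a, 'b) monoid_scheme \<Rightarrow> 'a set \<Rightarrow> 'a set" where
  "center_of G P = P \<inter> centralizer G P"

text \<open>The subgroup \<open>O\<^sup>p\<^sup>'(G)\<close>, for finite and infinite \<open>G\<close> alike. Finiteness of the index has to
  be demanded separately, since \<^const>\<open>card\<close> of an infinite set is 0.\<close>

definition O_p' :: "nat \<Rightarrow> ('a, 'b) monoid_scheme \<Rightarrow> 'a set" where
  "O_p' p G = \<Inter> {N. N \<lhd> G \<and> finite (rcosets\<^bsub>G\<^esub> N) \<and> coprime p (card (rcosets\<^bsub>G\<^esub> N))}"


section \<open>Fusion systems\<close>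

text \<open>A category whose objects are the subgroups of \<open>S\<close> and whose morphisms are homomorphisms of
  groups is given by its family of hom-sets \<open>F P Q\<close>. A morphism from \<open>P\<close> is a function that is
  \<^const>\<open>undefined\<close> outside \<open>P\<close>, so that composition of morphisms is \<^const>\<open>compose\<close> and the
  identity is \<open>\<lambda>x\<in>P. x\<close>. Values \<open>F P Q\<close> for sets that are not subgroups are irrelevant.\<close>

type_synonym 'a homs = "'a set \<Rightarrow> 'a set \<Rightarrow> ('a \<Rightarrow> 'a) set"

definition conj_map :: "('a, 'b) monoid_scheme \<Rightarrow> 'a \<Rightarrow> 'a set \<Rightarrow> 'a \<Rightarrow> 'a" where
  "conj_map S x P = (\<lambda>g\<in>P. x \<otimes>\<^bsub>S\<^esub> g \<otimes>\<^bsub>S\<^esub> inv\<^bsub>S\<^esub> x)"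

definition Hom_S :: "('a, 'b) monoid_scheme \<Rightarrow> 'a homs" where
  "Hom_S S P Q = {conj_map S x P | x. x \<in> carrier S \<and> conj_map S x P ` P \<subseteq> Q}"

definition Aut_S :: "('a, 'b) monoid_scheme \<Rightarrow> 'a set \<Rightarrow> ('a \<Rightarrow> 'a) set" where
  "Aut_S S P = Hom_S S P P"

definition Inn :: "('a, 'b) monoid_scheme \<Rightarrow> 'a set \<Rightarrow> ('a \<Rightarrow> 'a) set" where
  "Inn S P = {conj_map S x P | x. x \<in> P}"

definition Inj :: "('a, 'b) monoid_scheme \<Rightarrow> 'a homs" where
  "Inj S P Q = {\<phi> \<in> hom (S\<lparr>carrier := P\<rparr>) (S\<lparr>carrier := Q\<rparr>). \<phi> \<in> extensional P \<and> inj_on \<phi> P}"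

definition Iso :: "'a homs \<Rightarrow> 'a homs" where
  "Iso F P Q = {\<phi> \<in> F P Q. \<exists>\<psi>\<in>F Q P. compose P \<psi> \<phi> = (\<lambda>x\<in>P. x) \<and> compose Q \<phi> \<psi> = (\<lambda>x\<in>Q. x)}"

definition fusion_system :: "('a, 'b) monoid_scheme \<Rightarrow> 'a homs \<Rightarrow> bool" where
  "fusion_system S F \<longleftrightarrow>
     (\<forall>P. subgroup P S \<longrightarrow> (\<lambda>x\<in>P. x) \<in> F P P) \<and>
     (\<forall>P Q R \<phi> \<psi>. subgroup P S \<and> subgroup Q S \<and> subgroup R S \<and> \<phi> \<in> F P Q \<and> \<psi> \<in> F Q R \<longrightarrow>
        compose P \<psi> \<phi> \<in> F P R) \<and>
     (\<forall>P Q. subgroup P S \<and> subgroup Q S \<longrightarrow> Hom_S S P Q \<subseteq> F P Q \<and> F P Q \<subseteq> Inj S P Q) \<and>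
     (\<forall>P Q \<phi>. subgroup P S \<and> subgroup Q S \<and> \<phi> \<in> F P Q \<longrightarrow>
        (\<exists>R \<psi>. subgroup R S \<and> R \<subseteq> Q \<and> \<psi> \<in> Iso F P R \<and> \<phi> = compose P (\<lambda>x\<in>R. x) \<psi>))"

definition Aut_F :: "'a homs \<Rightarrow> 'a set \<Rightarrow> ('a \<Rightarrow> 'a) monoid" where
  "Aut_F F P = (BijGroup P)\<lparr>carrier := F P P\<rparr>"

definition Out_F :: "('a, 'b) monoid_scheme \<Rightarrow> 'a homs \<Rightarrow> 'a set \<Rightarrow> ('a \<Rightarrow> 'a) set monoid" where
  "Out_F S F P = Aut_F F P Mod Inn S P"

definition F_conjugate :: "('a, 'b) monoid_scheme \<Rightarrow> 'a homs \<Rightarrow> 'a set \<Rightarrow> 'a set \<Rightarrow> bool" where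
  "F_conjugate S F P P' \<longleftrightarrow> subgroup P S \<and> subgroup P' S \<and> Iso F P P' \<noteq> {}"

definition fully_centralized :: "('a, 'b) monoid_scheme \<Rightarrow> 'a homs \<Rightarrow> 'a set \<Rightarrow> bool" where
  "fully_centralized S F P \<longleftrightarrow>
     subgroup P S \<and> (\<forall>P'. F_conjugate S F P P' \<longrightarrow> card (centralizer S P) \<ge> card (centralizer S P'))"

definition fully_normalized :: "('a, 'b) monoid_scheme \<Rightarrow> 'a homs \<Rightarrow> 'a set \<Rightarrow> bool" where
  "fully_normalized S F P \<longleftrightarrow>
     subgroup P S \<and> (\<forall>P'. F_conjugate S F P P' \<longrightarrow> card (normalizer S P) \<ge> card (normalizer S P'))"

text \<open>The group \<open>N\<^sub>\<phi>\<close>; the function below is \<open>\<phi> c\<^sub>g \<phi>\<^sup>-\<^sup>1\<close> on \<open>\<phi>(P)\<close>.\<close>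

definition N_phi :: "('a, 'b) monoid_scheme \<Rightarrow> 'a set \<Rightarrow> ('a \<Rightarrow> 'a) \<Rightarrow> 'a set" where
  "N_phi S P \<phi> = {g \<in> normalizer S P.
     (\<lambda>y\<in>\<phi> ` P. \<phi> (conj_map S g P (inv_into P \<phi> y))) \<in> Aut_S S (\<phi> ` P)}"

definition saturated :: "nat \<Rightarrow> ('a, 'b) monoid_scheme \<Rightarrow> 'a homs \<Rightarrow> bool" where
  "saturated p S F \<longleftrightarrow>
     (\<forall>P. fully_normalized S F P \<longrightarrow>
        fully_centralized S F P \<and> sylow_subgroup p (Aut_S S P) (Aut_F F P)) \<and>
     (\<forall>P \<phi>. subgroup P S \<and> \<phi> \<in> F P (carrier S) \<and> fully_centralized S F (\<phi> ` P) \<longrightarrow>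
        (\<exists>\<psi> \<in> F (N_phi S P \<phi>) (carrier S). restrict \<psi> P = \<phi>))"

definition F_centric :: "('a, 'b) monoid_scheme \<Rightarrow> 'a homs \<Rightarrow> 'a set \<Rightarrow> bool" where
  "F_centric S F P \<longleftrightarrow>
     subgroup P S \<and> (\<forall>P'. F_conjugate S F P P' \<longrightarrow> centralizer S P' = center_of S P')"

text \<open>The fusion system \<open>O\<^sup>p\<^sup>'\<^sub>*(F)\<close>: fusion systems over \<open>S\<close> are closed under intersection, so the
  smallest one with the required property is the intersection of all of them.\<close>

definition O_p'_star :: "nat \<Rightarrow> ('a, 'b) monoid_scheme \<Rightarrow> 'a homs \<Rightarrow> 'a homs" where
  "O_p'_star p S F P Q = \<Inter> {E P Q | E. fusion_system S E \<and>
     (\<forall>P Q. subgroup P S \<and> subgroup Q S \<longrightarrow> E P Q \<subseteq> F P Q) \<and>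
     (\<forall>P. subgroup P S \<longrightarrow> O_p' p (Aut_F F P) \<subseteq> E P P)}"

definition Out0_F :: "nat \<Rightarrow> ('a, 'b) monoid_scheme \<Rightarrow> 'a homs \<Rightarrow> ('a \<Rightarrow> 'a) set set" where
  "Out0_F p S F = generate (Out_F S F (carrier S))
     {Inn S (carrier S) #>\<^bsub>Aut_F F (carrier S)\<^esub> \<alpha> | \<alpha>.
        \<alpha> \<in> carrier (Aut_F F (carrier S)) \<and>
        (\<exists>P. F_centric S F P \<and> restrict \<alpha> P \<in> O_p'_star p S F P (carrier S))}"


section \<open>Categories and centric linking systems\<close>

record ('o, 'm) cat =
  Ob :: "'o set"
  Ar :: "'m set"
  Dom :: "'m \<Rightarrow> 'o"
  Cod :: "'m \<Rightarrow> 'o"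
  Ident :: "'o \<Rightarrow> 'm"
  Comp :: "'m \<Rightarrow> 'm \<Rightarrow> 'm"

text \<open>\<open>Comp C g f\<close> is \<open>g \<circ> f\<close>.\<close>

definition Mor :: "('o, 'm) cat \<Rightarrow> 'o \<Rightarrow> 'o \<Rightarrow> 'm set" where
  "Mor C x y = {f \<in> Ar C. Dom C f = x \<and> Cod C f = y}"

locale small_category =
  fixes C :: "('o, 'm) cat"
  assumes Dom_Ob: "f \<in> Ar C \<Longrightarrow> Dom C f \<in> Ob C"
    and Cod_Ob: "f \<in> Ar C \<Longrightarrow> Cod C f \<in> Ob C"
    and Ident_Mor: "x \<in> Ob C \<Longrightarrow> Ident C x \<in> Mor C x x"
    and Comp_Mor: "\<lbrakk>f \<in> Mor C x y; g \<in> Mor C y z\<rbrakk> \<Longrightarrow> Comp C g f \<in> Mor C x z"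
    and Comp_Ident: "f \<in> Mor C x y \<Longrightarrow> Comp C f (Ident C x) = f"
    and Ident_Comp: "f \<in> Mor C x y \<Longrightarrow> Comp C (Ident C y) f = f"
    and Comp_assoc: "\<lbrakk>f \<in> Mor C w x; g \<in> Mor C x y; h \<in> Mor C y z\<rbrakk> \<Longrightarrow>
      Comp C h (Comp C g f) = Comp C (Comp C h g) f"

definition Aut_cat :: "('o, 'm) cat \<Rightarrow> 'o \<Rightarrow> 'm monoid" where
  "Aut_cat C x =
     \<lparr>carrier = {f \<in> Mor C x x. \<exists>g\<in>Mor C x x. Comp C g f = Ident C x \<and> Comp C f g = Ident C x},
      mult = Comp C, one = Ident C x\<rparr>"

text \<open>The functor \<open>\<pi>\<close> is the identity on objects and hence is given by its values on morphisms;
  as \<open>\<F>\<^sup>c\<close> is a full subcategory, its hom-sets are those of \<open>F\<close>. The last axiom of part (A) says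
  that the fibres of \<open>\<pi>\<close> on \<open>Mor P Q\<close> are exactly the \<open>Z(P)\<close>-orbits.\<close>

locale centric_linking_system = small_category L
  for S :: "('a, 'b) monoid_scheme" and F :: "'a homs" and L :: "('a set, 'm) cat"
    and \<pi> :: "'m \<Rightarrow> 'a \<Rightarrow> 'a" and \<delta> :: "'a set \<Rightarrow> 'a \<Rightarrow> 'm" +
  assumes Ob_L: "Ob L = {P. F_centric S F P}"
    and pi_Ident: "P \<in> Ob L \<Longrightarrow> \<pi> (Ident L P) = (\<lambda>x\<in>P. x)"
    and pi_Comp: "\<lbrakk>f \<in> Mor L P Q; g \<in> Mor L Q R\<rbrakk> \<Longrightarrow> \<pi> (Comp L g f) = compose P (\<pi> g) (\<pi> f)"
    and delta_hom: "P \<in> Ob L \<Longrightarrow> \<delta> P \<in> hom (S\<lparr>carrier := P\<rparr>) (Aut_cat L P)"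
    and delta_inj: "P \<in> Ob L \<Longrightarrow> inj_on (\<delta> P) P"
    and A_free: "\<lbrakk>f \<in> Mor L P Q; z \<in> center_of S P; Comp L f (\<delta> P z) = f\<rbrakk> \<Longrightarrow> z = \<one>\<^bsub>S\<^esub>"
    and A_surj: "\<lbrakk>P \<in> Ob L; Q \<in> Ob L\<rbrakk> \<Longrightarrow> \<pi> ` Mor L P Q = F P Q"
    and A_orbits: "\<lbrakk>f \<in> Mor L P Q; g \<in> Mor L P Q\<rbrakk> \<Longrightarrow>
      \<pi> f = \<pi> g \<longleftrightarrow> (\<exists>z\<in>center_of S P. g = Comp L f (\<delta> P z))"
    and B: "\<lbrakk>P \<in> Ob L; x \<in> P\<rbrakk> \<Longrightarrow> \<pi> (\<delta> P x) = conj_map S x P"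
    and C: "\<lbrakk>f \<in> Mor L P Q; x \<in> P\<rbrakk> \<Longrightarrow> Comp L f (\<delta> P x) = Comp L (\<delta> Q (\<pi> f x)) f"

definition p_local_finite_group ::
    "nat \<Rightarrow> ('a, 'b) monoid_scheme \<Rightarrow> 'a homs \<Rightarrow> ('a set, 'm) cat \<Rightarrow> ('m \<Rightarrow> 'a \<Rightarrow> 'a) \<Rightarrow>
     ('a set \<Rightarrow> 'a \<Rightarrow> 'm) \<Rightarrow> bool" where
  "p_local_finite_group p S F L \<pi> \<delta> \<longleftrightarrow>
     finite_p_group p S \<and> fusion_system S F \<and> saturated p S F \<and> centric_linking_system S F L \<pi> \<delta>"


section \<open>Geometric realization of the nerve\<close>

text \<open>An \<open>n\<close>-simplex of the nerve is a functor from the poset \<open>{0 \<le> \<dots> \<le> n}\<close> to \<open>C\<close>; it is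
  represented by the function sending \<open>i \<le> j\<close> to the arrow \<open>x\<^sub>i \<rightarrow> x\<^sub>j\<close>, which determines the
  objects \<open>x\<^sub>i\<close>.\<close>

definition nerve :: "('o, 'm) cat \<Rightarrow> nat \<Rightarrow> (nat \<Rightarrow> nat \<Rightarrow> 'm) set" where
  "nerve C n = {\<sigma>. \<exists>x.
     (\<forall>i\<le>n. x i \<in> Ob C \<and> \<sigma> i i = Ident C (x i)) \<and>
     (\<forall>i j. i \<le> j \<and> j \<le> n \<longrightarrow> \<sigma> i j \<in> Mor C (x i) (x j)) \<and>
     (\<forall>i j k. i \<le> j \<and> j \<le> k \<and> k \<le> n \<longrightarrow> \<sigma> i k = Comp C (\<sigma> j k) (\<sigma> i j)) \<and>
     (\<forall>i j. \<not> (i \<le> j \<and> j \<le> n) \<longrightarrow> \<sigma> i j = undefined)}"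

text \<open>The action of a monotone map \<open>\<theta> : {0..m} \<rightarrow> {0..n}\<close> on simplices of the nerve
  (contravariant) and on points of the standard simplices (covariant).\<close>

definition nerve_map :: "nat \<Rightarrow> (nat \<Rightarrow> nat) \<Rightarrow> (nat \<Rightarrow> nat \<Rightarrow> 'm) \<Rightarrow> nat \<Rightarrow> nat \<Rightarrow> 'm" where
  "nerve_map m \<theta> \<sigma> = (\<lambda>i j. if i \<le> j \<and> j \<le> m then \<sigma> (\<theta> i) (\<theta> j) else undefined)"

definition simplex_push :: "nat \<Rightarrow> (nat \<Rightarrow> nat) \<Rightarrow> (nat \<Rightarrow> real) \<Rightarrow> nat \<Rightarrow> real" where
  "simplex_push m \<theta> t = (\<lambda>j. \<Sum>i | i \<le> m \<and> \<theta> i = j. t i)"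

type_synonym 'm cell_point = "(nat \<times> (nat \<Rightarrow> nat \<Rightarrow> 'm)) \<times> (nat \<Rightarrow> real)"

definition cells :: "('o, 'm) cat \<Rightarrow> 'm cell_point topology" where
  "cells C = sum_topology (\<lambda>(n, \<sigma>). subtopology (powertop_real UNIV) (standard_simplex n))
     (SIGMA n : UNIV. nerve C n)"

definition glue :: "('o, 'm) cat \<Rightarrow> 'm cell_point rel" where
  "glue C = {(((m, nerve_map m \<theta> \<sigma>), t), ((n, \<sigma>), simplex_push m \<theta> t)) | m n \<theta> \<sigma> t.
     \<sigma> \<in> nerve C n \<and> t \<in> standard_simplex m \<and> \<theta> \<in> {..m} \<rightarrow> {..n} \<and> mono_on {..m} \<theta>}"

definition glue_equiv :: "('o, 'm) cat \<Rightarrow> 'm cell_point rel" where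
  "glue_equiv C = (glue C \<union> (glue C)\<inverse>)\<^sup>*"

definition quotient_topology :: "'x topology \<Rightarrow> 'x rel \<Rightarrow> 'x set topology" where
  "quotient_topology X r =
     topology (\<lambda>U. U \<subseteq> topspace X // r \<and> openin X {x \<in> topspace X. r `` {x} \<in> U})"

lemma openin_quotient_topology:
  "openin (quotient_topology X r) U \<longleftrightarrow>
     U \<subseteq> topspace X // r \<and> openin X {x \<in> topspace X. r `` {x} \<in> U}"
proof -
  have 1: "{x \<in> topspace X. r `` {x} \<in> U \<inter> V} =
      {x \<in> topspace X. r `` {x} \<in> U} \<inter> {x \<in> topspace X. r `` {x} \<in> V}" for U V
    by auto
  have 2: "{x \<in> topspace X. r `` {x} \<in> \<Union>K} = (\<Union>U\<in>K. {x \<in> topspace X. r `` {x} \<in> U})" for K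
    by auto
  have "istopology (\<lambda>U. U \<subseteq> topspace X // r \<and> openin X {x \<in> topspace X. r `` {x} \<in> U})"
    unfolding istopology_def 1 2 by blast
  then show ?thesis
    by (simp add: quotient_topology_def)
qed

lemma topspace_quotient_topology [simp]: "topspace (quotient_topology X r) = topspace X // r"
proof -
  have "{x \<in> topspace X. r `` {x} \<in> topspace X // r} = topspace X"
    by (auto simp: quotient_def)
  then have "openin (quotient_topology X r) (topspace X // r)"
    by (simp add: openin_quotient_topology)
  then show ?thesis
    by (metis openin_quotient_topology openin_subset openin_topspace subset_antisym)
qed

lemma quotient_map_quotient_topology:
  "quotient_map X (quotient_topology X r) (\<lambda>x. r `` {x})"
  by (auto simp: quotient_map_def openin_quotient_topology quotient_def)

definition realization :: "('o, 'm) cat \<Rightarrow> 'm cell_point set topology" where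
  "realization C = quotient_topology (cells C) (glue_equiv C)"

definition vertex :: "('o, 'm) cat \<Rightarrow> 'o \<Rightarrow> 'm cell_point set" where
  "vertex C x = glue_equiv C ``
     {((0, \<lambda>i j. if i = 0 \<and> j = 0 then Ident C x else undefined), \<lambda>i. if i = 0 then 1 else 0)}"

text \<open>The path from \<open>vertex C (Dom C f)\<close> to \<open>vertex C (Cod C f)\<close> along the 1-simplex \<open>f\<close>.\<close>

definition edge_simplex :: "('o, 'm) cat \<Rightarrow> 'm \<Rightarrow> nat \<Rightarrow> nat \<Rightarrow> 'm" where
  "edge_simplex C f = (\<lambda>i j.
     if i = 0 \<and> j = 0 then Ident C (Dom C f)
     else if i = 0 \<and> j = 1 then f
     else if i = 1 \<and> j = 1 then Ident C (Cod C f)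
     else undefined)"

definition edge_path :: "('o, 'm) cat \<Rightarrow> 'm \<Rightarrow> real \<Rightarrow> 'm cell_point set" where
  "edge_path C f = (\<lambda>t. glue_equiv C ``
     {((1, edge_simplex C f), \<lambda>i. if i = 0 then 1 - t else if i = 1 then t else 0)})"


section \<open>The fundamental group\<close>

definition loops :: "'x topology \<Rightarrow> 'x \<Rightarrow> (real \<Rightarrow> 'x) set" where
  "loops X a = {g. pathin X g \<and> g 0 = a \<and> g 1 = a}"

definition loop_class :: "'x topology \<Rightarrow> 'x \<Rightarrow> (real \<Rightarrow> 'x) \<Rightarrow> (real \<Rightarrow> 'x) set" where
  "loop_class X a g =
     {g'. homotopic_with (\<lambda>r. r 0 = a \<and> r 1 = a) (top_of_set {0..1}) X g g'}"

definition path_join :: "(real \<Rightarrow> 'x) \<Rightarrow> (real \<Rightarrow> 'x) \<Rightarrow> real \<Rightarrow> 'x" where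
  "path_join f g = (\<lambda>t. if t \<le> 1 / 2 then f (2 * t) else g (2 * t - 1))"

text \<open>Products are read from right to left, as for composition of morphisms: \<open>[f] [g]\<close> is the class
  of the loop that traverses \<open>g\<close> first. With this convention \<open>Aut\<^sub>L(S) \<rightarrow> \<pi>\<^sub>1(|L|)\<close> is a
  homomorphism rather than an anti-homomorphism. The union below is over equal classes.\<close>

definition fundamental_group :: "'x topology \<Rightarrow> 'x \<Rightarrow> (real \<Rightarrow> 'x) set monoid" where
  "fundamental_group X a =
     \<lparr>carrier = loop_class X a ` loops X a,
      mult = (\<lambda>A B. \<Union>f\<in>A. \<Union>g\<in>B. loop_class X a (path_join g f)),
      one = loop_class X a (\<lambda>_. a)\<rparr>"


section \<open>The natural map\<close>

definition pi1_L ::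
    "('a, 'b) monoid_scheme \<Rightarrow> ('a set, 'm) cat \<Rightarrow> (real \<Rightarrow> 'm cell_point set) set monoid" where
  "pi1_L S L = fundamental_group (realization L) (vertex L (carrier S))"

definition edge_class ::
    "('a, 'b) monoid_scheme \<Rightarrow> ('a set, 'm) cat \<Rightarrow> 'm \<Rightarrow> (real \<Rightarrow> 'm cell_point set) set" where
  "edge_class S L f = loop_class (realization L) (vertex L (carrier S)) (edge_path L f)"

definition pi1_mod_O_p' ::
    "nat \<Rightarrow> ('a, 'b) monoid_scheme \<Rightarrow> ('a set, 'm) cat \<Rightarrow> (real \<Rightarrow> 'm cell_point set) set set monoid"
  where "pi1_mod_O_p' p S L = pi1_L S L Mod O_p' p (pi1_L S L)"

text \<open>The value at a class \<open>A\<close> of automorphisms is the common coset of the loops given by all lifts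
  of all members of \<open>A\<close>.\<close>

definition natural_map ::
    "nat \<Rightarrow> ('a, 'b) monoid_scheme \<Rightarrow> ('a set, 'm) cat \<Rightarrow> ('m \<Rightarrow> 'a \<Rightarrow> 'a) \<Rightarrow>
     ('a \<Rightarrow> 'a) set \<Rightarrow> (real \<Rightarrow> 'm cell_point set) set set" where
  "natural_map p S L \<pi> A = the_elem
     ((\<lambda>f. O_p' p (pi1_L S L) #>\<^bsub>pi1_L S L\<^esub> edge_class S L f) `
        {f \<in> carrier (Aut_cat L (carrier S)). \<pi> f \<in> A})"

end

theory Submission
  imports
    Defs
    "HOL-Analysis.Abstract_Topological_Spaces"
    "HOL-Algebra.Sylow"
    "HOL-Algebra.Multiplicative_Group"
begin

text \<open>Write \<open>\<pi>\<^sub>1\<close> for the fundamental group of the realization of \<open>L\<close> and \<open>E\<close> for \<open>O\<^sup>p\<^sup>'\<^sub>*(F)\<close>. A choice of lifts of the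
  inclusions \<open>P \<le> S\<close> is a tree in \<open>L\<close>, along which every morphism of \<open>L\<close> is completed to a loop. The theorem
  comes from two facts on \<open>\<pi>\<^sub>1\<close> and one on \<open>F\<close>.

  The loops of the morphisms generate \<open>\<pi>\<^sub>1\<close> (\<open>fundamental_group_generated_by_edges\<close>), and every functor from \<open>L\<close> to a group
  induces a homomorphism on \<open>\<pi>\<^sub>1\<close> (\<open>functor_induces_hom\<close>). Both are proved with an open cover of the realization by
  contractible charts. A chart consists of the points that have more than half of their weight on vertices
  linked by identity arrows to one vertex, where weights are measured after a distortion of the interval \<open>[0, 1]\<close>; the distortions
  are needed for the charts to cover everything, and they are compatible with faces and degeneracies because
  vertices are ordered. The covering space that belongs to a functor appears only as a locally constant
  cocycle for these charts, and the homomorphism is its monodromy.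

  Every morphism between centric subgroups is an \<open>E\<close>-morphism followed by an automorphism of \<open>S\<close>
  (\<open>decomposition\<close>). Indeed, an isomorphism from \<open>P < S\<close> to a fully normalized subgroup \<open>Q\<close> extends to the normalizer
  of \<open>P\<close> after a correction by an element of \<open>O\<^sup>p\<^sup>'(Aut(Q))\<close>, since Sylow subgroups are conjugate by such elements; so one can
  induct on the index of \<open>P\<close>.

  The elements of \<open>S\<close> give loops of \<open>p\<close>-power order, which are trivial in \<open>\<pi>\<^sub>1/O\<^sup>p\<^sup>'(\<pi>\<^sub>1)\<close>. Hence the loop of a morphism, taken
  modulo \<open>O\<^sup>p\<^sup>'(\<pi>\<^sub>1)\<close>, depends only on its image in \<open>F\<close>, and this is a functor on the centric subgroups with values in a group
  without \<open>p\<close>-torsion. Such a functor kills \<open>E\<close> (\<open>functor_trivial_on_E\<close>). By the decomposition, each loop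
  then comes from an automorphism of \<open>S\<close>, and the natural map is surjective; for the same reason its kernel contains
  \<open>Out\<^sup>0(S)\<close>. For the reverse inclusion, sending a morphism to the class of the automorphism in its decomposition is a
  functor \<open>Theta\<close> to \<open>Out(S)/Out\<^sup>0(S)\<close>. As \<open>Inn(S)\<close> is a Sylow subgroup of \<open>Aut(S)\<close>, this group has order prime to \<open>p\<close>,
  so the induced homomorphism on \<open>\<pi>\<^sub>1\<close> factors through \<open>\<pi>\<^sub>1/O\<^sup>p\<^sup>'(\<pi>\<^sub>1)\<close>. Composed with the natural map it is the
  projection of \<open>Out(S)\<close>, and therefore the kernel of the natural map lies in \<open>Out\<^sup>0(S)\<close>.\<close>

section \<open>Paths in a topological space\<close>

lemma continuous_map_top_of_set_compose:
  assumes "continuous_map (top_of_set T) X h" "continuous_on S u" "u \<in> S \<rightarrow> T"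
  shows "continuous_map (top_of_set S) X (\<lambda>x. h (u x))"
proof -
  have "continuous_map (top_of_set S) (top_of_set T) u"
    using assms(2,3) by simp
  from continuous_map_compose[OF this assms(1)] show ?thesis by (simp add: o_def)
qed

lemma continuous_map_top_of_set_cases:
  fixes p :: "'s::topological_space \<Rightarrow> real"
  assumes "continuous_on S p"
    and f: "continuous_map (top_of_set {x \<in> S. p x \<le> c}) X f"
    and g: "continuous_map (top_of_set {x \<in> S. c \<le> p x}) X g"
    and fg: "\<And>x. x \<in> S \<Longrightarrow> p x = c \<Longrightarrow> f x = g x"
  shows "continuous_map (top_of_set S) X (\<lambda>x. if p x \<le> c then f x else g x)"
proof (rule continuous_map_cases_le[where q = "\<lambda>_. c"])
  have *: "S \<inter> {x \<in> S. Q x} = {x \<in> S. Q x}" for Q by blast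
  show "continuous_map (subtopology (top_of_set S) {x \<in> topspace (top_of_set S). p x \<le> c}) X f"
    "continuous_map (subtopology (top_of_set S) {x \<in> topspace (top_of_set S). c \<le> p x}) X g"
    using f g by (simp_all add: subtopology_subtopology *)
qed (use assms in auto)

definition path_between :: "'x topology \<Rightarrow> 'x \<Rightarrow> 'x \<Rightarrow> (real \<Rightarrow> 'x) \<Rightarrow> bool" where
  "path_between X a b g \<longleftrightarrow> pathin X g \<and> g 0 = a \<and> g 1 = b"

text \<open>Homotopy relative to the end points.\<close>

definition path_homotopic :: "'x topology \<Rightarrow> 'x \<Rightarrow> 'x \<Rightarrow> (real \<Rightarrow> 'x) \<Rightarrow> (real \<Rightarrow> 'x) \<Rightarrow> bool" where
  "path_homotopic X a b f g \<longleftrightarrow>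
     homotopic_with (\<lambda>r. r 0 = a \<and> r 1 = b) (top_of_set {0..1}) X f g"

definition path_rev :: "(real \<Rightarrow> 'x) \<Rightarrow> real \<Rightarrow> 'x" where
  "path_rev f = (\<lambda>t. f (1 - t))"

lemma path_homotopicI:
  fixes h :: "real \<times> real \<Rightarrow> 'x"
  assumes "continuous_map (top_of_set ({0..1} \<times> {0..1})) X h"
    and "\<And>t. t \<in> {0..1} \<Longrightarrow> h (0, t) = f t" "\<And>t. t \<in> {0..1} \<Longrightarrow> h (1, t) = g t"
    and "\<And>s. s \<in> {0..1} \<Longrightarrow> h (s, 0) = a" "\<And>s. s \<in> {0..1} \<Longrightarrow> h (s, 1) = b"
  shows "path_homotopic X a b f g"
  unfolding path_homotopic_def
  by (subst homotopic_with) (use assms in \<open>auto intro!: exI[of _ h]\<close>)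

lemma path_homotopicE:
  fixes X :: "'x topology"
  assumes "path_homotopic X a b f g"
  obtains h :: "real \<times> real \<Rightarrow> 'x"
  where "continuous_map (top_of_set ({0..1} \<times> {0..1})) X h"
    "\<And>t. h (0, t) = f t" "\<And>t. h (1, t) = g t"
    "\<And>s. s \<in> {0..1} \<Longrightarrow> h (s, 0) = a" "\<And>s. s \<in> {0..1} \<Longrightarrow> h (s, 1) = b"
  using assms unfolding path_homotopic_def homotopic_with_def by auto

lemma path_homotopic_refl: "path_homotopic X a b f f \<longleftrightarrow> path_between X a b f"
  by (auto simp: path_homotopic_def path_between_def pathin_def)

lemma path_homotopic_sym: "path_homotopic X a b f g \<Longrightarrow> path_homotopic X a b g f"
  by (simp add: path_homotopic_def homotopic_with_sym)

lemma path_homotopic_trans [trans]: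
  "path_homotopic X a b f g \<Longrightarrow> path_homotopic X a b g h \<Longrightarrow> path_homotopic X a b f h"
  unfolding path_homotopic_def by (rule homotopic_with_trans)

lemma path_homotopic_imp_path:
  "path_homotopic X a b f g \<Longrightarrow> path_between X a b f \<and> path_between X a b g"
  using path_homotopic_refl path_homotopic_sym path_homotopic_trans by metis

lemma path_homotopic_eq:
  assumes "path_between X a b f" "\<And>t. t \<in> {0..1} \<Longrightarrow> f t = g t"
  shows "path_homotopic X a b f g"
  unfolding path_homotopic_def
  by (rule homotopic_with_equal) (use assms in \<open>auto simp: path_between_def pathin_def\<close>)

lemma path_between_const: "a \<in> topspace X \<Longrightarrow> path_between X a a (\<lambda>_. a)"
  by (simp add: path_between_def)

lemma path_between_rev: "path_between X a b f \<Longrightarrow> path_between X b a (path_rev f)"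
  unfolding path_between_def path_rev_def pathin_def
  by (auto intro!: continuous_intros continuous_map_top_of_set_compose[of "{0..1}" X f])

lemma path_between_join:
  assumes "path_between X a b f" "path_between X b c g"
  shows "path_between X a c (path_join f g)"
proof -
  have "continuous_map (top_of_set {0..1}) X (\<lambda>t. if t \<le> 1/2 then f (2 * t) else g (2 * t - 1))"
  proof (rule continuous_map_top_of_set_cases)
    show "continuous_map (top_of_set {t \<in> {0..1}. t \<le> 1/2}) X (\<lambda>t. f (2 * t))"
      by (rule continuous_map_top_of_set_compose[of "{0..1}"])
        (use assms in \<open>auto simp: path_between_def pathin_def intro!: continuous_intros\<close>)
    show "continuous_map (top_of_set {t \<in> {0..1}. 1/2 \<le> t}) X (\<lambda>t. g (2 * t - 1))"
      by (rule continuous_map_top_of_set_compose[of "{0..1}"])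
        (use assms in \<open>auto simp: path_between_def pathin_def intro!: continuous_intros\<close>)
    show "f (2 * t) = g (2 * t - 1)" if "t = 1/2" for t
      using assms unfolding that by (simp add: path_between_def)
  qed auto
  then show ?thesis
    using assms by (auto simp: path_between_def pathin_def path_join_def)
qed

lemma path_homotopic_join:
  fixes X :: "'x topology"
  assumes "path_homotopic X a b f f'" "path_homotopic X b c g g'"
  shows "path_homotopic X a c (path_join f g) (path_join f' g')"
proof -
  obtain h :: "real \<times> real \<Rightarrow> 'x" where h: "continuous_map (top_of_set ({0..1} \<times> {0..1})) X h"
    "\<And>t. h (0, t) = f t" "\<And>t. h (1, t) = f' t"
    "\<And>s. s \<in> {0..1} \<Longrightarrow> h (s, 0) = a" "\<And>s. s \<in> {0..1} \<Longrightarrow> h (s, 1) = b"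
    using path_homotopicE[OF assms(1)] by metis
  obtain k :: "real \<times> real \<Rightarrow> 'x" where k: "continuous_map (top_of_set ({0..1} \<times> {0..1})) X k"
    "\<And>t. k (0, t) = g t" "\<And>t. k (1, t) = g' t"
    "\<And>s. s \<in> {0..1} \<Longrightarrow> k (s, 0) = b" "\<And>s. s \<in> {0..1} \<Longrightarrow> k (s, 1) = c"
    using path_homotopicE[OF assms(2)] by metis
  show ?thesis
  proof (rule path_homotopicI)
    let ?H = "\<lambda>x. if snd x \<le> 1/2 then h (fst x, 2 * snd x) else k (fst x, 2 * snd x - 1)"
    show "continuous_map (top_of_set ({0..1} \<times> {0..1})) X ?H"
    proof (rule continuous_map_top_of_set_cases)
      show "continuous_map (top_of_set {t \<in> {0..1} \<times> {0..1}. snd t \<le> 1/2}) X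
          (\<lambda>x. h (fst x, 2 * snd x))"
        by (rule continuous_map_top_of_set_compose[OF h(1)]) (auto intro!: continuous_intros)
      show "continuous_map (top_of_set {t \<in> {0..1} \<times> {0..1}. 1/2 \<le> snd t}) X
          (\<lambda>x. k (fst x, 2 * snd x - 1))"
        by (rule continuous_map_top_of_set_compose[OF k(1)]) (auto intro!: continuous_intros)
      show "h (fst x, 2 * snd x) = k (fst x, 2 * snd x - 1)"
        if "x \<in> {0..1} \<times> {0..1}" "snd x = 1/2" for x
        using that h(5)[of "fst x"] k(4)[of "fst x"] unfolding that(2) by auto
    qed (auto intro!: continuous_intros)
  qed (use h k in \<open>auto simp: path_join_def\<close>)
qed

lemma path_homotopic_rev:
  fixes X :: "'x topology"
  assumes "path_homotopic X a b f g"
  shows "path_homotopic X b a (path_rev f) (path_rev g)"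
proof -
  obtain h :: "real \<times> real \<Rightarrow> 'x" where h: "continuous_map (top_of_set ({0..1} \<times> {0..1})) X h"
    "\<And>t. h (0, t) = f t" "\<And>t. h (1, t) = g t"
    "\<And>s. s \<in> {0..1} \<Longrightarrow> h (s, 0) = a" "\<And>s. s \<in> {0..1} \<Longrightarrow> h (s, 1) = b"
    using path_homotopicE[OF assms] by metis
  show ?thesis
  proof (rule path_homotopicI)
    show "continuous_map (top_of_set ({0..1} \<times> {0..1})) X (\<lambda>x. h (fst x, 1 - snd x))"
      by (rule continuous_map_top_of_set_compose[OF h(1)]) (auto intro!: continuous_intros)
  qed (use h in \<open>auto simp: path_rev_def\<close>)
qed

text \<open>All the laws of the fundamental groupoid are instances of the next lemma: both sides are
  reparametrizations of one path, and the interval is convex.\<close>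

lemma path_homotopic_reparam:
  assumes "path_between X a b g"
    and u: "continuous_on {0..1} u" "u \<in> {0..1} \<rightarrow> {0..1}"
    and v: "continuous_on {0..1} v" "v \<in> {0..1} \<rightarrow> {0..1}"
    and "u 0 = v 0" "u 1 = v 1"
    and "\<And>t. t \<in> {0..1} \<Longrightarrow> f1 t = g (u t)" "\<And>t. t \<in> {0..1} \<Longrightarrow> f2 t = g (v t)"
  shows "path_homotopic X (g (u 0)) (g (u 1)) f1 f2"
proof (rule path_homotopicI)
  have c: "continuous_on ({0..1} \<times> {0..1}) (\<lambda>x. u (snd x))"
    "continuous_on ({0..1} \<times> {0..1}) (\<lambda>x. v (snd x))"
    by (auto intro!: continuous_on_compose2[OF u(1)] continuous_on_compose2[OF v(1)] continuous_intros)
  show "continuous_map (top_of_set ({0..1} \<times> {0..1})) X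
      (\<lambda>x. g ((1 - fst x) * u (snd x) + fst x * v (snd x)))"
  proof (rule continuous_map_top_of_set_compose)
    show "continuous_map (top_of_set {0..1}) X g"
      using assms(1) by (simp add: path_between_def pathin_def)
    show "(\<lambda>x. (1 - fst x) * u (snd x) + fst x * v (snd x)) \<in> {0..1} \<times> {0..1} \<rightarrow> {0..1::real}"
    proof (clarsimp, intro conjI)
      fix s t :: real assume st: "0 \<le> s" "s \<le> 1" "0 \<le> t" "t \<le> 1"
      then have uv: "0 \<le> u t" "u t \<le> 1" "0 \<le> v t" "v t \<le> 1" using u v by auto
      then show "0 \<le> (1 - s) * u t + s * v t" using st by simp
      show "(1 - s) * u t + s * v t \<le> 1"
        using convex_bound_le[of "u t" 1 "v t" "1 - s" s] uv st by simp
    qed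
  qed (intro continuous_intros c)
qed (use assms in \<open>auto simp: algebra_simps\<close>)

lemma path_homotopic_assoc:
  assumes "path_between X a b f" "path_between X b c g" "path_between X c d h"
  shows "path_homotopic X a d (path_join (path_join f g) h) (path_join f (path_join g h))"
proof -
  let ?k = "path_join f (path_join g h)"
  have k: "path_between X a d ?k"
    using assms by (meson path_between_join)
  have "path_homotopic X (?k (min (2 * 0) (min (0 + 1/4) (0/2 + 1/2))))
     (?k (min (2 * 1) (min (1 + 1/4) (1/2 + 1/2)))) (path_join (path_join f g) h) ?k"
  proof (rule path_homotopic_reparam[OF k, where v = "\<lambda>t. t"])
    show "path_join (path_join f g) h t = ?k (min (2 * t) (min (t + 1/4) (t/2 + 1/2)))" for t
      by (cases "t \<le> 1/4"; cases "t \<le> 1/2") (auto simp: path_join_def min_def algebra_simps)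
  qed (auto intro!: continuous_intros)
  then show ?thesis
    using k by (simp add: path_between_def min_def)
qed

lemma path_homotopic_join_const:
  assumes "path_between X a b f"
  shows "path_homotopic X a b (path_join f (\<lambda>_. b)) f"
proof -
  have "path_homotopic X (f (min 1 (2 * 0))) (f (min 1 (2 * 1))) (path_join f (\<lambda>_. b)) f"
    by (rule path_homotopic_reparam[OF assms, where v = "\<lambda>t. t"])
      (use assms in \<open>auto intro!: continuous_intros simp: path_join_def path_between_def\<close>)
  then show ?thesis
    using assms by (simp add: path_between_def)
qed

lemma path_homotopic_const_join:
  assumes "path_between X a b f"
  shows "path_homotopic X a b (path_join (\<lambda>_. a) f) f"
proof -
  have "path_homotopic X (f (max 0 (2 * 0 - 1))) (f (max 0 (2 * 1 - 1))) (path_join (\<lambda>_. a) f) f"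
  proof (rule path_homotopic_reparam[OF assms, where v = "\<lambda>t. t"])
    show "path_join (\<lambda>_. a) f t = f (max 0 (2 * t - 1))" for t
      using assms by (simp add: path_join_def path_between_def)
  qed (auto intro!: continuous_intros)
  then show ?thesis
    using assms by (simp add: path_between_def)
qed

lemma path_homotopic_join_rev:
  assumes "path_between X a b f"
  shows "path_homotopic X a a (path_join f (path_rev f)) (\<lambda>_. a)"
proof -
  have "path_homotopic X (f (min (2 * 0) (2 - 2 * 0))) (f (min (2 * 1) (2 - 2 * 1)))
      (path_join f (path_rev f)) (\<lambda>_. a)"
  proof (rule path_homotopic_reparam[OF assms, where v = "\<lambda>t. 0"])
    show "path_join f (path_rev f) t = f (min (2 * t) (2 - 2 * t))" for t
      by (simp add: path_join_def path_rev_def min_def)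
  qed (use assms in \<open>auto intro!: continuous_intros simp: path_between_def\<close>)
  then show ?thesis
    using assms by (simp add: path_between_def)
qed

lemma path_rev_rev [simp]: "path_rev (path_rev f) = f"
  by (simp add: path_rev_def)

lemma path_homotopic_rev_join:
  assumes "path_between X a b f"
  shows "path_homotopic X b b (path_join (path_rev f) f) (\<lambda>_. b)"
  using path_homotopic_join_rev[OF path_between_rev[OF assms]] by simp

section \<open>The fundamental group\<close>

lemma loops_eq: "loops X a = {g. path_between X a a g}"
  by (auto simp: loops_def path_between_def)

lemma loop_class_eq: "loop_class X a g = {g'. path_homotopic X a a g g'}"
  by (simp add: loop_class_def path_homotopic_def)

lemma loop_class_eqI: "path_homotopic X a a f g \<Longrightarrow> loop_class X a f = loop_class X a g"
  unfolding loop_class_eq by (auto intro: path_homotopic_sym path_homotopic_trans)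

lemma mult_fundamental_group:
  assumes "path_between X a a f" "path_between X a a g"
  shows "loop_class X a f \<otimes>\<^bsub>fundamental_group X a\<^esub> loop_class X a g = loop_class X a (path_join g f)"
proof -
  have 1: "loop_class X a (path_join g' f') = loop_class X a (path_join g f)"
    if "f' \<in> loop_class X a f" "g' \<in> loop_class X a g" for f' g'
  proof (rule loop_class_eqI[OF path_homotopic_join])
    show "path_homotopic X a a g' g" "path_homotopic X a a f' f"
      using that by (auto simp: loop_class_eq intro: path_homotopic_sym)
  qed
  have "loop_class X a f \<noteq> {}" "loop_class X a g \<noteq> {}"
    using assms path_homotopic_refl[of X a a] unfolding loop_class_eq by (metis empty_iff mem_Collect_eq)+
  moreover have "(\<Union>f'\<in>loop_class X a f. \<Union>g'\<in>loop_class X a g. loop_class X a (path_join g' f')) =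
      (\<Union>f'\<in>loop_class X a f. \<Union>g'\<in>loop_class X a g. loop_class X a (path_join g f))"
    by (intro SUP_cong refl 1)
  ultimately show ?thesis
    unfolding fundamental_group_def by simp
qed

lemma carrier_fundamental_group:
  "carrier (fundamental_group X a) = loop_class X a ` {g. path_between X a a g}"
  by (simp add: fundamental_group_def loops_eq)

lemma one_fundamental_group: "\<one>\<^bsub>fundamental_group X a\<^esub> = loop_class X a (\<lambda>_. a)"
  by (simp add: fundamental_group_def)

lemma loop_class_in_carrier:
  "path_between X a a g \<Longrightarrow> loop_class X a g \<in> carrier (fundamental_group X a)"
  by (simp add: carrier_fundamental_group)

lemma group_fundamental_group:
  assumes "a \<in> topspace X"
  shows "group (fundamental_group X a)"
proof (rule groupI)
  fix x y z
  assume x: "x \<in> carrier (fundamental_group X a)"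
  then obtain f where f: "path_between X a a f" "x = loop_class X a f"
    by (auto simp: carrier_fundamental_group)
  show "\<one>\<^bsub>fundamental_group X a\<^esub> \<otimes>\<^bsub>fundamental_group X a\<^esub> x = x"
    using f assms by (auto simp: one_fundamental_group mult_fundamental_group path_between_const
        intro!: loop_class_eqI path_homotopic_join_const)
  show "\<exists>y\<in>carrier (fundamental_group X a). y \<otimes>\<^bsub>fundamental_group X a\<^esub> x = \<one>\<^bsub>fundamental_group X a\<^esub>"
  proof (rule bexI[of _ "loop_class X a (path_rev f)"])
    show "loop_class X a (path_rev f) \<otimes>\<^bsub>fundamental_group X a\<^esub> x = \<one>\<^bsub>fundamental_group X a\<^esub>"
      unfolding f(2) one_fundamental_group mult_fundamental_group[OF path_between_rev[OF f(1)] f(1)]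
      by (rule loop_class_eqI[OF path_homotopic_join_rev[OF f(1)]])
  qed (rule loop_class_in_carrier[OF path_between_rev[OF f(1)]])
  assume y: "y \<in> carrier (fundamental_group X a)"
  then obtain g where g: "path_between X a a g" "y = loop_class X a g"
    by (auto simp: carrier_fundamental_group)
  show "x \<otimes>\<^bsub>fundamental_group X a\<^esub> y \<in> carrier (fundamental_group X a)"
    using f g by (auto simp: mult_fundamental_group intro!: loop_class_in_carrier path_between_join)
  assume z: "z \<in> carrier (fundamental_group X a)"
  then obtain h where h: "path_between X a a h" "z = loop_class X a h"
    by (auto simp: carrier_fundamental_group)
  show "x \<otimes>\<^bsub>fundamental_group X a\<^esub> y \<otimes>\<^bsub>fundamental_group X a\<^esub> z =
      x \<otimes>\<^bsub>fundamental_group X a\<^esub> (y \<otimes>\<^bsub>fundamental_group X a\<^esub> z)"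
    unfolding f g h
    by (simp only: mult_fundamental_group f g h path_between_join[OF g(1) f(1)]
          path_between_join[OF h(1) g(1)])
      (rule loop_class_eqI[OF path_homotopic_sym[OF path_homotopic_assoc[OF h(1) g(1) f(1)]]])
qed (auto simp: assms one_fundamental_group path_between_const intro!: loop_class_in_carrier)

text \<open>Once a path from the base point to each of the points in play has been chosen, this turns
  paths between such points into elements of the fundamental group.\<close>

definition connect :: "'x topology \<Rightarrow> 'x \<Rightarrow> (real \<Rightarrow> 'x) \<Rightarrow> (real \<Rightarrow> 'x) \<Rightarrow> (real \<Rightarrow> 'x) \<Rightarrow> (real \<Rightarrow> 'x) set" where
  "connect X v c f d = loop_class X v (path_join c (path_join f (path_rev d)))"

lemma connect_cong:
  assumes "path_homotopic X v a c c'" "path_homotopic X a b f f'" "path_homotopic X v b d d'"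
  shows "connect X v c f d = connect X v c' f' d'"
  unfolding connect_def
  by (intro loop_class_eqI path_homotopic_join[OF assms(1)] path_homotopic_join[OF assms(2)]
      path_homotopic_rev assms)

lemma connect_in_carrier:
  assumes "path_between X v a c" "path_between X a b f" "path_between X v b d"
  shows "connect X v c f d \<in> carrier (fundamental_group X v)"
  unfolding connect_def
  by (intro loop_class_in_carrier path_between_join[OF assms(1)] path_between_join[OF assms(2)]
      path_between_rev assms)

lemma connect_assoc:
  assumes "path_between X v a c" "path_between X a b e" "path_between X b x f" "path_between X v x d"
  shows "connect X v (path_join c e) f d = connect X v c (path_join e f) d"
proof -
  have r: "path_between X x v (path_rev d)" using assms(4) by (rule path_between_rev)
  have "path_homotopic X v v (path_join (path_join c e) (path_join f (path_rev d)))
      (path_join c (path_join e (path_join f (path_rev d))))"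
    by (rule path_homotopic_assoc) (use assms r in \<open>auto intro: path_between_join\<close>)
  also have "path_homotopic X v v \<dots> (path_join c (path_join (path_join e f) (path_rev d)))"
    using assms r path_homotopic_assoc path_homotopic_join path_homotopic_refl path_homotopic_sym
    by metis
  finally show ?thesis
    unfolding connect_def by (rule loop_class_eqI)
qed

lemma connect_mult:
  assumes c: "path_between X v a c" and f: "path_between X a b f" and d: "path_between X v b d"
    and g: "path_between X b x g" and e: "path_between X v x e"
  shows "connect X v d g e \<otimes>\<^bsub>fundamental_group X v\<^esub> connect X v c f d = connect X v c (path_join f g) e"
proof -
  note r = path_between_rev[OF d] path_between_rev[OF e]
  note J = path_between_join and R = path_homotopic_refl[THEN iffD2]
  note fr = J[OF f r(1)] and gr = J[OF g r(2)]
  have "connect X v d g e \<otimes>\<^bsub>fundamental_group X v\<^esub> connect X v c f d =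
     loop_class X v (path_join (path_join c (path_join f (path_rev d))) (path_join d (path_join g (path_rev e))))"
    unfolding connect_def
    by (rule mult_fundamental_group) (use assms r in \<open>auto intro: path_between_join\<close>)
  also have "\<dots> = loop_class X v (path_join c (path_join (path_join f g) (path_rev e)))"
  proof (rule loop_class_eqI)
    have "path_homotopic X v v (path_join (path_join c (path_join f (path_rev d))) (path_join d (path_join g (path_rev e))))
      (path_join c (path_join (path_join f (path_rev d)) (path_join d (path_join g (path_rev e)))))"
      by (rule path_homotopic_assoc[OF c fr J[OF d gr]])
    also have "path_homotopic X v v \<dots> (path_join c (path_join f (path_join g (path_rev e))))"
    proof (rule path_homotopic_join[OF R[OF c]])
      have "path_homotopic X a v (path_join (path_join f (path_rev d)) (path_join d (path_join g (path_rev e))))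
        (path_join f (path_join (path_rev d) (path_join d (path_join g (path_rev e)))))"
        by (rule path_homotopic_assoc[OF f r(1) J[OF d gr]])
      also have "path_homotopic X a v \<dots> (path_join f (path_join g (path_rev e)))"
      proof (rule path_homotopic_join[OF R[OF f]])
        have "path_homotopic X b v (path_join (path_rev d) (path_join d (path_join g (path_rev e))))
          (path_join (path_join (path_rev d) d) (path_join g (path_rev e)))"
          by (rule path_homotopic_sym[OF path_homotopic_assoc[OF r(1) d gr]])
        also have "path_homotopic X b v \<dots> (path_join (\<lambda>_. b) (path_join g (path_rev e)))"
          by (rule path_homotopic_join[OF path_homotopic_rev_join[OF d] R[OF gr]])
        also have "path_homotopic X b v \<dots> (path_join g (path_rev e))"
          by (rule path_homotopic_const_join[OF gr])
        finally show "path_homotopic X b v (path_join (path_rev d) (path_join d (path_join g (path_rev e)))) (path_join g (path_rev e))" .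
      qed
      finally show "path_homotopic X a v (path_join (path_join f (path_rev d)) (path_join d (path_join g (path_rev e))))
        (path_join f (path_join g (path_rev e)))" .
    qed
    also have "path_homotopic X v v \<dots> (path_join c (path_join (path_join f g) (path_rev e)))"
      by (rule path_homotopic_join[OF R[OF c] path_homotopic_sym[OF path_homotopic_assoc[OF f g r(2)]]])
    finally show "path_homotopic X v v (path_join (path_join c (path_join f (path_rev d))) (path_join d (path_join g (path_rev e))))
      (path_join c (path_join (path_join f g) (path_rev e)))" .
  qed
  finally show ?thesis
    by (simp add: connect_def)
qed

lemma connect_const:
  assumes "path_between X v a c"
  shows "connect X v c (\<lambda>_. a) c = \<one>\<^bsub>fundamental_group X v\<^esub>"
proof -
  note r = path_between_rev[OF assms]
  have "path_homotopic X v v (path_join c (path_join (\<lambda>_. a) (path_rev c))) (path_join c (path_rev c))"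
    by (rule path_homotopic_join[OF path_homotopic_refl[THEN iffD2, OF assms] path_homotopic_const_join[OF r]])
  also have "path_homotopic X v v \<dots> (\<lambda>_. v)"
    by (rule path_homotopic_join_rev[OF assms])
  finally show ?thesis
    unfolding connect_def one_fundamental_group by (rule loop_class_eqI)
qed

lemma connect_trivial_ends:
  assumes "path_between X v v f"
  shows "connect X v (\<lambda>_. v) f (\<lambda>_. v) = loop_class X v f"
proof -
  have "path_homotopic X v v (path_join f (path_rev (\<lambda>_. v))) f"
    using path_homotopic_join_const[OF assms] by (simp add: path_rev_def)
  moreover from this have "path_homotopic X v v (path_join (\<lambda>_. v) (path_join f (path_rev (\<lambda>_. v))))
      (path_join f (path_rev (\<lambda>_. v)))"
    using path_homotopic_imp_path path_homotopic_const_join by metis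
  ultimately show ?thesis
    unfolding connect_def by (metis loop_class_eqI)
qed

section \<open>The geometric realization of a nerve\<close>

definition cell_pt :: "('o, 'm) cat \<Rightarrow> nat \<Rightarrow> (nat \<Rightarrow> nat \<Rightarrow> 'm) \<Rightarrow> (nat \<Rightarrow> real) \<Rightarrow> 'm cell_point set"
  where "cell_pt C n \<sigma> t = glue_equiv C `` {((n, \<sigma>), t)}"

abbreviation corner :: "nat \<Rightarrow> nat \<Rightarrow> real" where
  "corner i \<equiv> (\<lambda>j. if j = i then 1 else 0)"

lemma equiv_glue_equiv: "equiv UNIV (glue_equiv C)"
  unfolding glue_equiv_def
  by (intro equivI refl_rtrancl trans_rtrancl sym_rtrancl) (auto simp: sym_Un_converse)

lemma cell_pt_eq_iff: "cell_pt C n \<sigma> t = cell_pt C m \<tau> s \<longleftrightarrow> (((n, \<sigma>), t), ((m, \<tau>), s)) \<in> glue_equiv C"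
  unfolding cell_pt_def by (rule eq_equiv_class_iff[OF equiv_glue_equiv]) auto

lemma cell_pt_glue:
  assumes "\<sigma> \<in> nerve C n" "t \<in> standard_simplex m" "\<theta> \<in> {..m} \<rightarrow> {..n}" "mono_on {..m} \<theta>"
  shows "cell_pt C m (nerve_map m \<theta> \<sigma>) t = cell_pt C n \<sigma> (simplex_push m \<theta> t)"
  unfolding cell_pt_eq_iff glue_equiv_def
  by (rule r_into_rtrancl) (use assms in \<open>auto simp: glue_def\<close>)

text \<open>A property of cell points that is invariant under the elementary identifications descends to
  the realization.\<close>

lemma cell_pt_invariant:
  assumes eq: "cell_pt C n \<sigma> t = cell_pt C n' \<sigma>' t'"
    and R: "\<And>m n \<theta> \<sigma> t. \<sigma> \<in> nerve C n \<Longrightarrow> t \<in> standard_simplex m \<Longrightarrow> \<theta> \<in> {..m} \<rightarrow> {..n} \<Longrightarrow>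
      mono_on {..m} \<theta> \<Longrightarrow> R m (nerve_map m \<theta> \<sigma>) t \<longleftrightarrow> R n \<sigma> (simplex_push m \<theta> t)"
  shows "R n \<sigma> t \<longleftrightarrow> R n' \<sigma>' t'"
proof -
  have "(((n, \<sigma>), t), ((n', \<sigma>'), t')) \<in> (glue C \<union> (glue C)\<inverse>)\<^sup>*"
    using eq by (simp add: cell_pt_eq_iff glue_equiv_def)
  then show ?thesis
  proof (induction "((n', \<sigma>'), t')" arbitrary: n' \<sigma>' t' rule: rtrancl_induct)
    case base
    show ?case ..
  next
    case (step y)
    obtain n1 \<sigma>1 t1 where y: "y = ((n1, \<sigma>1), t1)" by (metis prod.exhaust)
    have "R n1 \<sigma>1 t1 \<longleftrightarrow> R n' \<sigma>' t'"
      using step(2) R unfolding y glue_def by auto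
    then show ?case
      using step(3)[OF y] by simp
  qed
qed

lemma quotient_map_realization:
  "quotient_map (cells C) (realization C) (\<lambda>((n, \<sigma>), t). cell_pt C n \<sigma> t)"
  using quotient_map_quotient_topology[of "cells C" "glue_equiv C"]
  by (simp add: realization_def cell_pt_def case_prod_beta')

lemma topspace_realization:
  "topspace (realization C) = {cell_pt C n \<sigma> t | n \<sigma> t. \<sigma> \<in> nerve C n \<and> t \<in> standard_simplex n}"
proof -
  have "topspace (cells C) = {((n, \<sigma>), t) | n \<sigma> t. \<sigma> \<in> nerve C n \<and> t \<in> standard_simplex n}"
    by (auto simp: cells_def)
  moreover have "(\<lambda>((n, \<sigma>), t). cell_pt C n \<sigma> t) ` \<dots> =
      {cell_pt C n \<sigma> t | n \<sigma> t. \<sigma> \<in> nerve C n \<and> t \<in> standard_simplex n}"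
    by force
  ultimately show ?thesis
    using quotient_imp_surjective_map[OF quotient_map_realization, of C] by simp
qed

lemma cell_pt_in_topspace [simp]:
  "\<sigma> \<in> nerve C n \<Longrightarrow> t \<in> standard_simplex n \<Longrightarrow> cell_pt C n \<sigma> t \<in> topspace (realization C)"
  by (auto simp: topspace_realization)

lemma openin_realization:
  "openin (realization C) U \<longleftrightarrow> U \<subseteq> topspace (realization C) \<and>
     (\<forall>n. \<forall>\<sigma>\<in>nerve C n. openin (top_of_set (standard_simplex n)) {t \<in> standard_simplex n. cell_pt C n \<sigma> t \<in> U})"
proof -
  have "{x \<in> topspace (cells C). glue_equiv C `` {x} \<in> U} \<subseteq>
      (SIGMA i:(SIGMA n : UNIV. nerve C n). standard_simplex (fst i))"
    by (auto simp: cells_def)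
  moreover have "{t. ((n, \<sigma>), t) \<in> {x \<in> topspace (cells C). glue_equiv C `` {x} \<in> U}} =
      {t \<in> standard_simplex n. cell_pt C n \<sigma> t \<in> U}" if "\<sigma> \<in> nerve C n" for n \<sigma>
    using that by (auto simp: cells_def cell_pt_def)
  ultimately have "openin (cells C) {x \<in> topspace (cells C). glue_equiv C `` {x} \<in> U} \<longleftrightarrow>
     (\<forall>n. \<forall>\<sigma>\<in>nerve C n. openin (top_of_set (standard_simplex n)) {t \<in> standard_simplex n. cell_pt C n \<sigma> t \<in> U})"
    by (subst cells_def, subst openin_sum_topology)
      (auto simp: euclidean_product_topology split_beta)
  then show ?thesis
    by (simp add: realization_def openin_quotient_topology)
qed

lemma continuous_map_cell_pt:
  assumes "\<sigma> \<in> nerve C n"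
  shows "continuous_map (top_of_set (standard_simplex n)) (realization C) (cell_pt C n \<sigma>)"
  unfolding continuous_map_def using assms by (auto simp: openin_realization)

section \<open>Paths inside a simplex\<close>

lemma mix_continuous_on:
  fixes u v :: "'z::topological_space \<Rightarrow> nat \<Rightarrow> real"
  assumes "continuous_on S r" "continuous_on S u" "continuous_on S v"
  shows "continuous_on S (\<lambda>x i. (1 - r x) * u x i + r x * v x i)"
  by (intro continuous_on_coordinatewise_then_product continuous_intros assms
      continuous_on_product_then_coordinatewise[OF assms(2)] continuous_on_product_then_coordinatewise[OF assms(3)])

text \<open>Simplices are convex. The next lemma supplies every homotopy that stays within one simplex.\<close>

lemma cell_pt_paths_homotopic:
  assumes \<sigma>: "\<sigma> \<in> nerve C n"
    and u: "path_between (top_of_set (standard_simplex n)) a b u"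
    and v: "path_between (top_of_set (standard_simplex n)) a b v"
  shows "path_homotopic (realization C) (cell_pt C n \<sigma> a) (cell_pt C n \<sigma> b)
    (\<lambda>r. cell_pt C n \<sigma> (u r)) (\<lambda>r. cell_pt C n \<sigma> (v r))"
proof (rule path_homotopicI)
  let ?h = "\<lambda>x i. (1 - fst x) * u (snd x) i + fst x * v (snd x) i"
  have u': "continuous_on {0..1} u" "u \<in> {0..1} \<rightarrow> standard_simplex n" "u 0 = a" "u 1 = b"
    and v': "continuous_on {0..1} v" "v \<in> {0..1} \<rightarrow> standard_simplex n" "v 0 = a" "v 1 = b"
    using u v by (auto simp: path_between_def pathin_def)
  show "continuous_map (top_of_set ({0..1} \<times> {0..1})) (realization C) (\<lambda>x. cell_pt C n \<sigma> (?h x))"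
  proof (rule continuous_map_top_of_set_compose[OF continuous_map_cell_pt[OF \<sigma>]])
    show "continuous_on ({0..1} \<times> {0..1}) ?h"
    proof (rule mix_continuous_on)
      show "continuous_on ({0..1} \<times> {0..1}) (\<lambda>x. u (snd x))" "continuous_on ({0..1} \<times> {0..1}) (\<lambda>x. v (snd x))"
        by (rule continuous_on_compose2[OF u'(1)] continuous_on_compose2[OF v'(1)];
            auto intro!: continuous_on_snd continuous_on_id)+
    qed (intro continuous_intros)
    show "?h \<in> {0..1} \<times> {0..1} \<rightarrow> standard_simplex n"
      using u' v' by (auto intro!: convex_standard_simplex)
  qed
  show "cell_pt C n \<sigma> (?h (s, 0)) = cell_pt C n \<sigma> a" "cell_pt C n \<sigma> (?h (s, 1)) = cell_pt C n \<sigma> b" for s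
    using u' v' by (simp_all add: algebra_simps)
qed simp_all

definition segment :: "(nat \<Rightarrow> real) \<Rightarrow> (nat \<Rightarrow> real) \<Rightarrow> real \<Rightarrow> nat \<Rightarrow> real" where
  "segment a b = (\<lambda>r i. (1 - r) * a i + r * b i)"

definition line :: "('o, 'm) cat \<Rightarrow> nat \<Rightarrow> (nat \<Rightarrow> nat \<Rightarrow> 'm) \<Rightarrow> (nat \<Rightarrow> real) \<Rightarrow> (nat \<Rightarrow> real) \<Rightarrow>
    real \<Rightarrow> 'm cell_point set" where
  "line C n \<sigma> a b = (\<lambda>r. cell_pt C n \<sigma> (segment a b r))"

lemma segment_in: "a \<in> standard_simplex n \<Longrightarrow> b \<in> standard_simplex n \<Longrightarrow> 0 \<le> r \<Longrightarrow> r \<le> 1 \<Longrightarrow>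
    segment a b r \<in> standard_simplex n"
  by (simp add: segment_def convex_standard_simplex)

lemma path_between_segment:
  "a \<in> standard_simplex n \<Longrightarrow> b \<in> standard_simplex n \<Longrightarrow>
    path_between (top_of_set (standard_simplex n)) a b (segment a b)"
  unfolding path_between_def pathin_def segment_def
  by (auto intro!: mix_continuous_on continuous_intros convex_standard_simplex)

lemma path_between_line:
  assumes "\<sigma> \<in> nerve C n" "a \<in> standard_simplex n" "b \<in> standard_simplex n"
  shows "path_between (realization C) (cell_pt C n \<sigma> a) (cell_pt C n \<sigma> b) (line C n \<sigma> a b)"
  using path_homotopic_imp_path[OF cell_pt_paths_homotopic[OF assms(1)]] path_between_segment assms(2,3)
  unfolding line_def by blast

lemma line_join:
  assumes "\<sigma> \<in> nerve C n" "a \<in> standard_simplex n" "b \<in> standard_simplex n" "c \<in> standard_simplex n"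
  shows "path_homotopic (realization C) (cell_pt C n \<sigma> a) (cell_pt C n \<sigma> c)
    (path_join (line C n \<sigma> a b) (line C n \<sigma> b c)) (line C n \<sigma> a c)"
proof -
  have "path_join (line C n \<sigma> a b) (line C n \<sigma> b c) =
      (\<lambda>r. cell_pt C n \<sigma> (path_join (segment a b) (segment b c) r))"
    by (rule ext) (simp add: path_join_def line_def)
  then show ?thesis
    unfolding line_def[of C n \<sigma> a c]
    using cell_pt_paths_homotopic[OF assms(1) path_between_join[OF path_between_segment path_between_segment]
        path_between_segment] assms(2-4)
    by simp
qed

section \<open>Simplices of the nerve\<close>

abbreviation nerve_ob :: "('o, 'm) cat \<Rightarrow> (nat \<Rightarrow> nat \<Rightarrow> 'm) \<Rightarrow> nat \<Rightarrow> 'o" where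
  "nerve_ob C \<sigma> i \<equiv> Dom C (\<sigma> i i)"

lemma mono_on_atMostD: "mono_on {..m::nat} \<theta> \<Longrightarrow> i \<le> j \<Longrightarrow> j \<le> m \<Longrightarrow> \<theta> i \<le> \<theta> j"
  by (auto simp: mono_on_def)

lemma simplex_push_in:
  assumes "t \<in> standard_simplex m" "\<theta> \<in> {..m} \<rightarrow> {..n}"
  shows "simplex_push m \<theta> t \<in> standard_simplex n"
proof -
  have t: "\<And>i. 0 \<le> t i" "\<And>i. t i \<le> 1" "(\<Sum>i\<le>m. t i) = 1"
    using assms(1) by (auto simp: standard_simplex_def)
  have "(\<Sum>j\<le>n. simplex_push m \<theta> t j) = (\<Sum>j\<le>n. sum t {i \<in> {..m}. \<theta> i = j})"
    by (simp add: simplex_push_def)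
  also have "\<dots> = (\<Sum>i\<le>m. t i)"
    by (rule sum.group) (use assms in auto)
  finally have 1: "(\<Sum>j\<le>n. simplex_push m \<theta> t j) = 1"
    using t by simp
  have "simplex_push m \<theta> t j \<le> (\<Sum>i\<le>m. t i)" for j
    unfolding simplex_push_def by (rule sum_mono2) (use t in auto)
  moreover have "simplex_push m \<theta> t j = 0" if "n < j" for j
    unfolding simplex_push_def by (rule sum.neutral) (use funcset_mem[OF assms(2)] that in force)
  moreover have "0 \<le> simplex_push m \<theta> t j" for j
    unfolding simplex_push_def by (rule sum_nonneg) (use t in auto)
  ultimately show ?thesis
    using 1 t by (auto simp: standard_simplex_def)
qed

context small_category
begin

lemma nerveI:
  assumes "\<And>i. i \<le> n \<Longrightarrow> x i \<in> Ob C" "\<And>i. i \<le> n \<Longrightarrow> \<sigma> i i = Ident C (x i)"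
    and "\<And>i j. i \<le> j \<Longrightarrow> j \<le> n \<Longrightarrow> \<sigma> i j \<in> Mor C (x i) (x j)"
    and "\<And>i j k. i \<le> j \<Longrightarrow> j \<le> k \<Longrightarrow> k \<le> n \<Longrightarrow> \<sigma> i k = Comp C (\<sigma> j k) (\<sigma> i j)"
    and "\<And>i j. \<not> (i \<le> j \<and> j \<le> n) \<Longrightarrow> \<sigma> i j = undefined"
  shows "\<sigma> \<in> nerve C n"
  unfolding nerve_def using assms by blast

lemma Dom_Ident: "x \<in> Ob C \<Longrightarrow> Dom C (Ident C x) = x"
  using Ident_Mor by (simp add: Mor_def)

lemma Cod_Ident: "x \<in> Ob C \<Longrightarrow> Cod C (Ident C x) = x"
  using Ident_Mor by (simp add: Mor_def)

lemma Mor_Ob: "f \<in> Mor C x y \<Longrightarrow> x \<in> Ob C \<and> y \<in> Ob C"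
  using Dom_Ob Cod_Ob by (auto simp: Mor_def)

lemma nerve_Ident:
  assumes "\<sigma> \<in> nerve C n" "i \<le> n"
  shows "\<sigma> i i = Ident C (nerve_ob C \<sigma> i)" "nerve_ob C \<sigma> i \<in> Ob C"
  using assms Dom_Ident by (auto simp: nerve_def)

lemma nerve_Mor:
  assumes "\<sigma> \<in> nerve C n" "i \<le> j" "j \<le> n"
  shows "\<sigma> i j \<in> Mor C (nerve_ob C \<sigma> i) (nerve_ob C \<sigma> j)"
  using assms Dom_Ident by (auto simp: nerve_def)

lemma nerve_Comp:
  "\<sigma> \<in> nerve C n \<Longrightarrow> i \<le> j \<Longrightarrow> j \<le> k \<Longrightarrow> k \<le> n \<Longrightarrow> \<sigma> i k = Comp C (\<sigma> j k) (\<sigma> i j)"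
  by (auto simp: nerve_def)

lemma nerve_map_in:
  assumes "\<sigma> \<in> nerve C n" "\<theta> \<in> {..m} \<rightarrow> {..n}" "mono_on {..m} \<theta>"
  shows "nerve_map m \<theta> \<sigma> \<in> nerve C m"
proof (rule nerveI[of m "\<lambda>i. nerve_ob C \<sigma> (\<theta> i)"])
  have \<theta>: "\<theta> i \<le> n" if "i \<le> m" for i using that assms(2) by auto
  note mono = mono_on_atMostD[OF assms(3)]
  show "nerve_ob C \<sigma> (\<theta> i) \<in> Ob C" if "i \<le> m" for i
    using nerve_Ident(2)[OF assms(1) \<theta>[OF that]] .
  show "nerve_map m \<theta> \<sigma> i i = Ident C (nerve_ob C \<sigma> (\<theta> i))" if "i \<le> m" for i
    using nerve_Ident(1)[OF assms(1) \<theta>[OF that]] that by (simp add: nerve_map_def)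
  show "nerve_map m \<theta> \<sigma> i j \<in> Mor C (nerve_ob C \<sigma> (\<theta> i)) (nerve_ob C \<sigma> (\<theta> j))" if "i \<le> j" "j \<le> m" for i j
    using nerve_Mor[OF assms(1) mono[OF that] \<theta>] that by (simp add: nerve_map_def)
  show "nerve_map m \<theta> \<sigma> i k = Comp C (nerve_map m \<theta> \<sigma> j k) (nerve_map m \<theta> \<sigma> i j)"
    if "i \<le> j" "j \<le> k" "k \<le> m" for i j k
    using nerve_Comp[OF assms(1) mono mono \<theta>, of i j k] that by (simp add: nerve_map_def)
qed (auto simp: nerve_map_def)

definition point_simplex :: "'o \<Rightarrow> nat \<Rightarrow> nat \<Rightarrow> 'm" where
  "point_simplex x = (\<lambda>i j. if i = 0 \<and> j = 0 then Ident C x else undefined)"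

lemma point_simplex_in: "x \<in> Ob C \<Longrightarrow> point_simplex x \<in> nerve C 0"
  by (rule nerveI[of 0 "\<lambda>_. x"]) (auto simp: point_simplex_def Ident_Mor Comp_Ident[OF Ident_Mor])

lemma vertex_eq: "vertex C x = cell_pt C 0 (point_simplex x) (corner 0)"
  by (simp add: vertex_def cell_pt_def point_simplex_def)

text \<open>The vertices of positive weight may be scattered among the others; the monotone retraction of
  \<open>{0..n}\<close> onto them turns the simplex into a degenerate one without moving the point.\<close>

lemma cell_pt_eq_vertex:
  assumes \<sigma>: "\<sigma> \<in> nerve C n" and t: "t \<in> standard_simplex n" and x: "x \<in> Ob C"
    and I: "\<And>i j. i \<le> j \<Longrightarrow> j \<le> n \<Longrightarrow> t i \<noteq> 0 \<Longrightarrow> t j \<noteq> 0 \<Longrightarrow> \<sigma> i j = Ident C x"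
  shows "cell_pt C n \<sigma> t = vertex C x"
proof -
  define A where "A = {i. i \<le> n \<and> t i \<noteq> 0}"
  have fA: "finite A" by (simp add: A_def)
  have "A \<noteq> {}"
  proof
    assume "A = {}"
    then have "(\<Sum>i\<le>n. t i) = 0" by (intro sum.neutral) (auto simp: A_def)
    then show False using t by (simp add: standard_simplex_def)
  qed
  define \<theta> where "\<theta> j = Max {a \<in> A. a \<le> max j (Min A)}" for j
  have ne: "{a \<in> A. a \<le> max j (Min A)} \<noteq> {}" for j
    using Min_in[OF fA \<open>A \<noteq> {}\<close>] by auto
  have \<theta>A: "\<theta> j \<in> A" for j
    using Max_in[OF _ ne[of j]] fA by (auto simp: \<theta>_def)
  have \<theta>id: "\<theta> a = a" if "a \<in> A" for a
  proof -
    have "max a (Min A) = a" using Min_le[OF fA that] by simp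
    then show ?thesis unfolding \<theta>_def using that fA by (intro Max_eqI) auto
  qed
  have mono: "mono_on {..n} \<theta>"
    unfolding \<theta>_def by (intro mono_onI Max_mono ne) (use fA in auto)
  have \<theta>n: "\<theta> \<in> {..n} \<rightarrow> {..n}" using \<theta>A by (auto simp: A_def)
  have push: "simplex_push n \<theta> t j = t j" for j
  proof (cases "j \<in> A")
    case True
    have "simplex_push n \<theta> t j = sum t {j}"
      unfolding simplex_push_def
      by (rule sum.mono_neutral_right) (use True \<theta>id in \<open>auto simp: A_def\<close>)
    then show ?thesis by simp
  next
    case False
    have "t j = 0" using False t by (cases "j \<le> n") (auto simp: A_def standard_simplex_def)
    moreover have "simplex_push n \<theta> t j = 0"
      unfolding simplex_push_def using False \<theta>A by (intro sum.neutral) auto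
    ultimately show ?thesis by simp
  qed
  have "cell_pt C n \<sigma> t = cell_pt C n (nerve_map n \<theta> \<sigma>) t"
    using cell_pt_glue[OF \<sigma> t \<theta>n mono] ext[of "simplex_push n \<theta> t" t] push by simp
  also have "nerve_map n \<theta> \<sigma> = nerve_map n (\<lambda>_. 0) (point_simplex x)"
    using I[OF mono_on_atMostD[OF mono]] \<theta>A
    by (auto simp: nerve_map_def point_simplex_def A_def fun_eq_iff)
  also have "cell_pt C n \<dots> t = cell_pt C 0 (point_simplex x) (simplex_push n (\<lambda>_. 0) t)"
    by (rule cell_pt_glue[OF point_simplex_in[OF x] t]) (auto intro: mono_onI)
  also have "simplex_push n (\<lambda>_. 0) t = corner 0"
    using simplex_push_in[OF t, of "\<lambda>_. 0" 0] by (simp add: standard_simplex_0)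
  finally show ?thesis by (simp add: vertex_eq)
qed

lemma cell_pt_corner:
  assumes "\<sigma> \<in> nerve C n" "i \<le> n"
  shows "cell_pt C n \<sigma> (corner i) = vertex C (nerve_ob C \<sigma> i)"
  by (rule cell_pt_eq_vertex[OF assms(1)])
    (use assms nerve_Ident[OF assms] in \<open>auto split: if_splits\<close>)

lemma edge_simplex_in:
  assumes "f \<in> Mor C x y"
  shows "edge_simplex C f \<in> nerve C 1"
proof (rule nerveI[of 1 "\<lambda>i. if i = 0 then x else y"])
  have xy: "x \<in> Ob C" "y \<in> Ob C" "Dom C f = x" "Cod C f = y"
    using assms Mor_Ob by (auto simp: Mor_def)
  fix i j k :: nat
  show "edge_simplex C f i j \<in> Mor C (if i = 0 then x else y) (if j = 0 then x else y)"
    if "i \<le> j" "j \<le> 1"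
    using that assms xy Ident_Mor by (cases i; cases j) (auto simp: edge_simplex_def)
  show "edge_simplex C f i k = Comp C (edge_simplex C f j k) (edge_simplex C f i j)"
    if "i \<le> j" "j \<le> k" "k \<le> 1"
    using that assms xy by (cases i; cases j; cases k)
      (auto simp: edge_simplex_def Comp_Ident[OF Ident_Mor] Comp_Ident[OF assms] Ident_Comp[OF assms])
qed (use assms Mor_Ob in \<open>auto simp: edge_simplex_def Mor_def\<close>)

lemma edge_path_eq: "edge_path C f = line C 1 (edge_simplex C f) (corner 0) (corner 1)"
proof -
  have "(\<lambda>i. if i = 0 then 1 - t else if i = 1 then t else 0) = segment (corner 0) (corner 1) t" for t
    by (auto simp: segment_def fun_eq_iff)
  then show ?thesis
    by (simp add: edge_path_def line_def cell_pt_def)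
qed

lemma path_between_edge:
  assumes "f \<in> Mor C x y"
  shows "path_between (realization C) (vertex C x) (vertex C y) (edge_path C f)"
proof -
  note e = edge_simplex_in[OF assms]
  have "nerve_ob C (edge_simplex C f) 0 = x" "nerve_ob C (edge_simplex C f) 1 = y"
    using assms Mor_Ob Dom_Ident by (auto simp: edge_simplex_def Mor_def)
  then show ?thesis
    using path_between_line[OF e, of "corner 0" "corner 1"] cell_pt_corner[OF e]
    unfolding edge_path_eq by simp
qed

text \<open>The two paths agree only on \<open>[0, 1]\<close>: outside this interval the segments leave the simplex, where
  nothing is identified. This is why the statement is a homotopy and not an equation.\<close>

lemma line_eq_edge:
  assumes \<sigma>: "\<sigma> \<in> nerve C n" and ij: "i \<le> j" "j \<le> n"
  shows "path_homotopic (realization C) (vertex C (nerve_ob C \<sigma> i)) (vertex C (nerve_ob C \<sigma> j))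
    (line C n \<sigma> (corner i) (corner j)) (edge_path C (\<sigma> i j))"
proof (rule path_homotopic_eq)
  let ?\<theta> = "\<lambda>k::nat. if k = 0 then i else j"
  show "path_between (realization C) (vertex C (nerve_ob C \<sigma> i)) (vertex C (nerve_ob C \<sigma> j))
      (line C n \<sigma> (corner i) (corner j))"
    using path_between_line[OF \<sigma>, of "corner i" "corner j"] cell_pt_corner[OF \<sigma>] ij by simp
  fix r :: real assume r: "r \<in> {0..1}"
  have m: "\<sigma> i j \<in> Mor C (nerve_ob C \<sigma> i) (nerve_ob C \<sigma> j)"
    by (rule nerve_Mor[OF \<sigma> ij])
  have "nerve_map 1 ?\<theta> \<sigma> = edge_simplex C (\<sigma> i j)"
    using m nerve_Ident[OF \<sigma>] ij by (auto simp: nerve_map_def edge_simplex_def fun_eq_iff Mor_def le_Suc_eq)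
  moreover have "simplex_push 1 ?\<theta> (segment (corner 0) (corner 1) r) = segment (corner i) (corner j) r"
  proof
    fix k
    have "{l. l \<le> 1 \<and> ?\<theta> l = k} = (if i = k then {0} else {}) \<union> (if j = k then {1} else {})"
      by (auto simp: le_Suc_eq)
    then show "simplex_push 1 ?\<theta> (segment (corner 0) (corner 1) r) k = segment (corner i) (corner j) r k"
      by (auto simp: simplex_push_def segment_def)
  qed
  ultimately show "line C n \<sigma> (corner i) (corner j) r = edge_path C (\<sigma> i j) r"
    using cell_pt_glue[OF \<sigma>, of "segment (corner 0) (corner 1) r" 1 ?\<theta>] r ij
    by (auto simp: edge_path_eq line_def segment_in mono_on_def)
qed

definition triangle :: "'m \<Rightarrow> 'm \<Rightarrow> nat \<Rightarrow> nat \<Rightarrow> 'm" where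
  "triangle f g = (\<lambda>i j.
     if i = 0 \<and> j = 0 then Ident C (Dom C f) else if i = 0 \<and> j = 1 then f
     else if i = 1 \<and> j = 1 then Ident C (Cod C f) else if i = 1 \<and> j = 2 then g
     else if i = 2 \<and> j = 2 then Ident C (Cod C g) else if i = 0 \<and> j = 2 then Comp C g f else undefined)"

lemma triangle_in:
  assumes f: "f \<in> Mor C x y" and g: "g \<in> Mor C y z"
  shows "triangle f g \<in> nerve C 2"
proof (rule nerveI[of 2 "\<lambda>i. if i = 0 then x else if i = 1 then y else z"])
  have xy: "x \<in> Ob C" "y \<in> Ob C" "z \<in> Ob C" "Dom C f = x" "Cod C f = y" "Cod C g = z"
    using f g Mor_Ob by (auto simp: Mor_def)
  note I = Ident_Mor[OF xy(1)] Ident_Mor[OF xy(2)] Ident_Mor[OF xy(3)]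
  note c = I f g Comp_Mor[OF f g]
  note L = Comp_Ident[OF I(1)] Comp_Ident[OF I(2)] Comp_Ident[OF I(3)] Comp_Ident[OF f] Comp_Ident[OF g]
    Ident_Comp[OF f] Ident_Comp[OF g] Comp_Ident[OF c(6)] Ident_Comp[OF c(6)]
  have D: "i = 0 \<or> i = 1 \<or> i = 2" if "i \<le> 2" for i :: nat using that by auto
  fix i j k :: nat
  show "(if i = 0 then x else if i = 1 then y else z) \<in> Ob C" using xy by auto
  show "triangle f g i i = Ident C (if i = 0 then x else if i = 1 then y else z)" if "i \<le> 2"
    using D[OF that] xy by (auto simp: triangle_def)
  show "triangle f g i j \<in> Mor C (if i = 0 then x else if i = 1 then y else z)
      (if j = 0 then x else if j = 1 then y else z)" if "i \<le> j" "j \<le> 2"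
    using D[of i] D[of j] that xy c by (auto simp: triangle_def)
  show "triangle f g i k = Comp C (triangle f g j k) (triangle f g i j)" if "i \<le> j" "j \<le> k" "k \<le> 2"
    using D[of i] D[of j] D[of k] that xy L by (auto simp: triangle_def)
  show "triangle f g i j = undefined" if "\<not> (i \<le> j \<and> j \<le> 2)"
    using that by (auto simp: triangle_def)
qed

text \<open>Both sides run along the boundary of a triangle, within the simplex given by \<open>f\<close> and \<open>g\<close>.\<close>

lemma edge_join:
  assumes f: "f \<in> Mor C x y" and g: "g \<in> Mor C y z"
  shows "path_homotopic (realization C) (vertex C x) (vertex C z)
    (path_join (edge_path C f) (edge_path C g)) (edge_path C (Comp C g f))"
proof -
  let ?X = "realization C" and ?l = "\<lambda>i j. line C 2 (triangle f g) (corner i) (corner j)"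
  note tr = triangle_in[OF f g]
  have xy: "x \<in> Ob C" "y \<in> Ob C" "z \<in> Ob C" "Dom C f = x" "Cod C f = y" "Cod C g = z"
    using f g Mor_Ob by (auto simp: Mor_def)
  have ob: "nerve_ob C (triangle f g) 0 = x" "nerve_ob C (triangle f g) 1 = y" "nerve_ob C (triangle f g) 2 = z"
    using xy Dom_Ident by (simp_all add: triangle_def)
  have "path_homotopic ?X (vertex C x) (vertex C y) (?l 0 1) (edge_path C f)"
    "path_homotopic ?X (vertex C y) (vertex C z) (?l 1 2) (edge_path C g)"
    "path_homotopic ?X (vertex C x) (vertex C z) (?l 0 2) (edge_path C (Comp C g f))"
    using line_eq_edge[OF tr, of 0 1] line_eq_edge[OF tr, of 1 2] line_eq_edge[OF tr, of 0 2] ob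
    by (simp_all add: triangle_def)
  moreover have "path_homotopic ?X (vertex C x) (vertex C z) (path_join (?l 0 1) (?l 1 2)) (?l 0 2)"
    using line_join[OF tr, of "corner 0" "corner 1" "corner 2"] cell_pt_corner[OF tr] ob by simp
  ultimately show ?thesis
    by (meson path_homotopic_join path_homotopic_sym path_homotopic_trans)
qed

lemma vertex_in_topspace: "x \<in> Ob C \<Longrightarrow> vertex C x \<in> topspace (realization C)"
  by (simp add: vertex_eq point_simplex_in)

lemma edge_Ident:
  assumes "x \<in> Ob C"
  shows "path_homotopic (realization C) (vertex C x) (vertex C x) (edge_path C (Ident C x)) (\<lambda>_. vertex C x)"
proof (rule path_homotopic_eq[OF path_between_edge[OF Ident_Mor[OF assms]]])
  fix r :: real assume r: "r \<in> {0..1}"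
  show "edge_path C (Ident C x) r = vertex C x"
    unfolding edge_path_eq line_def
    by (rule cell_pt_eq_vertex[OF edge_simplex_in[OF Ident_Mor[OF assms]]])
      (use r assms in \<open>auto simp: segment_in edge_simplex_def Dom_Ident Cod_Ident le_Suc_eq\<close>)
qed

end

section \<open>The monodromy of a flat cocycle\<close>

text \<open>A locally constant cocycle describes a covering space without constructing it: over the open
  set \<open>U i\<close> the covering is \<open>U i \<times> G\<close>, and \<open>h i j\<close> changes from the coordinates over \<open>U i\<close> to those
  over \<open>U j\<close>. All coordinates agree over the base point.\<close>

locale flat_cocycle = group G for G (structure) +
  fixes X :: "'x topology" and I :: "'i set" and U :: "'i \<Rightarrow> 'x set" and h :: "'i \<Rightarrow> 'i \<Rightarrow> 'x \<Rightarrow> 'a"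
    and v :: 'x
  assumes cover: "q \<in> topspace X \<Longrightarrow> \<exists>i\<in>I. q \<in> U i"
    and U_open: "i \<in> I \<Longrightarrow> openin X (U i)"
    and h_closed: "i \<in> I \<Longrightarrow> j \<in> I \<Longrightarrow> q \<in> U i \<Longrightarrow> q \<in> U j \<Longrightarrow> h i j q \<in> carrier G"
    and h_cocycle: "i \<in> I \<Longrightarrow> j \<in> I \<Longrightarrow> k \<in> I \<Longrightarrow> q \<in> U i \<Longrightarrow> q \<in> U j \<Longrightarrow> q \<in> U k \<Longrightarrow>
      h j k q \<otimes> h i j q = h i k q"
    and h_open: "i \<in> I \<Longrightarrow> j \<in> I \<Longrightarrow> openin X {q \<in> U i \<inter> U j. h i j q = g}"
    and base: "v \<in> topspace X"
    and h_base: "i \<in> I \<Longrightarrow> j \<in> I \<Longrightarrow> v \<in> U i \<Longrightarrow> v \<in> U j \<Longrightarrow> h i j v = \<one>"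
begin

lemma h_refl: "i \<in> I \<Longrightarrow> q \<in> U i \<Longrightarrow> h i i q = \<one>"
  using h_cocycle[of i i i q] h_closed[of i i q] by (metis r_cancel_one)

lemma h_inverse: "i \<in> I \<Longrightarrow> j \<in> I \<Longrightarrow> q \<in> U i \<Longrightarrow> q \<in> U j \<Longrightarrow> h j i q \<otimes> h i j q = \<one>"
  using h_cocycle[of i j i q] h_refl by simp

text \<open>\<open>\<xi> s i\<close> is the coordinate over \<open>U i\<close> of a continuous lift of the path at time \<open>s\<close>.\<close>

definition is_lift :: "(real \<Rightarrow> 'x) \<Rightarrow> real \<Rightarrow> real \<Rightarrow> (real \<Rightarrow> 'i \<Rightarrow> 'a) \<Rightarrow> bool" where
  "is_lift \<gamma> a b \<xi> \<longleftrightarrow> (\<forall>s\<in>{a..b}. \<forall>i\<in>I. \<gamma> s \<in> U i \<longrightarrow> \<xi> s i \<in> carrier G \<and>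
     (\<forall>j\<in>I. \<gamma> s \<in> U j \<longrightarrow> \<xi> s j = h i j (\<gamma> s) \<otimes> \<xi> s i) \<and>
     (\<exists>d>0. \<forall>s'\<in>{a..b}. \<bar>s' - s\<bar> < d \<longrightarrow> \<gamma> s' \<in> U i \<and> \<xi> s' i = \<xi> s i))"

lemma lift_closed: "is_lift \<gamma> a b \<xi> \<Longrightarrow> s \<in> {a..b} \<Longrightarrow> i \<in> I \<Longrightarrow> \<gamma> s \<in> U i \<Longrightarrow> \<xi> s i \<in> carrier G"
  unfolding is_lift_def by blast

lemma lift_change: "is_lift \<gamma> a b \<xi> \<Longrightarrow> s \<in> {a..b} \<Longrightarrow> i \<in> I \<Longrightarrow> j \<in> I \<Longrightarrow> \<gamma> s \<in> U i \<Longrightarrow> \<gamma> s \<in> U j \<Longrightarrow>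
    \<xi> s j = h i j (\<gamma> s) \<otimes> \<xi> s i"
  unfolding is_lift_def by blast

lemma lift_local:
  assumes "is_lift \<gamma> a b \<xi>" "s \<in> {a..b}" "i \<in> I" "\<gamma> s \<in> U i"
  obtains d where "d > 0" "\<And>s'. s' \<in> {a..b} \<Longrightarrow> \<bar>s' - s\<bar> < d \<Longrightarrow> \<gamma> s' \<in> U i \<and> \<xi> s' i = \<xi> s i"
  using assms unfolding is_lift_def by blast

lemma path_stays_in_open:
  assumes "pathin X \<gamma>" "openin X V" "s \<in> {0..1}" "\<gamma> s \<in> V"
  obtains d where "d > 0" "\<And>s'. s' \<in> {0..1} \<Longrightarrow> \<bar>s' - s\<bar> < d \<Longrightarrow> \<gamma> s' \<in> V"
proof -
  have "openin (top_of_set {0..1}) {s \<in> {0..1}. \<gamma> s \<in> V}"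
    using assms(1,2) unfolding pathin_def by (simp add: continuous_map)
  then have "\<exists>d>0. \<forall>s'\<in>{0..1}. dist s' s < d \<longrightarrow> s' \<in> {s \<in> {0..1}. \<gamma> s \<in> V}"
    using assms(3,4) unfolding openin_euclidean_subtopology_iff by blast
  then show ?thesis
    using that by (auto simp: dist_real_def)
qed

lemma lift_cong:
  assumes "is_lift \<gamma> a b \<xi>" and eq: "\<And>s. s \<in> {a..b} \<Longrightarrow> \<gamma> s = \<gamma>' s"
  shows "is_lift \<gamma>' a b \<xi>"
  unfolding is_lift_def
proof (intro ballI impI conjI)
  fix s i assume s: "s \<in> {a..b}" and i: "i \<in> I" "\<gamma>' s \<in> U i"
  then have i': "\<gamma> s \<in> U i" using eq by simp
  show "\<xi> s i \<in> carrier G" using lift_closed[OF assms(1) s i(1) i'] .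
  show "\<xi> s j = h i j (\<gamma>' s) \<otimes> \<xi> s i" if "j \<in> I" "\<gamma>' s \<in> U j" for j
    using lift_change[OF assms(1) s i(1) that(1) i'] that(2) eq[OF s] by simp
  obtain d where "d > 0" "\<And>s'. s' \<in> {a..b} \<Longrightarrow> \<bar>s' - s\<bar> < d \<Longrightarrow> \<gamma> s' \<in> U i \<and> \<xi> s' i = \<xi> s i"
    using lift_local[OF assms(1) s i(1) i'] by blast
  then show "\<exists>d>0. \<forall>s'\<in>{a..b}. \<bar>s' - s\<bar> < d \<longrightarrow> \<gamma>' s' \<in> U i \<and> \<xi> s' i = \<xi> s i"
    using eq by (intro exI[of _ d]) metis
qed

lemma lift_exists_local:
  assumes \<gamma>: "pathin X \<gamma>" and ab: "0 \<le> a" "b \<le> 1" "a \<le> b"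
    and i: "i \<in> I" "\<And>s. s \<in> {a..b} \<Longrightarrow> \<gamma> s \<in> U i"
    and i0: "i0 \<in> I" "\<gamma> a \<in> U i0" "g0 \<in> carrier G"
  shows "\<exists>\<xi>. is_lift \<gamma> a b \<xi> \<and> \<xi> a i0 = g0"
proof -
  define g where "g = h i0 i (\<gamma> a) \<otimes> g0"
  let ?l = "\<lambda>s j. h i j (\<gamma> s) \<otimes> g"
  have a: "\<gamma> a \<in> U i" using i ab by simp
  have g: "g \<in> carrier G" using h_closed[OF i0(1) i(1) i0(2) a] i0 by (simp add: g_def)
  have "?l a i0 = g0"
    using h_closed[OF i0(1) i(1) i0(2) a] h_closed[OF i(1) i0(1) a i0(2)] i0
      h_inverse[OF i0(1) i(1) i0(2) a] by (simp add: g_def m_assoc[symmetric])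
  moreover have "is_lift \<gamma> a b ?l"
    unfolding is_lift_def
  proof (intro ballI impI conjI)
    fix s j assume s: "s \<in> {a..b}" and j: "j \<in> I" "\<gamma> s \<in> U j"
    note si = i(2)[OF s]
    show "?l s j \<in> carrier G" using h_closed[OF i(1) j(1) si j(2)] g by simp
    show "?l s k = h j k (\<gamma> s) \<otimes> ?l s j" if k: "k \<in> I" "\<gamma> s \<in> U k" for k
      using h_cocycle[OF i(1) j(1) k(1) si j(2) k(2)] h_closed[OF i(1) j(1) si j(2)]
        h_closed[OF j(1) k(1) j(2) k(2)] g by (simp add: m_assoc[symmetric])
    obtain d where "d > 0" "\<And>s'. s' \<in> {0..1} \<Longrightarrow> \<bar>s' - s\<bar> < d \<Longrightarrow> \<gamma> s' \<in> {q \<in> U i \<inter> U j. h i j q = h i j (\<gamma> s)}"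
      using path_stays_in_open[OF \<gamma> h_open[OF i(1) j(1), of "h i j (\<gamma> s)"], of s] s ab si j by auto
    then show "\<exists>d>0. \<forall>s'\<in>{a..b}. \<bar>s' - s\<bar> < d \<longrightarrow> \<gamma> s' \<in> U j \<and> ?l s' j = ?l s j"
      using ab by (intro exI[of _ d]) auto
  qed
  ultimately show ?thesis by (intro exI[of _ ?l]) simp
qed

lemma lift_agree:
  assumes "is_lift \<gamma> a b \<xi>1" "is_lift \<gamma> a' b' \<xi>2" "s \<in> {a..b}" "s \<in> {a'..b'}"
    and "i \<in> I" "\<gamma> s \<in> U i" "\<xi>1 s i = \<xi>2 s i" "j \<in> I" "\<gamma> s \<in> U j"
  shows "\<xi>1 s j = \<xi>2 s j"
  using lift_change[OF assms(1,3,5,8,6,9)] lift_change[OF assms(2,4,5,8,6,9)] assms(7) by simp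

lemma lift_glue:
  assumes l1: "is_lift \<gamma> a b \<xi>1" and l2: "is_lift \<gamma> b c \<xi>2" and ab: "a \<le> b" "b \<le> c"
    and i: "i \<in> I" "\<gamma> b \<in> U i" "\<xi>1 b i = \<xi>2 b i"
  shows "is_lift \<gamma> a c (\<lambda>s. if s \<le> b then \<xi>1 s else \<xi>2 s)" (is "is_lift _ _ _ ?l")
  unfolding is_lift_def
proof (intro ballI impI conjI)
  fix s j assume s: "s \<in> {a..c}" and j: "j \<in> I" "\<gamma> s \<in> U j"
  have ag: "\<xi>1 b k = \<xi>2 b k" if "k \<in> I" "\<gamma> b \<in> U k" for k
    using lift_agree[OF l1 l2 _ _ i that] ab by simp
  show "?l s j \<in> carrier G"
    using lift_closed[OF l1 _ j] lift_closed[OF l2 _ j] s by auto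
  show "?l s k = h j k (\<gamma> s) \<otimes> ?l s j" if k: "k \<in> I" "\<gamma> s \<in> U k" for k
    using lift_change[OF l1 _ j(1) k(1) j(2) k(2)] lift_change[OF l2 _ j(1) k(1) j(2) k(2)] s by auto
  consider "s < b" | "s = b" | "b < s" by linarith
  then show "\<exists>d>0. \<forall>s'\<in>{a..c}. \<bar>s' - s\<bar> < d \<longrightarrow> \<gamma> s' \<in> U j \<and> ?l s' j = ?l s j"
  proof cases
    case 1
    obtain d where "d > 0" "\<And>s'. s' \<in> {a..b} \<Longrightarrow> \<bar>s' - s\<bar> < d \<Longrightarrow> \<gamma> s' \<in> U j \<and> \<xi>1 s' j = \<xi>1 s j"
      using lift_local[OF l1 _ j] 1 s by auto
    then show ?thesis using 1 by (intro exI[of _ "min d (b - s)"]) auto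
  next
    case 2
    obtain d where d: "d > 0" "\<And>s'. s' \<in> {a..b} \<Longrightarrow> \<bar>s' - s\<bar> < d \<Longrightarrow> \<gamma> s' \<in> U j \<and> \<xi>1 s' j = \<xi>1 s j"
      using lift_local[OF l1 _ j] 2 ab by auto
    obtain d' where d': "d' > 0" "\<And>s'. s' \<in> {b..c} \<Longrightarrow> \<bar>s' - s\<bar> < d' \<Longrightarrow> \<gamma> s' \<in> U j \<and> \<xi>2 s' j = \<xi>2 s j"
      using lift_local[OF l2 _ j] 2 ab by auto
    show ?thesis
    proof (intro exI[of _ "min d d'"] conjI ballI impI)
      show "0 < min d d'" using d(1) d'(1) by simp
      fix s' assume s': "s' \<in> {a..c}" "\<bar>s' - s\<bar> < min d d'"
      have e: "\<xi>1 b j = \<xi>2 b j" using ag[OF j(1)] j(2) 2 by simp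
      have A: "\<gamma> s' \<in> U j \<and> \<xi>1 s' j = \<xi>1 s j" if "s' \<le> b"
        by (rule d(2)) (use s' that in auto)
      have B: "\<gamma> s' \<in> U j \<and> \<xi>2 s' j = \<xi>2 s j" if "\<not> s' \<le> b"
        by (rule d'(2)) (use s' that in auto)
      show "\<gamma> s' \<in> U j" using A B by blast
      show "?l s' j = ?l s j" using A B e 2 by (cases "s' \<le> b") simp_all
    qed
  next
    case 3
    obtain d where "d > 0" "\<And>s'. s' \<in> {b..c} \<Longrightarrow> \<bar>s' - s\<bar> < d \<Longrightarrow> \<gamma> s' \<in> U j \<and> \<xi>2 s' j = \<xi>2 s j"
      using lift_local[OF l2 _ j] 3 s by auto
    then show ?thesis using 3 by (intro exI[of _ "min d (s - b)"]) auto
  qed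
qed

text \<open>Bisection: a short piece of the path stays in one chart, and lifts of adjacent pieces can be glued once
  the second one starts where the first one ends.\<close>

lemma lift_exists:
  assumes \<gamma>: "pathin X \<gamma>" and i0: "i0 \<in> I" "\<gamma> 0 \<in> U i0" and g0: "g0 \<in> carrier G"
  shows "\<exists>\<xi>. is_lift \<gamma> 0 1 \<xi> \<and> \<xi> 0 i0 = g0"
proof -
  have in_X: "\<gamma> s \<in> topspace X" if "s \<in> {0..1}" for s
    using \<gamma> that by (auto simp: pathin_def continuous_map)
  define P where "P a b \<longleftrightarrow> (0 \<le> a \<and> b \<le> 1 \<and> a \<le> b \<longrightarrow> (\<forall>i0\<in>I. \<forall>g0\<in>carrier G. \<gamma> a \<in> U i0 \<longrightarrow>
    (\<exists>\<xi>. is_lift \<gamma> a b \<xi> \<and> \<xi> a i0 = g0)))" for a b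
  have "P 0 1"
  proof (rule Bolzano[of 0 1 P])
    fix a b c assume 1: "P a b" and 2: "P b c" and ab: "a \<le> b" "b \<le> c"
    show "P a c"
      unfolding P_def
    proof (intro impI ballI)
      fix i0 g0 assume ac: "0 \<le> a \<and> c \<le> 1 \<and> a \<le> c" and i0: "i0 \<in> I" "g0 \<in> carrier G" "\<gamma> a \<in> U i0"
      obtain \<xi>1 where l1: "is_lift \<gamma> a b \<xi>1" "\<xi>1 a i0 = g0"
        using 1 ac ab i0 unfolding P_def by auto
      obtain i where i: "i \<in> I" "\<gamma> b \<in> U i" using cover[OF in_X, of b] ab ac by auto
      have "\<xi>1 b i \<in> carrier G" using lift_closed[OF l1(1) _ i] ab by auto
      then obtain \<xi>2 where l2: "is_lift \<gamma> b c \<xi>2" "\<xi>2 b i = \<xi>1 b i"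
        using 2 ac ab i unfolding P_def by auto
      show "\<exists>\<xi>. is_lift \<gamma> a c \<xi> \<and> \<xi> a i0 = g0"
        using lift_glue[OF l1(1) l2(1) ab i l2(2)[symmetric]] l1(2) ab
        by (intro exI[of _ "\<lambda>s. if s \<le> b then \<xi>1 s else \<xi>2 s"]) auto
    qed
  next
    fix x :: real assume x: "0 \<le> x" "x \<le> 1"
    obtain i where i: "i \<in> I" "\<gamma> x \<in> U i" using cover[OF in_X, of x] x by auto
    obtain d where d: "d > 0" "\<And>s'. s' \<in> {0..1} \<Longrightarrow> \<bar>s' - x\<bar> < d \<Longrightarrow> \<gamma> s' \<in> U i"
      using path_stays_in_open[OF \<gamma> U_open[OF i(1)] _ i(2)] x by auto
    have "P a b" if ab: "a \<le> x" "x \<le> b" "b - a < d" for a b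
      unfolding P_def
    proof (intro impI ballI)
      fix i0 g0 assume ac: "0 \<le> a \<and> b \<le> 1 \<and> a \<le> b" and i0: "i0 \<in> I" "g0 \<in> carrier G" "\<gamma> a \<in> U i0"
      have "\<gamma> s \<in> U i" if "s \<in> {a..b}" for s
        using d(2)[of s] that ab ac by auto
      then show "\<exists>\<xi>. is_lift \<gamma> a b \<xi> \<and> \<xi> a i0 = g0"
        using lift_exists_local[OF \<gamma> _ _ _ i(1) _ i0(1,3,2)] ac by auto
    qed
    then show "\<exists>d>0. \<forall>a b. a \<le> x \<and> x \<le> b \<and> b - a < d \<longrightarrow> P a b"
      using d(1) by blast
  qed simp
  then show ?thesis
    using i0 g0 unfolding P_def by auto
qed

lemma lift_const_in_chart:
  assumes l: "is_lift \<gamma> a b \<xi>" and i: "i \<in> I" "\<And>s. s \<in> {c..d} \<Longrightarrow> \<gamma> s \<in> U i"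
    and cd: "a \<le> c" "c \<le> d" "d \<le> b"
  shows "\<xi> c i = \<xi> d i"
proof (rule connected_local_const[where A = "{c..d}" and f = "\<lambda>s. \<xi> s i"])
  show "\<forall>s\<in>{c..d}. \<forall>\<^sub>F s' in at s within {c..d}. \<xi> s i = \<xi> s' i"
  proof
    fix s assume s: "s \<in> {c..d}"
    then obtain e where "e > 0" "\<And>s'. s' \<in> {a..b} \<Longrightarrow> \<bar>s' - s\<bar> < e \<Longrightarrow> \<gamma> s' \<in> U i \<and> \<xi> s' i = \<xi> s i"
      using lift_local[OF l _ i(1) i(2)[OF s]] cd by auto
    then show "\<forall>\<^sub>F s' in at s within {c..d}. \<xi> s i = \<xi> s' i"
      using cd by (auto simp: eventually_at dist_real_def intro!: exI[of _ e])
  qed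
qed (use cd in auto)

lemma lift_unique:
  assumes \<gamma>: "pathin X \<gamma>" and l1: "is_lift \<gamma> 0 1 \<xi>1" and l2: "is_lift \<gamma> 0 1 \<xi>2"
    and i: "i \<in> I" "\<gamma> 0 \<in> U i" "\<xi>1 0 i = \<xi>2 0 i" and j: "j \<in> I" "\<gamma> 1 \<in> U j"
  shows "\<xi>1 1 j = \<xi>2 1 j"
proof -
  have in_X: "\<gamma> s \<in> topspace X" if "s \<in> {0..1}" for s
    using \<gamma> that by (auto simp: pathin_def continuous_map)
  define Q where "Q s \<longleftrightarrow> (\<forall>j\<in>I. \<gamma> s \<in> U j \<longrightarrow> \<xi>1 s j = \<xi>2 s j)" for s
  have "0 \<le> (0::real) \<and> (1::real) \<le> 1 \<longrightarrow> Q 0 \<longrightarrow> Q 1"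
  proof (rule Bolzano[of 0 1 "\<lambda>a b. 0 \<le> a \<and> b \<le> 1 \<longrightarrow> Q a \<longrightarrow> Q b"])
    fix x :: real assume x: "0 \<le> x" "x \<le> 1"
    obtain i where i: "i \<in> I" "\<gamma> x \<in> U i" using cover[OF in_X, of x] x by auto
    obtain d where d: "d > 0" "\<And>s'. s' \<in> {0..1} \<Longrightarrow> \<bar>s' - x\<bar> < d \<Longrightarrow> \<gamma> s' \<in> U i"
      using path_stays_in_open[OF \<gamma> U_open[OF i(1)] _ i(2)] x by auto
    have "Q b" if ab: "a \<le> x" "x \<le> b" "b - a < d" "0 \<le> a" "b \<le> 1" and Q: "Q a" for a b
    proof -
      have U: "\<gamma> s \<in> U i" if "s \<in> {a..b}" for s using d(2)[of s] that ab by auto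
      have "\<xi>1 b i = \<xi>1 a i" "\<xi>2 b i = \<xi>2 a i"
        using lift_const_in_chart[OF l1 i(1) U] lift_const_in_chart[OF l2 i(1) U] ab by auto
      moreover have "\<xi>1 a i = \<xi>2 a i" using Q i(1) U[of a] ab unfolding Q_def by auto
      ultimately have "\<xi>1 b i = \<xi>2 b i" by simp
      then show ?thesis
        unfolding Q_def using lift_agree[OF l1 l2 _ _ i(1) U] ab by auto
    qed
    then show "\<exists>d>0. \<forall>a b. a \<le> x \<and> x \<le> b \<and> b - a < d \<longrightarrow> (0 \<le> a \<and> b \<le> 1 \<longrightarrow> Q a \<longrightarrow> Q b)"
      using d(1) by blast
  qed auto
  moreover have "Q 0" unfolding Q_def using lift_agree[OF l1 l2 _ _ i] by auto
  ultimately show ?thesis using j unfolding Q_def by auto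
qed

text \<open>Lifts of nearby paths that start at the same point stay together. The comparison is carried
  along the path chart by chart, in the direction of \<open>t\<close> only; the connectedness of the interval takes
  care of the direction of \<open>s\<close>.\<close>

lemma lift_homotopy:
  fixes K :: "real \<times> real \<Rightarrow> 'x" and L :: "real \<Rightarrow> real \<Rightarrow> 'i \<Rightarrow> 'a"
  assumes K: "continuous_map (top_of_set ({0..1} \<times> {0..1})) X K"
    and l: "\<And>s. s \<in> {0..1} \<Longrightarrow> is_lift (\<lambda>t. K (s, t)) 0 1 (L s)"
    and K0: "\<And>s. s \<in> {0..1} \<Longrightarrow> K (s, 0) = v" and K1: "\<And>s. s \<in> {0..1} \<Longrightarrow> K (s, 1) = v"
    and i0: "i0 \<in> I" "v \<in> U i0" and L0: "\<And>s. s \<in> {0..1} \<Longrightarrow> L s 0 i0 = \<one>"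
  shows "L 0 1 i0 = L 1 1 i0"
proof (rule connected_local_const[where A = "{0..1::real}" and f = "\<lambda>s. L s 1 i0"])
  show "\<forall>s\<in>{0..1}. \<forall>\<^sub>F s' in at s within {0..1}. L s 1 i0 = L s' 1 i0"
  proof
    fix s0 :: real assume s0: "s0 \<in> {0..1}"
    have near: "\<exists>d>0. \<forall>s\<in>{0..1}. \<forall>t\<in>{0..1}. \<bar>s - s0\<bar> < d \<and> \<bar>t - x\<bar> < d \<longrightarrow> K (s, t) \<in> V"
      if x: "x \<in> {0..1}" and V: "openin X V" "K (s0, x) \<in> V" for x V
    proof -
      have "openin (top_of_set ({0..1} \<times> {0..1})) {z \<in> {0..1} \<times> {0..1}. K z \<in> V}"
        using K V(1) by (simp add: continuous_map)
      moreover have "(s0, x) \<in> {z \<in> {0..1} \<times> {0..1}. K z \<in> V}"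
        using x s0 V(2) by simp
      ultimately obtain e where e: "e > 0"
        "\<And>z. z \<in> {0..1} \<times> {0..1} \<Longrightarrow> dist z (s0, x) < e \<Longrightarrow> z \<in> {z \<in> {0..1} \<times> {0..1}. K z \<in> V}"
        using openin_euclidean_subtopology_iff[THEN iffD1] by meson
      have "K (s, t) \<in> V" if "s \<in> {0..1}" "t \<in> {0..1}" "\<bar>s - s0\<bar> < e/2" "\<bar>t - x\<bar> < e/2" for s t
      proof -
        have "dist (s, t) (s0, x) \<le> dist s s0 + dist t x"
          unfolding dist_Pair_Pair by (rule sqrt_sum_squares_le_sum) auto
        then have "dist (s, t) (s0, x) < e" using that by (simp add: dist_real_def)
        then show ?thesis using e(2)[of "(s, t)"] that by simp
      qed
      then show ?thesis using e(1) by (intro exI[of _ "e/2"]) auto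
    qed
    define Q where "Q t i \<longleftrightarrow> i \<in> I \<and> K (s0, t) \<in> U i \<and> (\<exists>d>0. \<forall>s\<in>{0..1}. \<bar>s - s0\<bar> < d \<longrightarrow>
      K (s, t) \<in> U i \<and> L s t i = L s0 t i)" for t i
    have Qch: "Q t j" if Qi: "Q t i" "j \<in> I" "K (s0, t) \<in> U j" "t \<in> {0..1}" for t i j
    proof -
      have i: "i \<in> I" "K (s0, t) \<in> U i" using Qi(1) by (auto simp: Q_def)
      obtain d where d: "d > 0" "\<And>s. s \<in> {0..1} \<Longrightarrow> \<bar>s - s0\<bar> < d \<Longrightarrow> K (s, t) \<in> U i \<and> L s t i = L s0 t i"
        using Qi(1) unfolding Q_def by blast
      obtain d' where d': "d' > 0" "\<And>s. s \<in> {0..1} \<Longrightarrow> \<bar>s - s0\<bar> < d' \<Longrightarrow>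
          K (s, t) \<in> {q \<in> U i \<inter> U j. h i j q = h i j (K (s0, t))}"
        using near[OF Qi(4) h_open[OF i(1) Qi(2), of "h i j (K (s0, t))"]] i Qi by fastforce
      have "K (s, t) \<in> U j \<and> L s t j = L s0 t j" if s: "s \<in> {0..1}" "\<bar>s - s0\<bar> < min d d'" for s
        using d(2)[OF s(1)] d'(2)[OF s(1)] s(2) lift_change[OF l[OF s(1)] _ i(1) \<open>j \<in> I\<close>, of t]
          lift_change[OF l[OF s0] _ i(1) \<open>j \<in> I\<close>, of t] \<open>t \<in> {0..1}\<close> i Qi by auto
      then show ?thesis
        unfolding Q_def using Qi d(1) d'(1) by (intro conjI exI[of _ "min d d'"]) auto
    qed
    have "0 \<le> (0::real) \<and> (1::real) \<le> 1 \<longrightarrow> (\<exists>i. Q 0 i) \<longrightarrow> (\<exists>i. Q 1 i)"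
    proof (rule Bolzano[of 0 1 "\<lambda>a b. 0 \<le> a \<and> b \<le> 1 \<longrightarrow> (\<exists>i. Q a i) \<longrightarrow> (\<exists>i. Q b i)"])
      fix x :: real assume x: "0 \<le> x" "x \<le> 1"
      have "K (s0, x) \<in> topspace X" using K s0 x by (auto simp: continuous_map)
      then obtain i where i: "i \<in> I" "K (s0, x) \<in> U i" using cover by blast
      obtain d where d: "d > 0" "\<And>s t. s \<in> {0..1} \<Longrightarrow> t \<in> {0..1} \<Longrightarrow> \<bar>s - s0\<bar> < d \<Longrightarrow> \<bar>t - x\<bar> < d \<Longrightarrow> K (s, t) \<in> U i"
        using near[OF _ U_open[OF i(1)] i(2)] x by auto
      have "Q b i" if ab: "a \<le> x" "x \<le> b" "b - a < d" "0 \<le> a" "b \<le> 1" and Q: "Q a j" for a b j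
      proof -
        have U: "K (s, t) \<in> U i" if "t \<in> {a..b}" "s \<in> {0..1}" "\<bar>s - s0\<bar> < d" for s t
          using d(2)[of s t] that ab by auto
        have U0: "K (s0, t) \<in> U i" if "t \<in> {a..b}" for t
          using U[OF that s0] d(1) by simp
        have "Q a i"
          by (rule Qch[OF Q i(1)]) (use U0[of a] ab in auto)
        then obtain e where e: "e > 0" "\<And>s. s \<in> {0..1} \<Longrightarrow> \<bar>s - s0\<bar> < e \<Longrightarrow> L s a i = L s0 a i"
          by (auto simp: Q_def)
        have "L s b i = L s0 b i" if s: "s \<in> {0..1}" "\<bar>s - s0\<bar> < d" "\<bar>s - s0\<bar> < e" for s
          using lift_const_in_chart[OF l[OF s(1)] i(1) U[OF _ s(1,2)]]
            lift_const_in_chart[OF l[OF s0] i(1) U0] e(2)[OF s(1,3)] ab by auto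
        then show ?thesis
          unfolding Q_def using i U0[of b] U ab d(1) e(1)
          by (intro conjI exI[of _ "min d e"]) auto
      qed
      then show "\<exists>d>0. \<forall>a b. a \<le> x \<and> x \<le> b \<and> b - a < d \<longrightarrow>
          (0 \<le> a \<and> b \<le> 1 \<longrightarrow> (\<exists>i. Q a i) \<longrightarrow> (\<exists>i. Q b i))"
        using d(1) by blast
    qed auto
    moreover have "Q 0 i0"
      unfolding Q_def using i0 K0 L0 s0 by (auto intro!: exI[of _ 1])
    ultimately obtain i where "Q 1 i" by auto
    then have "Q 1 i0" by (rule Qch) (use i0 K1 s0 in auto)
    then show "\<forall>\<^sub>F s' in at s0 within {0..1}. L s0 1 i0 = L s' 1 i0"
      by (auto simp: Q_def eventually_at dist_real_def)
  qed
qed auto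

lemma lift_reparam:
  assumes l: "is_lift \<gamma> 0 1 \<xi>" and c: "0 \<le> c" "0 \<le> d" "c + d \<le> 1"
  shows "is_lift (\<lambda>s. \<gamma> (c + d * s)) 0 1 (\<lambda>s. \<xi> (c + d * s))"
  unfolding is_lift_def
proof (intro ballI impI conjI)
  fix s :: real and i assume s: "s \<in> {0..1}" and i: "i \<in> I" "\<gamma> (c + d * s) \<in> U i"
  have r: "c + d * s' \<in> {0..1}" if "s' \<in> {0..1}" for s'
    using that c mult_left_le[of s' d] by auto
  show "\<xi> (c + d * s) i \<in> carrier G" using lift_closed[OF l r[OF s] i] .
  show "\<xi> (c + d * s) j = h i j (\<gamma> (c + d * s)) \<otimes> \<xi> (c + d * s) i" if "j \<in> I" "\<gamma> (c + d * s) \<in> U j" for j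
    using lift_change[OF l r[OF s] i(1) that(1) i(2) that(2)] .
  obtain e where e: "e > 0" "\<And>s'. s' \<in> {0..1} \<Longrightarrow> \<bar>s' - (c + d * s)\<bar> < e \<Longrightarrow> \<gamma> s' \<in> U i \<and> \<xi> s' i = \<xi> (c + d * s) i"
    using lift_local[OF l r[OF s] i] by blast
  have "\<bar>(c + d * s') - (c + d * s)\<bar> \<le> \<bar>s' - s\<bar>" for s'
  proof -
    have "(c + d * s') - (c + d * s) = d * (s' - s)" by (simp add: algebra_simps)
    then show ?thesis using c mult_right_le_one_le[of "\<bar>s' - s\<bar>" d] by (simp add: abs_mult mult.commute)
  qed
  then show "\<exists>e>0. \<forall>s'\<in>{0..1}. \<bar>s' - s\<bar> < e \<longrightarrow> \<gamma> (c + d * s') \<in> U i \<and> \<xi> (c + d * s') i = \<xi> (c + d * s) i"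
    using e r by (intro exI[of _ e]) (meson le_less_trans)
qed

text \<open>Changes of coordinates multiply from the left, hence \<open>G\<close> acts on lifts from the right. A lift over the
  second half of a loop can thus be made to start at \<open>\<one>\<close>.\<close>

lemma lift_right_mult:
  assumes "is_lift \<gamma> a b \<xi>" and "g \<in> carrier G"
  shows "is_lift \<gamma> a b (\<lambda>s i. \<xi> s i \<otimes> g)"
  unfolding is_lift_def
proof (intro ballI impI conjI)
  fix s i assume s: "s \<in> {a..b}" and i: "i \<in> I" "\<gamma> s \<in> U i"
  show "\<xi> s i \<otimes> g \<in> carrier G" using lift_closed[OF assms(1) s i] assms(2) by simp
  show "\<xi> s j \<otimes> g = h i j (\<gamma> s) \<otimes> (\<xi> s i \<otimes> g)" if "j \<in> I" "\<gamma> s \<in> U j" for j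
    using lift_change[OF assms(1) s i(1) that(1) i(2) that(2)] lift_closed[OF assms(1) s i] assms(2)
      h_closed[OF i(1) that(1) i(2) that(2)] by (simp add: m_assoc)
  show "\<exists>d>0. \<forall>s'\<in>{a..b}. \<bar>s' - s\<bar> < d \<longrightarrow> \<gamma> s' \<in> U i \<and> \<xi> s' i \<otimes> g = \<xi> s i \<otimes> g"
    using lift_local[OF assms(1) s i] by metis
qed

lemma lift_base:
  assumes "is_lift \<gamma> 0 1 \<xi>" "s \<in> {0..1}" "\<gamma> s = v" "i \<in> I" "v \<in> U i" "j \<in> I" "v \<in> U j"
  shows "\<xi> s i = \<xi> s j"
  using lift_change[OF assms(1,2,4,6)] lift_closed[OF assms(1,2,4)] h_base[OF assms(4,6,5,7)] assms(3,5,7)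
  by simp

text \<open>By \<open>h_base\<close> all charts show the same coordinate over \<open>v\<close>, so that the result depends neither on the
  chart \<open>i\<close> nor, by uniqueness, on the lift.\<close>

definition monodromy :: "(real \<Rightarrow> 'x) \<Rightarrow> 'a" where
  "monodromy \<gamma> = (SOME g. \<exists>\<xi> i. is_lift \<gamma> 0 1 \<xi> \<and> i \<in> I \<and> v \<in> U i \<and> \<xi> 0 i = \<one> \<and> \<xi> 1 i = g)"

lemma monodromy_eq:
  assumes \<gamma>: "path_between X v v \<gamma>" and l: "is_lift \<gamma> 0 1 \<xi>"
    and i: "i \<in> I" "v \<in> U i" "\<xi> 0 i = \<one>" and j: "j \<in> I" "v \<in> U j"
  shows "monodromy \<gamma> = \<xi> 1 j"
proof -
  have g: "pathin X \<gamma>" "\<gamma> 0 = v" "\<gamma> 1 = v" using \<gamma> by (auto simp: path_between_def)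
  have uniq: "g = \<xi> 1 i" if "is_lift \<gamma> 0 1 \<xi>2 \<and> k \<in> I \<and> v \<in> U k \<and> \<xi>2 0 k = \<one> \<and> \<xi>2 1 k = g" for g \<xi>2 k
  proof -
    have "\<xi>2 0 i = \<one>" "\<xi>2 1 i = g"
      using lift_base[of \<gamma> \<xi>2 _ k i] that g i by force+
    then show ?thesis
      using lift_unique[OF g(1) _ l i(1), of \<xi>2 i] that g i by simp
  qed
  have ex: "\<exists>g \<xi> i. is_lift \<gamma> 0 1 \<xi> \<and> i \<in> I \<and> v \<in> U i \<and> \<xi> 0 i = \<one> \<and> \<xi> 1 i = g"
    using l i by blast
  have "monodromy \<gamma> = \<xi> 1 i"
    unfolding monodromy_def by (rule someI2_ex[OF ex]) (use uniq in blast)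
  then show ?thesis using lift_base[OF l _ _ i(1,2) j, of 1] g by simp
qed

lemma monodromy_lift:
  assumes "path_between X v v \<gamma>"
  obtains \<xi> i where "is_lift \<gamma> 0 1 \<xi>" "i \<in> I" "v \<in> U i" "\<xi> 0 i = \<one>" "monodromy \<gamma> = \<xi> 1 i"
proof -
  have g: "pathin X \<gamma>" "\<gamma> 0 = v" "\<gamma> 1 = v" using assms by (auto simp: path_between_def)
  obtain i where i: "i \<in> I" "v \<in> U i" using cover[OF base] by blast
  then obtain \<xi> where "is_lift \<gamma> 0 1 \<xi>" "\<xi> 0 i = \<one>"
    using lift_exists[OF g(1) i(1) _ one_closed] g by auto
  then show ?thesis using that monodromy_eq[OF assms _ i _ i] i by blast
qed

lemma monodromy_closed:
  assumes "path_between X v v \<gamma>"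
  shows "monodromy \<gamma> \<in> carrier G"
proof -
  obtain \<xi> i where "is_lift \<gamma> 0 1 \<xi>" "i \<in> I" "v \<in> U i" "monodromy \<gamma> = \<xi> 1 i"
    using monodromy_lift[OF assms] by blast
  then show ?thesis
    using lift_closed[of \<gamma> 0 1 \<xi> 1 i] assms by (simp add: path_between_def)
qed

lemma monodromy_homotopic:
  assumes "path_homotopic X v v f g"
  shows "monodromy f = monodromy g"
proof -
  obtain K :: "real \<times> real \<Rightarrow> 'x" where K: "continuous_map (top_of_set ({0..1} \<times> {0..1})) X K"
    "\<And>t. K (0, t) = f t" "\<And>t. K (1, t) = g t"
    "\<And>s. s \<in> {0..1} \<Longrightarrow> K (s, 0) = v" "\<And>s. s \<in> {0..1} \<Longrightarrow> K (s, 1) = v"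
    using path_homotopicE[OF assms] by metis
  have p: "path_between X v v (\<lambda>t. K (s, t))" if "s \<in> {0..1}" for s
    unfolding path_between_def pathin_def
    using continuous_map_top_of_set_compose[OF K(1), of "{0..1}" "\<lambda>t. (s, t)",
        OF continuous_on_Pair[OF continuous_on_const continuous_on_id]] K(4,5) that
    by auto
  obtain i where i: "i \<in> I" "v \<in> U i" using cover[OF base] by blast
  have "\<exists>\<xi>. is_lift (\<lambda>t. K (s, t)) 0 1 \<xi> \<and> \<xi> 0 i = \<one>" if "s \<in> {0..1}" for s
    using lift_exists[OF _ i(1) _ one_closed, of "\<lambda>t. K (s, t)"] p[OF that] i by (auto simp: path_between_def)
  then obtain L where L: "\<And>s. s \<in> {0..1} \<Longrightarrow> is_lift (\<lambda>t. K (s, t)) 0 1 (L s) \<and> L s 0 i = \<one>"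
    by metis
  have "monodromy (\<lambda>t. K (s, t)) = L s 1 i" if "s \<in> {0..1}" for s
    using monodromy_eq[OF p[OF that] _ i _ i] L[OF that] by blast
  then show ?thesis
    using lift_homotopy[OF K(1) _ K(4,5) i, of L] L K(2,3) by (metis (no_types, lifting) atLeastAtMost_iff ext order_refl zero_le_one)
qed

lemma monodromy_join:
  assumes f: "path_between X v v f" and g: "path_between X v v g"
  shows "monodromy (path_join f g) = monodromy g \<otimes> monodromy f"
proof -
  note j = path_between_join[OF f g]
  obtain \<xi> i where l: "is_lift (path_join f g) 0 1 \<xi>" "i \<in> I" "v \<in> U i" "\<xi> 0 i = \<one>"
    "monodromy (path_join f g) = \<xi> 1 i" using monodromy_lift[OF j] by blast
  have ends: "f 0 = v" "f 1 = v" "g 0 = v" "g 1 = v" using f g by (auto simp: path_between_def)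
  have "is_lift (\<lambda>s. path_join f g (0 + 1/2 * s)) 0 1 (\<lambda>s. \<xi> (0 + 1/2 * s))"
    by (rule lift_reparam[OF l(1)]) auto
  then have "is_lift f 0 1 (\<lambda>s. \<xi> (0 + 1/2 * s))"
    by (rule lift_cong) (simp add: path_join_def)
  from monodromy_eq[OF f this l(2,3) _ l(2,3)] l(4) have m: "monodromy f = \<xi> (1/2) i"
    by simp
  note mc = monodromy_closed[OF f]
  have "is_lift (\<lambda>s. path_join f g (1/2 + 1/2 * s)) 0 1 (\<lambda>s. \<xi> (1/2 + 1/2 * s))"
    by (rule lift_reparam[OF l(1)]) auto
  moreover have "path_join f g (1/2 + 1/2 * s) = g s" if "s \<in> {0..1}" for s
    using ends that by (cases "s = 0") (auto simp: path_join_def)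
  ultimately have "is_lift g 0 1 (\<lambda>s. \<xi> (1/2 + 1/2 * s))"
    by (rule lift_cong)
  from lift_right_mult[OF this inv_closed[OF mc]]
  have "monodromy g = \<xi> 1 i \<otimes> inv (monodromy f)"
    using monodromy_eq[OF g _ l(2,3) _ l(2,3)] m mc by force
  moreover have "\<xi> 1 i \<in> carrier G" using monodromy_closed[OF j] l(5) by simp
  ultimately show ?thesis using l(5) mc by (simp add: m_assoc)
qed

lemma monodromy_hom:
  obtains \<Phi> where "\<Phi> \<in> hom (fundamental_group X v) G"
    "\<And>\<gamma>. path_between X v v \<gamma> \<Longrightarrow> \<Phi> (loop_class X v \<gamma>) = monodromy \<gamma>"
proof
  define \<Phi> where "\<Phi> A = monodromy (SOME \<gamma>. \<gamma> \<in> A)" for A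
  show *: "\<Phi> (loop_class X v \<gamma>) = monodromy \<gamma>" if "path_between X v v \<gamma>" for \<gamma>
  proof -
    have "\<gamma> \<in> loop_class X v \<gamma>" using that by (simp add: loop_class_eq path_homotopic_refl)
    then have "(SOME \<gamma>'. \<gamma>' \<in> loop_class X v \<gamma>) \<in> loop_class X v \<gamma>"
      by (rule someI[of "\<lambda>\<gamma>'. \<gamma>' \<in> loop_class X v \<gamma>"])
    then show ?thesis
      unfolding \<Phi>_def loop_class_eq using monodromy_homotopic by simp
  qed
  show "\<Phi> \<in> hom (fundamental_group X v) G"
    by (rule homI) (auto simp: carrier_fundamental_group mult_fundamental_group * path_between_join
        monodromy_join monodromy_closed)
qed

end

section \<open>Redistributing weights\<close>

text \<open>Stack the weights of a point of a simplex as consecutive intervals of \<open>[0, 1]\<close> and measure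
  these intervals by \<open>\<kappa>\<close> instead of by their lengths. This is natural for all monotone maps, since they
  only merge neighbouring intervals.\<close>

definition restack :: "(real \<Rightarrow> real) \<Rightarrow> nat \<Rightarrow> (nat \<Rightarrow> real) \<Rightarrow> nat \<Rightarrow> real" where
  "restack \<kappa> n t i = (if i \<le> n then \<kappa> (sum t {..<Suc i}) - \<kappa> (sum t {..<i}) else 0)"

definition distortions :: "(real \<Rightarrow> real) set" where
  "distortions = {\<kappa>. continuous_on UNIV \<kappa> \<and> mono \<kappa> \<and> \<kappa> 0 = 0 \<and> \<kappa> 1 = 1}"

lemma sum_restack: "k \<le> Suc n \<Longrightarrow> (\<Sum>i<k. restack \<kappa> n t i) = \<kappa> (sum t {..<k}) - \<kappa> 0"
  by (induction k) (auto simp: restack_def)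

lemma restack_nonneg:
  assumes "mono \<kappa>" "\<And>i. 0 \<le> t i"
  shows "0 \<le> restack \<kappa> n t i"
  using monoD[OF assms(1), of "sum t {..<i}" "sum t {..<Suc i}"] assms(2) by (simp add: restack_def)

lemma simplex_sum: "t \<in> standard_simplex n \<Longrightarrow> sum t {..<Suc n} = 1"
  by (simp add: standard_simplex_def lessThan_Suc_atMost)

lemma simplex_nonneg: "t \<in> standard_simplex n \<Longrightarrow> 0 \<le> t i"
  by (simp add: standard_simplex_def)

lemma sum_restack_simplex:
  assumes "\<kappa> \<in> distortions" "t \<in> standard_simplex n"
  shows "(\<Sum>i\<le>n. restack \<kappa> n t i) = 1"
  using sum_restack[of "Suc n" n \<kappa> t] simplex_sum[OF assms(2)] assms(1)
  by (simp add: distortions_def lessThan_Suc_atMost)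

text \<open>As \<open>\<theta>\<close> is monotone, the vertices mapped below a given one form an initial segment. Pushing forward
  preserves the weight of this segment, and partial sums from the left are all that \<open>\<kappa>\<close> is applied to.\<close>

lemma restack_push:
  assumes mono: "mono_on {..m} \<theta>" and \<theta>: "\<theta> \<in> {..m} \<rightarrow> {..n}"
  shows "simplex_push m \<theta> (restack \<kappa> m t) = restack \<kappa> n (simplex_push m \<theta> t)"
proof
  fix j
  have init: "\<exists>k\<le>Suc m. {i. i \<le> m \<and> \<theta> i < c} = {..<k}" for c
  proof (cases "\<exists>i\<le>m. c \<le> \<theta> i")
    case True
    define k where "k = (LEAST i. i \<le> m \<and> c \<le> \<theta> i)"
    have k: "k \<le> m \<and> c \<le> \<theta> k" using True unfolding k_def by (metis (mono_tags, lifting) LeastI)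
    have "i \<le> m \<and> \<theta> i < c \<longleftrightarrow> i < k" for i
    proof
      assume i: "i \<le> m \<and> \<theta> i < c"
      show "i < k"
        using mono_on_atMostD[OF mono, of k i] k i by (metis leD le_trans linorder_not_le)
    next
      assume "i < k"
      then show "i \<le> m \<and> \<theta> i < c"
        using not_less_Least[of i "\<lambda>i. i \<le> m \<and> c \<le> \<theta> i"] k unfolding k_def[symmetric] by auto
    qed
    then show ?thesis using k by (intro exI[of _ k]) auto
  next
    case False
    then have "\<theta> i < c" if "i \<le> m" for i using False that by (meson not_le)
    then show ?thesis by (intro exI[of _ "Suc m"]) (auto simp: less_Suc_eq_le)
  qed
  have cum: "sum (simplex_push m \<theta> t) {..<c} = sum t {i. i \<le> m \<and> \<theta> i < c}" for c and t :: "nat \<Rightarrow> real"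
  proof -
    have "sum (simplex_push m \<theta> t) {..<c} = (\<Sum>j<c. sum t {i \<in> {i. i \<le> m \<and> \<theta> i < c}. \<theta> i = j})"
      unfolding simplex_push_def by (intro sum.cong) auto
    also have "\<dots> = sum t {i. i \<le> m \<and> \<theta> i < c}"
      by (rule sum.group) auto
    finally show ?thesis .
  qed
  have cumr: "sum (restack \<kappa> m t) {i. i \<le> m \<and> \<theta> i < c} = \<kappa> (sum t {i. i \<le> m \<and> \<theta> i < c}) - \<kappa> 0" for c
    using init[of c] sum_restack[of _ m \<kappa> t] by auto
  show "simplex_push m \<theta> (restack \<kappa> m t) j = restack \<kappa> n (simplex_push m \<theta> t) j"
  proof (cases "j \<le> n")
    case True
    have "sum (simplex_push m \<theta> (restack \<kappa> m t)) {..<Suc j} - sum (simplex_push m \<theta> (restack \<kappa> m t)) {..<j}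
       = \<kappa> (sum (simplex_push m \<theta> t) {..<Suc j}) - \<kappa> (sum (simplex_push m \<theta> t) {..<j})"
      by (simp only: cum cumr)
    then show ?thesis using True by (simp add: restack_def)
  next
    case False
    then have "{i. i \<le> m \<and> \<theta> i = j} = {}" using \<theta> by auto
    then show ?thesis
      unfolding simplex_push_def using False by (simp only: sum.empty restack_def if_False)
  qed
qed

lemma continuous_on_restack:
  assumes "\<kappa> \<in> distortions"
  shows "continuous_on S (\<lambda>t. restack \<kappa> n t i)"
proof -
  have "continuous_on S (\<lambda>t. \<kappa> (sum t {..<k}))" for k
  proof (rule continuous_on_compose2[of UNIV \<kappa>])
    show "continuous_on S (\<lambda>t. sum t {..<k})"
      by (intro continuous_on_sum continuous_on_product_then_coordinatewise[OF continuous_on_id])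
  qed (use assms in \<open>auto simp: distortions_def\<close>)
  then show ?thesis
    by (cases "i \<le> n") (simp_all add: restack_def continuous_on_diff del: sum.lessThan_Suc)
qed

context small_category
begin

section \<open>Heavy vertices\<close>

text \<open>Two vertices of a simplex of the nerve are identified if the simplex restricts to a degenerate
  edge between them. A vertex is heavy if the vertices identified with it have together more than half
  of the restacked weight; all heavy vertices are thus identified. A point of the realization may have
  many heavy vertices in one representation and a single one in another, but what they are as objects
  of the category does not depend on the representation.\<close>

definition same :: "(nat \<Rightarrow> nat \<Rightarrow> 'm) \<Rightarrow> nat \<Rightarrow> nat \<Rightarrow> bool" where
  "same \<sigma> i j \<longleftrightarrow> \<sigma> (min i j) (max i j) = \<sigma> i i"

definition mass :: "(real \<Rightarrow> real) \<Rightarrow> nat \<Rightarrow> (nat \<Rightarrow> nat \<Rightarrow> 'm) \<Rightarrow> (nat \<Rightarrow> real) \<Rightarrow> nat \<Rightarrow> real" where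
  "mass \<kappa> n \<sigma> t i = sum (restack \<kappa> n t) {j. j \<le> n \<and> same \<sigma> i j}"

definition heavy :: "(real \<Rightarrow> real) \<Rightarrow> nat \<Rightarrow> (nat \<Rightarrow> nat \<Rightarrow> 'm) \<Rightarrow> (nat \<Rightarrow> real) \<Rightarrow> nat \<Rightarrow> bool" where
  "heavy \<kappa> n \<sigma> t i \<longleftrightarrow> i \<le> n \<and> mass \<kappa> n \<sigma> t i > 1/2"

lemma same_refl [simp]: "same \<sigma> i i"
  by (simp add: same_def)

lemma same_ob:
  assumes "\<sigma> \<in> nerve C n" "i \<le> n" "j \<le> n" "same \<sigma> i j"
  shows "nerve_ob C \<sigma> j = nerve_ob C \<sigma> i"
proof (cases "i \<le> j")
  case True
  then show ?thesis
    using nerve_Mor[OF assms(1) True assms(3)] nerve_Mor[OF assms(1) order_refl assms(2)] assms(4)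
    by (auto simp: same_def Mor_def)
next
  case False
  then show ?thesis
    using nerve_Mor[OF assms(1), of j i] nerve_Mor[OF assms(1) order_refl assms(2)] assms(2,4)
    by (auto simp: same_def Mor_def min_def max_def)
qed

lemma same_sym:
  assumes "\<sigma> \<in> nerve C n" "i \<le> n" "j \<le> n" "same \<sigma> i j"
  shows "same \<sigma> j i"
  using same_ob[OF assms] nerve_Ident(1)[OF assms(1)] assms(2-4)
  by (metis max.commute min.commute same_def)

text \<open>If two of the three sides of a commutative triangle are identities, so is the third; the order of \<open>i\<close>,
  \<open>j\<close>, \<open>k\<close> decides which side is which.\<close>

lemma same_trans:
  assumes \<sigma>: "\<sigma> \<in> nerve C n" and le: "i \<le> n" "j \<le> n" "k \<le> n" and ij: "same \<sigma> i j" and jk: "same \<sigma> j k"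
  shows "same \<sigma> i k"
proof -
  define x where "x = nerve_ob C \<sigma> i"
  have ob: "nerve_ob C \<sigma> i = x" "nerve_ob C \<sigma> j = x" "nerve_ob C \<sigma> k = x"
    using same_ob[OF \<sigma> le(1,2) ij] same_ob[OF \<sigma> le(2,3) jk] by (simp_all add: x_def)
  have d: "\<sigma> l l = Ident C x" if "l \<in> {i, j, k}" for l
    using nerve_Ident(1)[OF \<sigma>, of l] that le ob by auto
  have x: "x \<in> Ob C" using nerve_Ident(2)[OF \<sigma> le(1)] by (simp add: x_def)
  have third: "(\<sigma> a b = Ident C x \<and> \<sigma> b c = Ident C x \<longrightarrow> \<sigma> a c = Ident C x) \<and>
      (\<sigma> a b = Ident C x \<and> \<sigma> a c = Ident C x \<longrightarrow> \<sigma> b c = Ident C x) \<and>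
      (\<sigma> a c = Ident C x \<and> \<sigma> b c = Ident C x \<longrightarrow> \<sigma> a b = Ident C x)"
    if "a \<in> {i, j, k}" "b \<in> {i, j, k}" "c \<in> {i, j, k}" "a \<le> b" "b \<le> c" for a b c
  proof -
    have cn: "c \<le> n" using that(3) le by auto
    have m: "\<sigma> a b \<in> Mor C x x" "\<sigma> b c \<in> Mor C x x" "\<sigma> a c \<in> Mor C x x"
    proof -
      have "nerve_ob C \<sigma> a = x" "nerve_ob C \<sigma> b = x" "nerve_ob C \<sigma> c = x"
        using that(1-3) ob by blast+
      then show "\<sigma> a b \<in> Mor C x x" "\<sigma> b c \<in> Mor C x x" "\<sigma> a c \<in> Mor C x x"
        using nerve_Mor[OF \<sigma> that(4) le_trans[OF that(5) cn]] nerve_Mor[OF \<sigma> that(5) cn]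
          nerve_Mor[OF \<sigma> le_trans[OF that(4,5)] cn] by simp_all
    qed
    have "\<sigma> a c = Comp C (\<sigma> b c) (\<sigma> a b)" using nerve_Comp[OF \<sigma> that(4,5) cn] .
    then show ?thesis using Comp_Ident[OF m(1)] Comp_Ident[OF m(2)] Ident_Comp[OF m(1)] Ident_Comp[OF m(2)]
      Ident_Comp[OF Ident_Mor[OF x]] by auto
  qed
  have s: "same \<sigma> a b \<longleftrightarrow> \<sigma> (min a b) (max a b) = Ident C x" if "a \<in> {i, j, k}" for a b
    using d[OF that] by (simp add: same_def)
  have e1: "same \<sigma> a b \<longleftrightarrow> \<sigma> a b = Ident C x" if "a \<le> b" "a \<in> {i, j, k}" for a b
    using s[OF that(2)] that(1) by (simp only: min_absorb1 max_absorb2)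
  have e2: "same \<sigma> a b \<longleftrightarrow> \<sigma> b a = Ident C x" if "b \<le> a" "a \<in> {i, j, k}" for a b
    using s[OF that(2)] that(1) by (simp only: min_absorb2 max_absorb1)
  have mem: "i \<in> {i, j, k}" "j \<in> {i, j, k}" "k \<in> {i, j, k}" by auto
  consider "i \<le> j" "j \<le> k" "i \<le> k" | "i \<le> k" "k \<le> j" "i \<le> j" | "j \<le> i" "i \<le> k" "j \<le> k" | "j \<le> k" "k \<le> i" "j \<le> i" | "k \<le> i" "i \<le> j" "k \<le> j" | "k \<le> j" "j \<le> i" "k \<le> i"
    by linarith
  then show ?thesis
  proof cases
    case 1
    show ?thesis
      using third[OF mem(1) mem(2) mem(3) 1(1,2)] ij jk
      unfolding e1[OF 1(1) mem(1)] e1[OF 1(2) mem(2)] e1[OF 1(3) mem(1)] by blast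
  next
    case 2
    show ?thesis
      using third[OF mem(1) mem(3) mem(2) 2(1,2)] ij jk
      unfolding e1[OF 2(3) mem(1)] e2[OF 2(2) mem(2)] e1[OF 2(1) mem(1)] by blast
  next
    case 3
    show ?thesis
      using third[OF mem(2) mem(1) mem(3) 3(1,2)] ij jk
      unfolding e2[OF 3(1) mem(1)] e1[OF 3(3) mem(2)] e1[OF 3(2) mem(1)] by blast
  next
    case 4
    show ?thesis
      using third[OF mem(2) mem(3) mem(1) 4(1,2)] ij jk
      unfolding e2[OF 4(3) mem(1)] e1[OF 4(1) mem(2)] e2[OF 4(2) mem(1)] by blast
  next
    case 5
    show ?thesis
      using third[OF mem(3) mem(1) mem(2) 5(1,2)] ij jk
      unfolding e1[OF 5(2) mem(1)] e2[OF 5(3) mem(2)] e2[OF 5(1) mem(1)] by blast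
  next
    case 6
    show ?thesis
      using third[OF mem(3) mem(2) mem(1) 6(1,2)] ij jk
      unfolding e2[OF 6(2) mem(1)] e2[OF 6(1) mem(2)] e2[OF 6(3) mem(1)] by blast
  qed
qed

lemma mass_same:
  assumes "\<sigma> \<in> nerve C n" "i \<le> n" "j \<le> n" "same \<sigma> i j"
  shows "mass \<kappa> n \<sigma> t i = mass \<kappa> n \<sigma> t j"
proof -
  have "{k. k \<le> n \<and> same \<sigma> i k} = {k. k \<le> n \<and> same \<sigma> j k}"
    using same_trans[OF assms(1)] same_sym[OF assms(1)] assms(2-4) by blast
  then show ?thesis by (simp add: mass_def)
qed

text \<open>Two disjoint classes of vertices cannot both have more than half of the total weight 1.\<close>

lemma heavy_same:
  assumes \<sigma>: "\<sigma> \<in> nerve C n" and t: "t \<in> standard_simplex n" and \<kappa>: "\<kappa> \<in> distortions"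
    and ij: "heavy \<kappa> n \<sigma> t i" "heavy \<kappa> n \<sigma> t j"
  shows "same \<sigma> i j"
proof (rule ccontr)
  assume ns: "\<not> same \<sigma> i j"
  have le: "i \<le> n" "j \<le> n" using ij by (auto simp: heavy_def)
  let ?A = "\<lambda>i. {k. k \<le> n \<and> same \<sigma> i k}"
  have "?A i \<inter> ?A j = {}"
    using ns same_trans[OF \<sigma>] same_sym[OF \<sigma>] le by blast
  then have "mass \<kappa> n \<sigma> t i + mass \<kappa> n \<sigma> t j = sum (restack \<kappa> n t) (?A i \<union> ?A j)"
    unfolding mass_def by (subst sum.union_disjoint) auto
  also have "\<dots> \<le> sum (restack \<kappa> n t) {..n}"
    using restack_nonneg[of \<kappa> t] \<kappa> simplex_nonneg[OF t]
    by (intro sum_mono2) (auto simp: distortions_def)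
  also have "\<dots> = 1" by (rule sum_restack_simplex[OF \<kappa> t])
  finally show False using ij by (simp add: heavy_def)
qed

lemma same_nerve_map:
  assumes "mono_on {..m} \<theta>" "i \<le> m" "j \<le> m"
  shows "same (nerve_map m \<theta> \<sigma>) i j \<longleftrightarrow> same \<sigma> (\<theta> i) (\<theta> j)"
proof -
  have "\<theta> (min i j) = min (\<theta> i) (\<theta> j) \<and> \<theta> (max i j) = max (\<theta> i) (\<theta> j)"
    using mono_on_atMostD[OF assms(1)] assms(2,3) by (cases "i \<le> j") (auto simp: min_def max_def intro: antisym)
  moreover have "min i j \<le> max i j" "max i j \<le> m" using assms by auto
  ultimately show ?thesis
    using assms by (simp add: same_def nerve_map_def)
qed

lemma mass_nerve_map:
  assumes mono: "mono_on {..m} \<theta>" and \<theta>: "\<theta> \<in> {..m} \<rightarrow> {..n}" and i: "i \<le> m"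
  shows "mass \<kappa> m (nerve_map m \<theta> \<sigma>) t i = mass \<kappa> n \<sigma> (simplex_push m \<theta> t) (\<theta> i)"
proof -
  let ?B = "{j. j \<le> n \<and> same \<sigma> (\<theta> i) j}" and ?A = "{j. j \<le> m \<and> same \<sigma> (\<theta> i) (\<theta> j)}"
  have "mass \<kappa> n \<sigma> (simplex_push m \<theta> t) (\<theta> i) = sum (simplex_push m \<theta> (restack \<kappa> m t)) ?B"
    by (simp add: mass_def restack_push[OF mono \<theta>])
  also have "\<dots> = (\<Sum>j\<in>?B. sum (restack \<kappa> m t) {l \<in> ?A. \<theta> l = j})"
    unfolding simplex_push_def by (intro sum.cong) (auto intro: arg_cong[where f = "sum (restack \<kappa> m t)"])
  also have "\<dots> = sum (restack \<kappa> m t) ?A"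
    by (rule sum.group) (use \<theta> in auto)
  also have "?A = {j. j \<le> m \<and> same (nerve_map m \<theta> \<sigma>) i j}"
    using same_nerve_map[OF mono i] by auto
  finally show ?thesis by (simp add: mass_def)
qed

lemma heavy_nerve_map:
  assumes "mono_on {..m} \<theta>" "\<theta> \<in> {..m} \<rightarrow> {..n}" "i \<le> m"
  shows "heavy \<kappa> m (nerve_map m \<theta> \<sigma>) t i \<longleftrightarrow> heavy \<kappa> n \<sigma> (simplex_push m \<theta> t) (\<theta> i)"
  using assms by (auto simp: heavy_def mass_nerve_map)

text \<open>A heavy vertex outside the image of \<open>\<theta>\<close> can be traded for one inside: it is the image that
  carries the weight.\<close>

lemma heavy_in_image:
  assumes \<sigma>: "\<sigma> \<in> nerve C n" and mono: "mono_on {..m} \<theta>" and \<theta>: "\<theta> \<in> {..m} \<rightarrow> {..n}"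
    and i: "heavy \<kappa> n \<sigma> (simplex_push m \<theta> t) i"
  obtains l where "l \<le> m" "heavy \<kappa> m (nerve_map m \<theta> \<sigma>) t l" "same \<sigma> i (\<theta> l)"
proof -
  have i': "i \<le> n" "mass \<kappa> n \<sigma> (simplex_push m \<theta> t) i \<noteq> 0" using i by (auto simp: heavy_def)
  then obtain j where j: "j \<le> n" "same \<sigma> i j" "restack \<kappa> n (simplex_push m \<theta> t) j \<noteq> 0"
    unfolding mass_def by (metis (mono_tags, lifting) mem_Collect_eq sum.not_neutral_contains_not_neutral)
  then have "simplex_push m \<theta> (restack \<kappa> m t) j \<noteq> 0" by (simp add: restack_push[OF mono \<theta>])
  then have "{l. l \<le> m \<and> \<theta> l = j} \<noteq> {}" unfolding simplex_push_def by (metis sum.empty)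
  then obtain l where l: "l \<le> m" "\<theta> l = j" by auto
  have "heavy \<kappa> n \<sigma> (simplex_push m \<theta> t) j"
    using i mass_same[OF \<sigma> i'(1) j(1,2)] j(1) by (auto simp: heavy_def)
  then show ?thesis
    using that[OF l(1)] heavy_nerve_map[OF mono \<theta> l(1)] l j by simp
qed

lemma nerve_ob_map: "i \<le> m \<Longrightarrow> nerve_ob C (nerve_map m \<theta> \<sigma>) i = nerve_ob C \<sigma> (\<theta> i)"
  by (simp add: nerve_map_def)

section \<open>The charts\<close>

definition chart_at :: "(real \<Rightarrow> real) \<Rightarrow> 'o \<Rightarrow> 'm cell_point set set" where
  "chart_at \<kappa> x = {cell_pt C n \<sigma> t | n \<sigma> t. \<sigma> \<in> nerve C n \<and> t \<in> standard_simplex n \<and>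
     (\<exists>i. heavy \<kappa> n \<sigma> t i \<and> nerve_ob C \<sigma> i = x)}"

lemma in_chart_at_iff:
  assumes "\<sigma> \<in> nerve C n" "t \<in> standard_simplex n"
  shows "cell_pt C n \<sigma> t \<in> chart_at \<kappa> x \<longleftrightarrow> (\<exists>i. heavy \<kappa> n \<sigma> t i \<and> nerve_ob C \<sigma> i = x)"
proof -
  have "(\<exists>i. heavy \<kappa> n \<sigma> t i \<and> nerve_ob C \<sigma> i = x) \<longleftrightarrow> (\<exists>i. heavy \<kappa> n' \<sigma>' t' i \<and> nerve_ob C \<sigma>' i = x)"
    if "cell_pt C n \<sigma> t = cell_pt C n' \<sigma>' t'" for n' \<sigma>' t'
  proof (rule cell_pt_invariant[OF that])
    fix m n :: nat and \<theta> \<sigma> t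
    assume \<sigma>: "\<sigma> \<in> nerve C n" and \<theta>: "\<theta> \<in> {..m} \<rightarrow> {..n}" and mono: "mono_on {..m} \<theta>"
    show "(\<exists>i. heavy \<kappa> m (nerve_map m \<theta> \<sigma>) t i \<and> nerve_ob C (nerve_map m \<theta> \<sigma>) i = x) \<longleftrightarrow>
        (\<exists>i. heavy \<kappa> n \<sigma> (simplex_push m \<theta> t) i \<and> nerve_ob C \<sigma> i = x)" (is "?L \<longleftrightarrow> ?R")
    proof
      assume ?L
      then obtain i where i: "heavy \<kappa> m (nerve_map m \<theta> \<sigma>) t i" "nerve_ob C (nerve_map m \<theta> \<sigma>) i = x" by blast
      moreover have "i \<le> m" using i by (simp add: heavy_def)
      ultimately show ?R using heavy_nerve_map[OF mono \<theta>] nerve_ob_map by auto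
    next
      assume ?R
      then obtain i where i: "heavy \<kappa> n \<sigma> (simplex_push m \<theta> t) i" "nerve_ob C \<sigma> i = x" by blast
      obtain l where l: "l \<le> m" "heavy \<kappa> m (nerve_map m \<theta> \<sigma>) t l" "same \<sigma> i (\<theta> l)"
        by (rule heavy_in_image[OF \<sigma> mono \<theta> i(1)])
      have "i \<le> n" "\<theta> l \<le> n" using i(1) funcset_mem[OF \<theta>, of l] l(1) by (auto simp: heavy_def)
      then have "nerve_ob C (nerve_map m \<theta> \<sigma>) l = x"
        using same_ob[OF \<sigma> _ _ l(3)] i(2) nerve_ob_map[OF l(1)] by simp
      then show ?L using l(2) by blast
    qed
  qed
  then show ?thesis
    unfolding chart_at_def using assms by blast
qed

lemma continuous_on_mass: "\<kappa> \<in> distortions \<Longrightarrow> continuous_on S (\<lambda>t. mass \<kappa> n \<sigma> t i)"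
  unfolding mass_def by (intro continuous_on_sum continuous_on_restack)

lemma openin_mass:
  assumes "\<kappa> \<in> distortions"
  shows "openin (top_of_set S) {t \<in> S. mass \<kappa> n \<sigma> t i > 1/2}"
proof -
  have "open {t. mass \<kappa> n \<sigma> t i > 1/2}"
    by (intro open_Collect_less continuous_on_mass assms continuous_intros)
  moreover have "{t \<in> S. mass \<kappa> n \<sigma> t i > 1/2} = S \<inter> {t. mass \<kappa> n \<sigma> t i > 1/2}" by blast
  ultimately show ?thesis
    by (simp only: openin_open_Int)
qed

lemma chart_at_open:
  assumes "\<kappa> \<in> distortions"
  shows "openin (realization C) (chart_at \<kappa> x)"
  unfolding openin_realization
proof (intro conjI allI ballI)
  show "chart_at \<kappa> x \<subseteq> topspace (realization C)" by (auto simp: chart_at_def)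
  fix n \<sigma> assume \<sigma>: "\<sigma> \<in> nerve C n"
  have "{t \<in> standard_simplex n. cell_pt C n \<sigma> t \<in> chart_at \<kappa> x} =
     (\<Union>i \<in> {i. i \<le> n \<and> nerve_ob C \<sigma> i = x}. {t \<in> standard_simplex n. mass \<kappa> n \<sigma> t i > 1/2})"
    using in_chart_at_iff[OF \<sigma>] by (auto simp: heavy_def)
  also have "openin (top_of_set (standard_simplex n)) \<dots>"
    by (rule openin_Union) (use openin_mass[OF assms] in blast)
  finally show "openin (top_of_set (standard_simplex n)) {t \<in> standard_simplex n. cell_pt C n \<sigma> t \<in> chart_at \<kappa> x}" .
qed

text \<open>Blowing up the interval of one vertex of positive weight to the whole of \<open>[0, 1]\<close> makes that
  vertex heavy.\<close>

lemma charts_cover: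
  assumes "q \<in> topspace (realization C)"
  obtains \<kappa> x where "\<kappa> \<in> distortions" "q \<in> chart_at \<kappa> x"
proof -
  obtain n \<sigma> t where q: "\<sigma> \<in> nerve C n" "t \<in> standard_simplex n" "q = cell_pt C n \<sigma> t"
    using assms by (auto simp: topspace_realization)
  obtain i where i: "i \<le> n" "t i > 0"
  proof -
    have "\<exists>i\<le>n. t i \<noteq> 0"
    proof (rule ccontr)
      assume "\<not> (\<exists>i\<le>n. t i \<noteq> 0)"
      then have "(\<Sum>i\<le>n. t i) = 0" by (intro sum.neutral) auto
      then show False using q(2) by (simp add: standard_simplex_def)
    qed
    then show ?thesis using that simplex_nonneg[OF q(2)] by (metis less_eq_real_def)
  qed
  define a where "a = sum t {..<i}"
  define \<kappa> where "\<kappa> w = max 0 (min 1 ((w - a) / t i))" for w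
  have a: "0 \<le> a" unfolding a_def by (intro sum_nonneg simplex_nonneg[OF q(2)])
  have "sum t {..<Suc i} \<le> sum t {..<Suc n}"
    by (rule sum_mono2) (use i simplex_nonneg[OF q(2)] in auto)
  then have b: "a + t i \<le> 1" using simplex_sum[OF q(2)] by (simp add: a_def)
  have "mono \<kappa>" unfolding \<kappa>_def
    by (intro monoI max.mono min.mono order_refl divide_right_mono) (use i in auto)
  moreover have "continuous_on UNIV \<kappa>" unfolding \<kappa>_def by (intro continuous_intros) (use i in auto)
  moreover have "\<kappa> 0 = 0"
  proof -
    have "(0 - a) / t i \<le> 0" using a i by (intro divide_nonpos_pos) auto
    then show ?thesis by (simp add: \<kappa>_def max_def min_def)
  qed
  moreover have "\<kappa> 1 = 1" using b i by (simp add: \<kappa>_def pos_le_divide_eq)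
  ultimately have \<kappa>: "\<kappa> \<in> distortions" by (simp add: distortions_def)
  have "restack \<kappa> n t i = 1"
    using i by (simp add: restack_def a_def[symmetric]) (simp add: \<kappa>_def)
  moreover have "restack \<kappa> n t i \<le> mass \<kappa> n \<sigma> t i"
    unfolding mass_def using restack_nonneg[OF \<open>mono \<kappa>\<close> simplex_nonneg[OF q(2)]] i
    by (intro member_le_sum) auto
  ultimately have "heavy \<kappa> n \<sigma> t i" using i by (simp add: heavy_def)
  then show ?thesis
    using that[OF \<kappa>, of "nerve_ob C \<sigma> i"] in_chart_at_iff[OF q(1,2)] q(3) by blast
qed

end

context small_category
begin

section \<open>Contracting a chart\<close>

text \<open>The straight line from a point to the redistribution of its weight on its heavy vertices is
  natural for all identifications, hence contracts a chart to the vertex it belongs to.\<close>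

definition focus :: "(real \<Rightarrow> real) \<Rightarrow> nat \<Rightarrow> (nat \<Rightarrow> nat \<Rightarrow> 'm) \<Rightarrow> (nat \<Rightarrow> real) \<Rightarrow> nat \<Rightarrow> real" where
  "focus \<kappa> n \<sigma> t j = (if heavy \<kappa> n \<sigma> t j
     then restack \<kappa> n t j / sum (restack \<kappa> n t) {l. heavy \<kappa> n \<sigma> t l} else 0)"

lemma heavy_eq:
  assumes "\<sigma> \<in> nerve C n" "t \<in> standard_simplex n" "\<kappa> \<in> distortions" "heavy \<kappa> n \<sigma> t i"
  shows "{l. heavy \<kappa> n \<sigma> t l} = {l. l \<le> n \<and> same \<sigma> i l}"
proof (intro equalityI subsetI)
  have i: "i \<le> n" using assms(4) by (simp add: heavy_def)
  fix l assume "l \<in> {l. l \<le> n \<and> same \<sigma> i l}"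
  then show "l \<in> {l. heavy \<kappa> n \<sigma> t l}"
    using mass_same[OF assms(1) i, of l] assms(4) by (simp add: heavy_def)
qed (use heavy_same[OF assms] in \<open>simp add: heavy_def\<close>)

lemma focus_eq:
  assumes "\<sigma> \<in> nerve C n" "t \<in> standard_simplex n" "\<kappa> \<in> distortions" "heavy \<kappa> n \<sigma> t i"
  shows "focus \<kappa> n \<sigma> t = (\<lambda>j. if j \<le> n \<and> same \<sigma> i j then restack \<kappa> n t j / mass \<kappa> n \<sigma> t i else 0)"
proof
  fix j
  have "heavy \<kappa> n \<sigma> t j \<longleftrightarrow> j \<le> n \<and> same \<sigma> i j"
    using heavy_eq[OF assms] by blast
  then show "focus \<kappa> n \<sigma> t j = (if j \<le> n \<and> same \<sigma> i j then restack \<kappa> n t j / mass \<kappa> n \<sigma> t i else 0)"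
    by (simp only: focus_def heavy_eq[OF assms] mass_def)
qed

lemma focus_in:
  assumes "\<sigma> \<in> nerve C n" "t \<in> standard_simplex n" "\<kappa> \<in> distortions" "heavy \<kappa> n \<sigma> t i"
  shows "focus \<kappa> n \<sigma> t \<in> standard_simplex n"
proof -
  have pos: "mass \<kappa> n \<sigma> t i > 0" using assms(4) by (simp add: heavy_def)
  have nn: "0 \<le> restack \<kappa> n t j" for j
    using restack_nonneg assms(3) simplex_nonneg[OF assms(2)] by (auto simp: distortions_def)
  have le: "restack \<kappa> n t j \<le> mass \<kappa> n \<sigma> t i" if "j \<le> n" "same \<sigma> i j" for j
    unfolding mass_def by (rule member_le_sum) (use that nn in auto)
  have "(\<Sum>j\<le>n. focus \<kappa> n \<sigma> t j) = sum (\<lambda>j. restack \<kappa> n t j / mass \<kappa> n \<sigma> t i) {j. j \<le> n \<and> same \<sigma> i j}"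
    unfolding focus_eq[OF assms] by (rule sum.mono_neutral_cong_right) auto
  also have "\<dots> = 1" using pos by (simp add: mass_def flip: sum_divide_distrib)
  finally show ?thesis
    using nn le pos by (simp add: standard_simplex_def) (auto simp: focus_eq[OF assms])
qed

lemma focus_nonzero: "focus \<kappa> n \<sigma> t j \<noteq> 0 \<Longrightarrow> heavy \<kappa> n \<sigma> t j"
  by (auto simp: focus_def split: if_splits)

lemma focus_push:
  assumes mono: "mono_on {..m} \<theta>" and \<theta>: "\<theta> \<in> {..m} \<rightarrow> {..n}"
  shows "simplex_push m \<theta> (focus \<kappa> m (nerve_map m \<theta> \<sigma>) t) = focus \<kappa> n \<sigma> (simplex_push m \<theta> t)"
proof
  fix j
  let ?H = "heavy \<kappa> m (nerve_map m \<theta> \<sigma>) t" and ?H' = "heavy \<kappa> n \<sigma> (simplex_push m \<theta> t)"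
  let ?M = "sum (restack \<kappa> m t) {l. ?H l}"
  have H: "?H i \<longleftrightarrow> i \<le> m \<and> ?H' (\<theta> i)" for i
    using heavy_nerve_map[OF mono \<theta>] by (auto simp: heavy_def)
  have fin: "finite {l. ?H l}" "finite {l. ?H' l}" by (auto simp: heavy_def)
  have "sum (restack \<kappa> n (simplex_push m \<theta> t)) {l. ?H' l} =
      (\<Sum>j\<in>{l. ?H' l}. sum (restack \<kappa> m t) {l \<in> {l. ?H l}. \<theta> l = j})"
  proof (rule sum.cong[OF refl])
    fix j assume "j \<in> {l. ?H' l}"
    then have "{l \<in> {l. ?H l}. \<theta> l = j} = {l. l \<le> m \<and> \<theta> l = j}" using H by auto
    then show "restack \<kappa> n (simplex_push m \<theta> t) j = sum (restack \<kappa> m t) {l \<in> {l. ?H l}. \<theta> l = j}"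
      by (simp only: restack_push[OF mono \<theta>, symmetric] simplex_push_def[of m \<theta> "restack \<kappa> m t"])
  qed
  also have "\<dots> = ?M"
    by (rule sum.group) (use fin H in auto)
  finally have M: "sum (restack \<kappa> n (simplex_push m \<theta> t)) {l. ?H' l} = ?M" .
  have "simplex_push m \<theta> (focus \<kappa> m (nerve_map m \<theta> \<sigma>) t) j =
      (if ?H' j then simplex_push m \<theta> (restack \<kappa> m t) j / ?M else 0)"
    unfolding simplex_push_def[of m \<theta> "focus \<kappa> m (nerve_map m \<theta> \<sigma>) t"]
      simplex_push_def[of m \<theta> "restack \<kappa> m t"] sum_divide_distrib
    by (cases "?H' j") (auto simp: focus_def H intro!: sum.cong sum.neutral)
  then show "simplex_push m \<theta> (focus \<kappa> m (nerve_map m \<theta> \<sigma>) t) j = focus \<kappa> n \<sigma> (simplex_push m \<theta> t) j"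
    by (simp only: focus_def[of \<kappa> n] M restack_push[OF mono \<theta>])
qed

lemma cell_pt_heavy_support:
  assumes \<sigma>: "\<sigma> \<in> nerve C n" and t: "t \<in> standard_simplex n" and \<kappa>: "\<kappa> \<in> distortions"
    and i: "heavy \<kappa> n \<sigma> t i" and u: "u \<in> standard_simplex n" "\<And>j. u j \<noteq> 0 \<Longrightarrow> heavy \<kappa> n \<sigma> t j"
  shows "cell_pt C n \<sigma> u = vertex C (nerve_ob C \<sigma> i)"
proof (rule cell_pt_eq_vertex[OF \<sigma> u(1)])
  have i': "i \<le> n" using i by (simp add: heavy_def)
  show "nerve_ob C \<sigma> i \<in> Ob C" by (rule nerve_Ident(2)[OF \<sigma> i'])
  fix j k assume "j \<le> k" "k \<le> n" "u j \<noteq> 0" "u k \<noteq> 0"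
  then have "same \<sigma> j k" "same \<sigma> i j" "j \<le> n"
    using heavy_same[OF \<sigma> t \<kappa>] u(2) i by auto
  then show "\<sigma> j k = Ident C (nerve_ob C \<sigma> i)"
    using \<open>j \<le> k\<close> nerve_Ident(1)[OF \<sigma> \<open>j \<le> n\<close>] same_ob[OF \<sigma> i' \<open>j \<le> n\<close>] by (simp add: same_def)
qed

lemma segment_push: "simplex_push m \<theta> (segment a b r) = segment (simplex_push m \<theta> a) (simplex_push m \<theta> b) r"
  by (auto simp: simplex_push_def segment_def sum.distrib sum_distrib_left)

lemma line_nerve_map:
  assumes "\<sigma> \<in> nerve C n" "\<theta> \<in> {..m} \<rightarrow> {..n}" "mono_on {..m} \<theta>"
    and "a \<in> standard_simplex m" "b \<in> standard_simplex m" "r \<in> {0..1}"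
  shows "line C m (nerve_map m \<theta> \<sigma>) a b r = line C n \<sigma> (simplex_push m \<theta> a) (simplex_push m \<theta> b) r"
  using cell_pt_glue[OF assms(1) segment_in[OF assms(4,5)] assms(2,3)] assms(6)
  by (simp add: line_def segment_push)

definition contraction :: "(real \<Rightarrow> real) \<Rightarrow> 'm cell_point set \<Rightarrow> real \<Rightarrow> 'm cell_point set" where
  "contraction \<kappa> q r = (SOME y. \<exists>n \<sigma> t i. \<sigma> \<in> nerve C n \<and> t \<in> standard_simplex n \<and> q = cell_pt C n \<sigma> t \<and>
     heavy \<kappa> n \<sigma> t i \<and> y = line C n \<sigma> t (focus \<kappa> n \<sigma> t) r)"

lemma contraction_eq:
  assumes \<kappa>: "\<kappa> \<in> distortions" and r: "r \<in> {0..1}"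
    and \<sigma>: "\<sigma> \<in> nerve C n" and t: "t \<in> standard_simplex n" and i: "heavy \<kappa> n \<sigma> t i"
  shows "contraction \<kappa> (cell_pt C n \<sigma> t) r = line C n \<sigma> t (focus \<kappa> n \<sigma> t) r"
proof -
  define y0 where "y0 = line C n \<sigma> t (focus \<kappa> n \<sigma> t) r"
  define R where "R n \<sigma> t \<longleftrightarrow> (\<exists>i. heavy \<kappa> n \<sigma> t i) \<and> line C n \<sigma> t (focus \<kappa> n \<sigma> t) r = y0"
    for n \<sigma> and t :: "nat \<Rightarrow> real"
  have inv: "R n \<sigma> t \<longleftrightarrow> R n' \<sigma>' t'" if "cell_pt C n \<sigma> t = cell_pt C n' \<sigma>' t'" for n' \<sigma>' t'
  proof (rule cell_pt_invariant[OF that])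
    fix m n :: nat and \<theta> \<sigma> t
    assume a: "\<sigma> \<in> nerve C n" "t \<in> standard_simplex m" "\<theta> \<in> {..m} \<rightarrow> {..n}" "mono_on {..m} \<theta>"
    have ex: "(\<exists>i. heavy \<kappa> m (nerve_map m \<theta> \<sigma>) t i) \<longleftrightarrow> (\<exists>i. heavy \<kappa> n \<sigma> (simplex_push m \<theta> t) i)"
      using heavy_nerve_map[OF a(4,3)] heavy_in_image[OF a(1,4,3)] by (metis heavy_def)
    have "line C m (nerve_map m \<theta> \<sigma>) t (focus \<kappa> m (nerve_map m \<theta> \<sigma>) t) r =
      line C n \<sigma> (simplex_push m \<theta> t) (focus \<kappa> n \<sigma> (simplex_push m \<theta> t)) r"
      if "heavy \<kappa> m (nerve_map m \<theta> \<sigma>) t i" for i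
      using line_nerve_map[OF a(1,3,4,2) focus_in[OF nerve_map_in[OF a(1,3,4)] a(2) \<kappa> that] r]
      by (simp add: focus_push[OF a(4,3)])
    then show "R m (nerve_map m \<theta> \<sigma>) t \<longleftrightarrow> R n \<sigma> (simplex_push m \<theta> t)"
      unfolding R_def using ex by metis
  qed
  have "R n \<sigma> t" using i by (auto simp: R_def y0_def)
  then show ?thesis
    unfolding contraction_def y0_def[symmetric]
  proof (intro some_equality)
    show "\<exists>n' \<sigma>' t' i. \<sigma>' \<in> nerve C n' \<and> t' \<in> standard_simplex n' \<and> cell_pt C n \<sigma> t = cell_pt C n' \<sigma>' t' \<and>
        heavy \<kappa> n' \<sigma>' t' i \<and> y0 = line C n' \<sigma>' t' (focus \<kappa> n' \<sigma>' t') r"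
      using \<sigma> t i y0_def by blast
  qed (use inv R_def in blast)
qed

text \<open>As \<open>[0, 1]\<close> is locally compact, its product with the quotient map from the cells is again a quotient map.
  Openness may therefore be tested on cells, where near a given point a fixed vertex \<open>i\<close> stays heavy and the
  focus is given by a continuous formula.\<close>

lemma contraction_continuous:
  assumes \<kappa>: "\<kappa> \<in> distortions" and V: "openin (realization C) V"
  shows "openin (prod_topology (realization C) (top_of_set {0..1}))
    {z. fst z \<in> chart_at \<kappa> x \<and> snd z \<in> {0..1} \<and> contraction \<kappa> (fst z) (snd z) \<in> V}" (is "openin _ ?N")
proof -
  let ?I = "top_of_set {0..1::real}" and ?q = "\<lambda>((n, \<sigma>), t). cell_pt C n \<sigma> t"
  have "compact_space ?I" by (simp add: compact_space_subtopology)
  moreover have "Hausdorff_space ?I" by (simp add: Hausdorff_space_subtopology)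
  ultimately have "quotient_map (prod_topology (cells C) ?I) (prod_topology (realization C) ?I) (\<lambda>(z, r). (?q z, r))"
    by (intro quotient_map_prod_left quotient_map_realization compact_imp_locally_compact_space) auto
  moreover have "?N \<subseteq> topspace (prod_topology (realization C) ?I)"
    by (auto simp: chart_at_def)
  moreover have "openin (prod_topology (cells C) ?I)
      {z \<in> topspace (prod_topology (cells C) ?I). (\<lambda>(z, r). (?q z, r)) z \<in> ?N}" (is "openin _ ?M")
    unfolding openin_prod_topology_alt
  proof (intro allI impI)
    fix z r assume zr: "(z, r) \<in> ?M"
    then obtain n \<sigma> t where z: "z = ((n, \<sigma>), t)" and \<sigma>: "\<sigma> \<in> nerve C n" and t: "t \<in> standard_simplex n"
      and r: "r \<in> {0..1}" by (auto simp: cells_def)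
    have "cell_pt C n \<sigma> t \<in> chart_at \<kappa> x" and inV: "contraction \<kappa> (cell_pt C n \<sigma> t) r \<in> V"
      using zr by (auto simp: z)
    then obtain i where i: "heavy \<kappa> n \<sigma> t i" "nerve_ob C \<sigma> i = x"
      using in_chart_at_iff[OF \<sigma> t] by blast
    let ?S = "standard_simplex n"
    define f where "f t = (\<lambda>j. if j \<le> n \<and> same \<sigma> i j then restack \<kappa> n t j / mass \<kappa> n \<sigma> t i else 0)" for t
    let ?g = "\<lambda>z. segment (fst z) (f (fst z)) (snd z)"
    define O1 where "O1 = {t \<in> ?S. mass \<kappa> n \<sigma> t i > 1/2}"
    have O1: "openin (top_of_set ?S) O1" unfolding O1_def by (rule openin_mass[OF \<kappa>])
    have hv: "heavy \<kappa> n \<sigma> t' i" if "t' \<in> O1" for t'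
      using that i by (auto simp: O1_def heavy_def)
    have fe: "focus \<kappa> n \<sigma> t' = f t'" if "t' \<in> O1" for t'
      unfolding f_def by (rule focus_eq[OF \<sigma> _ \<kappa> hv[OF that]]) (use that in \<open>simp add: O1_def\<close>)
    have c: "contraction \<kappa> (cell_pt C n \<sigma> t') r' = cell_pt C n \<sigma> (?g (t', r'))"
      if "t' \<in> O1" "r' \<in> {0..1}" for t' r'
      using contraction_eq[OF \<kappa> that(2) \<sigma> _ hv[OF that(1)]] fe[OF that(1)] that(1)
      by (simp add: O1_def line_def)
    have "continuous_map (top_of_set (O1 \<times> {0..1})) (realization C) (\<lambda>z. cell_pt C n \<sigma> (?g z))"
    proof (rule continuous_map_top_of_set_compose[OF continuous_map_cell_pt[OF \<sigma>]])
      have f: "continuous_on O1 f"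
      proof (rule continuous_on_coordinatewise_then_product)
        show "continuous_on O1 (\<lambda>t. f t j)" for j
          by (cases "j \<le> n \<and> same \<sigma> i j")
            (auto simp: O1_def f_def intro!: continuous_on_divide continuous_on_restack[OF \<kappa>] continuous_on_mass[OF \<kappa>])
      qed
      show "continuous_on (O1 \<times> {0..1}) ?g"
        unfolding segment_def
        by (rule mix_continuous_on)
          (auto intro!: continuous_on_fst continuous_on_snd continuous_on_id continuous_on_compose2[OF f, of _ fst])
      show "?g \<in> O1 \<times> {0..1} \<rightarrow> ?S"
      proof
        fix z :: "(nat \<Rightarrow> real) \<times> real" assume z: "z \<in> O1 \<times> {0..1}"
        then have "fst z \<in> ?S" "heavy \<kappa> n \<sigma> (fst z) i" using hv by (auto simp: O1_def)
        then show "?g z \<in> ?S"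
          using segment_in[OF _ focus_in[OF \<sigma> _ \<kappa>, of "fst z" i], of "fst z" "snd z"] fe[of "fst z"] z by auto
      qed
    qed
    then have "openin (top_of_set (O1 \<times> {0..1})) {z \<in> O1 \<times> {0..1}. cell_pt C n \<sigma> (?g z) \<in> V}"
      using V by (simp add: continuous_map)
    moreover have "openin (top_of_set (?S \<times> {0..1::real})) (O1 \<times> {0..1})"
      using openin_Times[OF O1, of "{0..1}" "{0..1::real}"] by simp
    ultimately have "openin (top_of_set (?S \<times> {0..1})) {z \<in> O1 \<times> {0..1}. cell_pt C n \<sigma> (?g z) \<in> V}"
      using openin_trans by blast
    then have "openin (prod_topology (top_of_set ?S) ?I) {z \<in> O1 \<times> {0..1}. cell_pt C n \<sigma> (?g z) \<in> V}"
      by simp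
    moreover have "(t, r) \<in> {z \<in> O1 \<times> {0..1}. cell_pt C n \<sigma> (?g z) \<in> V}"
      using c[of t r] inV r t i by (auto simp: O1_def heavy_def)
    ultimately obtain A B where AB: "openin (top_of_set ?S) A" "openin ?I B" "t \<in> A" "r \<in> B"
      "A \<times> B \<subseteq> {z \<in> O1 \<times> {0..1}. cell_pt C n \<sigma> (?g z) \<in> V}"
      unfolding openin_prod_topology_alt by meson
    have "openin (cells C) ({(n, \<sigma>)} \<times> A)"
      unfolding cells_def openin_sum_topology
    proof (intro conjI ballI)
      show "{(n, \<sigma>)} \<times> A \<subseteq> Sigma (SIGMA n:UNIV. nerve C n)
         (topspace \<circ> (\<lambda>(n, \<sigma>). subtopology (powertop_real UNIV) (standard_simplex n)))"
        using openin_subset[OF AB(1)] \<sigma> by auto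
      fix k assume "k \<in> (SIGMA n:UNIV. nerve C n)"
      have "{x. (k, x) \<in> {(n, \<sigma>)} \<times> A} = (if k = (n, \<sigma>) then A else {})" by auto
      then show "openin (case k of (n, \<sigma>) \<Rightarrow> subtopology (powertop_real UNIV) (standard_simplex n)) {x. (k, x) \<in> {(n, \<sigma>)} \<times> A}"
        using AB(1) by (auto simp: euclidean_product_topology)
    qed
    moreover have "({(n, \<sigma>)} \<times> A) \<times> B \<subseteq> ?M"
    proof
      fix w assume "w \<in> ({(n, \<sigma>)} \<times> A) \<times> B"
      then obtain t' r' where w: "w = (((n, \<sigma>), t'), r')" "(t', r') \<in> A \<times> B" by auto
      then have "t' \<in> O1" "r' \<in> {0..1}" "cell_pt C n \<sigma> (?g (t', r')) \<in> V" using AB(5) by auto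
      moreover from this have "t' \<in> ?S" by (simp add: O1_def)
      moreover have "cell_pt C n \<sigma> t' \<in> chart_at \<kappa> x"
        using in_chart_at_iff[OF \<sigma> \<open>t' \<in> ?S\<close>] hv[OF \<open>t' \<in> O1\<close>] i(2) by blast
      ultimately show "w \<in> ?M"
        using c \<sigma> by (auto simp: w(1) cells_def)
    qed
    ultimately show "\<exists>U W. openin (cells C) U \<and> openin ?I W \<and> z \<in> U \<and> r \<in> W \<and> U \<times> W \<subseteq> ?M"
      using AB(2,3,4) z by (intro exI[of _ "{(n, \<sigma>)} \<times> A"] exI[of _ B]) auto
  qed
  ultimately show ?thesis
    unfolding quotient_map_def by blast
qed

lemma contraction_0:
  assumes "\<kappa> \<in> distortions" "q \<in> chart_at \<kappa> x"
  shows "contraction \<kappa> q 0 = q"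
  using assms contraction_eq[OF assms(1)] by (auto simp: chart_at_def line_def segment_def)

lemma contraction_1:
  assumes "\<kappa> \<in> distortions" "q \<in> chart_at \<kappa> x"
  shows "contraction \<kappa> q 1 = vertex C x"
proof -
  obtain n \<sigma> t i where q: "\<sigma> \<in> nerve C n" "t \<in> standard_simplex n" "heavy \<kappa> n \<sigma> t i"
    "nerve_ob C \<sigma> i = x" "q = cell_pt C n \<sigma> t"
    using assms(2) by (auto simp: chart_at_def)
  have "cell_pt C n \<sigma> (focus \<kappa> n \<sigma> t) = vertex C x"
    using cell_pt_heavy_support[OF q(1,2) assms(1) q(3) focus_in[OF q(1,2) assms(1) q(3)] focus_nonzero] q(4)
    by simp
  then show ?thesis
    using contraction_eq[OF assms(1) _ q(1-3), of 1] q(5) by (simp add: line_def segment_def)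
qed

text \<open>The segment from the focus to the corner \<open>i\<close> carries weight on heavy vertices only, so that it is constant
  in the realization; with it, the contraction becomes the other two sides of a triangle in the simplex.\<close>

lemma contraction_homotopic_line:
  assumes \<kappa>: "\<kappa> \<in> distortions" and \<sigma>: "\<sigma> \<in> nerve C n" and t: "t \<in> standard_simplex n" and i: "heavy \<kappa> n \<sigma> t i"
  shows "path_homotopic (realization C) (cell_pt C n \<sigma> t) (vertex C (nerve_ob C \<sigma> i))
    (contraction \<kappa> (cell_pt C n \<sigma> t)) (line C n \<sigma> t (corner i))"
proof -
  let ?X = "realization C" and ?w = "vertex C (nerve_ob C \<sigma> i)" and ?u = "focus \<kappa> n \<sigma> t"
  have i': "i \<le> n" using i by (simp add: heavy_def)
  note u = focus_in[OF \<sigma> t \<kappa> i]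
  have e: "corner i \<in> standard_simplex n" using i' by simp
  have uw: "cell_pt C n \<sigma> ?u = ?w" by (rule cell_pt_heavy_support[OF \<sigma> t \<kappa> i u focus_nonzero])
  note ew = cell_pt_corner[OF \<sigma> i']
  have l: "path_between ?X (cell_pt C n \<sigma> t) ?w (line C n \<sigma> t ?u)"
    using path_between_line[OF \<sigma> t u] uw by simp
  have "path_homotopic ?X (cell_pt C n \<sigma> t) ?w (contraction \<kappa> (cell_pt C n \<sigma> t)) (line C n \<sigma> t ?u)"
    by (rule path_homotopic_sym, rule path_homotopic_eq[OF l]) (use contraction_eq[OF \<kappa> _ \<sigma> t i] in auto)
  also have "path_homotopic ?X (cell_pt C n \<sigma> t) ?w \<dots> (path_join (line C n \<sigma> t ?u) (\<lambda>_. ?w))"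
    by (rule path_homotopic_sym[OF path_homotopic_join_const[OF l]])
  also have "path_homotopic ?X (cell_pt C n \<sigma> t) ?w \<dots> (path_join (line C n \<sigma> t ?u) (line C n \<sigma> ?u (corner i)))"
  proof (rule path_homotopic_join)
    show "path_homotopic ?X (cell_pt C n \<sigma> t) ?w (line C n \<sigma> t ?u) (line C n \<sigma> t ?u)"
      using l by (simp add: path_homotopic_refl)
    show "path_homotopic ?X ?w ?w (\<lambda>_. ?w) (line C n \<sigma> ?u (corner i))"
    proof (rule path_homotopic_eq[OF path_between_const])
      show "?w \<in> topspace ?X" using nerve_Ident(2)[OF \<sigma> i'] by (rule vertex_in_topspace)
      fix r :: real assume r: "r \<in> {0..1}"
      have "cell_pt C n \<sigma> (segment ?u (corner i) r) = ?w"
      proof (rule cell_pt_heavy_support[OF \<sigma> t \<kappa> i])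
        show "segment ?u (corner i) r \<in> standard_simplex n" using segment_in[OF u e] r by auto
        show "heavy \<kappa> n \<sigma> t j" if "segment ?u (corner i) r j \<noteq> 0" for j
          using that i focus_nonzero[of \<kappa> n \<sigma> t j] by (cases "j = i") (auto simp: segment_def)
      qed
      then show "?w = line C n \<sigma> ?u (corner i) r" by (simp add: line_def)
    qed
  qed
  also have "path_homotopic ?X (cell_pt C n \<sigma> t) ?w \<dots> (line C n \<sigma> t (corner i))"
    using line_join[OF \<sigma> t u e] ew by simp
  finally show ?thesis .
qed

end

text \<open>Each path runs along one half of the boundary of the square; the square is convex.\<close>

lemma square_homotopy:
  fixes h :: "real \<times> real \<Rightarrow> 'x"
  assumes "continuous_map (top_of_set ({0..1} \<times> {0..1})) X h"
  shows "path_homotopic X (h (0, 0)) (h (1, 1))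
    (path_join (\<lambda>s. h (s, 0)) (\<lambda>r. h (1, r))) (path_join (\<lambda>r. h (0, r)) (\<lambda>s. h (s, 1)))"
proof (rule path_homotopicI)
  let ?a = "\<lambda>x::real. min 1 (2 * x)" and ?b = "\<lambda>x::real. max 0 (2 * x - 1)"
  let ?u = "\<lambda>z. (1 - fst z) * ?a (snd z) + fst z * ?b (snd z)"
  let ?v = "\<lambda>z. (1 - fst z) * ?b (snd z) + fst z * ?a (snd z)"
  show "continuous_map (top_of_set ({0..1} \<times> {0..1})) X (\<lambda>z. h (?u z, ?v z))"
  proof (rule continuous_map_top_of_set_compose[OF assms])
    have mix: "(1 - s) * x + s * y \<in> {0..1}" if "s \<in> {0..1}" "x \<in> {0..1}" "y \<in> {0..1}" for s x y :: real
      using that convex_bound_le[of x 1 y "1 - s" s] by auto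
    show "(\<lambda>z. (?u z, ?v z)) \<in> {0..1} \<times> {0..1} \<rightarrow> {0..1} \<times> {0..1}"
    proof
      fix z :: "real \<times> real" assume z: "z \<in> {0..1} \<times> {0..1}"
      then have "?a (snd z) \<in> {0..1}" "?b (snd z) \<in> {0..1}" "fst z \<in> {0..1}" by auto
      then show "(?u z, ?v z) \<in> {0..1} \<times> {0..1}" using mix by blast
    qed
  qed (intro continuous_intros)
  fix t :: real
  show "h (?u (0, t), ?v (0, t)) = path_join (\<lambda>s. h (s, 0)) (\<lambda>r. h (1, r)) t"
    "h (?u (1, t), ?v (1, t)) = path_join (\<lambda>r. h (0, r)) (\<lambda>s. h (s, 1)) t"
    by (cases "t \<le> 1/2"; simp add: path_join_def)+
qed simp_all

section \<open>Edges generate the fundamental group\<close>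

context small_category
begin

text \<open>The paths \<open>c x\<close> take the place of a maximal tree. Any subgroup \<open>H\<close> that contains the loops
  completing the edges along this tree turns out to be the whole fundamental group.\<close>

context
  fixes x0 :: 'o and c :: "'o \<Rightarrow> real \<Rightarrow> 'm cell_point set" and H
  assumes x0: "x0 \<in> Ob C"
    and c: "\<And>x. x \<in> Ob C \<Longrightarrow> path_between (realization C) (vertex C x0) (vertex C x) (c x)"
    and c0: "path_homotopic (realization C) (vertex C x0) (vertex C x0) (c x0) (\<lambda>_. vertex C x0)"
    and H: "subgroup H (fundamental_group (realization C) (vertex C x0))"
    and edges: "\<And>f x y. f \<in> Mor C x y \<Longrightarrow>
      connect (realization C) (vertex C x0) (c x) (edge_path C f) (c y) \<in> H"
begin

abbreviation (input) "RX \<equiv> realization C"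
abbreviation (input) "v0 \<equiv> vertex C x0"
abbreviation (input) "PG \<equiv> fundamental_group RX v0"

text \<open>The condition to be carried along a loop: the path \<open>\<beta>\<close>, continued within a simplex to its \<open>i\<close>-th vertex
  and then back along the tree, has its class in \<open>H\<close>.\<close>

definition reaches :: "(real \<Rightarrow> 'm cell_point set) \<Rightarrow> nat \<Rightarrow> (nat \<Rightarrow> nat \<Rightarrow> 'm) \<Rightarrow> (nat \<Rightarrow> real) \<Rightarrow> nat \<Rightarrow> bool" where
  "reaches \<beta> n \<sigma> t i \<longleftrightarrow> connect RX v0 \<beta> (line C n \<sigma> t (corner i)) (c (nerve_ob C \<sigma> i)) \<in> H"

lemma PG_group: "group PG"
  by (rule group_fundamental_group[OF vertex_in_topspace[OF x0]])

lemma line_to_corner: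
  assumes "\<sigma> \<in> nerve C n" "t \<in> standard_simplex n" "i \<le> n"
  shows "path_between RX (cell_pt C n \<sigma> t) (vertex C (nerve_ob C \<sigma> i)) (line C n \<sigma> t (corner i))"
  using path_between_line[OF assms(1,2), of "corner i"] cell_pt_corner[OF assms(1,3)] assms(3) by simp

text \<open>The loops that belong to \<open>i\<close> and \<open>j\<close> differ by the loop of the edge \<open>\<sigma> i j\<close>.\<close>

lemma reaches_iff_le:
  assumes \<beta>: "path_between RX v0 (cell_pt C n \<sigma> t) \<beta>" and \<sigma>: "\<sigma> \<in> nerve C n" and t: "t \<in> standard_simplex n"
    and ij: "i \<le> j" "j \<le> n"
  shows "reaches \<beta> n \<sigma> t i \<longleftrightarrow> reaches \<beta> n \<sigma> t j"
proof -
  have i: "i \<le> n" using ij by simp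
  interpret group PG by (rule PG_group)
  interpret H: subgroup H PG by (rule H)
  let ?ci = "c (nerve_ob C \<sigma> i)" and ?cj = "c (nerve_ob C \<sigma> j)" and ?e = "line C n \<sigma> (corner i) (corner j)"
  note pi = c[OF nerve_Ident(2)[OF \<sigma> i]] and pj = c[OF nerve_Ident(2)[OF \<sigma> ij(2)]]
  note li = line_to_corner[OF \<sigma> t i] and lj = line_to_corner[OF \<sigma> t ij(2)]
  note he = line_eq_edge[OF \<sigma> ij]
  have eH: "connect RX v0 ?ci ?e ?cj \<in> H"
    using connect_cong[OF _ he] edges[OF nerve_Mor[OF \<sigma> ij]] pi pj by (metis path_homotopic_refl)
  have "connect RX v0 \<beta> (line C n \<sigma> t (corner j)) ?cj =
      connect RX v0 \<beta> (path_join (line C n \<sigma> t (corner i)) ?e) ?cj"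
  proof (rule connect_cong)
    show "path_homotopic RX (cell_pt C n \<sigma> t) (vertex C (nerve_ob C \<sigma> j)) (line C n \<sigma> t (corner j))
        (path_join (line C n \<sigma> t (corner i)) ?e)"
      using path_homotopic_sym[OF line_join[OF \<sigma> t, of "corner i" "corner j"]] i ij(2) cell_pt_corner[OF \<sigma> ij(2)] by simp
  qed (use \<beta> pj in \<open>simp_all add: path_homotopic_refl\<close>)
  also have "\<dots> = connect RX v0 ?ci ?e ?cj \<otimes>\<^bsub>PG\<^esub> connect RX v0 \<beta> (line C n \<sigma> t (corner i)) ?ci"
    using connect_mult[OF \<beta> li pi _ pj] path_homotopic_imp_path[OF he] by simp
  finally have eq: "connect RX v0 \<beta> (line C n \<sigma> t (corner j)) ?cj = \<dots>" .
  have ic: "connect RX v0 \<beta> (line C n \<sigma> t (corner i)) ?ci \<in> carrier PG"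
    by (rule connect_in_carrier[OF \<beta> li pi])
  show ?thesis
  proof
    assume "reaches \<beta> n \<sigma> t i"
    then show "reaches \<beta> n \<sigma> t j" using eq eH by (simp add: reaches_def)
  next
    assume "reaches \<beta> n \<sigma> t j"
    then have "inv\<^bsub>PG\<^esub> (connect RX v0 ?ci ?e ?cj) \<otimes>\<^bsub>PG\<^esub>
       (connect RX v0 ?ci ?e ?cj \<otimes>\<^bsub>PG\<^esub> connect RX v0 \<beta> (line C n \<sigma> t (corner i)) ?ci) \<in> H"
      using eq eH by (simp add: reaches_def)
    then show "reaches \<beta> n \<sigma> t i"
      using eH ic by (simp add: reaches_def flip: m_assoc)
  qed
qed

text \<open>As the vertex does not matter, the condition is invariant under the elementary identifications of cell
  points, hence depends only on the point of the realization.\<close>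

lemma reaches_rep:
  assumes \<beta>: "path_between RX v0 (cell_pt C n \<sigma> t) \<beta>" and eq: "cell_pt C n \<sigma> t = cell_pt C n' \<sigma>' t'"
    and \<sigma>: "\<sigma> \<in> nerve C n" "\<sigma>' \<in> nerve C n'" and t: "t \<in> standard_simplex n" "t' \<in> standard_simplex n'"
    and i: "i \<le> n" "i' \<le> n'" "reaches \<beta> n \<sigma> t i"
  shows "reaches \<beta> n' \<sigma>' t' i'"
proof -
  define q where "q = cell_pt C n \<sigma> t"
  define R where "R n \<sigma> t \<longleftrightarrow> cell_pt C n \<sigma> t = q \<and> (\<exists>i\<le>n. reaches \<beta> n \<sigma> t i)" for n \<sigma> t
  have all: "reaches \<beta> n \<sigma> t j"
    if "cell_pt C n \<sigma> t = q" "\<sigma> \<in> nerve C n" "t \<in> standard_simplex n" "i \<le> n" "j \<le> n" "reaches \<beta> n \<sigma> t i"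
    for n \<sigma> t i j
  proof -
    have "path_between RX v0 (cell_pt C n \<sigma> t) \<beta>" using \<beta> that(1) by (simp add: q_def)
    from reaches_iff_le[OF this that(2,3)] show ?thesis using that(4-6) by (metis nat_le_linear)
  qed
  have "R n \<sigma> t \<longleftrightarrow> R n' \<sigma>' t'"
  proof (rule cell_pt_invariant[OF eq])
    fix m n :: nat and \<theta> \<sigma> t
    assume a: "\<sigma> \<in> nerve C n" "t \<in> standard_simplex m" "\<theta> \<in> {..m} \<rightarrow> {..n}" "mono_on {..m} \<theta>"
    note g = cell_pt_glue[OF a] and p = simplex_push_in[OF a(2,3)] and nm = nerve_map_in[OF a(1,3,4)]
    have eqr: "reaches \<beta> m (nerve_map m \<theta> \<sigma>) t i \<longleftrightarrow> reaches \<beta> n \<sigma> (simplex_push m \<theta> t) (\<theta> i)"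
      if i: "i \<le> m" and q: "cell_pt C n \<sigma> (simplex_push m \<theta> t) = q" for i
    proof -
      have \<theta>i: "\<theta> i \<le> n" using a(3) i by auto
      have "simplex_push m \<theta> (corner i) = corner (\<theta> i)"
        using i by (auto simp: simplex_push_def fun_eq_iff)
      then have A: "line C m (nerve_map m \<theta> \<sigma>) t (corner i) r = line C n \<sigma> (simplex_push m \<theta> t) (corner (\<theta> i)) r"
        if "r \<in> {0..1}" for r
        using line_nerve_map[OF a(1,3,4,2) _ that, of "corner i"] i by simp
      have B: "path_between RX (cell_pt C m (nerve_map m \<theta> \<sigma>) t) (vertex C (nerve_ob C \<sigma> (\<theta> i)))
          (line C m (nerve_map m \<theta> \<sigma>) t (corner i))"
        using line_to_corner[OF nm a(2) i] nerve_ob_map[OF i] by simp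
      have "path_homotopic RX q (vertex C (nerve_ob C \<sigma> (\<theta> i)))
         (line C m (nerve_map m \<theta> \<sigma>) t (corner i)) (line C n \<sigma> (simplex_push m \<theta> t) (corner (\<theta> i)))"
        using path_homotopic_eq[OF B A] by (simp only: g q)
      then have "connect RX v0 \<beta> (line C m (nerve_map m \<theta> \<sigma>) t (corner i)) (c (nerve_ob C \<sigma> (\<theta> i))) =
         connect RX v0 \<beta> (line C n \<sigma> (simplex_push m \<theta> t) (corner (\<theta> i))) (c (nerve_ob C \<sigma> (\<theta> i)))"
        by (rule connect_cong[rotated]) (use \<beta> c[OF nerve_Ident(2)[OF a(1) \<theta>i]] in \<open>simp_all add: q_def path_homotopic_refl\<close>)
      then show ?thesis by (simp add: reaches_def nerve_ob_map[OF i])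
    qed
    show "R m (nerve_map m \<theta> \<sigma>) t \<longleftrightarrow> R n \<sigma> (simplex_push m \<theta> t)"
    proof
      assume "R m (nerve_map m \<theta> \<sigma>) t"
      then obtain i where i: "i \<le> m" "reaches \<beta> m (nerve_map m \<theta> \<sigma>) t i" and q: "cell_pt C n \<sigma> (simplex_push m \<theta> t) = q"
        using g by (auto simp: R_def)
      moreover have "\<theta> i \<le> n" using a(3) i by auto
      ultimately show "R n \<sigma> (simplex_push m \<theta> t)" using eqr[OF i(1) q] unfolding R_def by blast
    next
      assume r: "R n \<sigma> (simplex_push m \<theta> t)"
      then have q: "cell_pt C n \<sigma> (simplex_push m \<theta> t) = q" by (simp add: R_def)
      have "\<theta> 0 \<le> n" using a(3) by auto
      then have "reaches \<beta> n \<sigma> (simplex_push m \<theta> t) (\<theta> 0)"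
        using r all[OF q a(1) p] by (auto simp: R_def)
      then show "R m (nerve_map m \<theta> \<sigma>) t" using eqr[OF _ q, of 0] g q by (auto simp: R_def)
    qed
  qed
  then have "R n' \<sigma>' t'" using i by (auto simp: R_def q_def)
  then obtain l where "cell_pt C n' \<sigma>' t' = q" "l \<le> n'" "reaches \<beta> n' \<sigma>' t' l" unfolding R_def by blast
  then show ?thesis using all[OF _ \<sigma>(2) t(2) _ i(2)] by blast
qed

text \<open>The contraction of the chart, applied to the points of \<open>\<delta>\<close>, gives a square. Two of its sides are homotopic to
  lines to heavy vertices, and the one opposite to \<open>\<delta>\<close> is constant.\<close>

lemma reaches_along_chart:
  assumes \<kappa>: "\<kappa> \<in> distortions" and \<beta>: "path_between RX v0 a \<beta>" and \<delta>: "path_between RX a b \<delta>"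
    and ch: "\<And>s. s \<in> {0..1} \<Longrightarrow> \<delta> s \<in> chart_at \<kappa> x"
    and a: "\<sigma> \<in> nerve C n" "t \<in> standard_simplex n" "a = cell_pt C n \<sigma> t" "i \<le> n" "reaches \<beta> n \<sigma> t i"
  obtains n' \<sigma>' t' i' where "\<sigma>' \<in> nerve C n'" "t' \<in> standard_simplex n'" "b = cell_pt C n' \<sigma>' t'" "i' \<le> n'"
    "reaches (path_join \<beta> \<delta>) n' \<sigma>' t' i'"
proof -
  have ends: "\<delta> 0 = a" "\<delta> 1 = b" using \<delta> by (auto simp: path_between_def)
  obtain j where j: "heavy \<kappa> n \<sigma> t j" "nerve_ob C \<sigma> j = x"
    using in_chart_at_iff[OF a(1,2)] ch[of 0] ends a(3) by auto
  obtain n' \<sigma>' t' k where b: "\<sigma>' \<in> nerve C n'" "t' \<in> standard_simplex n'" "b = cell_pt C n' \<sigma>' t'"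
    and k: "heavy \<kappa> n' \<sigma>' t' k" "nerve_ob C \<sigma>' k = x"
    using ch[of 1] ends by (auto simp: chart_at_def)
  have jk: "j \<le> n" "k \<le> n'" using j k by (auto simp: heavy_def)
  have x: "x \<in> Ob C" using nerve_Ident(2)[OF a(1) jk(1)] j by simp
  define h where "h z = contraction \<kappa> (\<delta> (fst z)) (snd z)" for z
  have hc: "continuous_map (top_of_set ({0..1} \<times> {0..1})) RX h"
    unfolding continuous_map_def
  proof (intro conjI allI impI)
    have dc: "continuous_map (top_of_set ({0..1} \<times> {0..1})) (prod_topology RX (top_of_set {0..1})) (\<lambda>z. (\<delta> (fst z), snd z))"
    proof (rule continuous_map_pairedI)
      have "continuous_map (top_of_set {0..1}) RX \<delta>" using \<delta> by (simp add: path_between_def pathin_def)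
      then show "continuous_map (top_of_set ({0..1} \<times> {0..1})) RX (\<lambda>z. \<delta> (fst z))"
        by (rule continuous_map_top_of_set_compose) (auto intro: continuous_on_fst continuous_on_id)
    qed (auto intro: continuous_on_snd continuous_on_id)
    show pre: "openin (top_of_set ({0..1} \<times> {0..1})) {z \<in> topspace (top_of_set ({0..1} \<times> {0..1})). h z \<in> V}"
      if "openin RX V" for V
    proof -
      have "{z \<in> topspace (top_of_set ({0..1} \<times> {0..1})). h z \<in> V} =
         {z \<in> topspace (top_of_set ({0..1} \<times> {0..1})). (\<delta> (fst z), snd z) \<in>
            {z. fst z \<in> chart_at \<kappa> x \<and> snd z \<in> {0..1} \<and> contraction \<kappa> (fst z) (snd z) \<in> V}}"
        using ch by (auto simp: h_def)
      then show ?thesis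
        using openin_continuous_map_preimage[OF dc contraction_continuous[OF \<kappa> that, of x]] by simp
    qed
    show "h \<in> topspace (top_of_set ({0..1} \<times> {0..1})) \<rightarrow> topspace RX"
    proof
      fix z :: "real \<times> real" assume z: "z \<in> topspace (top_of_set ({0..1} \<times> {0..1}))"
      then obtain n \<sigma> t i where q: "\<sigma> \<in> nerve C n" "t \<in> standard_simplex n" "heavy \<kappa> n \<sigma> t i" "\<delta> (fst z) = cell_pt C n \<sigma> t"
        using ch[of "fst z"] by (auto simp: chart_at_def)
      then show "h z \<in> topspace RX"
        using contraction_eq[OF \<kappa> _ q(1-3), of "snd z"] z segment_in[OF q(2) focus_in[OF q(1,2) \<kappa> q(3)]]
        by (auto simp: h_def line_def)
    qed
  qed
  let ?w = "vertex C x"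
  have hv: "h (s, 0) = \<delta> s" "h (s, 1) = ?w" if "s \<in> {0..1}" for s
    using contraction_0[OF \<kappa> ch[OF that]] contraction_1[OF \<kappa> ch[OF that]] by (auto simp: h_def)
  have la: "path_homotopic RX a ?w (\<lambda>r. h (0, r)) (line C n \<sigma> t (corner j))"
    using contraction_homotopic_line[OF \<kappa> a(1,2) j(1)] j(2) a(3) ends by (simp add: h_def)
  have lb: "path_homotopic RX b ?w (\<lambda>r. h (1, r)) (line C n' \<sigma>' t' (corner k))"
    using contraction_homotopic_line[OF \<kappa> b(1,2) k(1)] k(2) b(3) ends by (simp add: h_def)
  have d1: "path_homotopic RX a b \<delta> (\<lambda>s. h (s, 0))"
    by (rule path_homotopic_eq[OF \<delta>]) (simp add: hv)
  have d2: "path_homotopic RX ?w ?w (\<lambda>s. h (s, 1)) (\<lambda>_. ?w)"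
    by (rule path_homotopic_sym, rule path_homotopic_eq[OF path_between_const[OF vertex_in_topspace[OF x]]]) (simp add: hv)
  have "path_homotopic RX a ?w (path_join \<delta> (line C n' \<sigma>' t' (corner k))) (path_join (\<lambda>s. h (s, 0)) (\<lambda>r. h (1, r)))"
    by (rule path_homotopic_join[OF d1 path_homotopic_sym[OF lb]])
  also have "path_homotopic RX a ?w \<dots> (path_join (\<lambda>r. h (0, r)) (\<lambda>s. h (s, 1)))"
    using square_homotopy[OF hc] hv ends by simp
  also have "path_homotopic RX a ?w \<dots> (path_join (line C n \<sigma> t (corner j)) (\<lambda>_. ?w))"
    by (rule path_homotopic_join[OF la d2])
  also have "path_homotopic RX a ?w \<dots> (line C n \<sigma> t (corner j))"
    by (rule path_homotopic_join_const[OF path_homotopic_imp_path[OF la, THEN conjunct2]])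
  finally have move: "path_homotopic RX a ?w (path_join \<delta> (line C n' \<sigma>' t' (corner k))) (line C n \<sigma> t (corner j))" .
  have lb': "path_between RX b ?w (line C n' \<sigma>' t' (corner k))" using path_homotopic_imp_path[OF lb] by blast
  have "connect RX v0 (path_join \<beta> \<delta>) (line C n' \<sigma>' t' (corner k)) (c x) =
      connect RX v0 \<beta> (path_join \<delta> (line C n' \<sigma>' t' (corner k))) (c x)"
    by (rule connect_assoc[OF \<beta> \<delta> lb' c[OF x]])
  also have "\<dots> = connect RX v0 \<beta> (line C n \<sigma> t (corner j)) (c x)"
    by (rule connect_cong[OF _ move]) (use \<beta> c[OF x] in \<open>simp_all add: path_homotopic_refl\<close>)
  also have "\<dots> \<in> H"
    using reaches_rep[OF _ refl a(1,1,2,2,4) jk(1) a(5)] \<beta> a(3) j(2) by (simp add: reaches_def)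
  finally have "reaches (path_join \<beta> \<delta>) n' \<sigma>' t' k" by (simp add: reaches_def k(2))
  then show ?thesis using that[OF b jk(2)] by blast
qed

text \<open>By bisection, a loop is cut into pieces that stay in one chart each, and the condition is carried from piece
  to piece.\<close>

theorem fundamental_group_generated_by_edges: "H = carrier PG"
proof
  interpret group PG by (rule PG_group)
  interpret H: subgroup H PG by (rule H)
  show "H \<subseteq> carrier PG" by (rule H.subset)
  show "carrier PG \<subseteq> H"
  proof
    fix A assume "A \<in> carrier PG"
    then obtain \<gamma> where \<gamma>: "path_between RX v0 v0 \<gamma>" "A = loop_class RX v0 \<gamma>"
      by (auto simp: carrier_fundamental_group)
    have g: "continuous_map (top_of_set {0..1}) RX \<gamma>" "\<gamma> 0 = v0" "\<gamma> 1 = v0"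
      using \<gamma>(1) by (auto simp: path_between_def pathin_def)
    define piece where "piece a b = (\<lambda>s::real. \<gamma> (a + (b - a) * s))" for a b
    have mix: "a + (b - a) * s \<in> {a..b}" if "a \<le> b" "s \<in> {0..1}" for a b s :: real
      using that mult_left_le[of s "b - a"] mult_nonneg_nonneg[of "b - a" s] by auto
    have piece: "path_between RX (\<gamma> a) (\<gamma> b) (piece a b)" if "0 \<le> a" "a \<le> b" "b \<le> 1" for a b
      unfolding path_between_def pathin_def piece_def
    proof (intro conjI continuous_map_top_of_set_compose[OF g(1)] continuous_intros)
      show "(\<lambda>s. a + (b - a) * s) \<in> {0..1} \<rightarrow> {0..1}"
        using mix[OF that(2)] that(1,3) by fastforce
    qed auto
    have join: "path_homotopic RX v0 (\<gamma> b) (path_join (piece 0 a) (piece a b)) (piece 0 b)"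
      if ab: "0 \<le> a" "a \<le> b" "b \<le> 1" for a b
    proof -
      let ?u = "\<lambda>s. a * min 1 (2 * s) + (b - a) * max 0 (2 * s - 1)"
      have "path_homotopic RX (\<gamma> (?u 0)) (\<gamma> (?u 1)) (path_join (piece 0 a) (piece a b)) (piece 0 b)"
      proof (rule path_homotopic_reparam[OF \<gamma>(1), where v = "\<lambda>s. b * s"])
        have "?u s \<in> {0..1}" if "s \<in> {0..1}" for s
          using mix[OF ab(1), of "min 1 (2 * s)"] mix[OF ab(2), of "max 0 (2 * s - 1)"] that ab
          by (cases "s \<le> 1/2") (auto simp: min_def max_def)
        then show "?u \<in> {0..1} \<rightarrow> {0..1}" by blast
        show "(\<lambda>s. b * s) \<in> {0..1} \<rightarrow> {0..1}" using ab by (auto intro: mult_le_one)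
        show "path_join (piece 0 a) (piece a b) s = \<gamma> (?u s)" for s
          by (cases "s \<le> 1/2") (simp_all add: path_join_def piece_def)
      qed (auto simp: piece_def intro!: continuous_intros)
      then show ?thesis using g by simp
    qed
    define good where "good b \<longleftrightarrow> (\<exists>n \<sigma> t i. \<sigma> \<in> nerve C n \<and> t \<in> standard_simplex n \<and>
      \<gamma> b = cell_pt C n \<sigma> t \<and> i \<le> n \<and> reaches (piece 0 b) n \<sigma> t i)" for b
    have "0 \<le> (0::real) \<and> (1::real) \<le> 1 \<longrightarrow> good 0 \<longrightarrow> good 1"
    proof (rule Bolzano[of 0 1 "\<lambda>a b. 0 \<le> a \<and> b \<le> 1 \<longrightarrow> good a \<longrightarrow> good b"])
      fix x :: real assume x: "0 \<le> x" "x \<le> 1"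
      then have "\<gamma> x \<in> topspace RX" using g(1) by (auto simp: continuous_map)
      then obtain \<kappa> y where \<kappa>: "\<kappa> \<in> distortions" "\<gamma> x \<in> chart_at \<kappa> y" by (rule charts_cover)
      have "openin (top_of_set {0..1}) {s \<in> {0..1}. \<gamma> s \<in> chart_at \<kappa> y}"
        using g(1) chart_at_open[OF \<kappa>(1)] by (simp add: continuous_map)
      moreover have "x \<in> {s \<in> {0..1}. \<gamma> s \<in> chart_at \<kappa> y}" using x \<kappa>(2) by simp
      ultimately obtain d where d: "d > 0"
        "\<And>s. s \<in> {0..1} \<Longrightarrow> dist s x < d \<Longrightarrow> s \<in> {s \<in> {0..1}. \<gamma> s \<in> chart_at \<kappa> y}"
        using openin_euclidean_subtopology_iff[THEN iffD1] by meson
      have "good b" if ab: "a \<le> x" "x \<le> b" "b - a < d" "0 \<le> a" "b \<le> 1" and ga: "good a" for a b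
      proof -
        obtain n \<sigma> t i where a: "\<sigma> \<in> nerve C n" "t \<in> standard_simplex n" "\<gamma> a = cell_pt C n \<sigma> t" "i \<le> n"
          "reaches (piece 0 a) n \<sigma> t i" using ga unfolding good_def by blast
        have ch: "piece a b s \<in> chart_at \<kappa> y" if "s \<in> {0..1}" for s
        proof -
          have "a + (b - a) * s \<in> {a..b}" using mix that ab by auto
          then have "a + (b - a) * s \<in> {0..1}" "dist (a + (b - a) * s) x < d"
            using ab by (auto simp: dist_real_def)
          then show ?thesis using d(2) by (auto simp: piece_def)
        qed
        have p0: "path_between RX v0 (\<gamma> a) (piece 0 a)" using piece[of 0 a] ab g by simp
        have pab: "path_between RX (\<gamma> a) (\<gamma> b) (piece a b)" using piece[of a b] ab by simp
        obtain n' \<sigma>' t' i' where b: "\<sigma>' \<in> nerve C n'" "t' \<in> standard_simplex n'" "\<gamma> b = cell_pt C n' \<sigma>' t'" "i' \<le> n'"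
          "reaches (path_join (piece 0 a) (piece a b)) n' \<sigma>' t' i'"
          by (rule reaches_along_chart[OF \<kappa>(1) p0 pab ch a])
        have "connect RX v0 (path_join (piece 0 a) (piece a b)) (line C n' \<sigma>' t' (corner i')) (c (nerve_ob C \<sigma>' i')) =
           connect RX v0 (piece 0 b) (line C n' \<sigma>' t' (corner i')) (c (nerve_ob C \<sigma>' i'))"
        proof (rule connect_cong)
          show "path_homotopic RX v0 (\<gamma> b) (path_join (piece 0 a) (piece a b)) (piece 0 b)"
            using join ab by auto
        qed (use line_to_corner[OF b(1,2,4)] b(3) c[OF nerve_Ident(2)[OF b(1,4)]] in \<open>simp_all add: path_homotopic_refl\<close>)
        then have "reaches (piece 0 b) n' \<sigma>' t' i'" using b(5) by (simp add: reaches_def)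
        then show "good b" using b unfolding good_def by blast
      qed
      then show "\<exists>d>0. \<forall>a b. a \<le> x \<and> x \<le> b \<and> b - a < d \<longrightarrow> (0 \<le> a \<and> b \<le> 1 \<longrightarrow> good a \<longrightarrow> good b)"
        using d(1) by blast
    qed auto
    moreover
    have ps: "point_simplex x0 \<in> nerve C 0" "nerve_ob C (point_simplex x0) 0 = x0"
      using point_simplex_in[OF x0] Dom_Ident[OF x0] by (auto simp: point_simplex_def)
    have vp: "v0 = cell_pt C 0 (point_simplex x0) (corner 0)" by (rule vertex_eq)
    have c0': "connect RX v0 \<beta> (line C 0 (point_simplex x0) (corner 0) (corner 0)) (c x0) = loop_class RX v0 \<beta>"
      if "path_between RX v0 v0 \<beta>" for \<beta>
    proof -
      have v0X: "v0 \<in> topspace RX" by (rule vertex_in_topspace[OF x0])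
      have "line C 0 (point_simplex x0) (corner 0) (corner 0) = (\<lambda>_. v0)"
        by (auto simp: line_def segment_def vp fun_eq_iff intro!: arg_cong[where f = "cell_pt C 0 (point_simplex x0)"])
      then have "connect RX v0 \<beta> (line C 0 (point_simplex x0) (corner 0) (corner 0)) (c x0) =
         connect RX v0 \<beta> (\<lambda>_. v0) (\<lambda>_. v0)"
        using connect_cong[OF _ _ c0, of "v0" \<beta> \<beta> "\<lambda>_. v0" "\<lambda>_. v0"] that path_between_const[OF v0X]
        by (simp add: path_homotopic_refl)
      also have "\<dots> = connect RX v0 (path_join (\<lambda>_. v0) \<beta>) (\<lambda>_. v0) (\<lambda>_. v0)"
        by (rule connect_cong[OF path_homotopic_sym[OF path_homotopic_const_join[OF that]]])
          (use path_between_const[OF v0X] in \<open>simp_all add: path_homotopic_refl\<close>)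
      also have "\<dots> = connect RX v0 (\<lambda>_. v0) (path_join \<beta> (\<lambda>_. v0)) (\<lambda>_. v0)"
        by (rule connect_assoc[OF path_between_const[OF v0X] that path_between_const[OF v0X] path_between_const[OF v0X]])
      also have "\<dots> = connect RX v0 (\<lambda>_. v0) \<beta> (\<lambda>_. v0)"
        by (rule connect_cong[OF _ path_homotopic_join_const[OF that]])
          (use path_between_const[OF v0X] in \<open>simp_all add: path_homotopic_refl\<close>)
      also have "\<dots> = loop_class RX v0 \<beta>" by (rule connect_trivial_ends[OF that])
      finally show ?thesis .
    qed
    have "good 0"
    proof -
      have "piece 0 0 = (\<lambda>_. v0)" by (simp add: piece_def g)
      moreover have "loop_class RX v0 (\<lambda>_. v0) \<in> H" using H.one_closed by (simp add: one_fundamental_group)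
      ultimately have "reaches (piece 0 0) 0 (point_simplex x0) (corner 0) 0"
        using c0'[OF path_between_const[OF vertex_in_topspace[OF x0]]] by (simp add: reaches_def ps(2))
      then show ?thesis
        unfolding good_def using ps vp g(2) by (intro exI[of _ "0::nat"] exI[of _ "point_simplex x0"] exI[of _ "corner 0"]) auto
    qed
    ultimately have "good 1" by simp
    then obtain n \<sigma> t i where b: "\<sigma> \<in> nerve C n" "t \<in> standard_simplex n" "v0 = cell_pt C n \<sigma> t" "i \<le> n"
      "reaches (piece 0 1) n \<sigma> t i" unfolding good_def using g(3) by auto
    have "piece 0 1 = \<gamma>" by (simp add: piece_def)
    then have "reaches \<gamma> 0 (point_simplex x0) (corner 0) 0"
      using reaches_rep[OF _ _ b(1) ps(1) b(2) _ b(4) _ b(5)] \<gamma>(1) b(3) vp by simp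
    then show "A \<in> H"
      using c0'[OF \<gamma>(1)] \<gamma>(2) by (simp add: reaches_def ps(2))
  qed
qed

end

section \<open>Functors to groups\<close>

text \<open>Over a chart, the covering that belongs to a functor to a group is trivialized by the heavy
  vertices; two charts differ by the value of the functor on the arrow between heavy vertices.\<close>

definition atlas :: "(real \<Rightarrow> real) \<Rightarrow> 'm cell_point set set" where
  "atlas \<kappa> = (\<Union>x. chart_at \<kappa> x)"

lemma in_atlas_iff:
  "\<sigma> \<in> nerve C n \<Longrightarrow> t \<in> standard_simplex n \<Longrightarrow> cell_pt C n \<sigma> t \<in> atlas \<kappa> \<longleftrightarrow> (\<exists>i. heavy \<kappa> n \<sigma> t i)"
  by (auto simp: atlas_def in_chart_at_iff)

context
  fixes G :: "('g, 'h) monoid_scheme" and \<Theta> :: "'m \<Rightarrow> 'g"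
  assumes group_G: "group G"
    and \<Theta>_closed: "\<And>f x y. f \<in> Mor C x y \<Longrightarrow> \<Theta> f \<in> carrier G"
    and \<Theta>_Comp: "\<And>f g x y z. f \<in> Mor C x y \<Longrightarrow> g \<in> Mor C y z \<Longrightarrow> \<Theta> (Comp C g f) = \<Theta> g \<otimes>\<^bsub>G\<^esub> \<Theta> f"
begin

interpretation G: group G by (rule group_G)

lemma \<Theta>_Ident: "x \<in> Ob C \<Longrightarrow> \<Theta> (Ident C x) = \<one>\<^bsub>G\<^esub>"
  using \<Theta>_Comp[OF Ident_Mor Ident_Mor] \<Theta>_closed[OF Ident_Mor] Comp_Ident[OF Ident_Mor]
  by (metis G.r_cancel_one)

text \<open>The value of \<open>\<Theta>\<close> at the arrow from the \<open>i\<close>-th to the \<open>j\<close>-th vertex, also if \<open>j < i\<close> and this arrow has to be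
  inverted in the group. The detour over the vertex 0 makes a case distinction superfluous.\<close>

definition shift :: "(nat \<Rightarrow> nat \<Rightarrow> 'm) \<Rightarrow> nat \<Rightarrow> nat \<Rightarrow> 'g" where
  "shift \<sigma> i j = \<Theta> (\<sigma> 0 j) \<otimes>\<^bsub>G\<^esub> inv\<^bsub>G\<^esub> \<Theta> (\<sigma> 0 i)"

lemma \<Theta>_nerve_closed: "\<sigma> \<in> nerve C n \<Longrightarrow> i \<le> n \<Longrightarrow> \<Theta> (\<sigma> 0 i) \<in> carrier G"
  using nerve_Mor[of \<sigma> n 0 i] \<Theta>_closed by blast

lemma shift_closed: "\<sigma> \<in> nerve C n \<Longrightarrow> i \<le> n \<Longrightarrow> j \<le> n \<Longrightarrow> shift \<sigma> i j \<in> carrier G"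
  by (simp add: shift_def \<Theta>_nerve_closed)

lemma shift_compose:
  assumes "\<sigma> \<in> nerve C n" "i \<le> n" "j \<le> n" "k \<le> n"
  shows "shift \<sigma> j k \<otimes>\<^bsub>G\<^esub> shift \<sigma> i j = shift \<sigma> i k"
proof -
  note cl = \<Theta>_nerve_closed[OF assms(1)]
  have "inv\<^bsub>G\<^esub> \<Theta> (\<sigma> 0 j) \<otimes>\<^bsub>G\<^esub> (\<Theta> (\<sigma> 0 j) \<otimes>\<^bsub>G\<^esub> inv\<^bsub>G\<^esub> \<Theta> (\<sigma> 0 i)) = inv\<^bsub>G\<^esub> \<Theta> (\<sigma> 0 i)"
    using cl assms(2,3) by (simp flip: G.m_assoc)
  then show ?thesis
    using cl assms(2-4) by (simp add: shift_def G.m_assoc)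
qed

lemma shift_same:
  assumes \<sigma>: "\<sigma> \<in> nerve C n" and le: "i \<le> n" "j \<le> n" and same: "same \<sigma> i j"
  shows "\<Theta> (\<sigma> 0 i) = \<Theta> (\<sigma> 0 j)"
proof -
  have *: "\<Theta> (\<sigma> 0 i) = \<Theta> (\<sigma> 0 j)" if ij: "i \<le> j" "j \<le> n" and s: "same \<sigma> i j" for i j
  proof -
    have i: "i \<le> n" using ij by simp
    have "\<Theta> (\<sigma> 0 j) = \<Theta> (\<sigma> i j) \<otimes>\<^bsub>G\<^esub> \<Theta> (\<sigma> 0 i)"
      using nerve_Comp[OF \<sigma> le0 ij] \<Theta>_Comp[OF nerve_Mor[OF \<sigma> le0 i] nerve_Mor[OF \<sigma> ij]] by simp
    moreover have "\<sigma> i j = Ident C (nerve_ob C \<sigma> i)"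
      using s ij nerve_Ident(1)[OF \<sigma> i] by (simp add: same_def)
    ultimately show ?thesis
      using \<Theta>_Ident[OF nerve_Ident(2)[OF \<sigma> i]] \<Theta>_nerve_closed[OF \<sigma> i] by simp
  qed
  show ?thesis
  proof (cases "i \<le> j")
    case True
    then show ?thesis by (rule *[OF _ le(2) same])
  next
    case False
    then show ?thesis by (intro *[OF _ le(1) same_sym[OF \<sigma> le same], symmetric]) simp
  qed
qed

lemma shift_nerve_map:
  assumes \<sigma>: "\<sigma> \<in> nerve C n" and \<theta>: "\<theta> \<in> {..m} \<rightarrow> {..n}" and mono: "mono_on {..m} \<theta>" and ij: "i \<le> m" "j \<le> m"
  shows "shift (nerve_map m \<theta> \<sigma>) i j = shift \<sigma> (\<theta> i) (\<theta> j)"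
proof -
  have le: "\<theta> l \<le> n" if "l \<le> m" for l using \<theta> that by auto
  have *: "\<Theta> (nerve_map m \<theta> \<sigma> 0 l) = shift \<sigma> (\<theta> 0) (\<theta> l)" if "l \<le> m" for l
  proof -
    have l: "\<theta> 0 \<le> \<theta> l" by (rule mono_on_atMostD[OF mono]) (use that in auto)
    have "\<Theta> (\<sigma> 0 (\<theta> l)) = \<Theta> (\<sigma> (\<theta> 0) (\<theta> l)) \<otimes>\<^bsub>G\<^esub> \<Theta> (\<sigma> 0 (\<theta> 0))"
      using nerve_Comp[OF \<sigma> le0 l le[OF that]]
        \<Theta>_Comp[OF nerve_Mor[OF \<sigma> le0 le[of 0]] nerve_Mor[OF \<sigma> l le[OF that]]] by simp
    then show ?thesis
      using that \<Theta>_nerve_closed[OF \<sigma> le] \<Theta>_closed[OF nerve_Mor[OF \<sigma> l le[OF that]]]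
      by (simp add: shift_def nerve_map_def G.m_assoc)
  qed
  have "shift (nerve_map m \<theta> \<sigma>) i j = shift \<sigma> (\<theta> 0) (\<theta> j) \<otimes>\<^bsub>G\<^esub> inv\<^bsub>G\<^esub> shift \<sigma> (\<theta> 0) (\<theta> i)"
    unfolding shift_def[of "nerve_map m \<theta> \<sigma>"] using * ij by simp
  also have "inv\<^bsub>G\<^esub> shift \<sigma> (\<theta> 0) (\<theta> i) = shift \<sigma> (\<theta> i) (\<theta> 0)"
    using \<Theta>_nerve_closed[OF \<sigma> le] ij by (simp add: shift_def G.inv_mult_group)
  finally show ?thesis using shift_compose[OF \<sigma> le le le] ij by simp
qed

definition transition :: "(real \<Rightarrow> real) \<Rightarrow> (real \<Rightarrow> real) \<Rightarrow> 'm cell_point set \<Rightarrow> 'g" where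
  "transition \<kappa> \<kappa>' q = (SOME g. \<exists>n \<sigma> t i j. \<sigma> \<in> nerve C n \<and> t \<in> standard_simplex n \<and> q = cell_pt C n \<sigma> t \<and>
     heavy \<kappa> n \<sigma> t i \<and> heavy \<kappa>' n \<sigma> t j \<and> g = shift \<sigma> i j)"

lemma transition_eq:
  assumes \<kappa>: "\<kappa> \<in> distortions" "\<kappa>' \<in> distortions"
    and \<sigma>: "\<sigma> \<in> nerve C n" and t: "t \<in> standard_simplex n" and ij: "heavy \<kappa> n \<sigma> t i" "heavy \<kappa>' n \<sigma> t j"
  shows "transition \<kappa> \<kappa>' (cell_pt C n \<sigma> t) = shift \<sigma> i j"
proof -
  define g0 where "g0 = shift \<sigma> i j"
  define R where "R n \<sigma> t \<longleftrightarrow> (\<exists>i j. heavy \<kappa> n \<sigma> t i \<and> heavy \<kappa>' n \<sigma> t j \<and> shift \<sigma> i j = g0)" for n \<sigma> t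
  have uniq: "shift \<sigma> i j = shift \<sigma> i' j'"
    if "\<sigma> \<in> nerve C n" "t \<in> standard_simplex n" "heavy \<kappa> n \<sigma> t i" "heavy \<kappa> n \<sigma> t i'" "heavy \<kappa>' n \<sigma> t j" "heavy \<kappa>' n \<sigma> t j'"
    for n \<sigma> t i i' j j'
  proof -
    have "\<Theta> (\<sigma> 0 i) = \<Theta> (\<sigma> 0 i')" "\<Theta> (\<sigma> 0 j) = \<Theta> (\<sigma> 0 j')"
      using shift_same[OF that(1)] heavy_same[OF that(1,2)] \<kappa> that(3-6) by (auto simp: heavy_def)
    then show ?thesis by (simp add: shift_def)
  qed
  have inv: "R n' \<sigma>' t'" if "cell_pt C n \<sigma> t = cell_pt C n' \<sigma>' t'" for n' \<sigma>' t'
  proof -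
    have "R n \<sigma> t \<longleftrightarrow> R n' \<sigma>' t'"
    proof (rule cell_pt_invariant[OF that])
      fix m n :: nat and \<theta> \<sigma> t
      assume a: "\<sigma> \<in> nerve C n" "t \<in> standard_simplex m" "\<theta> \<in> {..m} \<rightarrow> {..n}" "mono_on {..m} \<theta>"
      show "R m (nerve_map m \<theta> \<sigma>) t \<longleftrightarrow> R n \<sigma> (simplex_push m \<theta> t)"
      proof
        assume "R m (nerve_map m \<theta> \<sigma>) t"
        then obtain i j where h: "heavy \<kappa> m (nerve_map m \<theta> \<sigma>) t i" "heavy \<kappa>' m (nerve_map m \<theta> \<sigma>) t j"
          "shift (nerve_map m \<theta> \<sigma>) i j = g0" by (auto simp: R_def)
        moreover have "i \<le> m" "j \<le> m" using h by (auto simp: heavy_def)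
        ultimately show "R n \<sigma> (simplex_push m \<theta> t)"
          unfolding R_def using heavy_nerve_map[OF a(4,3)] shift_nerve_map[OF a(1,3,4)] by metis
      next
        assume "R n \<sigma> (simplex_push m \<theta> t)"
        then obtain i j where h: "heavy \<kappa> n \<sigma> (simplex_push m \<theta> t) i" "heavy \<kappa>' n \<sigma> (simplex_push m \<theta> t) j"
          "shift \<sigma> i j = g0" by (auto simp: R_def)
        obtain k where k: "k \<le> m" "heavy \<kappa> m (nerve_map m \<theta> \<sigma>) t k" by (rule heavy_in_image[OF a(1,4,3) h(1)])
        obtain l where l: "l \<le> m" "heavy \<kappa>' m (nerve_map m \<theta> \<sigma>) t l" by (rule heavy_in_image[OF a(1,4,3) h(2)])
        have "shift \<sigma> (\<theta> k) (\<theta> l) = g0"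
          using uniq[OF a(1) simplex_push_in[OF a(2,3)] _ h(1) _ h(2)] heavy_nerve_map[OF a(4,3)] k l h(3) by metis
        then show "R m (nerve_map m \<theta> \<sigma>) t"
          unfolding R_def using shift_nerve_map[OF a(1,3,4) k(1) l(1)] k l by metis
      qed
    qed
    moreover have "R n \<sigma> t" using ij by (auto simp: R_def g0_def)
    ultimately show ?thesis by simp
  qed
  show ?thesis
    unfolding transition_def g0_def[symmetric]
  proof (rule some_equality)
    show "\<exists>n' \<sigma>' t' i j. \<sigma>' \<in> nerve C n' \<and> t' \<in> standard_simplex n' \<and> cell_pt C n \<sigma> t = cell_pt C n' \<sigma>' t' \<and>
        heavy \<kappa> n' \<sigma>' t' i \<and> heavy \<kappa>' n' \<sigma>' t' j \<and> g0 = shift \<sigma>' i j"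
      using \<sigma> t ij g0_def by blast
    fix g assume "\<exists>n' \<sigma>' t' i j. \<sigma>' \<in> nerve C n' \<and> t' \<in> standard_simplex n' \<and> cell_pt C n \<sigma> t = cell_pt C n' \<sigma>' t' \<and>
        heavy \<kappa> n' \<sigma>' t' i \<and> heavy \<kappa>' n' \<sigma>' t' j \<and> g = shift \<sigma>' i j"
    then obtain n' \<sigma>' t' i' j' where g: "\<sigma>' \<in> nerve C n'" "t' \<in> standard_simplex n'" "cell_pt C n \<sigma> t = cell_pt C n' \<sigma>' t'"
      "heavy \<kappa> n' \<sigma>' t' i'" "heavy \<kappa>' n' \<sigma>' t' j'" "g = shift \<sigma>' i' j'" by blast
    obtain k l where "heavy \<kappa> n' \<sigma>' t' k" "heavy \<kappa>' n' \<sigma>' t' l" "shift \<sigma>' k l = g0"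
      using inv[OF g(3)] by (auto simp: R_def)
    then show "g = g0" using uniq[OF g(1,2) g(4) _ g(5)] g(6) by metis
  qed
qed

lemma atlas_rep:
  assumes "q \<in> atlas \<kappa>"
  obtains n \<sigma> t i where "\<sigma> \<in> nerve C n" "t \<in> standard_simplex n" "q = cell_pt C n \<sigma> t" "heavy \<kappa> n \<sigma> t i"
  using assms by (auto simp: atlas_def chart_at_def)

lemma flat_cocycle_transition:
  assumes x0: "x0 \<in> Ob C"
  shows "flat_cocycle G (realization C) distortions atlas transition (vertex C x0)"
proof (unfold_locales)
  let ?X = "realization C"
  show "\<exists>\<kappa>\<in>distortions. q \<in> atlas \<kappa>" if "q \<in> topspace ?X" for q
    using charts_cover[OF that] by (metis UN_I UNIV_I atlas_def)
  show "openin ?X (atlas \<kappa>)" if "\<kappa> \<in> distortions" for \<kappa>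
    unfolding atlas_def using chart_at_open[OF that] by blast
  show "transition \<kappa> \<kappa>' q \<in> carrier G"
    if \<kappa>: "\<kappa> \<in> distortions" "\<kappa>' \<in> distortions" and q: "q \<in> atlas \<kappa>" "q \<in> atlas \<kappa>'" for \<kappa> \<kappa>' q
  proof -
    obtain n \<sigma> t i where r: "\<sigma> \<in> nerve C n" "t \<in> standard_simplex n" "q = cell_pt C n \<sigma> t" "heavy \<kappa> n \<sigma> t i"
      by (rule atlas_rep[OF q(1)])
    obtain j where j: "heavy \<kappa>' n \<sigma> t j" using q(2) in_atlas_iff[OF r(1,2)] r(3) by auto
    show ?thesis
      using transition_eq[OF \<kappa> r(1,2,4) j] shift_closed[OF r(1)] r(3,4) j by (simp add: heavy_def)
  qed
  show "transition \<kappa>' \<kappa>'' q \<otimes>\<^bsub>G\<^esub> transition \<kappa> \<kappa>' q = transition \<kappa> \<kappa>'' q"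
    if \<kappa>: "\<kappa> \<in> distortions" "\<kappa>' \<in> distortions" "\<kappa>'' \<in> distortions" and q: "q \<in> atlas \<kappa>" "q \<in> atlas \<kappa>'" "q \<in> atlas \<kappa>''"
    for \<kappa> \<kappa>' \<kappa>'' q
  proof -
    obtain n \<sigma> t i where r: "\<sigma> \<in> nerve C n" "t \<in> standard_simplex n" "q = cell_pt C n \<sigma> t" "heavy \<kappa> n \<sigma> t i"
      by (rule atlas_rep[OF q(1)])
    obtain j where j: "heavy \<kappa>' n \<sigma> t j" using q(2) in_atlas_iff[OF r(1,2)] r(3) by auto
    obtain k where k: "heavy \<kappa>'' n \<sigma> t k" using q(3) in_atlas_iff[OF r(1,2)] r(3) by auto
    have le: "i \<le> n" "j \<le> n" "k \<le> n" using r j k by (auto simp: heavy_def)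
    show ?thesis
      unfolding r(3) transition_eq[OF \<kappa>(1,2) r(1,2,4) j] transition_eq[OF \<kappa>(2,3) r(1,2) j k]
        transition_eq[OF \<kappa>(1,3) r(1,2,4) k] by (rule shift_compose[OF r(1) le])
  qed
  show "openin ?X {q \<in> atlas \<kappa> \<inter> atlas \<kappa>'. transition \<kappa> \<kappa>' q = g}"
    if \<kappa>: "\<kappa> \<in> distortions" "\<kappa>' \<in> distortions" for \<kappa> \<kappa>' g
    unfolding openin_realization
  proof (intro conjI allI ballI)
    show "{q \<in> atlas \<kappa> \<inter> atlas \<kappa>'. transition \<kappa> \<kappa>' q = g} \<subseteq> topspace ?X"
      by (auto simp: atlas_def chart_at_def)
    fix n \<sigma> assume \<sigma>: "\<sigma> \<in> nerve C n"
    let ?S = "standard_simplex n"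
    have "{t \<in> ?S. cell_pt C n \<sigma> t \<in> {q \<in> atlas \<kappa> \<inter> atlas \<kappa>'. transition \<kappa> \<kappa>' q = g}} =
      (\<Union>(i, j) \<in> {(i, j). i \<le> n \<and> j \<le> n \<and> shift \<sigma> i j = g}.
        {t \<in> ?S. mass \<kappa> n \<sigma> t i > 1/2} \<inter> {t \<in> ?S. mass \<kappa>' n \<sigma> t j > 1/2})" (is "?A = ?B")
    proof (intro equalityI subsetI)
      fix t assume t: "t \<in> ?A"
      then have tS: "t \<in> ?S" by simp
      obtain i j where h: "heavy \<kappa> n \<sigma> t i" "heavy \<kappa>' n \<sigma> t j"
        using t in_atlas_iff[OF \<sigma> tS] by auto
      then have "shift \<sigma> i j = g" using t transition_eq[OF \<kappa> \<sigma> tS h] by simp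
      then show "t \<in> ?B" using h tS by (auto simp: heavy_def intro!: bexI[of _ "(i, j)"])
    next
      fix t assume "t \<in> ?B"
      then obtain i j where h: "t \<in> ?S" "heavy \<kappa> n \<sigma> t i" "heavy \<kappa>' n \<sigma> t j" "shift \<sigma> i j = g"
        by (auto simp: heavy_def)
      then show "t \<in> ?A"
        using transition_eq[OF \<kappa> \<sigma> h(1-3)] in_atlas_iff[OF \<sigma> h(1)] by auto
    qed
    also have "openin (top_of_set ?S) ?B"
    proof (rule openin_Union)
      fix U assume "U \<in> (\<lambda>(i, j). {t \<in> ?S. mass \<kappa> n \<sigma> t i > 1/2} \<inter> {t \<in> ?S. mass \<kappa>' n \<sigma> t j > 1/2}) `
          {(i, j). i \<le> n \<and> j \<le> n \<and> shift \<sigma> i j = g}"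
      then obtain i j where "U = {t \<in> ?S. mass \<kappa> n \<sigma> t i > 1/2} \<inter> {t \<in> ?S. mass \<kappa>' n \<sigma> t j > 1/2}" by auto
      then show "openin (top_of_set ?S) U"
        using openin_Int[OF openin_mass[OF \<kappa>(1)] openin_mass[OF \<kappa>(2)]] by blast
    qed
    finally show "openin (top_of_set ?S) ?A" .
  qed
  show "vertex C x0 \<in> topspace ?X" by (rule vertex_in_topspace[OF x0])
  show "transition \<kappa> \<kappa>' (vertex C x0) = \<one>\<^bsub>G\<^esub>"
    if \<kappa>: "\<kappa> \<in> distortions" "\<kappa>' \<in> distortions" and q: "vertex C x0 \<in> atlas \<kappa>" "vertex C x0 \<in> atlas \<kappa>'" for \<kappa> \<kappa>'
  proof -
    note p = point_simplex_in[OF x0]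
    have e: "corner 0 \<in> standard_simplex 0" by simp
    obtain i j where h: "heavy \<kappa> 0 (point_simplex x0) (corner 0) i" "heavy \<kappa>' 0 (point_simplex x0) (corner 0) j"
      using q in_atlas_iff[OF p e] by (auto simp: vertex_eq)
    then have "i = 0" "j = 0" by (auto simp: heavy_def)
    then show ?thesis
      unfolding vertex_eq transition_eq[OF \<kappa> p e h]
      using \<Theta>_nerve_closed[OF p, of 0] by (simp add: shift_def)
  qed
qed

text \<open>The lift of the edge of \<open>f\<close> does not change its coordinate as long as it stays in one chart. The edge is covered by
  one chart that sees the first vertex as heavy and one that sees the second one, and changing between them
  contributes \<open>\<Theta> f\<close>.\<close>

lemma functor_induces_hom:
  assumes x0: "x0 \<in> Ob C"
  obtains \<Phi> where "\<Phi> \<in> hom (fundamental_group (realization C) (vertex C x0)) G"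
    "\<And>f. f \<in> Mor C x0 x0 \<Longrightarrow> \<Phi> (loop_class (realization C) (vertex C x0) (edge_path C f)) = \<Theta> f"
proof -
  interpret flat_cocycle G "realization C" distortions atlas transition "vertex C x0"
    by (rule flat_cocycle_transition[OF x0])
  obtain \<Phi> where \<Phi>: "\<Phi> \<in> hom (fundamental_group (realization C) (vertex C x0)) G"
    "\<And>\<gamma>. path_between (realization C) (vertex C x0) (vertex C x0) \<gamma> \<Longrightarrow>
       \<Phi> (loop_class (realization C) (vertex C x0) \<gamma>) = monodromy \<gamma>"
    using monodromy_hom by metis
  have "monodromy (edge_path C f) = \<Theta> f" if f: "f \<in> Mor C x0 x0" for f
  proof -
    let ?\<sigma> = "edge_simplex C f" and ?w = "\<lambda>s. segment (corner 0) (corner 1) s"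
    note e = path_between_edge[OF f] and \<sigma> = edge_simplex_in[OF f]
    have w: "?w s \<in> standard_simplex 1" if "s \<in> {0..1}" for s
      by (rule segment_in) (use that in auto)
    have ep: "edge_path C f s = cell_pt C 1 ?\<sigma> (?w s)" for s
      by (simp add: edge_path_eq line_def)
    obtain \<xi> i0 where l: "is_lift (edge_path C f) 0 1 \<xi>" "i0 \<in> distortions" "vertex C x0 \<in> atlas i0"
      "\<xi> 0 i0 = \<one>\<^bsub>G\<^esub>" "monodromy (edge_path C f) = \<xi> 1 i0"
      using monodromy_lift[OF e] by blast
    (* the first chart sees the start of the edge for s <= 1/2, the second one its end for s >= 1/2 *)
    define \<kappa>1 :: "real \<Rightarrow> real" where "\<kappa>1 w = max 0 (min 1 (3 * w))" for w
    define \<kappa>2 :: "real \<Rightarrow> real" where "\<kappa>2 w = max 0 (min 1 (3 * w - 2))" for w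
    have \<kappa>: "\<kappa>1 \<in> distortions" "\<kappa>2 \<in> distortions"
    proof -
      have "continuous_on UNIV \<kappa>1" "continuous_on UNIV \<kappa>2"
        unfolding \<kappa>1_def \<kappa>2_def by (intro continuous_intros)+
      moreover have "mono \<kappa>1" "mono \<kappa>2"
        unfolding \<kappa>1_def \<kappa>2_def by (intro monoI max.mono min.mono order_refl; simp)+
      ultimately show "\<kappa>1 \<in> distortions" "\<kappa>2 \<in> distortions"
        by (auto simp: distortions_def \<kappa>1_def \<kappa>2_def)
    qed
    have ms: "mass \<kappa> 1 ?\<sigma> t i \<ge> restack \<kappa> 1 t i" if "\<kappa> \<in> distortions" "t \<in> standard_simplex 1" "i \<le> 1" for \<kappa> t i
      unfolding mass_def
      by (rule member_le_sum) (use that restack_nonneg simplex_nonneg[OF that(2)] in \<open>auto simp: distortions_def\<close>)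
    have sum1: "sum (?w s) {..<Suc 0} = 1 - s" "sum (?w s) {..<Suc 1} = 1" for s
      by (auto simp: segment_def)
    have h1: "heavy \<kappa>1 1 ?\<sigma> (?w s) 0" if "s \<in> {0..1/2}" for s
    proof -
      have "restack \<kappa>1 1 (?w s) 0 = 1"
        unfolding restack_def sum1 using that by (simp add: \<kappa>1_def)
      then show ?thesis using ms[OF \<kappa>(1) w, of s 0] that by (simp add: heavy_def)
    qed
    have h2: "heavy \<kappa>2 1 ?\<sigma> (?w s) 1" if "s \<in> {1/2..1}" for s
    proof -
      have "restack \<kappa>2 1 (?w s) 1 = \<kappa>2 1 - \<kappa>2 (1 - s)"
        unfolding restack_def using sum1[of s] by simp
      also have "\<dots> = 1" using that by (simp add: \<kappa>2_def max_def min_def)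
      finally show ?thesis using ms[OF \<kappa>(2) w, of s 1] that by (simp add: heavy_def)
    qed
    have a1: "edge_path C f s \<in> atlas \<kappa>1" if "s \<in> {0..1/2}" for s
      unfolding ep using in_atlas_iff[OF \<sigma> w] h1[OF that] that by auto
    have a2: "edge_path C f s \<in> atlas \<kappa>2" if "s \<in> {1/2..1}" for s
      unfolding ep using in_atlas_iff[OF \<sigma> w] h2[OF that] that by auto
    have ends: "edge_path C f 0 = vertex C x0" "edge_path C f 1 = vertex C x0"
      using e by (auto simp: path_between_def)
    have "\<xi> 0 \<kappa>1 = \<one>\<^bsub>G\<^esub>"
      using lift_base[OF l(1) _ ends(1) \<kappa>(1) _ l(2,3)] a1[of 0] ends l(4) by simp
    moreover have "\<xi> 0 \<kappa>1 = \<xi> (1/2) \<kappa>1"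
      by (rule lift_const_in_chart[OF l(1) \<kappa>(1) a1]) auto
    moreover have "\<xi> (1/2) \<kappa>2 = \<xi> 1 \<kappa>2"
      by (rule lift_const_in_chart[OF l(1) \<kappa>(2) a2]) auto
    moreover have "\<xi> 1 \<kappa>2 = \<xi> 1 i0"
      using lift_base[OF l(1) _ ends(2) \<kappa>(2) _ l(2,3)] a2[of 1] ends by simp
    moreover have "\<xi> (1/2) \<kappa>2 = transition \<kappa>1 \<kappa>2 (edge_path C f (1/2)) \<otimes>\<^bsub>G\<^esub> \<xi> (1/2) \<kappa>1"
      by (rule lift_change[OF l(1) _ \<kappa>]) (use a1 a2 in auto)
    moreover have "transition \<kappa>1 \<kappa>2 (edge_path C f (1/2)) = \<Theta> f"
    proof -
      have "transition \<kappa>1 \<kappa>2 (edge_path C f (1/2)) = shift ?\<sigma> 0 1"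
        unfolding ep by (rule transition_eq[OF \<kappa> \<sigma> w h1 h2]) auto
      also have "\<dots> = \<Theta> f \<otimes>\<^bsub>G\<^esub> inv\<^bsub>G\<^esub> \<Theta> (Ident C x0)"
        using f by (simp add: shift_def edge_simplex_def Mor_def)
      finally show ?thesis using \<Theta>_Ident[OF x0] \<Theta>_closed[OF f] by simp
    qed
    ultimately show ?thesis using l(5) \<Theta>_closed[OF f] by simp
  qed
  then show ?thesis
    using that[OF \<Phi>(1)] \<Phi>(2) path_between_edge by metis
qed

end

end

section \<open>The subgroup \<open>O\<^sup>p\<^sup>'(G)\<close>\<close>

lemma (in group_hom) group_hom_image: "group_hom G (H\<lparr>carrier := h ` carrier G\<rparr>) h"
proof -
  have "group (H\<lparr>carrier := h ` carrier G\<rparr>)"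
    by (rule H.subgroup_imp_group[OF img_is_subgroup])
  moreover have "h \<in> hom G (H\<lparr>carrier := h ` carrier G\<rparr>)"
    by (auto simp: hom_def)
  ultimately show ?thesis by (simp add: group_hom_def group_hom_axioms_def G.is_group)
qed

lemma (in group_hom) bij_rcosets_kernel:
  "bij_betw (\<lambda>X. the_elem (h ` X)) (rcosets (kernel G H h)) (h ` carrier G)"
proof -
  interpret I: group_hom G "H\<lparr>carrier := h ` carrier G\<rparr>" h by (rule group_hom_image)
  have "kernel G (H\<lparr>carrier := h ` carrier G\<rparr>) h = kernel G H h" by (simp add: kernel_def)
  with I.FactGroup_iso_set show ?thesis by (simp add: iso_def FactGroup_def)
qed

lemma (in group_hom) O_p'_subset_kernel:
  assumes "finite (h ` carrier G)" "coprime p (card (h ` carrier G))"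
  shows "O_p' p G \<subseteq> kernel G H h"
proof -
  have "finite (rcosets (kernel G H h))" "card (rcosets (kernel G H h)) = card (h ` carrier G)"
    using bij_rcosets_kernel assms(1) bij_betw_finite bij_betw_same_card by blast+
  then show ?thesis
    unfolding O_p'_def using normal_kernel assms(2) by auto
qed

context group
begin

lemma card_subgroup_dvd: "subgroup H G \<Longrightarrow> card H dvd order G"
  by (metis dvd_triv_right lagrange)

lemma carrier_p'_index: "carrier G \<in> {N. N \<lhd> G \<and> finite (rcosets N) \<and> coprime p (card (rcosets N))}"
proof -
  have "rcosets (carrier G) = {carrier G}"
    using coset_join2[OF _ subgroup_self] by (auto simp: RCOSETS_def)
  moreover have "carrier G \<lhd> G"
    by (rule normal_invI[OF subgroup_self]) auto
  ultimately show ?thesis by simp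
qed

lemma O_p'_subset: "O_p' p G \<subseteq> carrier G"
  unfolding O_p'_def using carrier_p'_index by blast

lemma O_p'_normal: "O_p' p G \<lhd> G"
proof (rule normal_invI)
  show "subgroup (O_p' p G) G"
    unfolding O_p'_def by (rule subgroups_Inter) (use carrier_p'_index normal_imp_subgroup in blast)+
  show "g \<otimes> h \<otimes> inv g \<in> O_p' p G" if "g \<in> carrier G" "h \<in> O_p' p G" for g h
    using that normal_inv_iff unfolding O_p'_def by blast
qed

lemma order_FactGroup: "N \<lhd> G \<Longrightarrow> order (G Mod N) = card (rcosets N)"
  by (simp add: order_def FactGroup_def)

text \<open>The order of the image in a quotient of order prime to \<open>p\<close> is both a power of \<open>p\<close> and prime to \<open>p\<close>.\<close>

lemma pow_in_O_p':
  assumes x: "x \<in> carrier G" and pow: "x [^] (p ^ k :: nat) \<in> O_p' p G"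
  shows "x \<in> O_p' p G"
  unfolding O_p'_def
proof (intro InterI)
  fix N assume "N \<in> {N. N \<lhd> G \<and> finite (rcosets N) \<and> coprime p (card (rcosets N))}"
  then have N: "N \<lhd> G" "finite (rcosets N)" "coprime p (card (rcosets N))"
    and xN: "x [^] (p ^ k :: nat) \<in> N" using pow unfolding O_p'_def by auto
  interpret N: normal N G by (rule N(1))
  interpret Q: group "G Mod N" by (rule N.factorgroup_is_group)
  have X: "N #> x \<in> carrier (G Mod N)" using x by (auto simp: carrier_FactGroup)
  have "(N #> x) [^]\<^bsub>G Mod N\<^esub> (p ^ k) = N"
    using N.FactGroup_pow[OF x] coset_join2[OF _ N.is_subgroup xN] x by simp
  then have "Q.ord (N #> x) dvd p ^ k" using Q.pow_eq_id[OF X] by simp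
  moreover have "Q.ord (N #> x) dvd card (rcosets N)"
    using Q.ord_dvd_group_order[OF X] order_FactGroup[OF N(1)] by simp
  moreover have "coprime (p ^ k) (card (rcosets N))" using N(3) by simp
  ultimately have "Q.ord (N #> x) = 1" by (metis coprime_common_divisor_nat nat_dvd_1_iff_1 coprime_def)
  then have "N #> x = N" using Q.ord_eq_1[OF X] by simp
  then show "x \<in> N" by (rule coset_join1[OF _ x N.is_subgroup])
qed

end

lemma (in group_hom) O_p'_image: "h ` O_p' p G \<subseteq> O_p' p H"
proof
  fix y assume "y \<in> h ` O_p' p G"
  then obtain x where x: "x \<in> O_p' p G" "y = h x" by blast
  show "y \<in> O_p' p H"
    unfolding O_p'_def
  proof (intro InterI)
    fix N assume "N \<in> {N. N \<lhd> H \<and> finite (rcosets\<^bsub>H\<^esub> N) \<and> coprime p (card (rcosets\<^bsub>H\<^esub> N))}"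
    then have N: "N \<lhd> H" "finite (rcosets\<^bsub>H\<^esub> N)" "coprime p (card (rcosets\<^bsub>H\<^esub> N))" by auto
    interpret N: normal N H by (rule N(1))
    let ?q = "\<lambda>a. N #>\<^bsub>H\<^esub> h a"
    interpret q: group_hom G "H Mod N" ?q
      using Group.hom_compose[OF homh N.r_coset_hom_Mod] N.factorgroup_is_group
      by (simp add: group_hom_def group_hom_axioms_def G.is_group o_def)
    have im: "subgroup (?q ` carrier G) (H Mod N)" by (rule q.img_is_subgroup)
    then have "card (?q ` carrier G) dvd card (rcosets\<^bsub>H\<^esub> N)"
      using q.H.card_subgroup_dvd[OF im] H.order_FactGroup[OF N(1)] by simp
    moreover have "finite (?q ` carrier G)"
      using finite_subset[OF subgroup.subset[OF im]] N(2) by (simp add: FactGroup_def)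
    ultimately have "x \<in> kernel G (H Mod N) ?q"
      using q.O_p'_subset_kernel[of p] x(1) N(3) by (meson coprime_divisors dvd_refl subsetD)
    then show "y \<in> N"
      using H.coset_join1[OF _ _ N.is_subgroup, of "h x"] x(2) by (simp add: kernel_def)
  qed
qed

section \<open>Finite \<open>p\<close>-groups acting on finite sets\<close>

lemma (in group) group_actionI:
  assumes cl: "\<And>g x. g \<in> carrier G \<Longrightarrow> x \<in> E \<Longrightarrow> act g x \<in> E"
    and one: "\<And>x. x \<in> E \<Longrightarrow> act \<one> x = x"
    and mult: "\<And>g h x. g \<in> carrier G \<Longrightarrow> h \<in> carrier G \<Longrightarrow> x \<in> E \<Longrightarrow> act (g \<otimes> h) x = act g (act h x)"
  shows "group_action G E (\<lambda>g. restrict (act g) E)"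
proof -
  have bij: "restrict (act g) E \<in> Bij E" if g: "g \<in> carrier G" for g
  proof -
    have "bij_betw (act g) E E"
    proof (rule bij_betw_byWitness[where f' = "act (inv g)"])
      show "\<forall>x\<in>E. act (inv g) (act g x) = x" "\<forall>x\<in>E. act g (act (inv g) x) = x"
        using mult[of "inv g" g] mult[of g "inv g"] one g by auto
    qed (use cl g in auto)
    then show ?thesis by (simp add: Bij_def cong: bij_betw_cong)
  qed
  have "(\<lambda>g. restrict (act g) E) \<in> hom G (BijGroup E)"
  proof (rule homI)
    fix g h assume gh: "g \<in> carrier G" "h \<in> carrier G"
    have "restrict (act (g \<otimes> h)) E = compose E (restrict (act g) E) (restrict (act h) E)"
      using mult[OF gh] cl[OF gh(2)] by (auto simp: compose_def)
    then show "restrict (act (g \<otimes> h)) E = restrict (act g) E \<otimes>\<^bsub>BijGroup E\<^esub> restrict (act h) E"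
      using bij gh by (simp add: BijGroup_def)
  qed (simp add: BijGroup_def bij)
  then show ?thesis
    by (simp add: group_action_def group_hom_def group_hom_axioms_def is_group group_BijGroup)
qed

text \<open>Orbits have lengths that divide \<open>p\<^sup>k\<close>, and those of length 1 are the fixed points.\<close>

lemma (in group_action) card_fixed_points:
  assumes p: "prime (p::nat)" and order: "finite (carrier G)" "order G = p ^ k" and E: "finite E"
  shows "card {x \<in> E. \<forall>g\<in>carrier G. \<phi> g x = x} mod p = card E mod p"
proof -
  interpret group G using group_hom group_hom.axioms(1) by auto
  let ?F = "{x \<in> E. \<forall>g\<in>carrier G. \<phi> g x = x}" and ?C = "orbit G \<phi> ` (E - {x \<in> E. \<forall>g\<in>carrier G. \<phi> g x = x})"
  have orbE: "orbit G \<phi> x \<subseteq> E" if "x \<in> E" for x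
    using element_image that by (auto simp: orbit_def)
  have fixed_orbit: "x \<in> ?F" if "x \<in> E" "y \<in> ?F" "y \<in> orbit G \<phi> x" for x y
  proof -
    have "x \<in> orbit G \<phi> y" using orbit_sym that by blast
    then have "x = y" using that(2) by (auto simp: orbit_def)
    then show ?thesis using that(2) by simp
  qed
  have "p dvd card (\<Union>?C)"
  proof (rule dvd_partition)
    show "finite (\<Union>?C)" by (rule finite_subset[OF _ E]) (use orbE in blast)
    show "\<forall>c\<in>?C. p dvd card c"
    proof
      fix c assume "c \<in> ?C"
      then obtain x where x: "x \<in> E" "x \<notin> ?F" "c = orbit G \<phi> x" by blast
      have "card c dvd p ^ k"
        using orbit_stabilizer_theorem[OF x(1)] order(2) x(3) by (metis dvd_triv_left)
      then obtain i where i: "card c = p ^ i" using p divides_primepow_nat by blast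
      have "card c \<noteq> 1"
      proof
        assume "card c = 1"
        then obtain z where "c = {z}" using card_1_singletonE by blast
        then have "\<forall>g\<in>carrier G. \<phi> g x = x"
          using orbit_refl[OF x(1)] x(3) by (auto simp: orbit_def)
        then show False using x by blast
      qed
      then show "p dvd card c" using i by (cases i) auto
    qed
    show "\<forall>c1\<in>?C. \<forall>c2\<in>?C. c1 \<noteq> c2 \<longrightarrow> c1 \<inter> c2 = {}"
    proof (intro ballI impI)
      fix c1 c2 assume "c1 \<in> ?C" "c2 \<in> ?C" "c1 \<noteq> c2"
      then show "c1 \<inter> c2 = {}"
        using disjoint_union[of c1 c2] by (auto simp: orbits_def)
    qed
  qed
  moreover have "\<Union>?C = E - ?F"
  proof
    show "\<Union>?C \<subseteq> E - ?F" using orbE fixed_orbit by blast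
    show "E - ?F \<subseteq> \<Union>?C" using orbit_refl by blast
  qed
  moreover have "card E = card ?F + card (E - ?F)"
    using E by (metis (no_types, lifting) card_Diff_subset card_mono finite_subset le_add_diff_inverse mem_Collect_eq subsetI)
  ultimately show ?thesis by (metis (no_types, lifting) add.right_neutral dvd_eq_mod_eq_0 mod_add_right_eq)
qed

context group
begin

lemma card_fixed_cosets:
  assumes fin: "finite (carrier G)" and p: "prime (p::nat)"
    and T: "subgroup T G" and R: "subgroup R G" "card R = p ^ k"
  shows "card {X \<in> rcosets T. \<forall>r\<in>R. X #> inv r = X} mod p = card (rcosets T) mod p"
proof -
  interpret T: subgroup T G by (rule T)
  interpret R: subgroup R G by (rule R(1))
  interpret GR: group "G\<lparr>carrier := R\<rparr>" by (rule subgroup_imp_group[OF R(1)])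
  have sub: "X \<subseteq> carrier G" if "X \<in> rcosets T" for X
    using T.rcosets_carrier[OF is_group that] .
  have inv_R: "inv\<^bsub>G\<lparr>carrier := R\<rparr>\<^esub> r = inv r" if "r \<in> R" for r
    using m_inv_consistent[OF R(1) that] by simp
  interpret A: group_action "G\<lparr>carrier := R\<rparr>" "rcosets T" "\<lambda>r. restrict (\<lambda>X. X #> inv r) (rcosets T)"
  proof (rule GR.group_actionI)
    show "X #> inv r \<in> rcosets T" if "r \<in> carrier (G\<lparr>carrier := R\<rparr>)" "X \<in> rcosets T" for r X
      using that by (auto simp: RCOSETS_def coset_mult_assoc T.subset)
    show "X #> inv \<one>\<^bsub>G\<lparr>carrier := R\<rparr>\<^esub> = X" if "X \<in> rcosets T" for X
      using sub[OF that] by simp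
    show "X #> inv (g \<otimes>\<^bsub>G\<lparr>carrier := R\<rparr>\<^esub> h) = X #> inv h #> inv g"
      if "g \<in> carrier (G\<lparr>carrier := R\<rparr>)" "h \<in> carrier (G\<lparr>carrier := R\<rparr>)" "X \<in> rcosets T" for g h X
      using that sub[OF that(3)] by (simp add: coset_mult_assoc inv_mult_group)
  qed
  have "finite (rcosets T)" using fin rcosets_subset_PowG[OF T] by (meson finite_Pow_iff finite_subset)
  then have "card {X \<in> rcosets T. \<forall>r\<in>R. restrict (\<lambda>X. X #> inv r) (rcosets T) X = X} mod p = card (rcosets T) mod p"
    using A.card_fixed_points[OF p, of k] R finite_subset[OF R.subset fin]
    by (simp add: order_def)
  moreover have "{X \<in> rcosets T. \<forall>r\<in>R. restrict (\<lambda>X. X #> inv r) (rcosets T) X = X} = {X \<in> rcosets T. \<forall>r\<in>R. X #> inv r = X}"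
    by auto
  ultimately show ?thesis by simp
qed

lemma fixed_coset:
  assumes T: "subgroup T G" and R: "R \<subseteq> carrier G" and x: "x \<in> carrier G"
    and fixed: "\<forall>r\<in>R. (T #> x) #> inv r = T #> x" and r: "r \<in> R"
  shows "x \<otimes> r \<otimes> inv x \<in> T"
proof -
  interpret T: subgroup T G by (rule T)
  have rG: "r \<in> carrier G" using r R by blast
  have "T #> (x \<otimes> inv r) = T #> x" using fixed r coset_mult_assoc[OF T.subset x inv_closed[OF rG]] by simp
  then have "x \<in> T #> (x \<otimes> inv r)" using rcos_self[OF x T] by simp
  then have "x \<otimes> inv (x \<otimes> inv r) \<in> T" using T.rcos_module_imp[OF is_group] x rG by simp
  then show ?thesis using x rG by (simp add: inv_mult_group m_assoc)
qed

text \<open>\<open>R\<close> acts on the cosets of \<open>T\<close>. Their number is prime to \<open>p\<close>, so one of them is fixed.\<close>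

lemma p_subgroup_conjugate_into:
  assumes "finite (carrier G)" "prime (p::nat)" and T: "subgroup T G" "\<not> p dvd card (rcosets T)"
    and R: "subgroup R G" "card R = p ^ k"
  obtains x where "x \<in> carrier G" "\<And>r. r \<in> R \<Longrightarrow> x \<otimes> r \<otimes> inv x \<in> T"
proof -
  have "{X \<in> rcosets T. \<forall>r\<in>R. X #> inv r = X} \<noteq> {}" (is "?F \<noteq> {}")
  proof
    assume "?F = {}"
    moreover have "card ?F mod p = card (rcosets T) mod p" by (rule card_fixed_cosets[OF assms(1,2) T(1) R])
    ultimately have "card (rcosets T) mod p = 0" by (simp only: card.empty mod_0)
    then show False using T(2) by (simp add: dvd_eq_mod_eq_0)
  qed
  then obtain X where "X \<in> rcosets T" "\<forall>r\<in>R. X #> inv r = X" by blast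
  then obtain x where "x \<in> carrier G" "\<forall>r\<in>R. (T #> x) #> inv r = T #> x" by (auto simp: RCOSETS_def)
  then show ?thesis using that fixed_coset[OF T(1) subgroup.subset[OF R(1)]] by blast
qed

lemma p_subgroup_subset_O_p':
  assumes R: "subgroup R G" "card R = p ^ k" "finite (carrier G)"
  shows "R \<subseteq> O_p' p G"
proof
  fix x assume x: "x \<in> R"
  interpret R: subgroup R G by (rule R(1))
  interpret GR: group "G\<lparr>carrier := R\<rparr>" by (rule subgroup_imp_group[OF R(1)])
  have "x [^]\<^bsub>G\<lparr>carrier := R\<rparr>\<^esub> (p ^ k) = \<one>"
    using GR.pow_order_eq_1[of x] x R(2) by (simp add: order_def)
  then have "x [^] (p ^ k) = \<one>" using nat_pow_consistent[of x "p ^ k" R] by simp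
  moreover have "\<one> \<in> O_p' p G" using normal_imp_subgroup[OF O_p'_normal] subgroup.one_closed by blast
  ultimately show "x \<in> O_p' p G" using pow_in_O_p'[of x p k] x by simp
qed

text \<open>Sylow subgroups are already conjugate in \<open>O\<^sup>p\<^sup>'(G)\<close>, because this group contains all of them.\<close>

lemma sylow_conjugate_in_O_p':
  assumes p: "prime p" and T: "sylow_subgroup p T G" and R: "subgroup R G" "card R = p ^ k"
  obtains x where "x \<in> O_p' p G" "\<And>r. r \<in> R \<Longrightarrow> x \<otimes> r \<otimes> inv x \<in> T"
proof -
  let ?O = "O_p' p G"
  have fin: "finite (carrier G)" and T': "subgroup T G" "card T = p ^ multiplicity p (order G)"
    using T by (auto simp: sylow_subgroup_def)
  have O: "subgroup ?O G" by (rule normal_imp_subgroup[OF O_p'_normal])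
  interpret O: group "G\<lparr>carrier := ?O\<rparr>" by (rule subgroup_imp_group[OF O])
  have TO: "subgroup T (G\<lparr>carrier := ?O\<rparr>)" "subgroup R (G\<lparr>carrier := ?O\<rparr>)"
    using subgroup_incl[OF T'(1) O p_subgroup_subset_O_p'[OF T' fin]]
      subgroup_incl[OF R(1) O p_subgroup_subset_O_p'[OF R fin]] by auto
  have "\<not> p dvd card (rcosets\<^bsub>G\<lparr>carrier := ?O\<rparr>\<^esub> T)"
  proof
    assume "p dvd card (rcosets\<^bsub>G\<lparr>carrier := ?O\<rparr>\<^esub> T)"
    then obtain c where "card (rcosets\<^bsub>G\<lparr>carrier := ?O\<rparr>\<^esub> T) = p * c" by (rule dvdE)
    then have "card ?O = p * card T * c"
      using O.lagrange[OF TO(1)] by (simp add: order_def mult_ac)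
    then have "p * card T dvd card ?O" by simp
    then have "p ^ Suc (multiplicity p (order G)) dvd order G"
      using card_subgroup_dvd[OF O] T'(2) by (metis dvd_trans power_Suc)
    moreover have "order G \<noteq> 0" using fin order_gt_0_iff_finite by simp
    ultimately show False
      using p power_dvd_iff_le_multiplicity by (metis Suc_n_not_le_n not_prime_unit)
  qed
  moreover have "finite (carrier (G\<lparr>carrier := ?O\<rparr>))" using finite_subset[OF O_p'_subset[of p] fin] by simp
  ultimately obtain x where "x \<in> carrier (G\<lparr>carrier := ?O\<rparr>)"
    "\<And>r. r \<in> R \<Longrightarrow> x \<otimes>\<^bsub>G\<lparr>carrier := ?O\<rparr>\<^esub> r \<otimes>\<^bsub>G\<lparr>carrier := ?O\<rparr>\<^esub> inv\<^bsub>G\<lparr>carrier := ?O\<rparr>\<^esub> x \<in> T"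
    using O.p_subgroup_conjugate_into[OF _ p TO(1) _ TO(2) R(2)] by metis
  then show ?thesis using that[of x] m_inv_consistent[OF O] by auto
qed

lemma normalizer_iff:
  assumes P: "P \<subseteq> carrier G" "finite P"
  shows "x \<in> normalizer G P \<longleftrightarrow> x \<in> carrier G \<and> (\<forall>r\<in>P. x \<otimes> r \<otimes> inv x \<in> P)"
proof -
  have eq: "x <# P #> inv x = (\<lambda>r. x \<otimes> r \<otimes> inv x) ` P"
    by (auto simp: l_coset_def r_coset_def)
  have "(\<lambda>r. x \<otimes> r \<otimes> inv x) ` P = P" if "x \<in> carrier G" "\<forall>r\<in>P. x \<otimes> r \<otimes> inv x \<in> P"
  proof (rule endo_inj_surj[OF P(2)])
    show "inj_on (\<lambda>r. x \<otimes> r \<otimes> inv x) P"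
      using that(1) P(1) conjugation_is_inj[of x] by (intro inj_onI) blast
  qed (use that in auto)
  then show ?thesis
    using P by (auto simp: normalizer_def stabilizer_def eq)
qed

text \<open>\<open>P\<close> acts on its own cosets. The number of fixed cosets is divisible by \<open>p\<close>, so there is one besides \<open>P\<close> itself, and
  its elements normalize \<open>P\<close>.\<close>

lemma p_group_normalizer_grows:
  assumes fin: "finite (carrier G)" and p: "prime (p::nat)" "order G = p ^ n"
    and P: "subgroup P G" "P \<noteq> carrier G"
  shows "P \<subset> normalizer G P"
proof -
  interpret P: subgroup P G by (rule P(1))
  have "card P dvd p ^ n" using card_subgroup_dvd[OF P(1)] p(2) by simp
  then obtain k where k: "card P = p ^ k" using p(1) divides_primepow_nat by blast
  have lag: "card (rcosets P) * card P = p ^ n" using lagrange[OF P(1)] p(2) by simp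
  then obtain j where j: "card (rcosets P) = p ^ j" using p(1) divides_primepow_nat by (metis dvd_triv_left)
  have "card (rcosets P) \<noteq> 1"
  proof
    assume "card (rcosets P) = 1"
    then have "card P = card (carrier G)" using lag p(2) by (simp add: order_def)
    then show False using card_subset_eq[OF fin P.subset] P(2) by blast
  qed
  then have "p dvd card (rcosets P)" using j by (cases j) auto
  then have dvd: "p dvd card {X \<in> rcosets P. \<forall>r\<in>P. X #> inv r = X}"
    using card_fixed_cosets[OF fin p(1) P(1) P(1) k] by (simp only: dvd_eq_mod_eq_0)
  have "P #> inv r = P" if "r \<in> P" for r using that by (simp add: coset_join2 P.subgroup_axioms)
  then have PF: "P \<in> {X \<in> rcosets P. \<forall>r\<in>P. X #> inv r = X}" using P.subgroup_in_rcosets[OF is_group] by blast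
  have "{X \<in> rcosets P. \<forall>r\<in>P. X #> inv r = X} \<noteq> {P}"
  proof
    assume "{X \<in> rcosets P. \<forall>r\<in>P. X #> inv r = X} = {P}"
    then have "p dvd 1" using dvd by simp
    then show False using p(1) by (simp add: prime_nat_iff)
  qed
  then obtain X where X: "X \<in> rcosets P" "\<forall>r\<in>P. X #> inv r = X" "X \<noteq> P" using PF by blast
  then obtain x where x: "x \<in> carrier G" "X = P #> x" by (auto simp: RCOSETS_def)
  have "x \<in> normalizer G P"
    using normalizer_iff[OF P.subset finite_subset[OF P.subset fin]] fixed_coset[OF P(1) P.subset x(1)] X(2) x by auto
  moreover have "x \<notin> P" using X(3) x(2) coset_join2[OF x(1) P(1)] by blast
  moreover have "P \<subseteq> normalizer G P"
    using normalizer_iff[OF P.subset finite_subset[OF P.subset fin]] by auto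
  ultimately show ?thesis by blast
qed

text \<open>Cauchy's theorem, which is the case of exponent 1 in Sylow's theorem.\<close>

lemma element_of_prime_order:
  assumes "finite (carrier G)" "prime (p::nat)" "p dvd order G"
  obtains x where "x \<in> carrier G" "x \<noteq> \<one>" "x [^] p = \<one>"
proof -
  obtain m where "order G = p ^ 1 * m" using assms(3) by (auto simp: dvd_def)
  then obtain H where H: "subgroup H G" "card H = p"
    using sylow_thm[OF assms(2) is_group _ assms(1)] by (metis power_one_right)
  interpret H: subgroup H G by (rule H(1))
  interpret GH: group "G\<lparr>carrier := H\<rparr>" by (rule subgroup_imp_group[OF H(1)])
  have "H \<noteq> {\<one>}" using H(2) assms(2) by (auto simp: prime_nat_iff)
  then obtain x where x: "x \<in> H" "x \<noteq> \<one>" using H.one_closed by blast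
  have "x [^]\<^bsub>G\<lparr>carrier := H\<rparr>\<^esub> p = \<one>" using GH.pow_order_eq_1[of x] x H(2) by (simp add: order_def)
  then show ?thesis using that[of x] x nat_pow_consistent[of x p H] by simp
qed

end

text \<open>By Cauchy's theorem, the order of the image is prime to \<open>p\<close>.\<close>

lemma (in group_hom) O_p'_subset_kernel_torsion:
  assumes fin: "finite (carrier G)" and p: "prime (p::nat)"
    and tf: "\<And>y. y \<in> carrier H \<Longrightarrow> y [^]\<^bsub>H\<^esub> p = \<one>\<^bsub>H\<^esub> \<Longrightarrow> y = \<one>\<^bsub>H\<^esub>"
  shows "O_p' p G \<subseteq> kernel G H h"
proof (rule O_p'_subset_kernel)
  show f: "finite (h ` carrier G)" using fin by simp
  interpret I: group_hom G "H\<lparr>carrier := h ` carrier G\<rparr>" h by (rule group_hom_image)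
  have "\<not> p dvd card (h ` carrier G)"
  proof
    assume "p dvd card (h ` carrier G)"
    then obtain y where "y \<in> h ` carrier G" "y \<noteq> \<one>\<^bsub>H\<^esub>" "y [^]\<^bsub>H\<lparr>carrier := h ` carrier G\<rparr>\<^esub> p = \<one>\<^bsub>H\<^esub>"
      using I.H.element_of_prime_order[OF _ p] f by (auto simp: order_def)
    then show False using tf H.nat_pow_consistent[of y p "h ` carrier G"] by auto
  qed
  then show "coprime p (card (h ` carrier G))" using p prime_imp_coprime by blast
qed

section \<open>Fusion systems\<close>

definition hom_inv :: "'a set \<Rightarrow> ('a \<Rightarrow> 'a) \<Rightarrow> 'a \<Rightarrow> 'a" where
  "hom_inv P \<phi> = (\<lambda>y\<in>\<phi> ` P. inv_into P \<phi> y)"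

locale fusion = group S for S :: "('a, 'b) monoid_scheme" (structure) +
  fixes F :: "'a homs"
  assumes finite_S: "finite (carrier S)" and fusion: "fusion_system S F"
begin

lemma finite_sub: "subgroup P S \<Longrightarrow> finite P"
  using finite_S subgroup.subset finite_subset by blast

lemma comp: "subgroup P S \<Longrightarrow> subgroup Q S \<Longrightarrow> subgroup R S \<Longrightarrow> \<phi> \<in> F P Q \<Longrightarrow> \<psi> \<in> F Q R \<Longrightarrow>
    compose P \<psi> \<phi> \<in> F P R"
  using fusion unfolding fusion_system_def by blast

lemma conj_in: "subgroup P S \<Longrightarrow> subgroup Q S \<Longrightarrow> x \<in> carrier S \<Longrightarrow> conj_map S x P ` P \<subseteq> Q \<Longrightarrow> conj_map S x P \<in> F P Q"
  using fusion unfolding fusion_system_def Hom_S_def by blast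

lemma in_Inj: "subgroup P S \<Longrightarrow> subgroup Q S \<Longrightarrow> \<phi> \<in> F P Q \<Longrightarrow> \<phi> \<in> Inj S P Q"
  using fusion unfolding fusion_system_def by blast

lemma morphism:
  assumes "subgroup P S" "subgroup Q S" "\<phi> \<in> F P Q"
  shows "\<phi> \<in> extensional P" "inj_on \<phi> P" "\<phi> ` P \<subseteq> Q" "\<And>x. x \<in> P \<Longrightarrow> \<phi> x \<in> Q"
    "\<And>x y. x \<in> P \<Longrightarrow> y \<in> P \<Longrightarrow> \<phi> (x \<otimes> y) = \<phi> x \<otimes> \<phi> y"
  using in_Inj[OF assms] by (auto simp: Inj_def hom_def)

lemma conj_map_one: "P \<subseteq> carrier S \<Longrightarrow> conj_map S \<one> P = (\<lambda>x\<in>P. x)"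
  by (auto simp: conj_map_def fun_eq_iff)

lemma incl: "subgroup P S \<Longrightarrow> subgroup Q S \<Longrightarrow> P \<subseteq> Q \<Longrightarrow> (\<lambda>x\<in>P. x) \<in> F P Q"
  using conj_in[of P Q \<one>] conj_map_one[OF subgroup.subset] by auto

lemma factor:
  assumes "subgroup P S" "subgroup Q S" "\<phi> \<in> F P Q"
  shows "subgroup (\<phi> ` P) S" "\<phi> \<in> F P (\<phi> ` P)" "hom_inv P \<phi> \<in> F (\<phi> ` P) P"
proof -
  obtain R \<psi> where R: "subgroup R S" "R \<subseteq> Q" "\<psi> \<in> Iso F P R" "\<phi> = compose P (\<lambda>x\<in>R. x) \<psi>"
    using fusion assms unfolding fusion_system_def by blast
  then obtain \<psi>' where \<psi>: "\<psi> \<in> F P R" "\<psi>' \<in> F R P" "compose P \<psi>' \<psi> = (\<lambda>x\<in>P. x)" "compose R \<psi> \<psi>' = (\<lambda>x\<in>R. x)"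
    by (auto simp: Iso_def)
  have "\<phi> = \<psi>"
  proof (rule extensionalityI[of _ P])
    show "\<phi> \<in> extensional P" by (rule morphism(1)[OF assms])
    show "\<psi> \<in> extensional P" by (rule morphism(1)[OF assms(1) R(1) \<psi>(1)])
    show "\<phi> x = \<psi> x" if "x \<in> P" for x
      using that morphism(4)[OF assms(1) R(1) \<psi>(1)] by (simp add: R(4) compose_def)
  qed
  have inv1: "\<psi>' (\<psi> x) = x" if "x \<in> P" for x using fun_cong[OF \<psi>(3), of x] that by (simp add: compose_def)
  have inv2: "\<psi> (\<psi>' y) = y" if "y \<in> R" for y using fun_cong[OF \<psi>(4), of y] that by (simp add: compose_def)
  have im: "\<phi> ` P = R"
    using inv2 morphism(4)[OF R(1) assms(1) \<psi>(2)] morphism(3)[OF assms(1) R(1) \<psi>(1)] \<open>\<phi> = \<psi>\<close>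
    by (metis image_eqI subsetI subset_antisym)
  have "hom_inv P \<phi> = \<psi>'"
  proof (rule extensionalityI[of _ R])
    show "hom_inv P \<phi> \<in> extensional R" by (simp add: hom_inv_def im)
    show "\<psi>' \<in> extensional R" by (rule morphism(1)[OF R(1) assms(1) \<psi>(2)])
    show "hom_inv P \<phi> y = \<psi>' y" if "y \<in> R" for y
      using that inv2[OF that] inv_into_f_f[OF morphism(2)[OF assms] morphism(4)[OF R(1) assms(1) \<psi>(2) that]]
      unfolding hom_inv_def im by (simp add: \<open>\<phi> = \<psi>\<close>)
  qed
  then show "subgroup (\<phi> ` P) S" "\<phi> \<in> F P (\<phi> ` P)" "hom_inv P \<phi> \<in> F (\<phi> ` P) P"
    using R(1) \<psi>(1,2) im \<open>\<phi> = \<psi>\<close> by auto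
qed

lemma retarget:
  assumes "subgroup P S" "subgroup Q S" "\<phi> \<in> F P Q" "subgroup Q' S" "\<phi> ` P \<subseteq> Q'"
  shows "\<phi> \<in> F P Q'"
proof -
  have "compose P (\<lambda>x\<in>\<phi> ` P. x) \<phi> = \<phi>"
    using morphism(1)[OF assms(1-3)] by (intro extensionalityI[of _ P]) (auto simp: compose_def)
  then show ?thesis
    using comp[OF assms(1) factor(1)[OF assms(1-3)] assms(4) factor(2)[OF assms(1-3)]
        incl[OF factor(1)[OF assms(1-3)] assms(4,5)]] by simp
qed

lemma restr:
  assumes "subgroup P S" "subgroup Q S" "\<phi> \<in> F P Q" "subgroup R S" "R \<subseteq> P"
  shows "restrict \<phi> R \<in> F R Q"
proof -
  have "compose R \<phi> (\<lambda>x\<in>R. x) = restrict \<phi> R" by (auto simp: compose_def fun_eq_iff)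
  then show ?thesis using comp[OF assms(4,1,2) incl[OF assms(4,1,5)] assms(3)] by simp
qed

lemma to_S: "subgroup P S \<Longrightarrow> subgroup Q S \<Longrightarrow> \<phi> \<in> F P Q \<Longrightarrow> \<phi> \<in> F P (carrier S)"
  using retarget subgroup_self subgroup.subset morphism(3) by (metis subset_trans)

lemma hom_inv_left: "subgroup P S \<Longrightarrow> subgroup Q S \<Longrightarrow> \<phi> \<in> F P Q \<Longrightarrow> x \<in> P \<Longrightarrow> hom_inv P \<phi> (\<phi> x) = x"
  using morphism(2) by (simp add: hom_inv_def)

lemma hom_inv_right: "y \<in> \<phi> ` P \<Longrightarrow> \<phi> (hom_inv P \<phi> y) = y"
  by (simp add: hom_inv_def f_inv_into_f)

lemma hom_inv_image: "subgroup P S \<Longrightarrow> subgroup Q S \<Longrightarrow> \<phi> \<in> F P Q \<Longrightarrow> hom_inv P \<phi> ` \<phi> ` P = P"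
  using hom_inv_left by (force simp: image_iff)

lemma endo_image: "subgroup P S \<Longrightarrow> \<phi> \<in> F P P \<Longrightarrow> \<phi> ` P = P"
  using endo_inj_surj[OF finite_sub] morphism(2,3) by blast

text \<open>For subfamilies of a fusion system, the axiom that morphisms factor through isomorphisms amounts to closure under
  restriction of the codomain to the image and under inverses.\<close>

lemma fusion_systemI:
  assumes sub: "\<And>P Q. subgroup P S \<Longrightarrow> subgroup Q S \<Longrightarrow> Hom_S S P Q \<subseteq> E P Q \<and> E P Q \<subseteq> F P Q"
    and cmp: "\<And>P Q R \<phi> \<psi>. subgroup P S \<Longrightarrow> subgroup Q S \<Longrightarrow> subgroup R S \<Longrightarrow> \<phi> \<in> E P Q \<Longrightarrow> \<psi> \<in> E Q R \<Longrightarrow>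
      compose P \<psi> \<phi> \<in> E P R"
    and fct: "\<And>P Q \<phi>. subgroup P S \<Longrightarrow> subgroup Q S \<Longrightarrow> \<phi> \<in> E P Q \<Longrightarrow>
      \<phi> \<in> E P (\<phi> ` P) \<and> hom_inv P \<phi> \<in> E (\<phi> ` P) P"
  shows "fusion_system S E"
  unfolding fusion_system_def
proof (intro conjI allI impI)
  fix P assume P: "subgroup P S"
  have "conj_map S \<one> P \<in> Hom_S S P P"
    unfolding Hom_S_def using conj_map_one[OF subgroup.subset[OF P]] by force
  then show "(\<lambda>x\<in>P. x) \<in> E P P"
    using sub[OF P P] conj_map_one[OF subgroup.subset[OF P]] by auto
next
  fix P Q \<phi> assume a: "subgroup P S \<and> subgroup Q S \<and> \<phi> \<in> E P Q"
  then have F: "\<phi> \<in> F P Q" using sub by blast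
  have "\<phi> \<in> Iso E P (\<phi> ` P)"
    unfolding Iso_def
  proof (intro CollectI conjI bexI)
    show "\<phi> \<in> E P (\<phi> ` P)" "hom_inv P \<phi> \<in> E (\<phi> ` P) P" using fct a by auto
    show "compose P (hom_inv P \<phi>) \<phi> = (\<lambda>x\<in>P. x)"
      using hom_inv_left a F by (auto simp: compose_def fun_eq_iff)
    show "compose (\<phi> ` P) \<phi> (hom_inv P \<phi>) = (\<lambda>x\<in>\<phi> ` P. x)"
      by (auto simp: compose_def fun_eq_iff hom_inv_right imageI)
  qed
  moreover have "\<phi> = compose P (\<lambda>x\<in>\<phi> ` P. x) \<phi>"
    using morphism(1) a F by (intro extensionalityI[of _ P]) (auto simp: compose_def)
  moreover have "subgroup (\<phi> ` P) S" "\<phi> ` P \<subseteq> Q" using factor(1) morphism(3) a F by blast+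
  ultimately show "\<exists>R \<psi>. subgroup R S \<and> R \<subseteq> Q \<and> \<psi> \<in> Iso E P R \<and> \<phi> = compose P (\<lambda>x\<in>R. x) \<psi>" by blast
next
  fix P Q assume "subgroup P S \<and> subgroup Q S"
  then show "Hom_S S P Q \<subseteq> E P Q" "E P Q \<subseteq> Inj S P Q" using sub in_Inj by blast+
qed (use cmp in blast)

section \<open>Automorphism groups\<close>

lemma Aut_Bij: "subgroup P S \<Longrightarrow> F P P \<subseteq> Bij P"
  using morphism(1,2) endo_image by (fastforce simp: Bij_def bij_betw_def)

lemma Aut_subgroup:
  assumes P: "subgroup P S"
  shows "subgroup (F P P) (BijGroup P)"
proof (rule group.subgroupI[OF group_BijGroup])
  show "F P P \<subseteq> carrier (BijGroup P)" using Aut_Bij[OF P] by (simp add: BijGroup_def)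
  show "F P P \<noteq> {}" using incl[OF P P] by blast
  show "inv\<^bsub>BijGroup P\<^esub> \<phi> \<in> F P P" if "\<phi> \<in> F P P" for \<phi>
  proof -
    have "inv\<^bsub>BijGroup P\<^esub> \<phi> = hom_inv P \<phi>"
      using that Aut_Bij[OF P] endo_image[OF P that] by (simp add: inv_BijGroup subsetD hom_inv_def)
    then show ?thesis using factor(3)[OF P P that] endo_image[OF P that] by simp
  qed
  show "\<phi> \<otimes>\<^bsub>BijGroup P\<^esub> \<psi> \<in> F P P" if "\<phi> \<in> F P P" "\<psi> \<in> F P P" for \<phi> \<psi>
  proof -
    have "\<phi> \<in> Bij P" "\<psi> \<in> Bij P" using that Aut_Bij[OF P] by auto
    then show ?thesis using comp[OF P P P that(2,1)] by (simp add: BijGroup_def)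
  qed
qed

lemma Aut_group: "subgroup P S \<Longrightarrow> group (Aut_F F P)"
  unfolding Aut_F_def by (rule group.subgroup_imp_group[OF group_BijGroup Aut_subgroup])

lemma Aut_carrier [simp]: "carrier (Aut_F F P) = F P P"
  by (simp add: Aut_F_def)

lemma Aut_one: "\<one>\<^bsub>Aut_F F P\<^esub> = (\<lambda>x\<in>P. x)"
  by (simp add: Aut_F_def BijGroup_def)

lemma Aut_mult:
  assumes "subgroup P S" "\<phi> \<in> F P P" "\<psi> \<in> F P P"
  shows "\<phi> \<otimes>\<^bsub>Aut_F F P\<^esub> \<psi> = compose P \<phi> \<psi>"
proof -
  have "\<phi> \<in> Bij P" "\<psi> \<in> Bij P" using assms Aut_Bij by auto
  then show ?thesis by (simp add: Aut_F_def BijGroup_def)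
qed

lemma Aut_inv:
  assumes P: "subgroup P S" and \<phi>: "\<phi> \<in> F P P"
  shows "inv\<^bsub>Aut_F F P\<^esub> \<phi> = hom_inv P \<phi>"
proof (rule group.inv_equality[OF Aut_group[OF P]])
  have h: "hom_inv P \<phi> \<in> F P P" using factor(3)[OF P P \<phi>] endo_image[OF P \<phi>] by simp
  show "hom_inv P \<phi> \<otimes>\<^bsub>Aut_F F P\<^esub> \<phi> = \<one>\<^bsub>Aut_F F P\<^esub>"
    unfolding Aut_mult[OF P h \<phi>] Aut_one using hom_inv_left[OF P P \<phi>] by (auto simp: compose_def fun_eq_iff)
qed (use \<phi> factor(3)[OF P P \<phi>] endo_image[OF P \<phi>] in auto)

lemma Aut_finite:
  assumes "subgroup P S"
  shows "finite (F P P)"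
proof (rule finite_subset)
  show "F P P \<subseteq> P \<rightarrow>\<^sub>E P"
    using morphism(1,4)[OF assms assms] by (auto simp: PiE_def)
  show "finite (P \<rightarrow>\<^sub>E P)" using finite_sub[OF assms] by (simp add: finite_PiE)
qed

lemma S_conj_in: "x \<in> carrier S \<Longrightarrow> conj_map S x (carrier S) \<in> F (carrier S) (carrier S)"
  by (rule conj_in[OF subgroup_self subgroup_self]) (auto simp: conj_map_def)

lemma conj_group_hom: "group_hom S (Aut_F F (carrier S)) (\<lambda>x. conj_map S x (carrier S))"
proof -
  have "conj_map S (x \<otimes> y) (carrier S) = compose (carrier S) (conj_map S x (carrier S)) (conj_map S y (carrier S))"
    if "x \<in> carrier S" "y \<in> carrier S" for x y
    using that by (auto simp: conj_map_def compose_def fun_eq_iff m_assoc inv_mult_group)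
  then have "(\<lambda>x. conj_map S x (carrier S)) \<in> hom S (Aut_F F (carrier S))"
    by (intro homI) (auto simp: S_conj_in Aut_mult[OF subgroup_self])
  then show ?thesis
    using Aut_group[OF subgroup_self] is_group by (simp add: group_hom_def group_hom_axioms_def)
qed

lemma F_conjugate_iff:
  "F_conjugate S F P P' \<longleftrightarrow> subgroup P S \<and> subgroup P' S \<and> (\<exists>\<phi>\<in>F P P'. \<phi> ` P = P')"
proof
  assume a: "F_conjugate S F P P'"
  then have P: "subgroup P S" "subgroup P' S" by (auto simp: F_conjugate_def)
  obtain \<phi> \<psi> where \<phi>: "\<phi> \<in> F P P'" "\<psi> \<in> F P' P" "compose P' \<phi> \<psi> = (\<lambda>x\<in>P'. x)"
    using a by (auto simp: F_conjugate_def Iso_def)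
  have "y \<in> \<phi> ` P" if "y \<in> P'" for y
  proof -
    have "\<phi> (\<psi> y) = y" using fun_cong[OF \<phi>(3), of y] that by (simp add: compose_def)
    then show ?thesis using morphism(4)[OF P(2,1) \<phi>(2) that] by (metis imageI)
  qed
  then show "subgroup P S \<and> subgroup P' S \<and> (\<exists>\<phi>\<in>F P P'. \<phi> ` P = P')"
    using P \<phi>(1) morphism(3)[OF P \<phi>(1)] by blast
next
  assume "subgroup P S \<and> subgroup P' S \<and> (\<exists>\<phi>\<in>F P P'. \<phi> ` P = P')"
  then obtain \<phi> where P: "subgroup P S" "subgroup P' S" and \<phi>: "\<phi> \<in> F P P'" "\<phi> ` P = P'" by blast
  have "hom_inv P \<phi> \<in> F P' P" using factor(3)[OF P \<phi>(1)] \<phi>(2) by simp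
  moreover have "compose P (hom_inv P \<phi>) \<phi> = (\<lambda>x\<in>P. x)"
    using hom_inv_left[OF P \<phi>(1)] by (auto simp: compose_def fun_eq_iff)
  moreover have "compose P' \<phi> (hom_inv P \<phi>) = (\<lambda>x\<in>P'. x)"
    using hom_inv_right[of _ \<phi> P] \<phi>(2) by (auto simp: compose_def fun_eq_iff)
  ultimately show "F_conjugate S F P P'"
    unfolding F_conjugate_def Iso_def using P \<phi>(1) by blast
qed

lemma F_conjugate_image:
  "subgroup P S \<Longrightarrow> subgroup Q S \<Longrightarrow> \<phi> \<in> F P Q \<Longrightarrow> F_conjugate S F P (\<phi> ` P)"
  unfolding F_conjugate_iff using factor(1,2) by blast

lemma F_conjugate_trans:
  assumes "F_conjugate S F P Q" "F_conjugate S F Q R"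
  shows "F_conjugate S F P R"
proof -
  obtain \<phi> \<psi> where a: "subgroup P S" "subgroup Q S" "subgroup R S" "\<phi> \<in> F P Q" "\<phi> ` P = Q" "\<psi> \<in> F Q R" "\<psi> ` Q = R"
    using assms by (auto simp: F_conjugate_iff)
  have "compose P \<psi> \<phi> ` P = R" using a by (auto simp: compose_def)
  then show ?thesis unfolding F_conjugate_iff using comp[OF a(1-3) a(4,6)] a by blast
qed

lemma F_conjugate_sym:
  assumes "F_conjugate S F P Q"
  shows "F_conjugate S F Q P"
  using assms factor(3) hom_inv_image unfolding F_conjugate_iff by metis

section \<open>Centric subgroups\<close>

lemma centric_sub: "F_centric S F P \<Longrightarrow> subgroup P S"
  by (simp add: F_centric_def)

lemma centric_conj: "F_centric S F P \<Longrightarrow> F_conjugate S F P Q \<Longrightarrow> F_centric S F Q"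
  unfolding F_centric_def using F_conjugate_trans F_conjugate_iff by blast

lemma centric_image: "F_centric S F P \<Longrightarrow> subgroup Q S \<Longrightarrow> \<phi> \<in> F P Q \<Longrightarrow> F_centric S F (\<phi> ` P)"
  using centric_conj F_conjugate_image centric_sub by blast

lemma centric_overgroup:
  assumes P: "F_centric S F P" and Q: "subgroup Q S" "P \<subseteq> Q"
  shows "F_centric S F Q"
  unfolding F_centric_def
proof (intro conjI allI impI)
  fix Q' assume "F_conjugate S F Q Q'"
  then obtain \<phi> where \<phi>: "subgroup Q' S" "\<phi> \<in> F Q Q'" "\<phi> ` Q = Q'" by (auto simp: F_conjugate_iff)
  have "F_conjugate S F P (restrict \<phi> P ` P)"
    using F_conjugate_image[OF centric_sub[OF P] \<phi>(1)] restr[OF Q(1) \<phi>(1,2) centric_sub[OF P] Q(2)] by blast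
  then have "centralizer S (\<phi> ` P) \<subseteq> \<phi> ` P"
    using P by (auto simp: F_centric_def center_of_def)
  moreover have "centralizer S Q' \<subseteq> centralizer S (\<phi> ` P)" using \<phi>(3) Q(2) by (auto simp: centralizer_def)
  ultimately have "centralizer S Q' \<subseteq> Q'" using \<phi>(3) Q(2) by blast
  then show "centralizer S Q' = center_of S Q'" by (auto simp: center_of_def)
qed (rule Q(1))

lemma centric_S: "F_centric S F (carrier S)"
  unfolding F_centric_def
proof (intro conjI allI impI subgroup_self)
  fix Q assume "F_conjugate S F (carrier S) Q"
  then obtain \<phi> where \<phi>: "subgroup Q S" "\<phi> \<in> F (carrier S) Q" "\<phi> ` carrier S = Q" by (auto simp: F_conjugate_iff)
  have "Q = carrier S"
    using endo_image[OF subgroup_self to_S[OF subgroup_self \<phi>(1,2)]] \<phi>(3) by simp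
  then show "centralizer S Q = center_of S Q" by (auto simp: center_of_def centralizer_def)
qed

section \<open>Conjugation by an automorphism of \<open>S\<close>\<close>

definition twist :: "('a \<Rightarrow> 'a) \<Rightarrow> 'a set \<Rightarrow> ('a \<Rightarrow> 'a) \<Rightarrow> 'a \<Rightarrow> 'a" where
  "twist \<beta> P \<phi> = (\<lambda>y\<in>\<beta> ` P. \<beta> (\<phi> (inv_into P \<beta> y)))"

context
  fixes \<beta> assumes \<beta>: "\<beta> \<in> F (carrier S) (carrier S)"
begin

lemma beta_inj: "P \<subseteq> carrier S \<Longrightarrow> inj_on \<beta> P"
  using morphism(2)[OF subgroup_self subgroup_self \<beta>] inj_on_subset by blast

lemma beta_mult: "x \<in> carrier S \<Longrightarrow> y \<in> carrier S \<Longrightarrow> \<beta> (x \<otimes> y) = \<beta> x \<otimes> \<beta> y"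
  using morphism(5)[OF subgroup_self subgroup_self \<beta>] .

lemma beta_closed: "x \<in> carrier S \<Longrightarrow> \<beta> x \<in> carrier S"
  using morphism(4)[OF subgroup_self subgroup_self \<beta>] .

lemma beta_restr:
  assumes "subgroup P S"
  shows "restrict \<beta> P \<in> F P (\<beta> ` P)" "subgroup (\<beta> ` P) S" "hom_inv P (restrict \<beta> P) \<in> F (\<beta> ` P) P"
proof -
  note r = restr[OF subgroup_self subgroup_self \<beta> assms subgroup.subset[OF assms]]
  have "restrict \<beta> P ` P = \<beta> ` P" by auto
  then show "restrict \<beta> P \<in> F P (\<beta> ` P)" "subgroup (\<beta> ` P) S" "hom_inv P (restrict \<beta> P) \<in> F (\<beta> ` P) P"
    using factor[OF assms subgroup_self r] by simp_all
qed

lemma twist_apply: "P \<subseteq> carrier S \<Longrightarrow> x \<in> P \<Longrightarrow> twist \<beta> P \<phi> (\<beta> x) = \<beta> (\<phi> x)"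
  using beta_inj by (simp add: twist_def)

lemma twist_in:
  assumes "subgroup P S" "subgroup Q S" "\<phi> \<in> F P Q"
  shows "twist \<beta> P \<phi> \<in> F (\<beta> ` P) (\<beta> ` Q)"
proof -
  let ?i = "hom_inv P (restrict \<beta> P)"
  have "compose (\<beta> ` P) \<phi> ?i \<in> F (\<beta> ` P) Q"
    by (rule comp[OF beta_restr(2)[OF assms(1)] assms(1,2) beta_restr(3)[OF assms(1)] assms(3)])
  then have "compose (\<beta> ` P) (restrict \<beta> Q) (compose (\<beta> ` P) \<phi> ?i) \<in> F (\<beta> ` P) (\<beta> ` Q)"
    using comp[OF beta_restr(2)[OF assms(1)] assms(2) beta_restr(2)[OF assms(2)] _ beta_restr(1)[OF assms(2)]] by blast
  moreover have "compose (\<beta> ` P) (restrict \<beta> Q) (compose (\<beta> ` P) \<phi> ?i) = twist \<beta> P \<phi>"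
  proof (rule extensionalityI[of _ "\<beta> ` P"])
    fix y assume "y \<in> \<beta> ` P"
    then obtain x where x: "x \<in> P" "y = \<beta> x" by blast
    have "?i (\<beta> x) = x"
      using hom_inv_left[OF assms(1) beta_restr(2,1)[OF assms(1)] x(1)] x(1) by simp
    then show "compose (\<beta> ` P) (restrict \<beta> Q) (compose (\<beta> ` P) \<phi> ?i) y = twist \<beta> P \<phi> y"
      using x morphism(4)[OF assms x(1)] twist_apply[OF subgroup.subset[OF assms(1)] x(1)]
      by (simp add: compose_def)
  qed (auto simp: twist_def)
  ultimately show ?thesis by simp
qed

lemma twist_comp:
  assumes "subgroup P S" "subgroup Q S" "\<phi> \<in> F P Q"
  shows "twist \<beta> P (compose P \<psi> \<phi>) = compose (\<beta> ` P) (twist \<beta> Q \<psi>) (twist \<beta> P \<phi>)"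
proof (rule extensionalityI[of _ "\<beta> ` P"])
  fix y assume "y \<in> \<beta> ` P"
  then obtain x where x: "x \<in> P" "y = \<beta> x" by blast
  show "twist \<beta> P (compose P \<psi> \<phi>) y = compose (\<beta> ` P) (twist \<beta> Q \<psi>) (twist \<beta> P \<phi>) y"
    using x twist_apply[OF subgroup.subset[OF assms(1)] x(1)] twist_apply[OF subgroup.subset[OF assms(2)] morphism(4)[OF assms x(1)]]
    by (simp add: compose_def)
qed (auto simp: twist_def)

lemma twist_image: "P \<subseteq> carrier S \<Longrightarrow> twist \<beta> P \<phi> ` \<beta> ` P = \<beta> ` \<phi> ` P"
  using twist_apply by (force simp: image_iff)

lemma twist_hom_inv:
  assumes "subgroup P S" "subgroup Q S" "\<phi> \<in> F P Q"
  shows "twist \<beta> (\<phi> ` P) (hom_inv P \<phi>) = hom_inv (\<beta> ` P) (twist \<beta> P \<phi>)"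
proof (rule extensionalityI[of _ "\<beta> ` \<phi> ` P"])
  note im = twist_image[OF subgroup.subset[OF assms(1)], of \<phi>]
  show "hom_inv (\<beta> ` P) (twist \<beta> P \<phi>) \<in> extensional (\<beta> ` \<phi> ` P)" by (simp add: hom_inv_def im)
  fix y assume "y \<in> \<beta> ` \<phi> ` P"
  then obtain x where x: "x \<in> P" "y = \<beta> (\<phi> x)" by blast
  have "hom_inv (\<beta> ` P) (twist \<beta> P \<phi>) (twist \<beta> P \<phi> (\<beta> x)) = \<beta> x"
    by (rule hom_inv_left[OF beta_restr(2)[OF assms(1)] beta_restr(2)[OF assms(2)] twist_in[OF assms]]) (use x in simp)
  then show "twist \<beta> (\<phi> ` P) (hom_inv P \<phi>) y = hom_inv (\<beta> ` P) (twist \<beta> P \<phi>) y"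
    using x twist_apply[OF subgroup.subset[OF assms(1)] x(1)] hom_inv_left[OF assms x(1)]
      twist_apply[OF subgroup.subset[OF factor(1)[OF assms]], of "\<phi> x" "hom_inv P \<phi>"] by simp
qed (simp add: twist_def)

lemma twist_conj:
  assumes "subgroup P S" "x \<in> carrier S"
  shows "twist \<beta> P (conj_map S x P) = conj_map S (\<beta> x) (\<beta> ` P)"
proof (rule extensionalityI[of _ "\<beta> ` P"])
  interpret h: group_hom S S \<beta>
    using beta_mult beta_closed by (simp add: group_hom_def group_hom_axioms_def hom_def is_group)
  fix y assume "y \<in> \<beta> ` P"
  then obtain z where z: "z \<in> P" "y = \<beta> z" by blast
  then have "z \<in> carrier S" using subgroup.subset[OF assms(1)] by blast
  then show "twist \<beta> P (conj_map S x P) y = conj_map S (\<beta> x) (\<beta> ` P) y"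
    using z twist_apply[OF subgroup.subset[OF assms(1)] z(1)] assms(2) by (simp add: conj_map_def)
qed (auto simp: twist_def conj_map_def)

lemma twist_group_hom:
  assumes P: "subgroup P S"
  shows "group_hom (Aut_F F P) (Aut_F F (\<beta> ` P)) (twist \<beta> P)"
proof -
  have "twist \<beta> P \<in> hom (Aut_F F P) (Aut_F F (\<beta> ` P))"
    by (rule homI) (use P twist_in[OF P P] twist_comp[OF P P] beta_restr(2)[OF P] in \<open>simp_all add: Aut_mult comp\<close>)
  then show ?thesis
    by (simp add: group_hom_def group_hom_axioms_def Aut_group P beta_restr(2)[OF P])
qed

end

end

section \<open>The fusion system \<open>O\<^sup>p\<^sup>'\<^sub>*(F)\<close>\<close>

locale fusion_prime = fusion +
  fixes p :: nat
begin

abbreviation E :: "'a homs" where "E \<equiv> O_p'_star p S F"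

definition admissible :: "'a homs \<Rightarrow> bool" where
  "admissible H \<longleftrightarrow> fusion_system S H \<and> (\<forall>P Q. subgroup P S \<and> subgroup Q S \<longrightarrow> H P Q \<subseteq> F P Q) \<and>
     (\<forall>P. subgroup P S \<longrightarrow> O_p' p (Aut_F F P) \<subseteq> H P P)"

lemma E_eq: "E P Q = \<Inter> {H P Q | H. admissible H}"
  by (simp add: O_p'_star_def admissible_def)

lemma E_least: "admissible H \<Longrightarrow> E P Q \<subseteq> H P Q"
  unfolding E_eq by blast

lemma admissible_F: "admissible F"
proof -
  have "O_p' p (Aut_F F P) \<subseteq> F P P" if "subgroup P S" for P
    using group.O_p'_subset[OF Aut_group[OF that], of p] by simp
  then show ?thesis
    using fusion unfolding admissible_def by blast
qed

lemma E_F: "E P Q \<subseteq> F P Q"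
  by (rule E_least[OF admissible_F])

lemma admissible_fusion: "admissible H \<Longrightarrow> fusion S H"
  by (simp add: admissible_def fusion_def fusion_axioms_def finite_S is_group)

lemma E_fusion_system: "fusion_system S E"
proof (rule fusion_systemI)
  fix P Q assume PQ: "subgroup P S" "subgroup Q S"
  show "Hom_S S P Q \<subseteq> E P Q \<and> E P Q \<subseteq> F P Q"
    using PQ E_F unfolding E_eq admissible_def fusion_system_def by blast
next
  fix P Q R \<phi> \<psi> assume a: "subgroup P S" "subgroup Q S" "subgroup R S" "\<phi> \<in> E P Q" "\<psi> \<in> E Q R"
  show "compose P \<psi> \<phi> \<in> E P R"
    unfolding E_eq
  proof clarify
    fix H assume H: "admissible H"
    then have "\<phi> \<in> H P Q" "\<psi> \<in> H Q R" using a(4,5) E_least by blast+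
    then show "compose P \<psi> \<phi> \<in> H P R" using fusion.comp[OF admissible_fusion[OF H]] a(1-3) by blast
  qed
next
  fix P Q \<phi> assume a: "subgroup P S" "subgroup Q S" "\<phi> \<in> E P Q"
  have "\<phi> \<in> H P (\<phi> ` P) \<and> hom_inv P \<phi> \<in> H (\<phi> ` P) P" if H: "admissible H" for H
    using fusion.factor(2,3)[OF admissible_fusion[OF H] a(1,2)] E_least[OF H] a(3) by blast
  then show "\<phi> \<in> E P (\<phi> ` P) \<and> hom_inv P \<phi> \<in> E (\<phi> ` P) P"
    unfolding E_eq by blast
qed

sublocale E: fusion S E
  by (simp add: fusion_def fusion_axioms_def finite_S is_group E_fusion_system)

lemma O_p'_in_E: "subgroup P S \<Longrightarrow> O_p' p (Aut_F F P) \<subseteq> E P P"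
  unfolding E_eq admissible_def by blast

text \<open>\<open>O\<^sup>p\<^sup>'\<^sub>*(F)\<close> is stable under conjugation by automorphisms of \<open>S\<close>: the morphisms whose conjugates lie in
  \<open>O\<^sup>p\<^sup>'\<^sub>*(F)\<close> form a fusion system that competes for being the smallest one.\<close>

lemma E_twist:
  assumes \<beta>: "\<beta> \<in> F (carrier S) (carrier S)" and PQ: "subgroup P S" "subgroup Q S" and \<phi>: "\<phi> \<in> E P Q"
  shows "twist \<beta> P \<phi> \<in> E (\<beta> ` P) (\<beta> ` Q)"
proof -
  define H where "H P Q = {\<phi> \<in> F P Q. twist \<beta> P \<phi> \<in> E (\<beta> ` P) (\<beta> ` Q)}" for P Q
  note sub = beta_restr(2)[OF \<beta>]
  have "fusion_system S H"
  proof (rule fusion_systemI)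
    fix P Q assume PQ: "subgroup P S" "subgroup Q S"
    have "conj_map S x P \<in> H P Q" if x: "x \<in> carrier S" "conj_map S x P ` P \<subseteq> Q" for x
    proof -
      have "conj_map S (\<beta> x) (\<beta> ` P) ` \<beta> ` P \<subseteq> \<beta> ` Q"
        using twist_image[OF \<beta> subgroup.subset[OF PQ(1)], of "conj_map S x P"] x(2)
        unfolding twist_conj[OF \<beta> PQ(1) x(1)] by blast
      then have "conj_map S (\<beta> x) (\<beta> ` P) \<in> E (\<beta> ` P) (\<beta> ` Q)"
        using E.conj_in sub PQ beta_closed[OF \<beta> x(1)] by blast
      then show ?thesis
        using conj_in[OF PQ x] by (simp add: H_def twist_conj[OF \<beta> PQ(1) x(1)])
    qed
    then show "Hom_S S P Q \<subseteq> H P Q \<and> H P Q \<subseteq> F P Q" by (auto simp: Hom_S_def H_def)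
  next
    fix P Q R \<phi> \<psi> assume a: "subgroup P S" "subgroup Q S" "subgroup R S" "\<phi> \<in> H P Q" "\<psi> \<in> H Q R"
    then have f: "\<phi> \<in> F P Q" "\<psi> \<in> F Q R" by (auto simp: H_def)
    show "compose P \<psi> \<phi> \<in> H P R"
      using comp[OF a(1-3) f] E.comp[OF sub[OF a(1)] sub[OF a(2)] sub[OF a(3)]] a(4,5)
      by (simp add: H_def twist_comp[OF \<beta> a(1,2) f(1)])
  next
    fix P Q \<phi> assume a: "subgroup P S" "subgroup Q S" "\<phi> \<in> H P Q"
    then have f: "\<phi> \<in> F P Q" "twist \<beta> P \<phi> \<in> E (\<beta> ` P) (\<beta> ` Q)" by (auto simp: H_def)
    show "\<phi> \<in> H P (\<phi> ` P) \<and> hom_inv P \<phi> \<in> H (\<phi> ` P) P"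
      using factor(2,3)[OF a(1,2) f(1)] E.factor(2,3)[OF sub[OF a(1)] sub[OF a(2)] f(2)]
      by (simp add: H_def twist_hom_inv[OF \<beta> a(1,2) f(1)] twist_image[OF \<beta> subgroup.subset[OF a(1)]])
  qed
  moreover have "O_p' p (Aut_F F P) \<subseteq> H P P" if P: "subgroup P S" for P
    using group_hom.O_p'_image[OF twist_group_hom[OF \<beta> P], of p] O_p'_in_E[OF sub[OF P]] O_p'_in_E[OF P] E_F
    unfolding H_def by blast
  ultimately have "admissible H" unfolding admissible_def H_def by blast
  then show ?thesis using E_least[of H P Q] \<phi> by (auto simp: H_def)
qed

text \<open>Morphisms that are an \<open>O\<^sup>p\<^sup>'\<^sub>*(F)\<close>-morphism followed by an automorphism of \<open>S\<close>.\<close>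

definition decomposes :: "'a set \<Rightarrow> ('a \<Rightarrow> 'a) \<Rightarrow> ('a \<Rightarrow> 'a) \<Rightarrow> bool" where
  "decomposes P \<phi> \<alpha> \<longleftrightarrow> \<alpha> \<in> F (carrier S) (carrier S) \<and> (\<exists>e\<in>E P (carrier S). \<phi> = compose P \<alpha> e)"

lemma decomposes_E: "e \<in> E P (carrier S) \<Longrightarrow> subgroup P S \<Longrightarrow> decomposes P e (\<lambda>x\<in>carrier S. x)"
  unfolding decomposes_def using incl[OF subgroup_self subgroup_self] E.morphism(1,4)[OF _ subgroup_self]
  by (auto simp: compose_def intro!: bexI[of _ e] extensionalityI[of _ P])

lemma decomposes_self: "\<alpha> \<in> F (carrier S) (carrier S) \<Longrightarrow> decomposes (carrier S) \<alpha> \<alpha>"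
  unfolding decomposes_def using E.incl[OF subgroup_self subgroup_self] morphism(1)[OF subgroup_self subgroup_self]
  by (auto simp: compose_def intro!: bexI[of _ "\<lambda>x\<in>carrier S. x"] extensionalityI[of _ "carrier S"])

lemma decomposes_restr:
  assumes "decomposes P \<phi> \<alpha>" "subgroup P S" "subgroup Q S" "Q \<subseteq> P"
  shows "decomposes Q (restrict \<phi> Q) \<alpha>"
proof -
  obtain e where e: "e \<in> E P (carrier S)" "\<phi> = compose P \<alpha> e" using assms(1) by (auto simp: decomposes_def)
  have "restrict \<phi> Q = compose Q \<alpha> (restrict e Q)" using assms(4) by (auto simp: e(2) compose_def fun_eq_iff)
  then show ?thesis
    using assms(1) E.restr[OF assms(2) subgroup_self e(1) assms(3,4)] by (auto simp: decomposes_def)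
qed

text \<open>\<open>\<beta> f \<alpha> e = \<beta> \<alpha> (\<alpha>\<^sup>-\<^sup>1 f \<alpha>) e\<close>, and the conjugate of \<open>f\<close> stays in \<open>O\<^sup>p\<^sup>'\<^sub>*(F)\<close>.\<close>

lemma decomposes_comp:
  assumes \<phi>: "decomposes P \<phi> \<alpha>" and \<psi>: "decomposes Q \<psi> \<beta>" and P: "subgroup P S" and Q: "subgroup Q S" and im: "\<phi> ` P \<subseteq> Q"
  shows "decomposes P (compose P \<psi> \<phi>) (compose (carrier S) \<beta> \<alpha>)"
proof -
  obtain e where e: "e \<in> E P (carrier S)" "\<phi> = compose P \<alpha> e" and \<alpha>: "\<alpha> \<in> F (carrier S) (carrier S)"
    using \<phi> by (auto simp: decomposes_def)
  obtain f where f: "f \<in> E Q (carrier S)" "\<psi> = compose Q \<beta> f" and \<beta>: "\<beta> \<in> F (carrier S) (carrier S)"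
    using \<psi> by (auto simp: decomposes_def)
  let ?\<gamma> = "hom_inv (carrier S) \<alpha>"
  have \<alpha>S: "\<alpha> ` carrier S = carrier S" by (rule endo_image[OF subgroup_self \<alpha>])
  have \<gamma>: "?\<gamma> \<in> F (carrier S) (carrier S)" using factor(3)[OF subgroup_self subgroup_self \<alpha>] \<alpha>S by simp
  note sQ = beta_restr(2)[OF \<gamma> Q]
  have tw: "twist ?\<gamma> Q f \<in> E (?\<gamma> ` Q) (?\<gamma> ` carrier S)" by (rule E_twist[OF \<gamma> Q subgroup_self f(1)])
  have eS: "e x \<in> carrier S" if "x \<in> P" for x using E.morphism(4)[OF P subgroup_self e(1) that] .
  have \<gamma>\<alpha>: "?\<gamma> (\<alpha> (e x)) = e x" if "x \<in> P" for x
    using hom_inv_left[OF subgroup_self subgroup_self \<alpha> eS[OF that]] .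
  have inQ: "\<alpha> (e x) \<in> Q" if "x \<in> P" for x using im that by (auto simp: e(2) compose_def)
  have "e ` P \<subseteq> ?\<gamma> ` Q" using \<gamma>\<alpha> inQ by (metis image_eqI image_subsetI)
  then have e': "e \<in> E P (?\<gamma> ` Q)" by (rule E.retarget[OF P subgroup_self e(1) sQ])
  have g: "compose P (twist ?\<gamma> Q f) e \<in> E P (carrier S)"
    using E.to_S[OF P _ E.comp[OF P sQ _ e' tw]] beta_restr(2)[OF \<gamma> subgroup_self] by blast
  have "compose P \<psi> \<phi> = compose P (compose (carrier S) \<beta> \<alpha>) (compose P (twist ?\<gamma> Q f) e)"
  proof (rule extensionalityI[of _ P])
    fix x assume x: "x \<in> P"
    have fq: "f (\<alpha> (e x)) \<in> carrier S" using E.morphism(4)[OF Q subgroup_self f(1) inQ[OF x]] .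
    have "twist ?\<gamma> Q f (e x) = ?\<gamma> (f (\<alpha> (e x)))"
      using twist_apply[OF \<gamma> subgroup.subset[OF Q] inQ[OF x], of f] \<gamma>\<alpha>[OF x] by simp
    moreover have "\<alpha> (?\<gamma> (f (\<alpha> (e x)))) = f (\<alpha> (e x))"
      by (rule hom_inv_right) (use fq \<alpha>S in simp)
    moreover have "?\<gamma> (f (\<alpha> (e x))) \<in> carrier S" using morphism(4)[OF subgroup_self subgroup_self \<gamma> fq] .
    ultimately show "compose P \<psi> \<phi> x = compose P (compose (carrier S) \<beta> \<alpha>) (compose P (twist ?\<gamma> Q f) e) x"
      using x inQ[OF x] by (simp add: compose_def e(2) f(2))
  qed auto
  then show ?thesis
    unfolding decomposes_def using g comp[OF subgroup_self subgroup_self subgroup_self \<alpha> \<beta>] by blast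
qed

lemma decomposes_inv:
  assumes \<phi>: "decomposes P \<phi> \<alpha>" and P: "subgroup P S" and F: "\<phi> \<in> F P (carrier S)"
  shows "decomposes (\<phi> ` P) (hom_inv P \<phi>) (hom_inv (carrier S) \<alpha>)"
proof -
  obtain e where e: "e \<in> E P (carrier S)" "\<phi> = compose P \<alpha> e" and \<alpha>: "\<alpha> \<in> F (carrier S) (carrier S)"
    using \<phi> by (auto simp: decomposes_def)
  let ?\<gamma> = "hom_inv (carrier S) \<alpha>"
  have \<alpha>S: "\<alpha> ` carrier S = carrier S" by (rule endo_image[OF subgroup_self \<alpha>])
  have \<gamma>: "?\<gamma> \<in> F (carrier S) (carrier S)" using factor(3)[OF subgroup_self subgroup_self \<alpha>] \<alpha>S by simp
  have eS: "e x \<in> carrier S" if "x \<in> P" for x using E.morphism(4)[OF P subgroup_self e(1) that] .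
  have im: "\<phi> ` P = \<alpha> ` e ` P" by (auto simp: e(2) compose_def)
  note i = E.factor[OF P subgroup_self e(1)]
  have tw: "twist \<alpha> (e ` P) (hom_inv P e) \<in> E (\<phi> ` P) (\<alpha> ` P)"
    unfolding im by (rule E_twist[OF \<alpha> i(1) P i(3)])
  have "hom_inv P \<phi> = compose (\<phi> ` P) ?\<gamma> (twist \<alpha> (e ` P) (hom_inv P e))"
  proof (rule extensionalityI[of _ "\<phi> ` P"])
    fix y assume "y \<in> \<phi> ` P"
    then obtain x where x: "x \<in> P" "y = \<phi> x" by blast
    have "x \<in> carrier S" using x(1) subgroup.subset[OF P] by blast
    then have "?\<gamma> (\<alpha> x) = x" by (rule hom_inv_left[OF subgroup_self subgroup_self \<alpha>])
    moreover have "\<phi> x = \<alpha> (e x)" using x(1) by (simp add: e(2) compose_def)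
    moreover have "twist \<alpha> (e ` P) (hom_inv P e) (\<alpha> (e x)) = \<alpha> x"
      using twist_apply[OF \<alpha> subgroup.subset[OF i(1)], of "e x" "hom_inv P e"] x(1)
        E.hom_inv_left[OF P subgroup_self e(1) x(1)] by simp
    ultimately show "hom_inv P \<phi> y = compose (\<phi> ` P) ?\<gamma> (twist \<alpha> (e ` P) (hom_inv P e)) y"
      using x hom_inv_left[OF P subgroup_self F x(1)] imageI[OF x(1), of \<phi>] by (simp add: compose_def)
  qed (auto simp: hom_inv_def)
  moreover have "twist \<alpha> (e ` P) (hom_inv P e) \<in> E (\<phi> ` P) (carrier S)"
    by (rule E.to_S[OF factor(1)[OF P subgroup_self F] beta_restr(2)[OF \<alpha> P] tw])
  ultimately show ?thesis unfolding decomposes_def using \<gamma> by blast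
qed

end

section \<open>Saturated fusion systems\<close>

locale saturated_fusion = fusion_prime +
  assumes p: "prime p" and p_group: "finite_p_group p S" and saturated: "saturated p S F"
begin

lemma card_sub: "subgroup P S \<Longrightarrow> \<exists>k. card P = p ^ k"
  using p_group card_subgroup_dvd divides_primepow_nat[OF p] unfolding finite_p_group_def by metis

lemma fully_normalized_exists:
  assumes "subgroup P S"
  obtains Q where "F_conjugate S F P Q" "fully_normalized S F Q"
proof -
  let ?C = "{Q. F_conjugate S F P Q}"
  have "?C \<subseteq> Pow (carrier S)" using subgroup.subset by (auto simp: F_conjugate_def)
  then have fin: "finite ?C" using finite_S finite_subset by blast
  have "P \<in> ?C" unfolding F_conjugate_iff using assms incl[OF assms assms] by (auto intro!: bexI[of _ "\<lambda>x\<in>P. x"])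
  then have "Max ((\<lambda>R. card (normalizer S R)) ` ?C) \<in> (\<lambda>R. card (normalizer S R)) ` ?C"
    using fin by (intro Max_in) auto
  then obtain Q where Q: "Q \<in> ?C" "Max ((\<lambda>R. card (normalizer S R)) ` ?C) = card (normalizer S Q)"
    by blast
  have max: "card (normalizer S R) \<le> card (normalizer S Q)" if "R \<in> ?C" for R
    unfolding Q(2)[symmetric] using fin that by (intro Max_ge) auto
  have "subgroup Q S" using Q(1) by (simp add: F_conjugate_def)
  then have "fully_normalized S F Q"
    unfolding fully_normalized_def using max F_conjugate_trans Q(1) by blast
  then show ?thesis using that Q(1) by blast
qed

lemma conj_map_in_Aut:
  assumes P: "subgroup P S" and g: "g \<in> normalizer S P"
  shows "conj_map S g P \<in> F P P"
proof (rule conj_in[OF P P])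
  show "g \<in> carrier S" "conj_map S g P ` P \<subseteq> P"
    using g normalizer_iff[OF subgroup.subset[OF P] finite_sub[OF P]] by (auto simp: conj_map_def)
qed

text \<open>This replaces Alperin's fusion theorem. The automorphisms of \<open>Q\<close> induced by \<open>N\<^sub>S(P)\<close> via \<open>\<psi>\<close> form a
  \<open>p\<close>-group, which some element of \<open>O\<^sup>p\<^sup>'(Aut(Q))\<close> conjugates into the Sylow subgroup \<open>Aut\<^sub>S(Q)\<close>. After
  that correction \<open>\<psi>\<close> extends to all of \<open>N\<^sub>S(P)\<close>.\<close>

lemma extend_to_normalizer:
  assumes P: "subgroup P S" and Q: "fully_normalized S F Q" and \<psi>: "\<psi> \<in> F P Q" "\<psi> ` P = Q"
  obtains \<eta> \<psi>' where "\<eta> \<in> O_p' p (Aut_F F Q)" "\<psi>' \<in> F (normalizer S P) (carrier S)"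
    "restrict \<psi>' P = compose P \<eta> \<psi>"
proof -
  have Qs: "subgroup Q S" using Q by (simp add: fully_normalized_def)
  have cent: "fully_centralized S F Q" and syl: "sylow_subgroup p (Aut_S S Q) (Aut_F F Q)"
    using saturated Q unfolding saturated_def by blast+
  let ?N = "normalizer S P"
  have N: "subgroup ?N S" by (rule normalizer_imp_subgroup[OF subgroup.subset[OF P]])
  have Nc: "g \<in> carrier S" "\<And>x. x \<in> P \<Longrightarrow> g \<otimes> x \<otimes> inv g \<in> P" if "g \<in> ?N" for g
    using that normalizer_iff[OF subgroup.subset[OF P] finite_sub[OF P]] by auto
  have Pc: "x \<in> carrier S" if "x \<in> P" for x using that subgroup.subset[OF P] by blast
  interpret A: group "Aut_F F Q" by (rule Aut_group[OF Qs])
  define i where "i = hom_inv P \<psi>"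
  have i: "i \<in> F Q P" using factor(3)[OF P Qs \<psi>(1)] \<psi>(2) by (simp add: i_def)
  have i\<psi>: "i (\<psi> x) = x" if "x \<in> P" for x using hom_inv_left[OF P Qs \<psi>(1) that] by (simp add: i_def)
  have \<psi>i: "\<psi> (i y) = y" if "y \<in> Q" for y using hom_inv_right[of y \<psi> P] that \<psi>(2) by (simp add: i_def)
  define r where "r g = compose Q \<psi> (compose Q (conj_map S g P) i)" for g
  have rA: "r g \<in> F Q Q" if "g \<in> ?N" for g
    unfolding r_def using comp[OF Qs P Qs comp[OF Qs P P i conj_map_in_Aut[OF P that]] \<psi>(1)] .
  have rap: "r g y = \<psi> (g \<otimes> i y \<otimes> inv g)" if "y \<in> Q" for g y
    using that morphism(4)[OF Qs P i that] by (simp add: r_def compose_def conj_map_def)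
  have rhom: "r \<in> hom (S\<lparr>carrier := ?N\<rparr>) (Aut_F F Q)"
  proof (rule homI)
    fix g h assume gh: "g \<in> carrier (S\<lparr>carrier := ?N\<rparr>)" "h \<in> carrier (S\<lparr>carrier := ?N\<rparr>)"
    then have gh': "g \<in> ?N" "h \<in> ?N" by auto
    have "r (g \<otimes> h) = compose Q (r g) (r h)"
    proof (rule extensionalityI[of _ Q])
      fix y assume y: "y \<in> Q"
      then have iy: "i y \<in> P" using morphism(4)[OF Qs P i] by blast
      have hy: "h \<otimes> i y \<otimes> inv h \<in> P" using Nc(2)[OF gh'(2) iy] .
      have "r h y \<in> Q" using morphism(4)[OF Qs Qs rA[OF gh'(2)] y] .
      then have "r g (r h y) = \<psi> (g \<otimes> (h \<otimes> i y \<otimes> inv h) \<otimes> inv g)"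
        using rap y i\<psi>[OF hy] by simp
      also have "g \<otimes> (h \<otimes> i y \<otimes> inv h) \<otimes> inv g = (g \<otimes> h) \<otimes> i y \<otimes> inv (g \<otimes> h)"
        using Nc(1)[OF gh'(1)] Nc(1)[OF gh'(2)] Pc[OF iy] by (simp add: m_assoc inv_mult_group)
      finally show "r (g \<otimes> h) y = compose Q (r g) (r h) y"
        using y rap[OF y] by (simp add: compose_def)
    qed (auto simp: r_def)
    then show "r (g \<otimes>\<^bsub>S\<lparr>carrier := ?N\<rparr>\<^esub> h) = r g \<otimes>\<^bsub>Aut_F F Q\<^esub> r h"
      using Aut_mult[OF Qs rA[OF gh'(1)] rA[OF gh'(2)]] by simp
  qed (simp add: rA)
  interpret r: group_hom "S\<lparr>carrier := ?N\<rparr>" "Aut_F F Q" r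
    using rhom by (simp add: group_hom_def group_hom_axioms_def subgroup_imp_group[OF N] A.is_group)
  have R: "subgroup (r ` ?N) (Aut_F F Q)" using r.img_is_subgroup by simp
  let ?K = "kernel (S\<lparr>carrier := ?N\<rparr>) (Aut_F F Q) r"
  have "card (rcosets\<^bsub>S\<lparr>carrier := ?N\<rparr>\<^esub> ?K) = card (r ` ?N)"
    using bij_betw_same_card[OF r.bij_rcosets_kernel] by simp
  moreover have "card (rcosets\<^bsub>S\<lparr>carrier := ?N\<rparr>\<^esub> ?K) * card ?K = card ?N"
    using r.G.lagrange[OF r.subgroup_kernel] by (simp add: order_def)
  ultimately have "card (r ` ?N) dvd card ?N" by (metis dvd_triv_left)
  then obtain k where k: "card (r ` ?N) = p ^ k"
    using card_sub[OF N] divides_primepow_nat[OF p] by metis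
  obtain \<eta> where \<eta>: "\<eta> \<in> O_p' p (Aut_F F Q)"
    "\<And>f. f \<in> r ` ?N \<Longrightarrow> \<eta> \<otimes>\<^bsub>Aut_F F Q\<^esub> f \<otimes>\<^bsub>Aut_F F Q\<^esub> inv\<^bsub>Aut_F F Q\<^esub> \<eta> \<in> Aut_S S Q"
    using A.sylow_conjugate_in_O_p'[OF p syl R k] by blast
  have \<eta>F: "\<eta> \<in> F Q Q" using \<eta>(1) A.O_p'_subset[of p] by auto
  have \<eta>Q: "\<eta> ` Q = Q" by (rule endo_image[OF Qs \<eta>F])
  let ?\<phi> = "compose P \<eta> \<psi>" and ?j = "hom_inv Q \<eta>"
  have j: "?j \<in> F Q Q" using factor(3)[OF Qs Qs \<eta>F] \<eta>Q by simp
  have \<phi>: "?\<phi> \<in> F P Q" by (rule comp[OF P Qs Qs \<psi>(1) \<eta>F])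
  have \<phi>S: "?\<phi> \<in> F P (carrier S)" by (rule to_S[OF P Qs \<phi>])
  have \<phi>P: "?\<phi> ` P = Q" using \<psi>(2) \<eta>Q by (auto simp: compose_def)
  have "N_phi S P ?\<phi> = ?N"
  proof -
    have "(\<lambda>y\<in>?\<phi> ` P. ?\<phi> (conj_map S g P (inv_into P ?\<phi> y))) \<in> Aut_S S (?\<phi> ` P)" if g: "g \<in> ?N" for g
    proof -
      have "(\<lambda>y\<in>Q. ?\<phi> (conj_map S g P (inv_into P ?\<phi> y))) =
          \<eta> \<otimes>\<^bsub>Aut_F F Q\<^esub> r g \<otimes>\<^bsub>Aut_F F Q\<^esub> inv\<^bsub>Aut_F F Q\<^esub> \<eta>"
        unfolding Aut_inv[OF Qs \<eta>F] Aut_mult[OF Qs \<eta>F rA[OF g]] Aut_mult[OF Qs comp[OF Qs Qs Qs rA[OF g] \<eta>F] j]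
      proof (rule extensionalityI[of _ Q])
        fix y assume y: "y \<in> Q"
        have jy: "?j y \<in> Q" using morphism(4)[OF Qs Qs j y] .
        have x: "i (?j y) \<in> P" using morphism(4)[OF Qs P i jy] .
        have "?\<phi> (i (?j y)) = y"
          using x \<psi>i[OF jy] hom_inv_right[of y \<eta> Q] y \<eta>Q by (simp add: compose_def)
        then have "inv_into P ?\<phi> y = i (?j y)"
          using inv_into_f_eq[OF morphism(2)[OF P Qs \<phi>] x] by blast
        then show "(\<lambda>y\<in>Q. ?\<phi> (conj_map S g P (inv_into P ?\<phi> y))) y = compose Q (compose Q \<eta> (r g)) ?j y"
          using y jy x Nc(2)[OF g x] rap[OF jy] by (simp add: compose_def conj_map_def)
      qed auto
      then show ?thesis using \<eta>(2) g \<phi>P by simp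
    qed
    then show ?thesis by (auto simp: N_phi_def)
  qed
  moreover have "\<exists>\<psi>' \<in> F (N_phi S P ?\<phi>) (carrier S). restrict \<psi>' P = ?\<phi>"
    using saturated P \<phi>S cent \<phi>P unfolding saturated_def by metis
  ultimately show ?thesis using that \<eta>(1) by metis
qed

text \<open>By downward induction on the order of \<open>P\<close>: compare both \<open>P\<close> and \<open>\<phi>(P)\<close> with a fully normalized conjugate, and
  extend both comparisons to the normalizers, which are larger.\<close>

lemma decomposition:
  "F_centric S F P \<Longrightarrow> \<phi> \<in> F P (carrier S) \<Longrightarrow> \<exists>\<alpha>. decomposes P \<phi> \<alpha>"
proof (induction "card (carrier S) - card P" arbitrary: P \<phi> rule: less_induct)
  case less
  have P: "subgroup P S" by (rule centric_sub[OF less.prems(1)])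
  show ?case
  proof (cases "P = carrier S")
    case True
    then show ?thesis using decomposes_self less.prems(2) by blast
  next
    case False
    have to_normalized: "\<exists>\<alpha>. decomposes R \<psi> \<alpha>"
      if R: "F_centric S F R" "card R = card P" and Q: "fully_normalized S F Q" and \<psi>: "\<psi> \<in> F R Q" "\<psi> ` R = Q" for R Q \<psi>
    proof -
      have Rs: "subgroup R S" by (rule centric_sub[OF R(1)])
      have Qs: "subgroup Q S" using Q by (simp add: fully_normalized_def)
      interpret A: group "Aut_F F Q" by (rule Aut_group[OF Qs])
      have RS: "R \<noteq> carrier S"
        using R(2) False card_subset_eq[OF finite_S subgroup.subset[OF P]] by auto
      let ?N = "normalizer S R"
      have N: "subgroup ?N S" by (rule normalizer_imp_subgroup[OF subgroup.subset[OF Rs]])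
      have RN: "R \<subset> ?N"
        using p_group_normalizer_grows[OF finite_S p _ Rs RS] p_group by (auto simp: finite_p_group_def)
      obtain \<eta> \<psi>' where \<eta>: "\<eta> \<in> O_p' p (Aut_F F Q)" and \<psi>': "\<psi>' \<in> F ?N (carrier S)" "restrict \<psi>' R = compose R \<eta> \<psi>"
        by (rule extend_to_normalizer[OF Rs Q \<psi>])
      have \<eta>E: "\<eta> \<in> E Q Q" using O_p'_in_E[OF Qs] \<eta> by blast
      have "card P < card ?N" "card ?N \<le> card (carrier S)"
        using psubset_card_mono[OF finite_sub[OF N] RN] R(2) card_mono[OF finite_S subgroup.subset[OF N]] by auto
      then have "card (carrier S) - card ?N < card (carrier S) - card P" by simp
      then obtain \<alpha> where "decomposes ?N \<psi>' \<alpha>"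
        using less.hyps[OF _ centric_overgroup[OF R(1) N] \<psi>'(1)] RN by blast
      then have d1: "decomposes R (compose R \<eta> \<psi>) \<alpha>"
        using decomposes_restr[OF _ N Rs] RN \<psi>'(2) by fastforce
      have \<eta>Q: "\<eta> ` Q = Q" by (rule E.endo_image[OF Qs \<eta>E])
      have "hom_inv Q \<eta> \<in> E Q Q" using E.factor(3)[OF Qs Qs \<eta>E] \<eta>Q by simp
      then have d2: "decomposes Q (hom_inv Q \<eta>) (\<lambda>x\<in>carrier S. x)"
        using decomposes_E[OF E.to_S[OF Qs Qs] Qs] by blast
      have "compose R \<eta> \<psi> ` R \<subseteq> Q" using \<psi>(2) \<eta>Q by (auto simp: compose_def)
      from decomposes_comp[OF d1 d2 Rs Qs this]
      have "\<exists>\<alpha>. decomposes R (compose R (hom_inv Q \<eta>) (compose R \<eta> \<psi>)) \<alpha>" by blast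
      moreover have "compose R (hom_inv Q \<eta>) (compose R \<eta> \<psi>) = \<psi>"
      proof (rule extensionalityI[of _ R])
        show "\<psi> \<in> extensional R" by (rule morphism(1)[OF Rs Qs \<psi>(1)])
        show "compose R (hom_inv Q \<eta>) (compose R \<eta> \<psi>) x = \<psi> x" if "x \<in> R" for x
          using that E.hom_inv_left[OF Qs Qs \<eta>E, of "\<psi> x"] \<psi>(2) by (auto simp: compose_def)
      qed simp
      ultimately show ?thesis by simp
    qed
    let ?P' = "\<phi> ` P"
    have P': "subgroup ?P' S" "\<phi> \<in> F P ?P'" using factor[OF P subgroup_self less.prems(2)] by auto
    have cP': "F_centric S F ?P'" by (rule centric_image[OF less.prems(1) subgroup_self less.prems(2)])
    have card: "card ?P' = card P" by (rule card_image[OF morphism(2)[OF P subgroup_self less.prems(2)]])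
    obtain Q where Q: "F_conjugate S F ?P' Q" "fully_normalized S F Q" by (rule fully_normalized_exists[OF P'(1)])
    then obtain \<psi> where Qs: "subgroup Q S" and \<psi>: "\<psi> \<in> F ?P' Q" "\<psi> ` ?P' = Q" by (auto simp: F_conjugate_iff)
    obtain \<beta> where \<beta>: "decomposes ?P' \<psi> \<beta>" using to_normalized[OF cP' card Q(2) \<psi>] by blast
    have \<psi>\<phi>: "compose P \<psi> \<phi> \<in> F P Q" by (rule comp[OF P P'(1) Qs P'(2) \<psi>(1)])
    have im: "compose P \<psi> \<phi> ` P = Q" using \<psi>(2) by (auto simp: compose_def)
    obtain \<alpha> where \<alpha>: "decomposes P (compose P \<psi> \<phi>) \<alpha>"
      using to_normalized[OF less.prems(1) refl Q(2) \<psi>\<phi> im] by blast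
    have inv: "decomposes Q (hom_inv ?P' \<psi>) (hom_inv (carrier S) \<beta>)"
      using decomposes_inv[OF \<beta> P'(1) to_S[OF P'(1) Qs \<psi>(1)]] \<psi>(2) by simp
    have "compose P (hom_inv ?P' \<psi>) (compose P \<psi> \<phi>) = \<phi>"
    proof (rule extensionalityI[of _ P])
      show "\<phi> \<in> extensional P" by (rule morphism(1)[OF P P'])
      show "compose P (hom_inv ?P' \<psi>) (compose P \<psi> \<phi>) x = \<phi> x" if "x \<in> P" for x
        using that hom_inv_left[OF P'(1) Qs \<psi>(1), of "\<phi> x"] by (simp add: compose_def)
    qed simp
    then show ?thesis
      using decomposes_comp[OF \<alpha> inv P Qs] im by auto
  qed
qed

section \<open>Functors to groups without \<open>p\<close>-torsion\<close>

text \<open>\<open>J P \<phi>\<close> is the value of a functor at \<open>\<phi>\<close>, regarded as a morphism from \<open>P\<close> to \<open>S\<close>; inclusions are sent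
  to the identity. The morphisms with trivial value, together with all morphisms defined on subgroups that are not
  centric, form a fusion system, and this contains \<open>O\<^sup>p\<^sup>'(Aut(P))\<close> because the target has no \<open>p\<close>-torsion.\<close>

lemma functor_trivial_on_E:
  fixes \<Gamma> :: "('g, 'h) monoid_scheme" (structure)
  assumes \<Gamma>: "group \<Gamma>" and tf: "\<And>y. y \<in> carrier \<Gamma> \<Longrightarrow> y [^]\<^bsub>\<Gamma>\<^esub> p = \<one>\<^bsub>\<Gamma>\<^esub> \<Longrightarrow> y = \<one>\<^bsub>\<Gamma>\<^esub>"
    and cl: "\<And>P \<phi>. F_centric S F P \<Longrightarrow> \<phi> \<in> F P (carrier S) \<Longrightarrow> J P \<phi> \<in> carrier \<Gamma>"
    and cmp: "\<And>P Q \<phi> \<psi>. F_centric S F P \<Longrightarrow> F_centric S F Q \<Longrightarrow> \<phi> \<in> F P Q \<Longrightarrow> \<psi> \<in> F Q (carrier S) \<Longrightarrow>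
      J P (compose P \<psi> \<phi>) = J Q \<psi> \<otimes>\<^bsub>\<Gamma>\<^esub> J P \<phi>"
    and id: "\<And>P. F_centric S F P \<Longrightarrow> J P (\<lambda>x\<in>P. x) = \<one>\<^bsub>\<Gamma>\<^esub>"
    and e: "F_centric S F P" "e \<in> E P (carrier S)"
  shows "J P e = \<one>\<^bsub>\<Gamma>\<^esub>"
proof -
  interpret \<Gamma>: group \<Gamma> by (rule \<Gamma>)
  define H where "H P Q = {\<phi> \<in> F P Q. F_centric S F P \<longrightarrow> J P \<phi> = \<one>\<^bsub>\<Gamma>\<^esub>}" for P Q
  have homJ: "group_hom (Aut_F F P) \<Gamma> (J P)" if P: "F_centric S F P" for P
  proof -
    have Ps: "subgroup P S" by (rule centric_sub[OF P])
    have "J P \<in> hom (Aut_F F P) \<Gamma>"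
      by (rule homI) (use Ps cl[OF P to_S[OF Ps Ps]] cmp[OF P P _ to_S[OF Ps Ps]] in \<open>simp_all add: Aut_mult\<close>)
    then show ?thesis using Aut_group[OF Ps] \<Gamma> by (simp add: group_hom_def group_hom_axioms_def)
  qed
  have kerJ: "J P \<phi> = \<one>\<^bsub>\<Gamma>\<^esub>" if P: "F_centric S F P" and \<phi>: "\<phi> \<in> O_p' p (Aut_F F P)" for P \<phi>
  proof -
    have "finite (carrier (Aut_F F P))" using Aut_finite[OF centric_sub[OF P]] by simp
    then have "O_p' p (Aut_F F P) \<subseteq> kernel (Aut_F F P) \<Gamma> (J P)"
      by (rule group_hom.O_p'_subset_kernel_torsion[OF homJ[OF P] _ p]) (rule tf)
    then show ?thesis using \<phi> unfolding kernel_def by blast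
  qed
  have conj: "J (carrier S) (conj_map S x (carrier S)) = \<one>\<^bsub>\<Gamma>\<^esub>" if x: "x \<in> carrier S" for x
  proof -
    have "(\<lambda>x. conj_map S x (carrier S)) ` O_p' p S \<subseteq> O_p' p (Aut_F F (carrier S))"
      by (rule group_hom.O_p'_image[OF conj_group_hom])
    moreover have "carrier S \<subseteq> O_p' p S"
      using p_subgroup_subset_O_p'[OF subgroup_self _ finite_S] card_sub[OF subgroup_self] by blast
    ultimately show ?thesis using kerJ[OF centric_S] x by blast
  qed
  have "fusion_system S H"
  proof (rule fusion_systemI)
    fix P Q assume PQ: "subgroup P S" "subgroup Q S"
    have "J P (conj_map S x P) = \<one>\<^bsub>\<Gamma>\<^esub>" if x: "x \<in> carrier S" and P: "F_centric S F P" for x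
    proof -
      have "conj_map S x P = compose P (conj_map S x (carrier S)) (\<lambda>x\<in>P. x)"
        using subgroup.subset[OF PQ(1)] by (auto simp: conj_map_def compose_def fun_eq_iff)
      then show ?thesis
        using cmp[OF P centric_S incl[OF PQ(1) subgroup_self subgroup.subset[OF PQ(1)]] S_conj_in[OF x]] conj[OF x] id[OF P]
        by simp
    qed
    then show "Hom_S S P Q \<subseteq> H P Q \<and> H P Q \<subseteq> F P Q"
      using conj_in[OF PQ] by (auto simp: Hom_S_def H_def)
  next
    fix P Q R \<phi> \<psi> assume a: "subgroup P S" "subgroup Q S" "subgroup R S" "\<phi> \<in> H P Q" "\<psi> \<in> H Q R"
    then have f: "\<phi> \<in> F P Q" "\<psi> \<in> F Q R" by (auto simp: H_def)
    have "J P (compose P \<psi> \<phi>) = \<one>\<^bsub>\<Gamma>\<^esub>" if P: "F_centric S F P"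
    proof -
      have Q: "F_centric S F Q"
        using centric_overgroup[OF centric_image[OF P a(2) f(1)] a(2) morphism(3)[OF a(1,2) f(1)]] .
      show ?thesis
        using cmp[OF P Q f(1) to_S[OF a(2,3) f(2)]] a(4,5) P Q by (simp add: H_def)
    qed
    then show "compose P \<psi> \<phi> \<in> H P R" using comp[OF a(1-3) f] by (simp add: H_def)
  next
    fix P Q \<phi> assume a: "subgroup P S" "subgroup Q S" "\<phi> \<in> H P Q"
    then have f: "\<phi> \<in> F P Q" by (auto simp: H_def)
    note fc = factor[OF a(1,2) f]
    have "J (\<phi> ` P) (hom_inv P \<phi>) = \<one>\<^bsub>\<Gamma>\<^esub>" if P': "F_centric S F (\<phi> ` P)"
    proof -
      have P: "F_centric S F P"
        using centric_conj[OF P' F_conjugate_sym[OF F_conjugate_image[OF a(1,2) f]]] .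
      have "compose P (hom_inv P \<phi>) \<phi> = (\<lambda>x\<in>P. x)"
        using hom_inv_left[OF a(1,2) f] by (auto simp: compose_def fun_eq_iff)
      then have "J (\<phi> ` P) (hom_inv P \<phi>) \<otimes>\<^bsub>\<Gamma>\<^esub> J P \<phi> = \<one>\<^bsub>\<Gamma>\<^esub>"
        using cmp[OF P P' fc(2) to_S[OF fc(1) a(1) fc(3)]] id[OF P] by simp
      moreover have "J P \<phi> = \<one>\<^bsub>\<Gamma>\<^esub>" using a(3) P by (simp add: H_def)
      ultimately show ?thesis using \<Gamma>.r_one[OF cl[OF P' to_S[OF fc(1) a(1) fc(3)]]] by metis
    qed
    then show "\<phi> \<in> H P (\<phi> ` P) \<and> hom_inv P \<phi> \<in> H (\<phi> ` P) P"
      using a(3) fc by (simp add: H_def)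
  qed
  moreover have "O_p' p (Aut_F F P) \<subseteq> H P P" if P: "subgroup P S" for P
    using kerJ group.O_p'_subset[OF Aut_group[OF P], of p] by (auto simp: H_def)
  ultimately have "admissible H" unfolding admissible_def H_def by blast
  then show ?thesis using E_least[of H P "carrier S"] e by (auto simp: H_def)
qed

section \<open>The quotient of \<open>Out(S)\<close> by \<open>Out\<^sup>0(S)\<close>\<close>

abbreviation A where "A \<equiv> Aut_F F (carrier S)"
abbreviation I where "I \<equiv> Inn S (carrier S)"
abbreviation Out where "Out \<equiv> Out_F S F (carrier S)"
abbreviation Out0 where "Out0 \<equiv> Out0_F p S F"

lemma group_A: "group A"
  by (rule Aut_group[OF subgroup_self])

lemma I_eq: "I = (\<lambda>x. conj_map S x (carrier S)) ` carrier S"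
  by (auto simp: Inn_def)

lemma I_normal: "I \<lhd> A"
proof (rule group.normal_invI[OF group_A])
  show "subgroup I A" unfolding I_eq by (rule group_hom.img_is_subgroup[OF conj_group_hom])
  fix \<alpha> \<beta> assume \<alpha>: "\<alpha> \<in> carrier A" and "\<beta> \<in> I"
  then obtain x where x: "x \<in> carrier S" "\<beta> = conj_map S x (carrier S)" by (auto simp: I_eq)
  have \<alpha>': "\<alpha> \<in> F (carrier S) (carrier S)" using \<alpha> by simp
  note c = S_conj_in[OF x(1)]
  have \<alpha>S: "\<alpha> ` carrier S = carrier S" by (rule endo_image[OF subgroup_self \<alpha>'])
  have j: "hom_inv (carrier S) \<alpha> \<in> F (carrier S) (carrier S)"
    using factor(3)[OF subgroup_self subgroup_self \<alpha>'] \<alpha>S by simp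
  have "\<alpha> \<otimes>\<^bsub>A\<^esub> \<beta> \<otimes>\<^bsub>A\<^esub> inv\<^bsub>A\<^esub> \<alpha> = twist \<alpha> (carrier S) \<beta>"
    unfolding x(2) Aut_inv[OF subgroup_self \<alpha>'] Aut_mult[OF subgroup_self \<alpha>' c]
      Aut_mult[OF subgroup_self comp[OF subgroup_self subgroup_self subgroup_self c \<alpha>'] j]
    using \<alpha>S morphism(4)[OF subgroup_self subgroup_self j]
    by (auto simp: twist_def compose_def fun_eq_iff hom_inv_def)
  also have "\<dots> = conj_map S (\<alpha> x) (carrier S)"
    using twist_conj[OF \<alpha>' subgroup_self x(1)] \<alpha>S x(2) by simp
  also have "\<dots> \<in> I" using beta_closed[OF \<alpha>' x(1)] by (auto simp: I_eq)
  finally show "\<alpha> \<otimes>\<^bsub>A\<^esub> \<beta> \<otimes>\<^bsub>A\<^esub> inv\<^bsub>A\<^esub> \<alpha> \<in> I" .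
qed

lemma group_Out: "group Out"
  unfolding Out_F_def by (rule normal.factorgroup_is_group[OF I_normal])

definition gens :: "('a \<Rightarrow> 'a) set set" where
  "gens = {I #>\<^bsub>A\<^esub> \<alpha> | \<alpha>. \<alpha> \<in> carrier A \<and> (\<exists>P. F_centric S F P \<and> restrict \<alpha> P \<in> E P (carrier S))}"

lemma Out0_eq: "Out0 = generate Out gens"
  by (simp add: Out0_F_def gens_def)

lemma Out_coset_mult:
  "\<alpha> \<in> carrier A \<Longrightarrow> \<beta> \<in> carrier A \<Longrightarrow> (I #>\<^bsub>A\<^esub> \<alpha>) \<otimes>\<^bsub>Out\<^esub> (I #>\<^bsub>A\<^esub> \<beta>) = I #>\<^bsub>A\<^esub> (\<alpha> \<otimes>\<^bsub>A\<^esub> \<beta>)"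
  using normal.rcos_sum[OF I_normal] by (simp add: Out_F_def)

lemma coset_hom: "group_hom A Out (\<lambda>\<alpha>. I #>\<^bsub>A\<^esub> \<alpha>)"
  using normal.r_coset_hom_Mod[OF I_normal] group_A group_Out
  by (simp add: group_hom_def group_hom_axioms_def Out_F_def)

lemma Out_carrier: "carrier Out = (\<lambda>\<alpha>. I #>\<^bsub>A\<^esub> \<alpha>) ` carrier A"
  by (simp add: Out_F_def carrier_FactGroup)

text \<open>Conjugation by \<open>\<beta>\<close> carries the restriction of \<open>\<alpha>\<close> to \<open>P\<close> into that of \<open>\<beta> \<alpha> \<beta>\<^sup>-\<^sup>1\<close> to \<open>\<beta>(P)\<close>, and it preserves
  \<open>O\<^sup>p\<^sup>'\<^sub>*(F)\<close>.\<close>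

lemma Out0_normal: "Out0 \<lhd> Out"
  unfolding Out0_eq
proof (rule group.normal_generateI[OF group_Out])
  show "gens \<subseteq> carrier Out" by (auto simp: gens_def Out_carrier)
  fix h g assume "h \<in> gens" and "g \<in> carrier Out"
  then obtain \<alpha> \<beta> P where \<alpha>: "\<alpha> \<in> carrier A" "h = I #>\<^bsub>A\<^esub> \<alpha>" and P: "F_centric S F P" "restrict \<alpha> P \<in> E P (carrier S)"
    and \<beta>: "\<beta> \<in> carrier A" "g = I #>\<^bsub>A\<^esub> \<beta>"
    by (auto simp: gens_def Out_carrier)
  interpret A: group A by (rule group_A)
  interpret q: group_hom A Out "\<lambda>\<alpha>. I #>\<^bsub>A\<^esub> \<alpha>" by (rule coset_hom)
  have Ps: "subgroup P S" by (rule centric_sub[OF P(1)])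
  have F: "\<alpha> \<in> F (carrier S) (carrier S)" "\<beta> \<in> F (carrier S) (carrier S)" using \<alpha>(1) \<beta>(1) by auto
  let ?j = "hom_inv (carrier S) \<beta>"
  have \<beta>S: "\<beta> ` carrier S = carrier S" by (rule endo_image[OF subgroup_self F(2)])
  have j: "?j \<in> F (carrier S) (carrier S)"
    using factor(3)[OF subgroup_self subgroup_self F(2)] \<beta>S by simp
  let ?\<gamma> = "\<beta> \<otimes>\<^bsub>A\<^esub> \<alpha> \<otimes>\<^bsub>A\<^esub> inv\<^bsub>A\<^esub> \<beta>"
  have \<gamma>: "?\<gamma> = compose (carrier S) (compose (carrier S) \<beta> \<alpha>) ?j"
    unfolding Aut_inv[OF subgroup_self F(2)] Aut_mult[OF subgroup_self F(2,1)]
      Aut_mult[OF subgroup_self comp[OF subgroup_self subgroup_self subgroup_self F] j] ..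
  have "restrict ?\<gamma> (\<beta> ` P) = twist \<beta> P (restrict \<alpha> P)"
  proof (rule extensionalityI[of _ "\<beta> ` P"])
    fix y assume "y \<in> \<beta> ` P"
    then obtain x where x: "x \<in> P" "y = \<beta> x" by blast
    then have xS: "x \<in> carrier S" using subgroup.subset[OF Ps] by blast
    show "restrict ?\<gamma> (\<beta> ` P) y = twist \<beta> P (restrict \<alpha> P) y"
      using x xS twist_apply[OF F(2) subgroup.subset[OF Ps] x(1)] hom_inv_left[OF subgroup_self subgroup_self F(2) xS]
        beta_closed[OF F(2) xS] by (simp add: \<gamma> compose_def)
  qed (auto simp: twist_def)
  then have "restrict ?\<gamma> (\<beta> ` P) \<in> E (\<beta> ` P) (carrier S)"
    using E_twist[OF F(2) Ps subgroup_self P(2)] \<beta>S by simp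
  moreover have "F_centric S F (\<beta> ` P)"
    using centric_image[OF P(1) beta_restr(2)[OF F(2) Ps] beta_restr(1)[OF F(2) Ps]] by simp
  moreover have "?\<gamma> \<in> carrier A" by (intro A.m_closed A.inv_closed \<alpha>(1) \<beta>(1))
  ultimately have "I #>\<^bsub>A\<^esub> ?\<gamma> \<in> gens" unfolding gens_def by blast
  moreover have "I #>\<^bsub>A\<^esub> ?\<gamma> = g \<otimes>\<^bsub>Out\<^esub> h \<otimes>\<^bsub>Out\<^esub> inv\<^bsub>Out\<^esub> g"
    unfolding \<alpha>(2) \<beta>(2) q.hom_inv[OF \<beta>(1), symmetric] q.hom_mult[OF \<beta>(1) \<alpha>(1), symmetric]
    by (rule q.hom_mult[OF A.m_closed[OF \<beta>(1) \<alpha>(1)] A.inv_closed[OF \<beta>(1)]])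
  ultimately show "g \<otimes>\<^bsub>Out\<^esub> h \<otimes>\<^bsub>Out\<^esub> inv\<^bsub>Out\<^esub> g \<in> gens"
    by simp
qed

abbreviation Gm where "Gm \<equiv> Out Mod Out0"

definition cls :: "('a \<Rightarrow> 'a) \<Rightarrow> ('a \<Rightarrow> 'a) set set" where
  "cls \<alpha> = Out0 #>\<^bsub>Out\<^esub> (I #>\<^bsub>A\<^esub> \<alpha>)"

lemma group_Gm: "group Gm"
  by (rule normal.factorgroup_is_group[OF Out0_normal])

lemma cls_hom: "group_hom A Gm cls"
proof -
  have "cls \<in> hom A Gm"
    using Group.hom_compose[OF group_hom.homh[OF coset_hom] normal.r_coset_hom_Mod[OF Out0_normal]]
    by (simp add: cls_def[abs_def] o_def)
  then show ?thesis using group_A group_Gm by (simp add: group_hom_def group_hom_axioms_def)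
qed

lemma cls_one_iff:
  assumes "\<alpha> \<in> carrier A"
  shows "cls \<alpha> = \<one>\<^bsub>Gm\<^esub> \<longleftrightarrow> I #>\<^bsub>A\<^esub> \<alpha> \<in> Out0"
proof -
  have c: "I #>\<^bsub>A\<^esub> \<alpha> \<in> carrier Out" using assms by (auto simp: Out_carrier)
  have "subgroup Out0 Out" by (rule normal_imp_subgroup[OF Out0_normal])
  then show ?thesis
    using group.coset_join1[OF group_Out _ c] group.coset_join2[OF group_Out c] by (auto simp: cls_def)
qed

text \<open>\<open>Inn(S)\<close> is a Sylow subgroup of \<open>Aut(S)\<close>, as \<open>S\<close> is fully normalized.\<close>

lemma coprime_Gm: "finite (carrier Gm) \<and> coprime p (card (carrier Gm))"
proof -
  interpret A: group A by (rule group_A)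
  have fin: "finite (carrier A)" using Aut_finite[OF subgroup_self] by simp
  have only: "Q = carrier S" if "F_conjugate S F (carrier S) Q" for Q
    using that endo_image[OF subgroup_self to_S[OF subgroup_self]] unfolding F_conjugate_iff by metis
  have "fully_normalized S F (carrier S)"
    unfolding fully_normalized_def using only subgroup_self by blast
  then have "sylow_subgroup p (Aut_S S (carrier S)) A" using saturated unfolding saturated_def by blast
  moreover have "Aut_S S (carrier S) = I"
    by (auto simp: Aut_S_def Hom_S_def Inn_def conj_map_def)
  ultimately have cI: "card I = p ^ multiplicity p (order A)" by (simp add: sylow_subgroup_def)
  have lag: "card (carrier Out) * card I = order A"
    using A.lagrange[OF normal_imp_subgroup[OF I_normal]] by (simp add: Out_F_def FactGroup_def)
  have "\<not> p dvd card (carrier Out)"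
  proof
    assume "p dvd card (carrier Out)"
    then obtain c where "card (carrier Out) = p * c" by (rule dvdE)
    then have "order A = p ^ Suc (multiplicity p (order A)) * c" using lag cI by (simp add: mult_ac)
    then have "p ^ Suc (multiplicity p (order A)) dvd order A" by (rule dvdI)
    moreover have "order A \<noteq> 0" using fin A.order_gt_0_iff_finite by simp
    ultimately show False
      using p power_dvd_iff_le_multiplicity by (metis Suc_n_not_le_n not_prime_unit)
  qed
  moreover have "card (carrier Gm) dvd card (carrier Out)"
    using group.lagrange[OF group_Out normal_imp_subgroup[OF Out0_normal]]
    by (metis FactGroup_def dvd_triv_left order_def partial_object.select_convs(1))
  ultimately have "\<not> p dvd card (carrier Gm)" using dvd_trans by blast
  moreover have "finite (carrier Gm)"
    using fin by (simp add: carrier_FactGroup Out_carrier)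
  ultimately show ?thesis using prime_imp_coprime[OF p] by blast
qed

text \<open>The functor that kills \<open>O\<^sup>p\<^sup>'\<^sub>*(F)\<close> and is the projection on \<open>Aut(S)\<close>.\<close>

definition Theta :: "'a set \<Rightarrow> ('a \<Rightarrow> 'a) \<Rightarrow> ('a \<Rightarrow> 'a) set set" where
  "Theta P \<phi> = cls (SOME \<alpha>. decomposes P \<phi> \<alpha>)"

text \<open>If \<open>\<alpha> e = \<beta> f\<close>, then \<open>\<beta>\<^sup>-\<^sup>1 \<alpha>\<close> restricts to \<open>f e\<^sup>-\<^sup>1\<close> on the centric subgroup \<open>e(P)\<close>, hence represents an
  element of \<open>Out\<^sup>0(S)\<close>.\<close>

lemma Theta_eq:
  assumes P: "F_centric S F P" and d: "decomposes P \<phi> \<alpha>"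
  shows "Theta P \<phi> = cls \<alpha>"
proof -
  have Ps: "subgroup P S" by (rule centric_sub[OF P])
  have "cls \<alpha> = cls \<beta>" if d': "decomposes P \<phi> \<beta>" for \<beta>
  proof -
    interpret A: group A by (rule group_A)
    interpret c: group_hom A Gm cls by (rule cls_hom)
    obtain e where e: "e \<in> E P (carrier S)" "\<phi> = compose P \<alpha> e" and \<alpha>: "\<alpha> \<in> F (carrier S) (carrier S)"
      using d by (auto simp: decomposes_def)
    obtain f where f: "f \<in> E P (carrier S)" "\<phi> = compose P \<beta> f" and \<beta>: "\<beta> \<in> F (carrier S) (carrier S)"
      using d' by (auto simp: decomposes_def)
    let ?j = "hom_inv (carrier S) \<beta>"
    have j: "?j \<in> F (carrier S) (carrier S)"
      using factor(3)[OF subgroup_self subgroup_self \<beta>] endo_image[OF subgroup_self \<beta>] by simp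
    let ?\<gamma> = "inv\<^bsub>A\<^esub> \<beta> \<otimes>\<^bsub>A\<^esub> \<alpha>"
    have \<gamma>: "?\<gamma> = compose (carrier S) ?j \<alpha>"
      unfolding Aut_inv[OF subgroup_self \<beta>] Aut_mult[OF subgroup_self j \<alpha>] ..
    note ef = E.factor[OF Ps subgroup_self e(1)]
    have eq: "compose (e ` P) f (hom_inv P e) = restrict ?\<gamma> (e ` P)"
    proof (rule extensionalityI[of _ "e ` P"])
      fix y assume "y \<in> e ` P"
      then obtain x where x: "x \<in> P" "y = e x" by blast
      have eS: "e x \<in> carrier S" "f x \<in> carrier S"
        using E.morphism(4)[OF Ps subgroup_self e(1) x(1)] E.morphism(4)[OF Ps subgroup_self f(1) x(1)] .
      have "\<alpha> (e x) = \<beta> (f x)" using fun_cong[OF e(2)[unfolded f(2)], of x] x(1) by (simp add: compose_def)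
      then have "?\<gamma> (e x) = f x"
        using eS hom_inv_left[OF subgroup_self subgroup_self \<beta> eS(2)] by (simp add: \<gamma> compose_def)
      then show "compose (e ` P) f (hom_inv P e) y = restrict ?\<gamma> (e ` P) y"
        using x E.hom_inv_left[OF Ps subgroup_self e(1) x(1)] by (simp add: compose_def)
    qed auto
    have "restrict ?\<gamma> (e ` P) \<in> E (e ` P) (carrier S)"
      using E.comp[OF ef(1) Ps subgroup_self ef(3) f(1)] unfolding eq .
    moreover have "F_centric S F (e ` P)"
      using centric_image[OF P subgroup_self] e(1) E_F by blast
    moreover have \<gamma>A: "?\<gamma> \<in> carrier A"
      by (intro A.m_closed A.inv_closed) (use \<alpha> \<beta> in simp_all)
    ultimately have "I #>\<^bsub>A\<^esub> ?\<gamma> \<in> gens" unfolding gens_def by blast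
    then have "cls ?\<gamma> = \<one>\<^bsub>Gm\<^esub>"
      using cls_one_iff[OF \<gamma>A] generate.incl[of _ gens Out] by (simp add: Out0_eq)
    moreover have "\<alpha> = \<beta> \<otimes>\<^bsub>A\<^esub> ?\<gamma>"
    proof -
      have c: "\<alpha> \<in> carrier A" "\<beta> \<in> carrier A" using \<alpha> \<beta> by simp_all
      show ?thesis
        unfolding A.m_assoc[OF c(2) A.inv_closed[OF c(2)] c(1), symmetric] A.r_inv[OF c(2)] A.l_one[OF c(1)] ..
    qed
    then have "cls \<alpha> = cls \<beta> \<otimes>\<^bsub>Gm\<^esub> cls ?\<gamma>" using c.hom_mult[of \<beta> ?\<gamma>] \<beta> \<gamma>A by simp
    ultimately show ?thesis using c.hom_closed[of \<beta>] \<beta> by (simp del: one_FactGroup mult_FactGroup)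
  qed
  then show ?thesis
    unfolding Theta_def using someI[of "decomposes P \<phi>", OF d] by simp
qed

lemma Theta_self: "\<alpha> \<in> F (carrier S) (carrier S) \<Longrightarrow> Theta (carrier S) \<alpha> = cls \<alpha>"
  using Theta_eq[OF centric_S decomposes_self] .

lemma Theta_closed:
  assumes "F_centric S F P" "\<phi> \<in> F P (carrier S)"
  shows "Theta P \<phi> \<in> carrier Gm"
proof -
  obtain \<alpha> where "decomposes P \<phi> \<alpha>" using decomposition[OF assms] by blast
  then show ?thesis
    using Theta_eq[OF assms(1)] group_hom.hom_closed[OF cls_hom, of \<alpha>] by (simp add: decomposes_def)
qed

lemma Theta_comp:
  assumes P: "F_centric S F P" and Q: "F_centric S F Q" and \<phi>: "\<phi> \<in> F P Q" and \<psi>: "\<psi> \<in> F Q (carrier S)"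
  shows "Theta P (compose P \<psi> \<phi>) = Theta Q \<psi> \<otimes>\<^bsub>Gm\<^esub> Theta P \<phi>"
proof -
  note Ps = centric_sub[OF P] and Qs = centric_sub[OF Q]
  obtain \<alpha> where \<alpha>: "decomposes P \<phi> \<alpha>" using decomposition[OF P to_S[OF Ps Qs \<phi>]] by blast
  obtain \<beta> where \<beta>: "decomposes Q \<psi> \<beta>" using decomposition[OF Q \<psi>] by blast
  have A: "\<alpha> \<in> F (carrier S) (carrier S)" "\<beta> \<in> F (carrier S) (carrier S)"
    using \<alpha> \<beta> by (auto simp: decomposes_def)
  have "Theta P (compose P \<psi> \<phi>) = cls (compose (carrier S) \<beta> \<alpha>)"
    by (rule Theta_eq[OF P decomposes_comp[OF \<alpha> \<beta> Ps Qs morphism(3)[OF Ps Qs \<phi>]]])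
  also have "\<dots> = cls \<beta> \<otimes>\<^bsub>Gm\<^esub> cls \<alpha>"
    using group_hom.hom_mult[OF cls_hom, of \<beta> \<alpha>] A by (simp add: Aut_mult[OF subgroup_self])
  finally show ?thesis by (simp only: Theta_eq[OF P \<alpha>] Theta_eq[OF Q \<beta>])
qed

end

section \<open>The fundamental group of a linking system\<close>

locale linking = saturated_fusion S F p + centric_linking_system S F L \<pi> \<delta>
  for S :: "('a, 'b) monoid_scheme" (structure) and F :: "'a homs" and p :: nat
    and L :: "('a set, 'm) cat" and \<pi> :: "'m \<Rightarrow> 'a \<Rightarrow> 'a" and \<delta> :: "'a set \<Rightarrow> 'a \<Rightarrow> 'm"
begin

abbreviation (input) "Q0 \<equiv> carrier S"
abbreviation (input) "X \<equiv> realization L"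
abbreviation (input) "v \<equiv> vertex L Q0"
abbreviation "PiL \<equiv> pi1_L S L"
abbreviation "K \<equiv> O_p' p PiL"

lemma Pi_eq: "PiL = fundamental_group X v"
  by (simp add: pi1_L_def)

lemma Ob_iff: "P \<in> Ob L \<longleftrightarrow> F_centric S F P"
  by (simp add: Ob_L)

lemma Ob_S: "Q0 \<in> Ob L"
  by (simp add: Ob_L centric_S)

lemma Mor_centric: "f \<in> Mor L P Q \<Longrightarrow> F_centric S F P \<and> F_centric S F Q"
  using Mor_Ob Ob_iff by blast

lemma pi_in: "f \<in> Mor L P Q \<Longrightarrow> \<pi> f \<in> F P Q"
  using A_surj Mor_Ob by blast

lemma lift_ex:
  assumes "F_centric S F P" "F_centric S F Q" "\<phi> \<in> F P Q"
  obtains f where "f \<in> Mor L P Q" "\<pi> f = \<phi>"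
proof -
  have "\<phi> \<in> \<pi> ` Mor L P Q" using A_surj[OF Ob_iff[THEN iffD2] Ob_iff[THEN iffD2], OF assms(1,2)] assms(3) by simp
  then show ?thesis using that by auto
qed

text \<open>The identity is chosen for \<open>S\<close> itself, in order that the tree be trivial there.\<close>

definition iota :: "'a set \<Rightarrow> 'm" where
  "iota P = (if P = Q0 then Ident L Q0 else SOME f. f \<in> Mor L P Q0 \<and> \<pi> f = (\<lambda>x\<in>P. x))"

lemma iota:
  assumes P: "F_centric S F P"
  shows "iota P \<in> Mor L P Q0 \<and> \<pi> (iota P) = (\<lambda>x\<in>P. x)"
proof (cases "P = Q0")
  case True
  then show ?thesis using Ident_Mor[OF Ob_S] pi_Ident[OF Ob_S] by (simp add: iota_def)
next
  case False
  have "(\<lambda>x\<in>P. x) \<in> F P Q0"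
    using incl[OF centric_sub[OF P] subgroup_self subgroup.subset[OF centric_sub[OF P]]] .
  then obtain f where "f \<in> Mor L P Q0 \<and> \<pi> f = (\<lambda>x\<in>P. x)" using lift_ex[OF P centric_S] by blast
  then show ?thesis
    using someI[of "\<lambda>f. f \<in> Mor L P Q0 \<and> \<pi> f = (\<lambda>x\<in>P. x)"] False by (simp add: iota_def)
qed

definition tree :: "'a set \<Rightarrow> real \<Rightarrow> 'm cell_point set" where
  "tree P = path_rev (edge_path L (iota P))"

lemma path_between_tree: "P \<in> Ob L \<Longrightarrow> path_between X v (vertex L P) (tree P)"
  unfolding tree_def using path_between_rev path_between_edge iota Ob_iff by metis

lemma v_in: "v \<in> topspace X"
  by (rule vertex_in_topspace[OF Ob_S])

lemma tree_S: "path_homotopic X v v (tree Q0) (\<lambda>_. v)"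
  using path_homotopic_rev[OF edge_Ident[OF Ob_S]] by (simp add: tree_def iota_def path_rev_def)

definition loopL :: "'m \<Rightarrow> (real \<Rightarrow> 'm cell_point set) set" where
  "loopL f = connect X v (tree (Dom L f)) (edge_path L f) (tree (Cod L f))"

lemma loopL_eq: "f \<in> Mor L P Q \<Longrightarrow> loopL f = connect X v (tree P) (edge_path L f) (tree Q)"
  by (auto simp: loopL_def Mor_def)

lemma loopL_closed: "f \<in> Mor L P Q \<Longrightarrow> loopL f \<in> carrier PiL"
  unfolding Pi_eq using loopL_eq connect_in_carrier path_between_tree path_between_edge Mor_Ob by metis

lemma loopL_Comp:
  assumes f: "f \<in> Mor L P Q" and g: "g \<in> Mor L Q R"
  shows "loopL (Comp L g f) = loopL g \<otimes>\<^bsub>PiL\<^esub> loopL f"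
proof -
  have ob: "P \<in> Ob L" "Q \<in> Ob L" "R \<in> Ob L" using f g Mor_Ob by blast+
  have "loopL g \<otimes>\<^bsub>PiL\<^esub> loopL f = connect X v (tree P) (path_join (edge_path L f) (edge_path L g)) (tree R)"
    unfolding Pi_eq loopL_eq[OF f] loopL_eq[OF g]
    by (rule connect_mult[OF path_between_tree[OF ob(1)] path_between_edge[OF f] path_between_tree[OF ob(2)]
          path_between_edge[OF g] path_between_tree[OF ob(3)]])
  also have "\<dots> = connect X v (tree P) (edge_path L (Comp L g f)) (tree R)"
    by (rule connect_cong[OF _ edge_join[OF f g]]) (use path_between_tree ob in \<open>simp_all add: path_homotopic_refl\<close>)
  finally show ?thesis by (simp add: loopL_eq[OF Comp_Mor[OF f g]])
qed

lemma loopL_S: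
  assumes f: "f \<in> Mor L Q0 Q0"
  shows "loopL f = edge_class S L f"
proof -
  note e = path_between_edge[OF f]
  have "loopL f = connect X v (\<lambda>_. v) (edge_path L f) (\<lambda>_. v)"
    unfolding loopL_eq[OF f] using connect_cong[OF tree_S _ tree_S] e path_homotopic_refl by metis
  then show ?thesis using connect_trivial_ends[OF e] by (simp add: edge_class_def)
qed

lemma loopL_iota:
  assumes P: "F_centric S F P"
  shows "loopL (iota P) = \<one>\<^bsub>PiL\<^esub>"
proof -
  let ?e = "edge_path L (iota P)"
  have f: "iota P \<in> Mor L P Q0" using iota[OF P] by blast
  have PO: "P \<in> Ob L" using P Ob_iff by blast
  note e = path_between_edge[OF f] and t = path_between_tree[OF PO] and c = path_between_const[OF v_in]
  note R = path_homotopic_refl[THEN iffD2]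
  have "loopL (iota P) = connect X v (tree P) ?e (\<lambda>_. v)"
    unfolding loopL_eq[OF f] by (rule connect_cong[OF R[OF t] R[OF e] tree_S])
  also have "\<dots> = connect X v (tree P) (path_join ?e (\<lambda>_. v)) (\<lambda>_. v)"
    by (rule connect_cong[OF R[OF t] path_homotopic_sym[OF path_homotopic_join_const[OF e]] R[OF c]])
  also have "\<dots> = connect X v (path_join (tree P) ?e) (\<lambda>_. v) (\<lambda>_. v)"
    by (rule connect_assoc[OF t e c c, symmetric])
  also have "\<dots> = connect X v (\<lambda>_. v) (\<lambda>_. v) (\<lambda>_. v)"
    by (rule connect_cong[OF _ R[OF c] R[OF c]]) (use path_homotopic_rev_join[OF e] in \<open>simp add: tree_def\<close>)
  also have "\<dots> = \<one>\<^bsub>PiL\<^esub>"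
    unfolding Pi_eq by (rule connect_const[OF c])
  finally show ?thesis .
qed

lemma Pi_group: "group PiL"
  unfolding Pi_eq by (rule group_fundamental_group[OF v_in])

sublocale PiL: group PiL by (rule Pi_group)

lemma K_normal: "K \<lhd> PiL"
  by (rule PiL.O_p'_normal)

abbreviation "PQ \<equiv> PiL Mod K"

definition q :: "(real \<Rightarrow> 'm cell_point set) set \<Rightarrow> (real \<Rightarrow> 'm cell_point set) set set" where
  "q x = K #>\<^bsub>PiL\<^esub> x"

lemma PQ_group: "group PQ"
  by (rule normal.factorgroup_is_group[OF K_normal])

lemma q_hom: "group_hom PiL PQ q"
  using normal.r_coset_hom_Mod[OF K_normal] Pi_group PQ_group
  by (simp add: q_def[abs_def] group_hom_def group_hom_axioms_def)

sublocale q: group_hom PiL PQ q by (rule q_hom)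

lemma q_surj: "carrier PQ = q ` carrier PiL"
  by (simp add: carrier_FactGroup q_def[abs_def])

lemma q_one_iff: "x \<in> carrier PiL \<Longrightarrow> q x = \<one>\<^bsub>PQ\<^esub> \<longleftrightarrow> x \<in> K"
  using PiL.coset_join1[OF _ _ normal_imp_subgroup[OF K_normal]] PiL.coset_join2[OF _ normal_imp_subgroup[OF K_normal]]
  by (auto simp: q_def)

text \<open>\<open>O\<^sup>p\<^sup>'\<close> contains all elements with a \<open>p\<close>-th power in it, also in an infinite group.\<close>

lemma PQ_torsion:
  assumes "y \<in> carrier PQ" "y [^]\<^bsub>PQ\<^esub> p = \<one>\<^bsub>PQ\<^esub>"
  shows "y = \<one>\<^bsub>PQ\<^esub>"
proof -
  obtain x where x: "x \<in> carrier PiL" "y = q x" using assms(1) q_surj by blast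
  have "q (x [^]\<^bsub>PiL\<^esub> p) = \<one>\<^bsub>PQ\<^esub>" using assms(2) q.hom_nat_pow[OF x(1), of p] x(2) by simp
  then have "x [^]\<^bsub>PiL\<^esub> (p ^ 1) \<in> K" using q_one_iff[of "x [^]\<^bsub>PiL\<^esub> p"] x(1) by simp
  then have "x \<in> K" by (rule PiL.pow_in_O_p'[OF x(1)])
  then show ?thesis using q_one_iff[OF x(1)] x(2) by simp
qed

lemma delta_Mor:
  assumes "P \<in> Ob L" "x \<in> P"
  shows "\<delta> P x \<in> Mor L P P"
  using delta_hom[OF assms(1)] assms(2) by (auto simp: hom_def Aut_cat_def)

text \<open>\<open>\<delta>\<^sub>P(x)\<close> has \<open>p\<close>-power order, and so has its loop.\<close>

lemma q_delta:
  assumes P: "P \<in> Ob L" and x: "x \<in> P"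
  shows "q (loopL (\<delta> P x)) = \<one>\<^bsub>PQ\<^esub>"
proof -
  have Ps: "subgroup P S" using P Ob_iff centric_sub by blast
  interpret P: group "S\<lparr>carrier := P\<rparr>" by (rule subgroup_imp_group[OF Ps])
  have "(\<lambda>x. loopL (\<delta> P x)) \<in> hom (S\<lparr>carrier := P\<rparr>) PiL"
  proof (rule homI)
    show "loopL (\<delta> P x) \<in> carrier PiL" if "x \<in> carrier (S\<lparr>carrier := P\<rparr>)" for x
      using that loopL_closed[OF delta_Mor[OF P]] by simp
    show "loopL (\<delta> P (x \<otimes>\<^bsub>S\<lparr>carrier := P\<rparr>\<^esub> y)) = loopL (\<delta> P x) \<otimes>\<^bsub>PiL\<^esub> loopL (\<delta> P y)"
      if "x \<in> carrier (S\<lparr>carrier := P\<rparr>)" "y \<in> carrier (S\<lparr>carrier := P\<rparr>)" for x y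
      using that hom_mult[OF delta_hom[OF P] that] loopL_Comp[OF delta_Mor[OF P] delta_Mor[OF P]]
      by (simp add: Aut_cat_def)
  qed
  then interpret d: group_hom "S\<lparr>carrier := P\<rparr>" PiL "\<lambda>x. loopL (\<delta> P x)"
    by (simp add: group_hom_def group_hom_axioms_def P.is_group Pi_group)
  obtain k where "card P = p ^ k" using card_sub[OF Ps] by blast
  then have "P.ord x dvd p ^ k"
    using P.ord_dvd_group_order[of x] x by (simp add: order_def)
  then have pow: "x [^]\<^bsub>S\<lparr>carrier := P\<rparr>\<^esub> (p ^ k) = \<one>\<^bsub>S\<lparr>carrier := P\<rparr>\<^esub>"
    using P.pow_eq_id[of x "p ^ k"] x by simp
  have "loopL (\<delta> P x) [^]\<^bsub>PiL\<^esub> (p ^ k) = loopL (\<delta> P (x [^]\<^bsub>S\<lparr>carrier := P\<rparr>\<^esub> (p ^ k)))"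
    by (rule d.hom_nat_pow[symmetric]) (use x in simp)
  also have "\<dots> = \<one>\<^bsub>PiL\<^esub>" unfolding pow by (rule d.hom_one)
  finally have "loopL (\<delta> P x) [^]\<^bsub>PiL\<^esub> (p ^ k) = \<one>\<^bsub>PiL\<^esub>" .
  moreover have "\<one>\<^bsub>PiL\<^esub> \<in> K" using normal_imp_subgroup[OF K_normal] subgroup.one_closed by blast
  ultimately have "loopL (\<delta> P x) \<in> K"
    using PiL.pow_in_O_p'[of "loopL (\<delta> P x)" p k] loopL_closed[OF delta_Mor[OF P x]] by simp
  then show ?thesis using q_one_iff[OF loopL_closed[OF delta_Mor[OF P x]]] by simp
qed

lemma q_loopL_Comp: "f \<in> Mor L P Q \<Longrightarrow> g \<in> Mor L Q R \<Longrightarrow> q (loopL (Comp L g f)) = q (loopL g) \<otimes>\<^bsub>PQ\<^esub> q (loopL f)"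
  using loopL_Comp loopL_closed q.hom_mult by metis

lemma q_loopL_closed: "f \<in> Mor L P Q \<Longrightarrow> q (loopL f) \<in> carrier PQ"
  using loopL_closed q.hom_closed by blast

lemma q_loopL_cong:
  assumes f: "f \<in> Mor L P Q" and g: "g \<in> Mor L P Q" and eq: "\<pi> f = \<pi> g"
  shows "q (loopL f) = q (loopL g)"
proof -
  obtain z where z: "z \<in> center_of S P" "g = Comp L f (\<delta> P z)" using A_orbits[OF f g] eq by blast
  have P: "P \<in> Ob L" using f Mor_Ob by blast
  have zP: "z \<in> P" using z(1) by (simp add: center_of_def)
  have "q (loopL g) = q (loopL f) \<otimes>\<^bsub>PQ\<^esub> \<one>\<^bsub>PQ\<^esub>"
    using q_loopL_Comp[OF delta_Mor[OF P zP] f] q_delta[OF P zP] z(2) by simp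
  also have "\<dots> = q (loopL f)" by (rule group.is_monoid[OF PQ_group, THEN monoid.r_one, OF q_loopL_closed[OF f]])
  finally show ?thesis by simp
qed

text \<open>Modulo \<open>O\<^sup>p\<^sup>'(\<pi>\<^sub>1)\<close> the loop given by a morphism depends only on its image in \<open>F\<close>.\<close>

definition loopF :: "'a set \<Rightarrow> ('a \<Rightarrow> 'a) \<Rightarrow> (real \<Rightarrow> 'm cell_point set) set set" where
  "loopF P \<phi> = q (loopL (SOME f. f \<in> Mor L P Q0 \<and> \<pi> f = \<phi>))"

lemma loopF_S:
  assumes "f \<in> Mor L P Q0"
  shows "loopF P (\<pi> f) = q (loopL f)"
proof -
  have "(SOME g. g \<in> Mor L P Q0 \<and> \<pi> g = \<pi> f) \<in> Mor L P Q0 \<and> \<pi> (SOME g. g \<in> Mor L P Q0 \<and> \<pi> g = \<pi> f) = \<pi> f"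
    by (rule someI[of "\<lambda>g. g \<in> Mor L P Q0 \<and> \<pi> g = \<pi> f" f]) (use assms in simp)
  then show ?thesis unfolding loopF_def using q_loopL_cong[OF _ assms] by blast
qed

lemma loopF_eq:
  assumes f: "f \<in> Mor L P Q"
  shows "loopF P (\<pi> f) = q (loopL f)"
proof -
  have c: "F_centric S F P" "F_centric S F Q" using Mor_centric[OF f] by auto
  note i = iota[OF c(2)] and s = centric_sub[OF c(1)] centric_sub[OF c(2)]
  have m: "Comp L (iota Q) f \<in> Mor L P Q0" using Comp_Mor[OF f] i by blast
  have "\<pi> (Comp L (iota Q) f) = compose P (\<lambda>x\<in>Q. x) (\<pi> f)" using pi_Comp[OF f, of "iota Q" Q0] i by simp
  also have "\<dots> = \<pi> f"
    using morphism(1,4)[OF s pi_in[OF f]] by (intro extensionalityI[of _ P]) (auto simp: compose_def)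
  finally have "loopF P (\<pi> f) = q (loopL (Comp L (iota Q) f))" using loopF_S[OF m] by simp
  also have "loopL (Comp L (iota Q) f) = loopL f"
    using loopL_Comp[OF f, of "iota Q" Q0] i loopL_iota[OF c(2)] loopL_closed[OF f] by simp
  finally show ?thesis .
qed

lemma loopF_comp:
  assumes "F_centric S F P" "F_centric S F Q" "\<phi> \<in> F P Q" "\<psi> \<in> F Q Q0"
  shows "loopF P (compose P \<psi> \<phi>) = loopF Q \<psi> \<otimes>\<^bsub>PQ\<^esub> loopF P \<phi>"
proof -
  obtain f where f: "f \<in> Mor L P Q" "\<pi> f = \<phi>" by (rule lift_ex[OF assms(1-3)])
  obtain g where g: "g \<in> Mor L Q Q0" "\<pi> g = \<psi>" by (rule lift_ex[OF assms(2) centric_S assms(4)])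
  have "loopF P (\<pi> (Comp L g f)) = loopF Q (\<pi> g) \<otimes>\<^bsub>PQ\<^esub> loopF P (\<pi> f)"
    unfolding loopF_eq[OF Comp_Mor[OF f(1) g(1)]] loopF_eq[OF f(1)] loopF_eq[OF g(1)] by (rule q_loopL_Comp[OF f(1) g(1)])
  then show ?thesis using pi_Comp[OF f(1) g(1)] f(2) g(2) by simp
qed

lemma loopF_closed: "F_centric S F P \<Longrightarrow> \<phi> \<in> F P Q0 \<Longrightarrow> loopF P \<phi> \<in> carrier PQ"
  using lift_ex[OF _ centric_S] loopF_S q_loopL_closed by metis

lemma loopF_incl: "F_centric S F P \<Longrightarrow> loopF P (\<lambda>x\<in>P. x) = \<one>\<^bsub>PQ\<^esub>"
  using loopF_S[of "iota P" P] iota[of P] loopL_iota[of P] q.hom_one by metis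

lemma loopF_E:
  assumes "F_centric S F P" "e \<in> E P Q0"
  shows "loopF P e = \<one>\<^bsub>PQ\<^esub>"
  by (rule functor_trivial_on_E[where \<Gamma> = PQ and J = loopF, OF PQ_group PQ_torsion loopF_closed loopF_comp loopF_incl assms])

lemma loopF_decomposes:
  assumes P: "F_centric S F P" and d: "decomposes P \<phi> \<alpha>"
  shows "loopF P \<phi> = loopF Q0 \<alpha>"
proof -
  obtain e where e: "e \<in> E P Q0" "\<phi> = compose P \<alpha> e" and \<alpha>: "\<alpha> \<in> F Q0 Q0"
    using d by (auto simp: decomposes_def)
  have "loopF P \<phi> = loopF Q0 \<alpha> \<otimes>\<^bsub>PQ\<^esub> \<one>\<^bsub>PQ\<^esub>"
    unfolding e(2) loopF_E[OF P e(1), symmetric] by (rule loopF_comp[OF P centric_S subsetD[OF E_F e(1)] \<alpha>])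
  also have "\<dots> = loopF Q0 \<alpha>" by (rule group.is_monoid[OF PQ_group, THEN monoid.r_one, OF loopF_closed[OF centric_S \<alpha>]])
  finally show ?thesis .
qed

section \<open>The natural map\<close>

text \<open>Every endomorphism of \<open>S\<close> in \<open>L\<close> is invertible: composing with a lift of the inverse of its image
  gives some \<open>\<delta>\<^sub>S(z)\<close>.\<close>

lemma Aut_cat_S: "carrier (Aut_cat L Q0) = Mor L Q0 Q0"
proof -
  have half: "\<exists>g\<in>Mor L Q0 Q0. Comp L g f = Ident L Q0" "\<exists>g\<in>Mor L Q0 Q0. Comp L f g = Ident L Q0"
    if f: "f \<in> Mor L Q0 Q0" for f
  proof -
    have \<phi>: "\<pi> f \<in> F Q0 Q0" by (rule pi_in[OF f])
    have im: "\<pi> f ` Q0 = Q0" by (rule endo_image[OF subgroup_self \<phi>])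
    have "hom_inv Q0 (\<pi> f) \<in> F Q0 Q0" using factor(3)[OF subgroup_self subgroup_self \<phi>] im by simp
    then obtain g where g: "g \<in> Mor L Q0 Q0" "\<pi> g = hom_inv Q0 (\<pi> f)" by (rule lift_ex[OF centric_S centric_S])
    note gf = Comp_Mor[OF f g(1)] and fg = Comp_Mor[OF g(1) f] and id = Ident_Mor[OF Ob_S]
    have unit: "\<exists>w\<in>Mor L Q0 Q0. Comp L w h = Ident L Q0 \<and> Comp L h w = Ident L Q0"
      if h: "h \<in> Mor L Q0 Q0" "\<pi> h = (\<lambda>x\<in>Q0. x)" for h
    proof -
      obtain z where z: "z \<in> center_of S Q0" "h = Comp L (Ident L Q0) (\<delta> Q0 z)"
        using A_orbits[OF id h(1)] h(2) pi_Ident[OF Ob_S] by auto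
      have zS: "z \<in> Q0" using z(1) by (simp add: center_of_def)
      have "h = \<delta> Q0 z" using z(2) Ident_Comp[OF delta_Mor[OF Ob_S zS]] by simp
      then have "h \<in> carrier (Aut_cat L Q0)" using delta_hom[OF Ob_S] zS by (auto simp: hom_def)
      then show ?thesis by (auto simp: Aut_cat_def)
    qed
    have "\<pi> (Comp L g f) = (\<lambda>x\<in>Q0. x)"
      unfolding pi_Comp[OF f g(1)] g(2) using hom_inv_left[OF subgroup_self subgroup_self \<phi>] by (auto simp: compose_def fun_eq_iff)
    then obtain w where w: "w \<in> Mor L Q0 Q0" "Comp L w (Comp L g f) = Ident L Q0" using unit[OF gf] by blast
    then show "\<exists>g\<in>Mor L Q0 Q0. Comp L g f = Ident L Q0"
      using Comp_assoc[OF f g(1) w(1)] Comp_Mor[OF g(1) w(1)] by metis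
    have "\<pi> (Comp L f g) = (\<lambda>x\<in>Q0. x)"
      unfolding pi_Comp[OF g(1) f] g(2) using hom_inv_right[of _ "\<pi> f" Q0] im by (auto simp: compose_def fun_eq_iff)
    then obtain w where w: "w \<in> Mor L Q0 Q0" "Comp L (Comp L f g) w = Ident L Q0" using unit[OF fg] by blast
    then show "\<exists>g\<in>Mor L Q0 Q0. Comp L f g = Ident L Q0"
      using Comp_assoc[OF w(1) g(1) f] Comp_Mor[OF w(1) g(1)] by metis
  qed
  have "\<exists>g\<in>Mor L Q0 Q0. Comp L g f = Ident L Q0 \<and> Comp L f g = Ident L Q0" if f: "f \<in> Mor L Q0 Q0" for f
  proof -
    obtain g where g: "g \<in> Mor L Q0 Q0" "Comp L g f = Ident L Q0" using half(1)[OF f] by blast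
    obtain h where h: "h \<in> Mor L Q0 Q0" "Comp L f h = Ident L Q0" using half(2)[OF f] by blast
    have "g = h"
      using Comp_assoc[OF h(1) f g(1)] g(2) h(2) Comp_Ident[OF g(1)] Ident_Comp[OF h(1)] by simp
    then show ?thesis using g h by blast
  qed
  then show ?thesis by (auto simp: Aut_cat_def)
qed

abbreviation "nat_map \<equiv> natural_map p S L \<pi>"

text \<open>The lifts of \<open>c\<^sub>x \<alpha>\<close> are those of \<open>\<alpha>\<close> composed with \<open>\<delta>\<^sub>S(x)\<close>, whose loop is trivial modulo \<open>O\<^sup>p\<^sup>'(\<pi>\<^sub>1)\<close>, and hence the
  members of a class in \<open>Out(S)\<close> all give the same coset.\<close>

lemma natural_map_eq:
  assumes f: "f \<in> Mor L Q0 Q0"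
  shows "nat_map (I #>\<^bsub>A\<^esub> \<pi> f) = q (loopL f)"
proof -
  interpret A: group A by (rule group_A)
  have \<alpha>: "\<pi> f \<in> carrier A" using pi_in[OF f] by simp
  have all: "q (loopL g) = q (loopL f)" if g: "g \<in> Mor L Q0 Q0" "\<pi> g \<in> I #>\<^bsub>A\<^esub> \<pi> f" for g
  proof -
    obtain x where x: "x \<in> Q0" "\<pi> g = conj_map S x Q0 \<otimes>\<^bsub>A\<^esub> \<pi> f"
      using g(2) by (auto simp: r_coset_def I_eq)
    note d = delta_Mor[OF Ob_S x(1)]
    have "\<pi> g = \<pi> (Comp L (\<delta> Q0 x) f)"
      unfolding pi_Comp[OF f d] B[OF Ob_S x(1)] x(2)
      by (rule Aut_mult[OF subgroup_self S_conj_in[OF x(1)] pi_in[OF f]])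
    then have "q (loopL g) = q (loopL (Comp L (\<delta> Q0 x) f))" by (rule q_loopL_cong[OF g(1) Comp_Mor[OF f d]])
    also have "\<dots> = \<one>\<^bsub>PQ\<^esub> \<otimes>\<^bsub>PQ\<^esub> q (loopL f)" using q_loopL_Comp[OF f d] q_delta[OF Ob_S x(1)] by simp
    also have "\<dots> = q (loopL f)" by (rule group.is_monoid[OF PQ_group, THEN monoid.l_one, OF q_loopL_closed[OF f]])
    finally show ?thesis .
  qed
  let ?M = "{g \<in> Mor L Q0 Q0. \<pi> g \<in> I #>\<^bsub>A\<^esub> \<pi> f}"
  have "f \<in> ?M" using f A.rcos_self[OF \<alpha> normal_imp_subgroup[OF I_normal]] by blast
  moreover have "(\<lambda>g. K #>\<^bsub>PiL\<^esub> edge_class S L g) ` ?M = (\<lambda>g. q (loopL f)) ` ?M"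
  proof (rule image_cong[OF refl])
    fix g assume "g \<in> ?M"
    then have g: "g \<in> Mor L Q0 Q0" "\<pi> g \<in> I #>\<^bsub>A\<^esub> \<pi> f" by blast+
    show "K #>\<^bsub>PiL\<^esub> edge_class S L g = q (loopL f)"
      unfolding loopL_S[OF g(1), symmetric] q_def[symmetric] by (rule all[OF g])
  qed
  ultimately have "(\<lambda>g. K #>\<^bsub>PiL\<^esub> edge_class S L g) ` ?M = {q (loopL f)}"
    using image_constant[of f ?M "q (loopL f)"] by simp
  then show ?thesis unfolding natural_map_def Aut_cat_S by simp
qed

lemma natural_map_loopF:
  assumes "\<alpha> \<in> F Q0 Q0"
  shows "nat_map (I #>\<^bsub>A\<^esub> \<alpha>) = loopF Q0 \<alpha>"
proof -
  obtain f where "f \<in> Mor L Q0 Q0" "\<pi> f = \<alpha>" by (rule lift_ex[OF centric_S centric_S assms])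
  then show ?thesis using natural_map_eq loopF_S by metis
qed

lemma natural_map_hom: "group_hom Out PQ nat_map"
proof -
  have "nat_map \<in> hom Out PQ"
  proof (rule homI)
    fix x y assume "x \<in> carrier Out" "y \<in> carrier Out"
    then obtain \<alpha> \<beta> where a: "x = I #>\<^bsub>A\<^esub> \<alpha>" "y = I #>\<^bsub>A\<^esub> \<beta>" "\<alpha> \<in> F Q0 Q0" "\<beta> \<in> F Q0 Q0"
      by (auto simp: Out_carrier)
    show "nat_map x \<in> carrier PQ" using natural_map_loopF[OF a(3)] loopF_closed[OF centric_S a(3)] a(1) by simp
    have "x \<otimes>\<^bsub>Out\<^esub> y = I #>\<^bsub>A\<^esub> compose Q0 \<alpha> \<beta>"
      using Out_coset_mult[of \<alpha> \<beta>] a Aut_mult[OF subgroup_self a(3,4)] by simp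
    then show "nat_map (x \<otimes>\<^bsub>Out\<^esub> y) = nat_map x \<otimes>\<^bsub>PQ\<^esub> nat_map y"
      using natural_map_loopF[OF comp[OF subgroup_self subgroup_self subgroup_self a(4,3)]]
        natural_map_loopF[OF a(3)] natural_map_loopF[OF a(4)] loopF_comp[OF centric_S centric_S a(4,3)] a(1,2)
      by simp
  qed
  then show ?thesis using group_Out PQ_group by (simp add: group_hom_def group_hom_axioms_def)
qed

text \<open>Modulo \<open>O\<^sup>p\<^sup>'(\<pi>\<^sub>1)\<close>, the loop of an edge is that of the automorphism of \<open>S\<close> in a decomposition of the morphism. So the
  preimage of the image of the natural map contains the loops of all edges.\<close>

lemma natural_map_surj: "nat_map ` carrier Out = carrier PQ"
proof -
  interpret n: group_hom Out PQ nat_map by (rule natural_map_hom)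
  define H where "H = {x \<in> carrier PiL. q x \<in> nat_map ` carrier Out}"
  have im: "subgroup (nat_map ` carrier Out) PQ" by (rule n.img_is_subgroup)
  have "subgroup H PiL"
  proof (rule PiL.subgroupI)
    show "H \<noteq> {}" using subgroup.one_closed[OF im] q.hom_one PiL.one_closed unfolding H_def by blast
    show "inv\<^bsub>PiL\<^esub> a \<in> H" if "a \<in> H" for a
      using that subgroup.m_inv_closed[OF im] q.hom_inv unfolding H_def by fastforce
    show "a \<otimes>\<^bsub>PiL\<^esub> b \<in> H" if "a \<in> H" "b \<in> H" for a b
      using that subgroup.m_closed[OF im] q.hom_mult unfolding H_def by fastforce
  qed (auto simp: H_def)
  moreover have "connect X v (tree P) (edge_path L f) (tree Q) \<in> H" if f: "f \<in> Mor L P Q" for f P Q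
  proof -
    have c: "F_centric S F P" "F_centric S F Q" using Mor_centric[OF f] by auto
    obtain \<alpha> where d: "decomposes P (\<pi> f) \<alpha>"
      using decomposition[OF c(1) to_S[OF centric_sub[OF c(1)] centric_sub[OF c(2)] pi_in[OF f]]] by blast
    have \<alpha>: "\<alpha> \<in> F Q0 Q0" using d by (simp add: decomposes_def)
    have "q (loopL f) = nat_map (I #>\<^bsub>A\<^esub> \<alpha>)"
      using loopF_eq[OF f] loopF_decomposes[OF c(1) d] natural_map_loopF[OF \<alpha>] by simp
    then have "loopL f \<in> H" using loopL_closed[OF f] \<alpha> by (auto simp: H_def Out_carrier)
    then show ?thesis by (simp add: loopL_eq[OF f])
  qed
  ultimately have "H = carrier PiL"
    unfolding Pi_eq using fundamental_group_generated_by_edges[OF Ob_S path_between_tree tree_S] by blast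
  then show ?thesis using q_surj subgroup.subset[OF im] by (auto simp: H_def)
qed

text \<open>A generator of \<open>Out\<^sup>0(S)\<close> gives the same loop as its restriction in \<open>O\<^sup>p\<^sup>'\<^sub>*(F)\<close>, which is trivial. Conversely, \<open>Theta\<close>
  induces a homomorphism from \<open>\<pi>\<^sub>1\<close> to a finite group of order prime to \<open>p\<close>, which must kill \<open>O\<^sup>p\<^sup>'(\<pi>\<^sub>1)\<close>, and on the loops of
  automorphisms of \<open>S\<close> this homomorphism is the projection to \<open>Out(S)/Out\<^sup>0(S)\<close>.\<close>

lemma natural_map_kernel: "kernel Out PQ nat_map = Out0"
proof
  interpret n: group_hom Out PQ nat_map by (rule natural_map_hom)
  have "gens \<subseteq> kernel Out PQ nat_map"
  proof
    fix x assume "x \<in> gens"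
    then obtain \<alpha> P where a: "x = I #>\<^bsub>A\<^esub> \<alpha>" "\<alpha> \<in> F Q0 Q0" and P: "F_centric S F P" "restrict \<alpha> P \<in> E P Q0"
      by (auto simp: gens_def)
    have "decomposes P (restrict \<alpha> P) \<alpha>"
      using decomposes_restr[OF decomposes_self[OF a(2)] subgroup_self centric_sub[OF P(1)] subgroup.subset[OF centric_sub[OF P(1)]]] .
    then have "loopF Q0 \<alpha> = \<one>\<^bsub>PQ\<^esub>" using loopF_decomposes[OF P(1)] loopF_E[OF P] by simp
    then show "x \<in> kernel Out PQ nat_map"
      using natural_map_loopF[OF a(2)] a by (auto simp: kernel_def Out_carrier)
  qed
  then show "Out0 \<subseteq> kernel Out PQ nat_map"
    unfolding Out0_eq by (rule n.G.generate_subgroup_incl[OF _ n.subgroup_kernel])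
  have comp: "Theta (Dom L (Comp L g f)) (\<pi> (Comp L g f)) =
      Theta (Dom L g) (\<pi> g) \<otimes>\<^bsub>Gm\<^esub> Theta (Dom L f) (\<pi> f)" if f: "f \<in> Mor L P Q" and g: "g \<in> Mor L Q R" for f g P Q R
  proof -
    have d: "Dom L f = P" "Dom L g = Q" "Dom L (Comp L g f) = P"
      using f g Comp_Mor[OF f g] by (auto simp: Mor_def)
    have c: "F_centric S F P" "F_centric S F Q" "F_centric S F R" using Mor_centric[OF f] Mor_centric[OF g] by auto
    show ?thesis
      unfolding d pi_Comp[OF f g]
      by (rule Theta_comp[OF c(1,2) pi_in[OF f] to_S[OF centric_sub[OF c(2)] centric_sub[OF c(3)] pi_in[OF g]]])
  qed
  have closed: "Theta (Dom L f) (\<pi> f) \<in> carrier Gm" if f: "f \<in> Mor L P Q" for f P Q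
  proof -
    have c: "F_centric S F P" "F_centric S F Q" using Mor_centric[OF f] by auto
    have "Dom L f = P" using f by (simp add: Mor_def)
    then show ?thesis using Theta_closed[OF c(1) to_S[OF centric_sub[OF c(1)] centric_sub[OF c(2)] pi_in[OF f]]] by simp
  qed
  obtain \<Phi> where \<Phi>: "\<Phi> \<in> hom (fundamental_group X v) Gm"
    "\<And>f. f \<in> Mor L Q0 Q0 \<Longrightarrow> \<Phi> (loop_class X v (edge_path L f)) = Theta (Dom L f) (\<pi> f)"
    by (rule functor_induces_hom[of Gm "\<lambda>f. Theta (Dom L f) (\<pi> f)" Q0, OF group_Gm _ _ Ob_S])
      (rule closed comp that, assumption+)+
  interpret \<Phi>: group_hom PiL Gm \<Phi>
    using \<Phi>(1) Pi_group group_Gm by (simp add: group_hom_def group_hom_axioms_def Pi_eq)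
  have im: "subgroup (\<Phi> ` carrier PiL) Gm" by (rule \<Phi>.img_is_subgroup)
  have "card (\<Phi> ` carrier PiL) dvd card (carrier Gm)"
    using \<Phi>.H.card_subgroup_dvd[OF im] by (simp add: order_def)
  then have "K \<subseteq> kernel PiL Gm \<Phi>"
    using \<Phi>.O_p'_subset_kernel coprime_Gm finite_subset[OF subgroup.subset[OF im]]
    by (meson coprime_divisors dvd_refl)
  moreover have "x \<in> Out0" if x: "x \<in> kernel Out PQ nat_map" and K: "K \<subseteq> kernel PiL Gm \<Phi>" for x
  proof -
    obtain \<alpha> where a: "x = I #>\<^bsub>A\<^esub> \<alpha>" "\<alpha> \<in> F Q0 Q0" using x by (auto simp: kernel_def Out_carrier)
    obtain f where f: "f \<in> Mor L Q0 Q0" "\<pi> f = \<alpha>" by (rule lift_ex[OF centric_S centric_S a(2)])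
    have "q (loopL f) = \<one>\<^bsub>PQ\<^esub>" using x natural_map_eq[OF f(1)] f(2) a(1) by (simp add: kernel_def)
    then have "loopL f \<in> kernel PiL Gm \<Phi>" using q_one_iff[OF loopL_closed[OF f(1)]] K by blast
    then have "\<Phi> (loop_class X v (edge_path L f)) = \<one>\<^bsub>Gm\<^esub>"
      using loopL_S[OF f(1)] by (simp add: kernel_def edge_class_def)
    moreover have "Dom L f = Q0" using f(1) by (simp add: Mor_def)
    ultimately have "cls \<alpha> = \<one>\<^bsub>Gm\<^esub>" using \<Phi>(2)[OF f(1)] Theta_self[OF a(2)] f(2) by simp
    then show ?thesis using cls_one_iff[of \<alpha>] a by simp
  qed
  ultimately show "kernel Out PQ nat_map \<subseteq> Out0" by blast
qed

end

theorem theorem3: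
  fixes p :: nat
    and S :: "('a, 'b) monoid_scheme"
    and F :: "'a homs"
    and L :: "('a set, 'm) cat"
    and \<pi> :: "'m \<Rightarrow> 'a \<Rightarrow> 'a"
    and \<delta> :: "'a set \<Rightarrow> 'a \<Rightarrow> 'm"
  assumes "prime p"
    and "p_local_finite_group p S F L \<pi> \<delta>"
  shows "(\<forall>f \<in> carrier (Aut_cat L (carrier S)).
            natural_map p S L \<pi> (Inn S (carrier S) #>\<^bsub>Aut_F F (carrier S)\<^esub> \<pi> f)
              = O_p' p (pi1_L S L) #>\<^bsub>pi1_L S L\<^esub> edge_class S L f) \<and>
         natural_map p S L \<pi> \<in> epi (Out_F S F (carrier S)) (pi1_mod_O_p' p S L) \<and>
         kernel (Out_F S F (carrier S)) (pi1_mod_O_p' p S L) (natural_map p S L \<pi>)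
           = Out0_F p S F"
proof -
  have a: "finite_p_group p S" "fusion_system S F" "saturated p S F" "centric_linking_system S F L \<pi> \<delta>"
    using assms(2) by (auto simp: p_local_finite_group_def)
  interpret linking S F p L \<pi> \<delta>
    using a assms(1) unfolding linking_def saturated_fusion_def saturated_fusion_axioms_def fusion_prime_def
      fusion_def fusion_axioms_def by (simp add: finite_p_group_def)
  show ?thesis
    using natural_map_eq loopL_S group_hom.homh[OF natural_map_hom] natural_map_surj natural_map_kernel
    by (simp add: Aut_cat_S pi1_mod_O_p'_def epi_def q_def)
qed

end
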